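(* Let $G$ be a locally compact group, $N$ be a closed normal subgroup of $G$, and $\xi\in\chi(N)$. Then $L^1_\xi(G,N)^*$ is isometrically isomorphic to $L^\infty_\xi(G,N)$.
   Context: Locally compact groups are Hausdorff. $\mathbb{T}=\{z\in\mathbb{C}:|z|=1\}$, and $\chi(N)$ is the set of characters of $N$, i.e. continuous group homomorphisms $\xi:N\to\mathbb{T}$. Fix left Haar measures $\lambda_G$ on $G$ and $\lambda_N$ on $N$, and let $\lambda_{G/N}$ be the left Haar measure on the quotient group $G/N$ normalized by Weil's formula $\int_{G/N}\left(\int_N f(xs)\,d\lambda_N(s)\right)d\lambda_{G/N}(xN)=\int_G f(x)\,d\lambda_G(x)$ for all $f\in L^1(G)=L^1(G,\lambda_G)$. Let $\mathrm{q}:G\to G/N$, $\mathrm{q}(x)=xN$. $\mathcal{C}_\xi(G,N)$ is the space of continuous functions $\psi:G\to\mathbb{C}$ such that $\mathrm{q}(\mathrm{supp}(\psi))$ is compact in $G/N$ and $\psi(xk)=\xi(k)\psi(x)$ for all $x\in G$, $k\in N$. For $\psi\in\mathcal{C}_\xi(G,N)$ the function $|\psi|$ is constant on cosets of $N$, and $\|\psi\|_{(1)}:=\int_{G/N}|\psi(y)|\,d\lambda_{G/N}(yN)$. $L^1_\xi(G,N)$ is the Banach completion of $(\mathcal{C}_\xi(G,N),\|\cdot\|_{(1)})$, and $L^1_\xi(G,N)^*$ is its dual space. A set is locally $\lambda_G$-null if its intersection with every Borel set of finite $\lambda_G$-measure is $\lambda_G$-null; a function is locally $\lambda_G$-measurable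 if the preimage of every Borel set meets every Borel set of finite $\lambda_G$-measure in a $\lambda_G$-measurable set; "l.a.e." (locally almost everywhere) means outside a locally null set. $L^\infty(G)$ is the Banach space of all locally $\lambda_G$-measurable functions $f:G\to\mathbb{C}$ which are bounded except on a locally $\lambda_G$-null set, modulo functions which are zero l.a.e., with norm $\|f\|_\infty:=\inf\{t:|f(x)|\le t\text{ for l.a.e. }x\in G\}$. For $k\in N$ put $R_k\psi(x):=\psi(xk)$. $L^\infty_\xi(G,N):=\{\psi\in L^\infty(G):R_k\psi=\xi(k)\psi\text{ for every }k\in N\}$, a closed subspace of $L^\infty(G)$, equipped with the norm $\|\cdot\|_\infty$. *)

theory Defs
  imports "HOL-Analysis.Analysis" "HOL-Algebra.Coset"
begin

section \<open>Complex normed spaces with explicit carriers\<close>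

text \<open>The spaces of the theorem depend on \<open>G\<close>, \<open>N\<close> and \<open>\<xi>\<close>, so they are values rather than types.
  The zero vector is determined by the addition and is not recorded.\<close>

record 'v normed_cspace =
  vset :: "'v set"
  vadd :: "'v \<Rightarrow> 'v \<Rightarrow> 'v"
  vscale :: "complex \<Rightarrow> 'v \<Rightarrow> 'v"
  vnorm :: "'v \<Rightarrow> real"

definition vdist :: "'v normed_cspace \<Rightarrow> 'v \<Rightarrow> 'v \<Rightarrow> real" where
  "vdist V x y = vnorm V (vadd V x (vscale V (-1) y))"

text \<open>Quotient by an equivalence relation compatible with the operations and the norm.\<close>

definition quotient_space :: "('v \<times> 'v) set \<Rightarrow> 'v normed_cspace \<Rightarrow> 'v set normed_cspace" where
  "quotient_space r V = \<lparr>
     vset = vset V // r,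
     vadd = (\<lambda>X Y. \<Union>x\<in>X. \<Union>y\<in>Y. r `` {vadd V x y}),
     vscale = (\<lambda>c X. \<Union>x\<in>X. r `` {vscale V c x}),
     vnorm = (\<lambda>X. the_elem (vnorm V ` X)) \<rparr>"

text \<open>The Banach completion: Cauchy sequences modulo sequences tending to zero.\<close>

definition cauchy_seqs :: "'v normed_cspace \<Rightarrow> (nat \<Rightarrow> 'v) set" where
  "cauchy_seqs V = {\<sigma>. range \<sigma> \<subseteq> vset V \<and>
     (\<forall>\<epsilon>>0. \<exists>n0. \<forall>m\<ge>n0. \<forall>n\<ge>n0. vdist V (\<sigma> m) (\<sigma> n) < \<epsilon>)}"

definition cauchy_space :: "'v normed_cspace \<Rightarrow> (nat \<Rightarrow> 'v) normed_cspace" where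
  "cauchy_space V = \<lparr>
     vset = cauchy_seqs V,
     vadd = (\<lambda>\<sigma> \<tau> n. vadd V (\<sigma> n) (\<tau> n)),
     vscale = (\<lambda>c \<sigma> n. vscale V c (\<sigma> n)),
     vnorm = (\<lambda>\<sigma>. lim (\<lambda>n. vnorm V (\<sigma> n))) \<rparr>"

definition banach_completion :: "'v normed_cspace \<Rightarrow> (nat \<Rightarrow> 'v) set normed_cspace" where
  "banach_completion V = quotient_space
     {(\<sigma>, \<tau>). \<sigma> \<in> cauchy_seqs V \<and> \<tau> \<in> cauchy_seqs V \<and> (\<lambda>n. vdist V (\<sigma> n) (\<tau> n)) \<longlonglongrightarrow> 0}
     (cauchy_space V)"

definition bounded_functionals :: "'v normed_cspace \<Rightarrow> ('v \<Rightarrow> complex) set" where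
  "bounded_functionals V = {\<phi> \<in> extensional (vset V).
     (\<forall>x\<in>vset V. \<forall>y\<in>vset V. \<phi> (vadd V x y) = \<phi> x + \<phi> y) \<and>
     (\<forall>c. \<forall>x\<in>vset V. \<phi> (vscale V c x) = c * \<phi> x) \<and>
     (\<exists>B. \<forall>x\<in>vset V. cmod (\<phi> x) \<le> B * vnorm V x)}"

definition dual_space :: "'v normed_cspace \<Rightarrow> ('v \<Rightarrow> complex) normed_cspace" where
  "dual_space V = \<lparr>
     vset = bounded_functionals V,
     vadd = (\<lambda>\<phi> \<psi>. \<lambda>x\<in>vset V. \<phi> x + \<psi> x),
     vscale = (\<lambda>c \<phi>. \<lambda>x\<in>vset V. c * \<phi> x),
     vnorm = (\<lambda>\<phi>. SUP x\<in>{x \<in> vset V. vnorm V x \<le> 1}. cmod (\<phi> x)) \<rparr>"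

definition isometrically_isomorphic :: "'v normed_cspace \<Rightarrow> 'w normed_cspace \<Rightarrow> bool" where
  "isometrically_isomorphic V W \<longleftrightarrow> (\<exists>\<Phi>. bij_betw \<Phi> (vset V) (vset W) \<and>
     (\<forall>x\<in>vset V. \<forall>y\<in>vset V. \<Phi> (vadd V x y) = vadd W (\<Phi> x) (\<Phi> y)) \<and>
     (\<forall>c. \<forall>x\<in>vset V. \<Phi> (vscale V c x) = vscale W c (\<Phi> x)) \<and>
     (\<forall>x\<in>vset V. vnorm W (\<Phi> x) = vnorm V x))"


section \<open>Locally compact groups, characters, quotients\<close>

definition locally_compact_group :: "('a, 'b) monoid_scheme \<Rightarrow> 'a topology \<Rightarrow> bool" where
  "locally_compact_group G T \<longleftrightarrow>
     group G \<and> topspace T = carrier G \<and>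
     continuous_map (prod_topology T T) T (\<lambda>(x, y). x \<otimes>\<^bsub>G\<^esub> y) \<and>
     continuous_map T T (\<lambda>x. inv\<^bsub>G\<^esub> x) \<and>
     Hausdorff_space T \<and> locally_compact_space T"

definition circle_group :: "complex monoid" where
  "circle_group = \<lparr>carrier = {z. cmod z = 1}, mult = (*), one = 1\<rparr>"

definition characters :: "('a, 'b) monoid_scheme \<Rightarrow> 'a topology \<Rightarrow> ('a \<Rightarrow> complex) set" where
  "characters G T = {\<xi> \<in> hom G circle_group. continuous_map T euclidean \<xi>}"

abbreviation subgroup_of :: "('a, 'b) monoid_scheme \<Rightarrow> 'a set \<Rightarrow> ('a, 'b) monoid_scheme" where
  "subgroup_of G N \<equiv> G\<lparr>carrier := N\<rparr>"

text \<open>The elements of \<open>G Mod N\<close> are the cosets \<open>N #> x\<close>, which equal \<open>x <# N\<close> for normal \<open>N\<close>.\<close>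

definition quot_map :: "('a, 'b) monoid_scheme \<Rightarrow> 'a set \<Rightarrow> 'a \<Rightarrow> 'a set" where
  "quot_map G N x = x <#\<^bsub>G\<^esub> N"

definition quot_topology :: "('a, 'b) monoid_scheme \<Rightarrow> 'a topology \<Rightarrow> 'a set \<Rightarrow> 'a set topology" where
  "quot_topology G T N = topology (\<lambda>\<U>. \<U> \<subseteq> carrier (G Mod N) \<and>
     openin T {x \<in> topspace T. quot_map G N x \<in> \<U>})"

lemma openin_quot_topology:
  "openin (quot_topology G T N) \<U> \<longleftrightarrow>
     \<U> \<subseteq> carrier (G Mod N) \<and> openin T {x \<in> topspace T. quot_map G N x \<in> \<U>}"
proof -
  have "istopology (\<lambda>\<U>. \<U> \<subseteq> carrier (G Mod N) \<and>
      openin T {x \<in> topspace T. quot_map G N x \<in> \<U>})"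
    unfolding istopology_def
  proof (intro conjI allI impI)
    fix S U
    assume "S \<subseteq> carrier (G Mod N) \<and> openin T {x \<in> topspace T. quot_map G N x \<in> S}"
      and "U \<subseteq> carrier (G Mod N) \<and> openin T {x \<in> topspace T. quot_map G N x \<in> U}"
    then have "openin T ({x \<in> topspace T. quot_map G N x \<in> S} \<inter> {x \<in> topspace T. quot_map G N x \<in> U})"
      by blast
    moreover have "{x \<in> topspace T. quot_map G N x \<in> S} \<inter> {x \<in> topspace T. quot_map G N x \<in> U}
        = {x \<in> topspace T. quot_map G N x \<in> S \<inter> U}" by blast
    ultimately show "openin T {x \<in> topspace T. quot_map G N x \<in> S \<inter> U}" by simp
  next
    fix \<K>
    assume "\<forall>K\<in>\<K>. K \<subseteq> carrier (G Mod N) \<and> openin T {x \<in> topspace T. quot_map G N x \<in> K}"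
    then have "openin T (\<Union>K\<in>\<K>. {x \<in> topspace T. quot_map G N x \<in> K})" by blast
    moreover have "(\<Union>K\<in>\<K>. {x \<in> topspace T. quot_map G N x \<in> K})
        = {x \<in> topspace T. quot_map G N x \<in> \<Union>\<K>}" by blast
    ultimately show "openin T {x \<in> topspace T. quot_map G N x \<in> \<Union>\<K>}" by simp
  qed auto
  then show ?thesis by (simp add: quot_topology_def)
qed

text \<open>The value at a coset \<open>Y\<close> of a function on \<open>G\<close> that is constant on cosets.\<close>

definition on_coset :: "('a \<Rightarrow> 'c) \<Rightarrow> 'a set \<Rightarrow> 'c" where
  "on_coset f Y = the_elem (f ` Y)"


section \<open>Haar measures and Weil's formula\<close>

definition borel_of_top :: "'a topology \<Rightarrow> 'a measure" where
  "borel_of_top T = sigma (topspace T) {U. openin T U}"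

text \<open>A nonzero left invariant Radon measure on the Borel sets: finite on compact sets, outer
  regular on Borel sets and inner regular on open sets. For this convention
  \<open>L\<^sup>\<infinity>\<close> has to be formed with locally null sets.\<close>

definition left_haar_measure :: "('a, 'b) monoid_scheme \<Rightarrow> 'a topology \<Rightarrow> 'a measure \<Rightarrow> bool" where
  "left_haar_measure G T \<mu> \<longleftrightarrow>
     sets \<mu> = sets (borel_of_top T) \<and>
     emeasure \<mu> (space \<mu>) \<noteq> 0 \<and>
     (\<forall>K. compactin T K \<longrightarrow> emeasure \<mu> K < \<infinity>) \<and>
     (\<forall>A\<in>sets \<mu>. emeasure \<mu> A = (INF U\<in>{U. openin T U \<and> A \<subseteq> U}. emeasure \<mu> U)) \<and>
     (\<forall>U. openin T U \<longrightarrow> emeasure \<mu> U = (SUP K\<in>{K. compactin T K \<and> K \<subseteq> U}. emeasure \<mu> K)) \<and>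
     (\<forall>g\<in>carrier G. \<forall>A\<in>sets \<mu>. emeasure \<mu> (g <#\<^bsub>G\<^esub> A) = emeasure \<mu> A)"

text \<open>The identity includes that the iterated integral makes sense: the inner integral exists for
  almost every coset, and is then integrable on the quotient. The inner integral depends only on
  the coset of \<open>x\<close> by left invariance of \<open>\<mu>N\<close>. Integrable functions are those measurable for the
  completed measures, since the inner integral of a Borel function need not be Borel.\<close>

definition weil_formula ::
  "('a, 'b) monoid_scheme \<Rightarrow> 'a measure \<Rightarrow> 'a measure \<Rightarrow> 'a set measure \<Rightarrow> bool" where
  "weil_formula G \<mu>G \<mu>N \<mu>Q \<longleftrightarrow>
     (\<forall>f :: 'a \<Rightarrow> complex. integrable (completion \<mu>G) f \<longrightarrow>
        (AE Y in completion \<mu>Q. \<forall>x\<in>Y. integrable (completion \<mu>N) (\<lambda>s. f (x \<otimes>\<^bsub>G\<^esub> s))) \<and>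
        integrable (completion \<mu>Q) (on_coset (\<lambda>x. LINT s|completion \<mu>N. f (x \<otimes>\<^bsub>G\<^esub> s))) \<and>
        (LINT Y|completion \<mu>Q. on_coset (\<lambda>x. LINT s|completion \<mu>N. f (x \<otimes>\<^bsub>G\<^esub> s)) Y)
          = (LINT x|completion \<mu>G. f x))"


section \<open>Covariant functions of a character\<close>

definition C_xi :: "('a, 'b) monoid_scheme \<Rightarrow> 'a topology \<Rightarrow> 'a set \<Rightarrow> ('a \<Rightarrow> complex) \<Rightarrow>
    ('a \<Rightarrow> complex) set" where
  "C_xi G T N \<xi> = {\<psi> \<in> extensional (carrier G).
     continuous_map T euclidean \<psi> \<and>
     compactin (quot_topology G T N) (quot_map G N ` (T closure_of {x \<in> carrier G. \<psi> x \<noteq> 0})) \<and>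
     (\<forall>x\<in>carrier G. \<forall>k\<in>N. \<psi> (x \<otimes>\<^bsub>G\<^esub> k) = \<xi> k * \<psi> x)}"

definition C_xi_space :: "('a, 'b) monoid_scheme \<Rightarrow> 'a topology \<Rightarrow> 'a set \<Rightarrow> ('a \<Rightarrow> complex) \<Rightarrow>
    'a set measure \<Rightarrow> ('a \<Rightarrow> complex) normed_cspace" where
  "C_xi_space G T N \<xi> \<mu>Q = \<lparr>
     vset = C_xi G T N \<xi>,
     vadd = (\<lambda>f g. \<lambda>x\<in>carrier G. f x + g x),
     vscale = (\<lambda>c f. \<lambda>x\<in>carrier G. c * f x),
     vnorm = (\<lambda>\<psi>. LINT Y|\<mu>Q. on_coset (\<lambda>y. cmod (\<psi> y)) Y) \<rparr>"

definition L1_xi :: "('a, 'b) monoid_scheme \<Rightarrow> 'a topology \<Rightarrow> 'a set \<Rightarrow> ('a \<Rightarrow> complex) \<Rightarrow>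
    'a set measure \<Rightarrow> (nat \<Rightarrow> 'a \<Rightarrow> complex) set normed_cspace" where
  "L1_xi G T N \<xi> \<mu>Q = banach_completion (C_xi_space G T N \<xi> \<mu>Q)"

definition locally_null :: "'a measure \<Rightarrow> 'a set \<Rightarrow> bool" where
  "locally_null \<mu> E \<longleftrightarrow> E \<subseteq> space \<mu> \<and>
     (\<forall>F\<in>sets \<mu>. emeasure \<mu> F < \<infinity> \<longrightarrow> E \<inter> F \<in> null_sets (completion \<mu>))"

definition lae :: "'a measure \<Rightarrow> ('a \<Rightarrow> bool) \<Rightarrow> bool" where
  "lae \<mu> P \<longleftrightarrow> locally_null \<mu> {x \<in> space \<mu>. \<not> P x}"

definition locally_measurable :: "'a measure \<Rightarrow> ('a \<Rightarrow> complex) \<Rightarrow> bool" where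
  "locally_measurable \<mu> f \<longleftrightarrow>
     (\<forall>B\<in>sets borel. \<forall>F\<in>sets \<mu>. emeasure \<mu> F < \<infinity> \<longrightarrow> f -` B \<inter> F \<in> sets (completion \<mu>))"

definition Linfty_funs :: "'a measure \<Rightarrow> ('a \<Rightarrow> complex) set" where
  "Linfty_funs \<mu> = {f \<in> extensional (space \<mu>).
     locally_measurable \<mu> f \<and> (\<exists>B. lae \<mu> (\<lambda>x. cmod (f x) \<le> B))}"

definition lae_rel :: "'a measure \<Rightarrow> (('a \<Rightarrow> complex) \<times> ('a \<Rightarrow> complex)) set" where
  "lae_rel \<mu> = {(f, g). f \<in> Linfty_funs \<mu> \<and> g \<in> Linfty_funs \<mu> \<and> lae \<mu> (\<lambda>x. f x = g x)}"

definition Linfty :: "'a measure \<Rightarrow> ('a \<Rightarrow> complex) set normed_cspace" where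
  "Linfty \<mu> = quotient_space (lae_rel \<mu>) \<lparr>
     vset = Linfty_funs \<mu>,
     vadd = (\<lambda>f g. \<lambda>x\<in>space \<mu>. f x + g x),
     vscale = (\<lambda>c f. \<lambda>x\<in>space \<mu>. c * f x),
     vnorm = (\<lambda>f. Inf {t. lae \<mu> (\<lambda>x. cmod (f x) \<le> t)}) \<rparr>"

text \<open>\<open>R\<^sub>k\<close> on classes; well defined because right translation preserves locally null sets.\<close>

definition right_translate :: "('a, 'b) monoid_scheme \<Rightarrow> 'a measure \<Rightarrow> 'a \<Rightarrow>
    ('a \<Rightarrow> complex) set \<Rightarrow> ('a \<Rightarrow> complex) set" where
  "right_translate G \<mu> k X = (\<Union>f\<in>X. lae_rel \<mu> `` {\<lambda>x\<in>carrier G. f (x \<otimes>\<^bsub>G\<^esub> k)})"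

definition Linfty_xi :: "('a, 'b) monoid_scheme \<Rightarrow> 'a set \<Rightarrow> ('a \<Rightarrow> complex) \<Rightarrow> 'a measure \<Rightarrow>
    ('a \<Rightarrow> complex) set normed_cspace" where
  "Linfty_xi G N \<xi> \<mu> = (Linfty \<mu>)\<lparr>vset :=
     {X \<in> vset (Linfty \<mu>). \<forall>k\<in>N. right_translate G \<mu> k X = vscale (Linfty \<mu>) (\<xi> k) X}\<rparr>"

end

theory Submission
  imports Defs "HOL-Algebra.Zassenhaus"
begin

text \<open>
  A bounded functional on \<open>L\<^sup>1\<^sub>\<xi>(G,N)\<close> is a bounded functional on \<open>L\<^sup>1(G)\<close>, and those are given by
  bounded functions. The link is the averaging map, which sends \<open>f\<close> in \<open>C\<^sub>c(G)\<close> to the covariant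
  function \<open>x \<mapsto> \<integral>\<^sub>N f(xs) cnj(\<xi>(s)) ds\<close>. By Weil's formula it does not increase the norm
  (\<open>coset_norm_average\<close>), and every \<open>\<psi>\<close> in \<open>C\<^sub>\<xi>(G,N)\<close> has a preimage with the norm of \<open>\<psi>\<close>, namely
  \<open>\<psi> h / Ph\<close>, where \<open>h \<ge> 0\<close> has compact support and its integrals \<open>Ph\<close> over the cosets are
  positive on the support of \<open>\<psi>\<close> (\<open>covariant_lift\<close>). So a functional \<open>\<phi>\<close>, composed with averaging,
  is integration against some \<open>w\<close> in \<open>L\<^sup>\<infinity>(G)\<close> with the norm of \<open>\<phi>\<close> (\<open>L1_functional_density\<close>).
  Averaging turns the right translation by \<open>k\<close> in \<open>N\<close> into a multiplication by a scalar
  (\<open>average_right_translate\<close>), whence \<open>w(xk) = cnj(\<xi>(k)) w(x)\<close> locally almost everywhere, for each \<open>k\<close>.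

  Conversely, such a \<open>w\<close> defines a functional on \<open>C\<^sub>\<xi>(G,N)\<close> if \<open>\<integral> f w = 0\<close> whenever the average of
  \<open>f\<close> vanishes (\<open>covariant_annihilates_kernel\<close>). The exceptional null set depends on \<open>k\<close>, and
  \<open>(x,k) \<mapsto> w(xk)\<close> need not be measurable for a product measure, so \<open>w\<close> cannot be integrated over the
  cosets. Instead Fubini's theorem is applied to kernels that are continuous in both variables,
  with \<open>w\<close> as a weight in one of them, and the covariance of \<open>w\<close> is used for one \<open>k\<close> at a time
  (\<open>covariant_adjoint\<close>).

  So far the dual space consists of functions that transform under the conjugate of \<open>\<xi>\<close>.
  Complex conjugation would make them transform under \<open>\<xi>\<close>, but it is not linear. They are multiplied by
  \<open>u\<^sup>2\<close>, where \<open>u\<close> is a locally measurable function of modulus one with \<open>u(xk) = \<xi>(k) u(x)\<close>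
  (\<open>covariant_phase\<close>).

  Three general facts are needed on the way. A functional on a normed space and on its completion are the
  same thing (\<open>dual_completion\<close>). Haar measure is unique up to a factor (\<open>haar_unique\<close>), which
  yields the modular function and shows that right translations preserve locally null sets. And
  although \<open>G\<close> need not be \<open>\<sigma>\<close>-finite, translates of the pieces of an open \<open>\<sigma>\<close>-compact subgroup
  partition \<open>G\<close> in such a way that a set of finite measure meets only countably many of them
  (\<open>localizing_cosets\<close>), so densities can be found piece by piece.
\<close>

section \<open>The dual of a completion\<close>

lemma isometrically_isomorphic_trans:
  assumes "isometrically_isomorphic U V" "isometrically_isomorphic V W"
  shows "isometrically_isomorphic U W"
proof -
  obtain \<Phi> \<Psi> where f: "bij_betw \<Phi> (vset U) (vset V)"
      "\<forall>x\<in>vset U. \<forall>y\<in>vset U. \<Phi> (vadd U x y) = vadd V (\<Phi> x) (\<Phi> y)"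
      "\<forall>c. \<forall>x\<in>vset U. \<Phi> (vscale U c x) = vscale V c (\<Phi> x)" "\<forall>x\<in>vset U. vnorm V (\<Phi> x) = vnorm U x"
    and g: "bij_betw \<Psi> (vset V) (vset W)"
      "\<forall>x\<in>vset V. \<forall>y\<in>vset V. \<Psi> (vadd V x y) = vadd W (\<Psi> x) (\<Psi> y)"
      "\<forall>c. \<forall>x\<in>vset V. \<Psi> (vscale V c x) = vscale W c (\<Psi> x)" "\<forall>x\<in>vset V. vnorm W (\<Psi> x) = vnorm V x"
    using assms unfolding isometrically_isomorphic_def by meson
  have "\<Phi> x \<in> vset V" if "x \<in> vset U" for x using f(1) that by (rule bij_betw_apply)
  then show ?thesis unfolding isometrically_isomorphic_def
    by (intro exI[of _ "\<Psi> \<circ> \<Phi>"]) (simp add: bij_betw_trans[OF f(1) g(1)] f(2-) g(2-))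
qed

text \<open>The norm of a functional is its least bound. A vector of norm zero is mapped to zero since
  \<open>\<phi>\<close> is bounded, so a seminorm suffices. Few laws are assumed in order to cover both a space and
  its completion.\<close>

lemma dual_norm_le_iff_gen:
  assumes phi: "\<phi> \<in> bounded_functionals V" and ne: "vset V \<noteq> {}"
    and cl: "\<And>c x. x \<in> vset V \<Longrightarrow> vscale V c x \<in> vset V"
    and nn: "\<And>x. x \<in> vset V \<Longrightarrow> 0 \<le> vnorm V x"
    and sc: "\<And>c x. x \<in> vset V \<Longrightarrow> vnorm V (vscale V c x) = cmod c * vnorm V x"
  shows "vnorm (dual_space V) \<phi> \<le> t \<longleftrightarrow> 0 \<le> t \<and> (\<forall>x\<in>vset V. cmod (\<phi> x) \<le> t * vnorm V x)"
proof -
  let ?B = "{x \<in> vset V. vnorm V x \<le> 1}"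
  obtain B where B: "\<And>x. x \<in> vset V \<Longrightarrow> cmod (\<phi> x) \<le> B * vnorm V x"
    using phi unfolding bounded_functionals_def by blast
  have hom: "\<phi> (vscale V c x) = c * \<phi> x" if "x \<in> vset V" for c x
    using phi that by (simp add: bounded_functionals_def)
  obtain z where z: "z \<in> vset V" using ne by blast
  then have z0: "vscale V 0 z \<in> ?B" by (simp add: cl sc)
  have "cmod (\<phi> x) \<le> \<bar>B\<bar>" if "x \<in> ?B" for x
    using B[of x] that mult_mono[of B "\<bar>B\<bar>" "vnorm V x" 1] nn[of x] by fastforce
  then have bdd: "bdd_above ((\<lambda>x. cmod (\<phi> x)) ` ?B)" by (auto intro!: bdd_aboveI)
  have "(SUP x\<in>?B. cmod (\<phi> x)) \<le> t \<longleftrightarrow> (\<forall>x\<in>?B. cmod (\<phi> x) \<le> t)"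
    using z0 bdd by (intro cSUP_le_iff) auto
  also have "\<dots> \<longleftrightarrow> 0 \<le> t \<and> (\<forall>x\<in>vset V. cmod (\<phi> x) \<le> t * vnorm V x)"
  proof safe
    assume t: "\<forall>x\<in>?B. cmod (\<phi> x) \<le> t"
    then show "0 \<le> t" using z0 norm_ge_zero order_trans by blast
    fix x assume x: "x \<in> vset V"
    show "cmod (\<phi> x) \<le> t * vnorm V x"
    proof (cases "vnorm V x = 0")
      case True
      then show ?thesis using B[OF x] by simp
    next
      case False
      then have p: "vnorm V x > 0" using nn[OF x] by simp
      let ?c = "complex_of_real (1 / vnorm V x)"
      have "cmod (\<phi> (vscale V ?c x)) \<le> t" using t x p by (simp add: cl sc norm_divide)
      then show ?thesis using p x by (simp add: hom norm_mult norm_divide pos_divide_le_eq)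
    qed
  next
    fix x assume "0 \<le> t" "\<forall>x\<in>vset V. cmod (\<phi> x) \<le> t * vnorm V x" "x \<in> vset V" "vnorm V x \<le> 1"
    then show "cmod (\<phi> x) \<le> t" using mult_left_le[of "vnorm V x" t] by fastforce
  qed
  finally show ?thesis by (simp add: dual_space_def)
qed

text \<open>The zero vector is \<open>0 \<cdot> y\<close> for any \<open>y\<close>. Nonzero vectors may have norm zero.\<close>

locale cnormed =
  fixes V :: "'v normed_cspace"
  assumes add_closed: "x \<in> vset V \<Longrightarrow> y \<in> vset V \<Longrightarrow> vadd V x y \<in> vset V"
    and scale_closed: "x \<in> vset V \<Longrightarrow> vscale V c x \<in> vset V"
    and nonempty: "vset V \<noteq> {}"
    and add_commute: "x \<in> vset V \<Longrightarrow> y \<in> vset V \<Longrightarrow> vadd V x y = vadd V y x"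
    and add_assoc: "x \<in> vset V \<Longrightarrow> y \<in> vset V \<Longrightarrow> z \<in> vset V \<Longrightarrow>
      vadd V (vadd V x y) z = vadd V x (vadd V y z)"
    and add_zero: "x \<in> vset V \<Longrightarrow> y \<in> vset V \<Longrightarrow> vadd V x (vscale V 0 y) = x"
    and scale_add: "x \<in> vset V \<Longrightarrow> y \<in> vset V \<Longrightarrow>
      vscale V c (vadd V x y) = vadd V (vscale V c x) (vscale V c y)"
    and add_scale: "x \<in> vset V \<Longrightarrow> vscale V (c + d) x = vadd V (vscale V c x) (vscale V d x)"
    and scale_scale: "x \<in> vset V \<Longrightarrow> vscale V c (vscale V d x) = vscale V (c * d) x"
    and scale_one: "x \<in> vset V \<Longrightarrow> vscale V 1 x = x"
    and norm_triangle: "x \<in> vset V \<Longrightarrow> y \<in> vset V \<Longrightarrow>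
      vnorm V (vadd V x y) \<le> vnorm V x + vnorm V y"
    and norm_scale: "x \<in> vset V \<Longrightarrow> vnorm V (vscale V c x) = cmod c * vnorm V x"
begin

abbreviation neg where "neg x \<equiv> vscale V (-1) x"

lemma add_left_commute:
  assumes "x \<in> vset V" "y \<in> vset V" "z \<in> vset V"
  shows "vadd V x (vadd V y z) = vadd V y (vadd V x z)"
  by (metis assms add_assoc add_commute)

lemma neg_add_cancel: "x \<in> vset V \<Longrightarrow> y \<in> vset V \<Longrightarrow> vadd V x (vadd V y (neg y)) = x"
  by (metis add_scale add_zero scale_one add.right_inverse)

lemma zero_norm: "x \<in> vset V \<Longrightarrow> vnorm V (vscale V 0 x) = 0"
  by (simp add: norm_scale)

lemma vdist_self: "x \<in> vset V \<Longrightarrow> vdist V x x = 0"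
  using add_scale[of x 1 "-1"] by (metis add.right_inverse scale_one vdist_def zero_norm)

lemma norm_nonneg: assumes "x \<in> vset V" shows "0 \<le> vnorm V x"
  using norm_triangle[OF assms scale_closed[OF assms, of "-1"]] vdist_self[OF assms]
  by (simp add: vdist_def norm_scale assms)

lemma vdist_nonneg: "x \<in> vset V \<Longrightarrow> y \<in> vset V \<Longrightarrow> 0 \<le> vdist V x y"
  by (simp add: vdist_def norm_nonneg add_closed scale_closed)

lemma vdist_sym: assumes "x \<in> vset V" "y \<in> vset V" shows "vdist V x y = vdist V y x"
proof -
  have "vadd V y (neg x) = neg (vadd V x (neg y))"
    using assms by (simp add: scale_add scale_closed scale_scale scale_one add_commute)
  then show ?thesis using assms by (simp add: vdist_def norm_scale add_closed scale_closed)
qed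

lemma vdist_triangle:
  assumes "x \<in> vset V" "y \<in> vset V" "z \<in> vset V"
  shows "vdist V x z \<le> vdist V x y + vdist V y z"
proof -
  have "vadd V x (neg z) = vadd V (vadd V x (neg z)) (vadd V y (neg y))"
    using assms by (simp add: neg_add_cancel add_closed scale_closed)
  also have "\<dots> = vadd V (vadd V x (neg y)) (vadd V y (neg z))"
    using assms by (simp add: add_assoc add_commute add_left_commute add_closed scale_closed)
  finally show ?thesis using assms
    by (simp add: vdist_def norm_triangle add_closed scale_closed)
qed

lemma vdist_add:
  assumes "x \<in> vset V" "y \<in> vset V" "x' \<in> vset V" "y' \<in> vset V"
  shows "vdist V (vadd V x x') (vadd V y y') \<le> vdist V x y + vdist V x' y'"
proof -
  have "vadd V (vadd V x x') (neg (vadd V y y')) = vadd V (vadd V x (neg y)) (vadd V x' (neg y'))"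
    using assms by (simp add: scale_add add_assoc add_commute add_left_commute add_closed scale_closed)
  then show ?thesis using assms by (simp add: vdist_def norm_triangle add_closed scale_closed)
qed

lemma vdist_scale:
  assumes "x \<in> vset V" "y \<in> vset V"
  shows "vdist V (vscale V c x) (vscale V c y) = cmod c * vdist V x y"
proof -
  have "vadd V (vscale V c x) (neg (vscale V c y)) = vscale V c (vadd V x (neg y))"
    using assms by (simp add: scale_add scale_closed scale_scale)
  then show ?thesis using assms by (simp add: vdist_def norm_scale add_closed scale_closed)
qed

lemma norm_le_add_vdist:
  assumes "x \<in> vset V" "y \<in> vset V" shows "vnorm V x \<le> vnorm V y + vdist V x y"
proof -
  have "x = vadd V y (vadd V x (neg y))"
    using assms neg_add_cancel[of x y] by (simp add: add_left_commute scale_closed)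
  then show ?thesis using norm_triangle[of y "vadd V x (neg y)"] assms
    by (simp add: vdist_def add_closed scale_closed)
qed

lemma norm_diff_le_vdist:
  assumes "x \<in> vset V" "y \<in> vset V" shows "\<bar>vnorm V x - vnorm V y\<bar> \<le> vdist V x y"
  using norm_le_add_vdist[OF assms] norm_le_add_vdist[OF assms(2,1)] vdist_sym[OF assms] by linarith

subsection \<open>Classes of Cauchy sequences\<close>

definition null_rel where "null_rel = {(\<sigma>, \<tau>). \<sigma> \<in> cauchy_seqs V \<and> \<tau> \<in> cauchy_seqs V \<and>
  (\<lambda>n. vdist V (\<sigma> n) (\<tau> n)) \<longlonglongrightarrow> 0}"

abbreviation cls where "cls \<sigma> \<equiv> null_rel `` {\<sigma>}"

lemma seq_mem: "\<sigma> \<in> cauchy_seqs V \<Longrightarrow> \<sigma> n \<in> vset V"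
  by (auto simp: cauchy_seqs_def)

lemma equiv_null_rel: "equiv (cauchy_seqs V) null_rel"
proof (rule equivI)
  show "null_rel \<subseteq> cauchy_seqs V \<times> cauchy_seqs V" by (auto simp: null_rel_def)
  show "refl_on (cauchy_seqs V) null_rel"
    by (auto simp: refl_on_def null_rel_def vdist_self seq_mem)
  show "sym null_rel" by (rule symI) (auto simp: null_rel_def vdist_sym seq_mem)
  show "trans null_rel"
  proof (rule transI)
    fix \<rho> \<sigma> \<tau> assume "(\<rho>, \<sigma>) \<in> null_rel" "(\<sigma>, \<tau>) \<in> null_rel"
    then have m: "\<rho> \<in> cauchy_seqs V" "\<sigma> \<in> cauchy_seqs V" "\<tau> \<in> cauchy_seqs V"
      and l: "(\<lambda>n. vdist V (\<rho> n) (\<sigma> n) + vdist V (\<sigma> n) (\<tau> n)) \<longlonglongrightarrow> 0"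
      by (auto simp: null_rel_def intro: tendsto_add_zero)
    have "(\<lambda>n. vdist V (\<rho> n) (\<tau> n)) \<longlonglongrightarrow> 0"
      by (rule tendsto_sandwich[OF _ _ tendsto_const l])
        (use m in \<open>auto intro!: always_eventually vdist_nonneg vdist_triangle simp: seq_mem\<close>)
    then show "(\<rho>, \<tau>) \<in> null_rel" using m by (simp add: null_rel_def)
  qed
qed

lemma add_cauchy:
  assumes "\<sigma> \<in> cauchy_seqs V" "\<tau> \<in> cauchy_seqs V"
  shows "(\<lambda>n. vadd V (\<sigma> n) (\<tau> n)) \<in> cauchy_seqs V"
  unfolding cauchy_seqs_def
proof (intro CollectI conjI allI impI)
  show "range (\<lambda>n. vadd V (\<sigma> n) (\<tau> n)) \<subseteq> vset V" using assms by (auto intro: add_closed seq_mem)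
  fix e :: real assume "e > 0"
  then obtain a b where a: "\<forall>m\<ge>a. \<forall>n\<ge>a. vdist V (\<sigma> m) (\<sigma> n) < e/2"
    and b: "\<forall>m\<ge>b. \<forall>n\<ge>b. vdist V (\<tau> m) (\<tau> n) < e/2"
    using assms unfolding cauchy_seqs_def mem_Collect_eq by (meson half_gt_zero)
  show "\<exists>n0. \<forall>m\<ge>n0. \<forall>n\<ge>n0. vdist V (vadd V (\<sigma> m) (\<tau> m)) (vadd V (\<sigma> n) (\<tau> n)) < e"
  proof (intro exI[of _ "max a b"] allI impI)
    fix m n assume mn: "max a b \<le> m" "max a b \<le> n"
    have "vdist V (vadd V (\<sigma> m) (\<tau> m)) (vadd V (\<sigma> n) (\<tau> n))
        \<le> vdist V (\<sigma> m) (\<sigma> n) + vdist V (\<tau> m) (\<tau> n)"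
      by (intro vdist_add seq_mem assms)
    also have "\<dots> < e/2 + e/2" by (intro add_strict_mono) (use a b mn in auto)
    finally show "vdist V (vadd V (\<sigma> m) (\<tau> m)) (vadd V (\<sigma> n) (\<tau> n)) < e" by simp
  qed
qed

lemma scale_cauchy:
  assumes "\<sigma> \<in> cauchy_seqs V"
  shows "(\<lambda>n. vscale V c (\<sigma> n)) \<in> cauchy_seqs V"
  unfolding cauchy_seqs_def
proof (intro CollectI conjI allI impI)
  show "range (\<lambda>n. vscale V c (\<sigma> n)) \<subseteq> vset V" using assms by (auto intro: scale_closed seq_mem)
  fix e :: real assume "e > 0"
  then have "e / (cmod c + 1) > 0" by (simp add: add_nonneg_pos)
  then obtain a where a: "\<forall>m\<ge>a. \<forall>n\<ge>a. vdist V (\<sigma> m) (\<sigma> n) < e / (cmod c + 1)"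
    using assms unfolding cauchy_seqs_def mem_Collect_eq by meson
  show "\<exists>n0. \<forall>m\<ge>n0. \<forall>n\<ge>n0. vdist V (vscale V c (\<sigma> m)) (vscale V c (\<sigma> n)) < e"
  proof (intro exI[of _ a] allI impI)
    fix m n assume mn: "a \<le> m" "a \<le> n"
    have "vdist V (vscale V c (\<sigma> m)) (vscale V c (\<sigma> n)) = cmod c * vdist V (\<sigma> m) (\<sigma> n)"
      by (intro vdist_scale seq_mem assms)
    also have "\<dots> \<le> (cmod c + 1) * vdist V (\<sigma> m) (\<sigma> n)"
      by (intro mult_right_mono vdist_nonneg seq_mem assms) auto
    also have "\<dots> < e" using a mn
      by (metis add_nonneg_pos mult.commute norm_ge_zero pos_less_divide_eq zero_less_one)
    finally show "vdist V (vscale V c (\<sigma> m)) (vscale V c (\<sigma> n)) < e" .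
  qed
qed

lemma const_cauchy: "x \<in> vset V \<Longrightarrow> (\<lambda>_. x) \<in> cauchy_seqs V"
  by (auto simp: cauchy_seqs_def vdist_self)

lemma norm_convergent:
  assumes "\<sigma> \<in> cauchy_seqs V" shows "convergent (\<lambda>n. vnorm V (\<sigma> n))"
proof (rule Cauchy_convergent, rule metric_CauchyI)
  fix e :: real assume "e > 0"
  then obtain a where a: "\<forall>m\<ge>a. \<forall>n\<ge>a. vdist V (\<sigma> m) (\<sigma> n) < e"
    using assms unfolding cauchy_seqs_def mem_Collect_eq by meson
  show "\<exists>M. \<forall>m\<ge>M. \<forall>n\<ge>M. dist (vnorm V (\<sigma> m)) (vnorm V (\<sigma> n)) < e"
    using a norm_diff_le_vdist[OF seq_mem seq_mem, OF assms assms]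
    by (metis dist_real_def le_less_trans)
qed

abbreviation cmpl where "cmpl \<equiv> banach_completion V"

lemma vset_cmpl: "vset cmpl = cauchy_seqs V // null_rel"
  by (simp add: banach_completion_def quotient_space_def cauchy_space_def null_rel_def)

lemma cls_mem: "\<sigma> \<in> cauchy_seqs V \<Longrightarrow> cls \<sigma> \<in> vset cmpl"
  by (simp add: vset_cmpl quotientI)

lemma clsE: assumes "X \<in> vset cmpl" obtains \<sigma> where "\<sigma> \<in> cauchy_seqs V" "X = cls \<sigma>"
  using assms by (auto simp: vset_cmpl elim: quotientE)

lemma cls_add:
  assumes s: "\<sigma> \<in> cauchy_seqs V" and t: "\<tau> \<in> cauchy_seqs V"
  shows "vadd cmpl (cls \<sigma>) (cls \<tau>) = cls (\<lambda>n. vadd V (\<sigma> n) (\<tau> n))"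
proof -
  have "(\<lambda>\<sigma> \<tau>. cls (\<lambda>n. vadd V (\<sigma> n) (\<tau> n))) respects2 null_rel"
  proof (rule congruent2I')
    fix \<sigma> \<sigma>' \<tau> \<tau>' assume "(\<sigma>, \<sigma>') \<in> null_rel" "(\<tau>, \<tau>') \<in> null_rel"
    then have m: "\<sigma> \<in> cauchy_seqs V" "\<sigma>' \<in> cauchy_seqs V" "\<tau> \<in> cauchy_seqs V" "\<tau>' \<in> cauchy_seqs V"
      and l: "(\<lambda>n. vdist V (\<sigma> n) (\<sigma>' n) + vdist V (\<tau> n) (\<tau>' n)) \<longlonglongrightarrow> 0"
      by (auto simp: null_rel_def intro: tendsto_add_zero)
    have "(\<lambda>n. vdist V (vadd V (\<sigma> n) (\<tau> n)) (vadd V (\<sigma>' n) (\<tau>' n))) \<longlonglongrightarrow> 0"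
      by (rule tendsto_sandwich[OF _ _ tendsto_const l])
        (use m in \<open>auto intro!: always_eventually vdist_nonneg vdist_add add_closed simp: seq_mem\<close>)
    then show "cls (\<lambda>n. vadd V (\<sigma> n) (\<tau> n)) = cls (\<lambda>n. vadd V (\<sigma>' n) (\<tau>' n))"
      by (intro equiv_class_eq[OF equiv_null_rel])
        (simp add: null_rel_def add_cauchy[OF m(1,3)] add_cauchy[OF m(2,4)])
  qed
  from UN_equiv_class2[OF equiv_null_rel equiv_null_rel this s t] show ?thesis
    by (simp add: banach_completion_def quotient_space_def cauchy_space_def null_rel_def)
qed

lemma cls_scale:
  assumes s: "\<sigma> \<in> cauchy_seqs V"
  shows "vscale cmpl c (cls \<sigma>) = cls (\<lambda>n. vscale V c (\<sigma> n))"
proof -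
  have "(\<lambda>\<sigma>. cls (\<lambda>n. vscale V c (\<sigma> n))) respects null_rel"
  proof (rule congruentI)
    fix \<sigma> \<sigma>' assume "(\<sigma>, \<sigma>') \<in> null_rel"
    then have m: "\<sigma> \<in> cauchy_seqs V" "\<sigma>' \<in> cauchy_seqs V"
      and l: "(\<lambda>n. vdist V (\<sigma> n) (\<sigma>' n)) \<longlonglongrightarrow> 0" by (auto simp: null_rel_def)
    have "(\<lambda>n. vdist V (vscale V c (\<sigma> n)) (vscale V c (\<sigma>' n))) \<longlonglongrightarrow> 0"
      using tendsto_mult_left[OF l, of "cmod c"] m by (simp add: vdist_scale seq_mem)
    then show "cls (\<lambda>n. vscale V c (\<sigma> n)) = cls (\<lambda>n. vscale V c (\<sigma>' n))"
      by (intro equiv_class_eq[OF equiv_null_rel])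
        (simp add: null_rel_def scale_cauchy[OF m(1)] scale_cauchy[OF m(2)])
  qed
  from UN_equiv_class[OF equiv_null_rel this s] show ?thesis
    by (simp add: banach_completion_def quotient_space_def cauchy_space_def null_rel_def)
qed

lemma cls_norm:
  assumes s: "\<sigma> \<in> cauchy_seqs V"
  shows "(\<lambda>n. vnorm V (\<sigma> n)) \<longlonglongrightarrow> vnorm cmpl (cls \<sigma>)"
proof -
  have "lim (\<lambda>n. vnorm V (\<tau> n)) = lim (\<lambda>n. vnorm V (\<sigma> n))" if "(\<sigma>, \<tau>) \<in> null_rel" for \<tau>
  proof -
    have t: "\<tau> \<in> cauchy_seqs V" and l: "(\<lambda>n. vdist V (\<sigma> n) (\<tau> n)) \<longlonglongrightarrow> 0"
      using that by (auto simp: null_rel_def)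
    have "(\<lambda>n. vnorm V (\<sigma> n) - vnorm V (\<tau> n)) \<longlonglongrightarrow> 0"
      by (rule Lim_null_comparison[OF _ l])
        (use s t in \<open>auto intro!: always_eventually norm_diff_le_vdist simp: seq_mem\<close>)
    then have "lim (\<lambda>n. vnorm V (\<sigma> n)) - lim (\<lambda>n. vnorm V (\<tau> n)) = 0"
      using norm_convergent[OF s] norm_convergent[OF t] unfolding convergent_LIMSEQ_iff
      by (blast intro: LIMSEQ_unique tendsto_diff)
    then show ?thesis by simp
  qed
  then have "(\<lambda>\<tau>. lim (\<lambda>n. vnorm V (\<tau> n))) ` cls \<sigma> \<subseteq> {lim (\<lambda>n. vnorm V (\<sigma> n))}"
    by blast
  then have "(\<lambda>\<tau>. lim (\<lambda>n. vnorm V (\<tau> n))) ` cls \<sigma> = {lim (\<lambda>n. vnorm V (\<sigma> n))}"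
    using equiv_class_self[OF equiv_null_rel s] by blast
  then have "vnorm cmpl (cls \<sigma>) = lim (\<lambda>n. vnorm V (\<sigma> n))"
    by (simp add: banach_completion_def quotient_space_def cauchy_space_def flip: null_rel_def)
  then show ?thesis using norm_convergent[OF s] by (simp add: convergent_LIMSEQ_iff)
qed

lemma bounded_functional_diff:
  assumes "\<phi> \<in> bounded_functionals V" "x \<in> vset V" "y \<in> vset V"
  shows "\<phi> (vadd V x (neg y)) = \<phi> x - \<phi> y"
  using assms by (simp add: bounded_functionals_def scale_closed)

text \<open>A bounded functional maps a Cauchy sequence to a Cauchy sequence of numbers, whose limit
  is the value of the extended functional at the class.\<close>

definition extend :: "('v \<Rightarrow> complex) \<Rightarrow> (nat \<Rightarrow> 'v) set \<Rightarrow> complex" where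
  "extend \<phi> = (\<lambda>X\<in>vset cmpl. lim (\<lambda>n. \<phi> ((SOME \<sigma>. \<sigma> \<in> cauchy_seqs V \<and> cls \<sigma> = X) n)))"

lemma extend_limit:
  assumes phi: "\<phi> \<in> bounded_functionals V" and s: "\<sigma> \<in> cauchy_seqs V"
  shows "(\<lambda>n. \<phi> (\<sigma> n)) \<longlonglongrightarrow> extend \<phi> (cls \<sigma>)"
proof -
  obtain B where B: "\<And>x. x \<in> vset V \<Longrightarrow> cmod (\<phi> x) \<le> B * vnorm V x"
    using phi unfolding bounded_functionals_def by blast
  have B': "cmod (\<phi> x) \<le> (\<bar>B\<bar> + 1) * vnorm V x" if "x \<in> vset V" for x
    using B[OF that] mult_right_mono[of B "\<bar>B\<bar> + 1" "vnorm V x"] norm_nonneg[OF that] by linarith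
  have D: "cmod (\<phi> x - \<phi> y) \<le> (\<bar>B\<bar> + 1) * vdist V x y" if "x \<in> vset V" "y \<in> vset V" for x y
    using B'[of "vadd V x (neg y)"] that
    by (simp add: bounded_functional_diff[OF phi] vdist_def add_closed scale_closed)
  define \<tau> where "\<tau> = (SOME \<tau>. \<tau> \<in> cauchy_seqs V \<and> cls \<tau> = cls \<sigma>)"
  have t: "\<tau> \<in> cauchy_seqs V" "cls \<tau> = cls \<sigma>"
    unfolding \<tau>_def using someI[of "\<lambda>\<tau>. \<tau> \<in> cauchy_seqs V \<and> cls \<tau> = cls \<sigma>" \<sigma>] s by auto
  have "(\<tau>, \<sigma>) \<in> null_rel" using t(1,2) s eq_equiv_class_iff[OF equiv_null_rel] by blast
  then have l: "(\<lambda>n. vdist V (\<sigma> n) (\<tau> n)) \<longlonglongrightarrow> 0"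
    using s t by (simp add: null_rel_def vdist_sym seq_mem)
  have "Cauchy (\<lambda>n. \<phi> (\<tau> n))"
  proof (rule metric_CauchyI)
    fix e :: real assume "e > 0"
    then have "e / (\<bar>B\<bar> + 1) > 0" by simp
    then obtain a where a: "\<forall>m\<ge>a. \<forall>n\<ge>a. vdist V (\<tau> m) (\<tau> n) < e / (\<bar>B\<bar> + 1)"
      using t(1) unfolding cauchy_seqs_def mem_Collect_eq by meson
    have "dist (\<phi> (\<tau> m)) (\<phi> (\<tau> n)) < e" if "m \<ge> a" "n \<ge> a" for m n
    proof -
      have "cmod (\<phi> (\<tau> m) - \<phi> (\<tau> n)) \<le> (\<bar>B\<bar> + 1) * vdist V (\<tau> m) (\<tau> n)"
        by (intro D seq_mem t)
      also have "\<dots> < e" using a that by (simp add: pos_less_divide_eq mult.commute)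
      finally show ?thesis by (simp add: dist_norm)
    qed
    then show "\<exists>M. \<forall>m\<ge>M. \<forall>n\<ge>M. dist (\<phi> (\<tau> m)) (\<phi> (\<tau> n)) < e" by blast
  qed
  then have "(\<lambda>n. \<phi> (\<tau> n)) \<longlonglongrightarrow> extend \<phi> (cls \<sigma>)"
    using cls_mem[OF s] by (simp add: extend_def \<tau>_def Cauchy_convergent_iff convergent_LIMSEQ_iff)
  moreover have "(\<lambda>n. \<phi> (\<sigma> n) - \<phi> (\<tau> n)) \<longlonglongrightarrow> 0"
    by (rule Lim_null_comparison[OF _ tendsto_mult_right_zero[OF l, of "\<bar>B\<bar> + 1"]])
      (use s t in \<open>auto intro!: always_eventually D simp: seq_mem\<close>)
  ultimately show ?thesis using tendsto_add by fastforce
qed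

lemma extend_bound:
  assumes phi: "\<phi> \<in> bounded_functionals V" and t: "\<And>x. x \<in> vset V \<Longrightarrow> cmod (\<phi> x) \<le> t * vnorm V x"
    and X: "X \<in> vset cmpl"
  shows "cmod (extend \<phi> X) \<le> t * vnorm cmpl X"
proof -
  obtain \<sigma> where s: "\<sigma> \<in> cauchy_seqs V" "X = cls \<sigma>" using X by (rule clsE)
  show ?thesis unfolding s(2)
    by (rule LIMSEQ_le[OF tendsto_norm[OF extend_limit[OF phi s(1)]]
          tendsto_mult_left[OF cls_norm[OF s(1)], of t]])
      (use t[OF seq_mem[OF s(1)]] in blast)
qed

lemma extend_mem:
  assumes phi: "\<phi> \<in> bounded_functionals V"
  shows "extend \<phi> \<in> bounded_functionals cmpl"
  unfolding bounded_functionals_def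
proof (intro CollectI conjI ballI allI)
  show "extend \<phi> \<in> extensional (vset cmpl)" by (simp add: extend_def)
  fix X assume X: "X \<in> vset cmpl"
  obtain \<sigma> where s: "\<sigma> \<in> cauchy_seqs V" "X = cls \<sigma>" using X by (rule clsE)
  {
    fix c
    have "(\<lambda>n. \<phi> (vscale V c (\<sigma> n))) \<longlonglongrightarrow> c * extend \<phi> X"
      using tendsto_mult_left[OF extend_limit[OF phi s(1)], of c] phi s
      by (simp add: bounded_functionals_def seq_mem)
    then show "extend \<phi> (vscale cmpl c X) = c * extend \<phi> X"
      using extend_limit[OF phi scale_cauchy[OF s(1), of c]] s
      by (simp add: cls_scale LIMSEQ_unique)
  next
    fix Y assume Y: "Y \<in> vset cmpl"
    obtain \<tau> where t: "\<tau> \<in> cauchy_seqs V" "Y = cls \<tau>" using Y by (rule clsE)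
    have "(\<lambda>n. \<phi> (vadd V (\<sigma> n) (\<tau> n))) \<longlonglongrightarrow> extend \<phi> X + extend \<phi> Y"
      using tendsto_add[OF extend_limit[OF phi s(1)] extend_limit[OF phi t(1)]] phi s t
      by (simp add: bounded_functionals_def seq_mem)
    then show "extend \<phi> (vadd cmpl X Y) = extend \<phi> X + extend \<phi> Y"
      using extend_limit[OF phi add_cauchy[OF s(1) t(1)]] s t
      by (simp add: cls_add LIMSEQ_unique)
  }
next
  obtain B where B: "\<And>x. x \<in> vset V \<Longrightarrow> cmod (\<phi> x) \<le> B * vnorm V x"
    using phi unfolding bounded_functionals_def by blast
  show "\<exists>B. \<forall>X\<in>vset cmpl. cmod (extend \<phi> X) \<le> B * vnorm cmpl X"
    by (rule exI[of _ B]) (intro ballI extend_bound[OF phi B])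
qed

definition restr :: "((nat \<Rightarrow> 'v) set \<Rightarrow> complex) \<Rightarrow> 'v \<Rightarrow> complex" where
  "restr \<phi> = (\<lambda>x\<in>vset V. \<phi> (cls (\<lambda>_. x)))"

lemma const_norm: "x \<in> vset V \<Longrightarrow> vnorm cmpl (cls (\<lambda>_. x)) = vnorm V x"
  using LIMSEQ_unique[OF tendsto_const cls_norm[OF const_cauchy]] by (rule sym)

lemma restr_mem:
  assumes "\<phi> \<in> bounded_functionals cmpl"
  shows "restr \<phi> \<in> bounded_functionals V"
proof -
  obtain B where "\<And>X. X \<in> vset cmpl \<Longrightarrow> cmod (\<phi> X) \<le> B * vnorm cmpl X"
    using assms unfolding bounded_functionals_def by blast
  then have "cmod (restr \<phi> x) \<le> B * vnorm V x" if "x \<in> vset V" for x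
    using that cls_mem[OF const_cauchy[OF that]] by (simp add: restr_def const_norm[symmetric])
  then have bd: "\<exists>B. \<forall>x\<in>vset V. cmod (restr \<phi> x) \<le> B * vnorm V x" by blast
  have "cls (\<lambda>_. vadd V x y) = vadd cmpl (cls (\<lambda>_. x)) (cls (\<lambda>_. y))"
    if "x \<in> vset V" "y \<in> vset V" for x y
    using cls_add[OF const_cauchy const_cauchy, OF that] by simp
  moreover have "cls (\<lambda>_. vscale V c x) = vscale cmpl c (cls (\<lambda>_. x))" if "x \<in> vset V" for c x
    using cls_scale[OF const_cauchy, OF that] by simp
  ultimately have "restr \<phi> (vadd V x y) = restr \<phi> x + restr \<phi> y"
    "restr \<phi> (vscale V c x) = c * restr \<phi> x" if "x \<in> vset V" "y \<in> vset V" for c x y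
    using that assms cls_mem[OF const_cauchy[OF that(1)]] cls_mem[OF const_cauchy[OF that(2)]]
    unfolding restr_def bounded_functionals_def by (simp_all add: add_closed scale_closed)
  then show ?thesis using bd by (auto simp: bounded_functionals_def restr_def)
qed

lemma restr_extend: "\<phi> \<in> bounded_functionals V \<Longrightarrow> restr (extend \<phi>) = \<phi>"
proof (rule extensionalityI[of _ "vset V"])
  fix x assume "\<phi> \<in> bounded_functionals V" "x \<in> vset V"
  then show "restr (extend \<phi>) x = \<phi> x"
    using extend_limit[OF _ const_cauchy, of \<phi> x] by (simp add: restr_def LIMSEQ_const_iff)
qed (auto simp: restr_def bounded_functionals_def)

text \<open>The class of \<open>\<sigma>\<close> is the limit of the classes of the constant sequences \<open>\<sigma> m\<close>, so a bounded
  functional is determined by its values on these.\<close>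

lemma extend_restr:
  assumes phi: "\<phi> \<in> bounded_functionals cmpl"
  shows "extend (restr \<phi>) = \<phi>"
proof (rule extensionalityI[of _ "vset cmpl"])
  fix X assume "X \<in> vset cmpl"
  then obtain \<sigma> where s: "\<sigma> \<in> cauchy_seqs V" "X = cls \<sigma>" by (rule clsE)
  obtain B where B: "\<And>X. X \<in> vset cmpl \<Longrightarrow> cmod (\<phi> X) \<le> B * vnorm cmpl X"
    using phi unfolding bounded_functionals_def by blast
  define d where "d m = (\<lambda>n. vadd V (\<sigma> n) (neg (\<sigma> m)))" for m
  have d: "d m \<in> cauchy_seqs V" for m
    unfolding d_def by (intro add_cauchy s const_cauchy scale_closed seq_mem)
  have dc: "cls (d m) = vadd cmpl X (vscale cmpl (-1) (cls (\<lambda>_. \<sigma> m)))" for m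
    unfolding s(2) d_def cls_scale[OF const_cauchy[OF seq_mem[OF s(1)]]]
    by (rule cls_add[OF s(1) scale_cauchy[OF const_cauchy[OF seq_mem[OF s(1)]]], symmetric])
  have "\<phi> (cls (d m)) = \<phi> X - restr \<phi> (\<sigma> m)" for m
  proof -
    have c: "cls (\<lambda>_. \<sigma> m) \<in> vset cmpl" by (intro cls_mem const_cauchy seq_mem s)
    have "vscale cmpl (-1) (cls (\<lambda>_. \<sigma> m)) \<in> vset cmpl"
      unfolding cls_scale[OF const_cauchy[OF seq_mem[OF s(1)]]]
      by (intro cls_mem const_cauchy scale_closed seq_mem s)
    then have "\<phi> (cls (d m)) = \<phi> X + \<phi> (vscale cmpl (-1) (cls (\<lambda>_. \<sigma> m)))"
      using phi \<open>X \<in> vset cmpl\<close> unfolding dc bounded_functionals_def by blast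
    also have "\<phi> (vscale cmpl (-1) (cls (\<lambda>_. \<sigma> m))) = - 1 * \<phi> (cls (\<lambda>_. \<sigma> m))"
      using phi c unfolding bounded_functionals_def by blast
    finally show ?thesis by (simp add: restr_def seq_mem[OF s(1)])
  qed
  then have b: "cmod (\<phi> X - restr \<phi> (\<sigma> m)) \<le> B * vnorm cmpl (cls (d m))" for m
    using B[OF cls_mem[OF d[of m]]] by simp
  have "(\<lambda>m. vnorm cmpl (cls (d m))) \<longlonglongrightarrow> 0"
  proof (rule LIMSEQ_I)
    fix e :: real assume "e > 0"
    then obtain a where a: "\<forall>m\<ge>a. \<forall>n\<ge>a. vdist V (\<sigma> m) (\<sigma> n) < e/2"
      using s(1) unfolding cauchy_seqs_def mem_Collect_eq by (meson half_gt_zero)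
    have "norm (vnorm cmpl (cls (d m)) - 0) < e" if "m \<ge> a" for m
    proof -
      have l: "(\<lambda>n. vnorm V (d m n)) \<longlonglongrightarrow> vnorm cmpl (cls (d m))" by (rule cls_norm[OF d])
      have "vnorm cmpl (cls (d m)) \<le> e/2"
        by (rule LIMSEQ_le_const2[OF l]) (use a that in \<open>auto simp: d_def vdist_def intro!: exI[of _ a] less_imp_le\<close>)
      moreover have "0 \<le> vnorm cmpl (cls (d m))"
        by (rule LIMSEQ_le_const[OF l]) (use d in \<open>auto intro!: norm_nonneg simp: seq_mem\<close>)
      ultimately show ?thesis using \<open>e > 0\<close> by simp
    qed
    then show "\<exists>no. \<forall>m\<ge>no. norm (vnorm cmpl (cls (d m)) - 0) < e" by blast
  qed
  then have "(\<lambda>m. B * vnorm cmpl (cls (d m))) \<longlonglongrightarrow> 0" by (rule tendsto_mult_right_zero)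
  then have "(\<lambda>m. \<phi> X - restr \<phi> (\<sigma> m)) \<longlonglongrightarrow> 0"
    by (rule Lim_null_comparison[rotated]) (simp add: b)
  then have "(\<lambda>m. restr \<phi> (\<sigma> m)) \<longlonglongrightarrow> \<phi> X"
    using tendsto_diff[OF tendsto_const[of "\<phi> X"]] by fastforce
  then show "extend (restr \<phi>) X = \<phi> X"
    using extend_limit[OF restr_mem[OF phi] s(1)] s(2) LIMSEQ_unique by blast
qed (use phi in \<open>auto simp: extend_def bounded_functionals_def\<close>)

lemma cmpl_scale_closed: "X \<in> vset cmpl \<Longrightarrow> vscale cmpl c X \<in> vset cmpl"
  by (erule clsE) (auto simp: cls_scale intro: cls_mem scale_cauchy)

lemma cmpl_norm_nonneg: assumes "X \<in> vset cmpl" shows "0 \<le> vnorm cmpl X"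
proof -
  obtain \<sigma> where s: "\<sigma> \<in> cauchy_seqs V" "X = cls \<sigma>" using assms by (rule clsE)
  show ?thesis unfolding s(2)
    by (rule LIMSEQ_le_const[OF cls_norm[OF s(1)]]) (use s in \<open>auto intro!: norm_nonneg simp: seq_mem\<close>)
qed

lemma cmpl_norm_scale: assumes "X \<in> vset cmpl" shows "vnorm cmpl (vscale cmpl c X) = cmod c * vnorm cmpl X"
proof -
  obtain \<sigma> where s: "\<sigma> \<in> cauchy_seqs V" "X = cls \<sigma>" using assms by (rule clsE)
  have "(\<lambda>n. vnorm V (vscale V c (\<sigma> n))) \<longlonglongrightarrow> cmod c * vnorm cmpl X"
    using tendsto_mult_left[OF cls_norm[OF s(1)], of "cmod c"] s by (simp add: norm_scale seq_mem)
  then show ?thesis using cls_norm[OF scale_cauchy[OF s(1), of c]] s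
    by (simp add: cls_scale LIMSEQ_unique)
qed

lemma dual_norm_le_iff:
  assumes "\<phi> \<in> bounded_functionals V"
  shows "vnorm (dual_space V) \<phi> \<le> t \<longleftrightarrow> 0 \<le> t \<and> (\<forall>x\<in>vset V. cmod (\<phi> x) \<le> t * vnorm V x)"
  using dual_norm_le_iff_gen[OF assms nonempty scale_closed norm_nonneg norm_scale] .

lemma cmpl_dual_norm_le_iff:
  assumes "\<phi> \<in> bounded_functionals cmpl"
  shows "vnorm (dual_space cmpl) \<phi> \<le> t \<longleftrightarrow>
    0 \<le> t \<and> (\<forall>X\<in>vset cmpl. cmod (\<phi> X) \<le> t * vnorm cmpl X)"
proof (rule dual_norm_le_iff_gen[OF assms _ cmpl_scale_closed cmpl_norm_nonneg cmpl_norm_scale])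
  show "vset cmpl \<noteq> {}" using nonempty cls_mem[OF const_cauchy] by blast
qed

text \<open>Restriction to the constant sequences is the isomorphism. It is injective because these are
  dense, and onto because bounded functionals extend.\<close>

lemma dual_completion: "isometrically_isomorphic (dual_space cmpl) (dual_space V)"
  unfolding isometrically_isomorphic_def
proof (intro exI[of _ restr] conjI ballI allI)
  show "bij_betw restr (vset (dual_space cmpl)) (vset (dual_space V))"
    by (rule bij_betw_byWitness[of _ extend])
      (auto simp: dual_space_def restr_extend extend_restr restr_mem extend_mem)
next
  fix \<phi> assume "\<phi> \<in> vset (dual_space cmpl)"
  then have phi: "\<phi> \<in> bounded_functionals cmpl" by (simp add: dual_space_def)
  have c: "cls (\<lambda>_. x) \<in> vset cmpl" if "x \<in> vset V" for x
    using that by (intro cls_mem const_cauchy)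
  show "restr (vscale (dual_space cmpl) c \<phi>) = vscale (dual_space V) c (restr \<phi>)" for c
    using c by (auto simp: dual_space_def restr_def fun_eq_iff)
  show "restr (vadd (dual_space cmpl) \<phi> \<psi>) = vadd (dual_space V) (restr \<phi>) (restr \<psi>)" for \<psi>
    using c by (auto simp: dual_space_def restr_def fun_eq_iff)
  have "(\<forall>X\<in>vset cmpl. cmod (\<phi> X) \<le> t * vnorm cmpl X) \<longleftrightarrow>
      (\<forall>x\<in>vset V. cmod (restr \<phi> x) \<le> t * vnorm V x)" for t
    using extend_bound[OF restr_mem[OF phi], of t] c extend_restr[OF phi]
    by (auto simp: restr_def const_norm) (metis c const_norm)
  then have "vnorm (dual_space cmpl) \<phi> \<le> t \<longleftrightarrow> vnorm (dual_space V) (restr \<phi>) \<le> t" for t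
    by (simp add: cmpl_dual_norm_le_iff[OF phi] dual_norm_le_iff[OF restr_mem[OF phi]])
  then show "vnorm (dual_space V) (restr \<phi>) = vnorm (dual_space cmpl) \<phi>"
    by (meson order_antisym order_refl)
qed

end

section \<open>Integrals of continuous kernels\<close>

lemma continuous_map_metric_iff:
  fixes f :: "'a \<Rightarrow> 'b::metric_space"
  shows "continuous_map X euclidean f \<longleftrightarrow>
    (\<forall>x\<in>topspace X. \<forall>e>0. \<exists>U. openin X U \<and> x \<in> U \<and> (\<forall>y\<in>U. dist (f y) (f x) < e))"
  using Met_TC.continuous_map_to_metric[of X f]
  by (simp add: mtopology_is_euclidean ball_def dist_commute)

lemma continuous_map_mult:
  fixes f g :: "'a \<Rightarrow> 'b::real_normed_algebra"
  shows "continuous_map X euclidean f \<Longrightarrow> continuous_map X euclidean g \<Longrightarrow>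
    continuous_map X euclidean (\<lambda>x. f x * g x)"
  by (simp add: continuous_map_atin tendsto_mult)

lemma continuous_map_cdivide:
  fixes f g :: "'a \<Rightarrow> 'b::real_normed_field"
  shows "continuous_map X euclidean f \<Longrightarrow> continuous_map X euclidean g \<Longrightarrow>
    (\<And>x. x \<in> topspace X \<Longrightarrow> g x \<noteq> 0) \<Longrightarrow> continuous_map X euclidean (\<lambda>x. f x / g x)"
  by (simp add: continuous_map_atin tendsto_divide)

lemma continuous_map_cnj:
  "continuous_map X euclidean f \<Longrightarrow> continuous_map X euclidean (\<lambda>x. cnj (f x))"
  by (simp add: continuous_map_atin tendsto_cnj)

lemma continuous_map_of_real:
  "continuous_map X euclidean f \<Longrightarrow> continuous_map X euclidean (\<lambda>x. complex_of_real (f x))"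
  by (simp add: continuous_map_atin tendsto_of_real)

lemma compactin_bounded_image:
  fixes f :: "'a \<Rightarrow> 'b::metric_space"
  assumes "compactin X K" "continuous_map X euclidean f" shows "bounded (f ` K)"
  using image_compactin[OF assms] by (simp add: compact_imp_bounded)

text \<open>Joint continuity becomes uniform when one variable runs through a compact set.\<close>

lemma tube_uniform:
  fixes F :: "'x \<Rightarrow> 'y \<Rightarrow> 'b::metric_space"
  assumes F: "continuous_map (prod_topology X Y) euclidean (\<lambda>(x, y). F x y)"
    and x0: "x0 \<in> topspace X" and L: "compactin Y L" and e: "e > 0"
  obtains U where "openin X U" "x0 \<in> U" "\<And>x y. x \<in> U \<Longrightarrow> y \<in> L \<Longrightarrow> dist (F x y) (F x0 y) < e"
proof -
  let ?d = "\<lambda>(x, y). dist (F x y) (F x0 y)"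
  have "continuous_map (prod_topology X Y) (prod_topology X Y) (\<lambda>(x, y). (x0, y))"
    using x0 by (auto simp: case_prod_unfold intro!: continuous_map_pairedI continuous_map_snd)
  from continuous_map_compose[OF this F]
  have "continuous_map (prod_topology X Y) euclidean (\<lambda>(x, y). F x0 y)"
    by (simp add: o_def case_prod_unfold)
  with F have "continuous_map (prod_topology X Y) euclideanreal ?d"
    by (auto simp: continuous_map_atin case_prod_unfold intro!: tendsto_dist)
  from openin_continuous_map_preimage[OF this, of "{..<e}"]
  have W: "openin (prod_topology X Y) {z \<in> topspace (prod_topology X Y). ?d z < e}" by simp
  have "L \<subseteq> topspace Y" using L by (rule compactin_subset_topspace)
  then have "{x0} \<times> L \<subseteq> {z \<in> topspace (prod_topology X Y). ?d z < e}" using x0 e by auto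
  from tube_lemma_right[OF W L x0 this] obtain U V where
    "openin X U" "x0 \<in> U" "L \<subseteq> V" "U \<times> V \<subseteq> {z \<in> topspace (prod_topology X Y). ?d z < e}" by blast
  moreover from this have "dist (F x y) (F x0 y) < e" if "x \<in> U" "y \<in> L" for x y
  proof -
    have "(x, y) \<in> U \<times> V" using that \<open>L \<subseteq> V\<close> by blast
    then have "(x, y) \<in> {z \<in> topspace (prod_topology X Y). ?d z < e}"
      using \<open>U \<times> V \<subseteq> _\<close> by blast
    then show ?thesis by simp
  qed
  ultimately show thesis by (intro that[of U])
qed

lemma continuous_map_slice:
  assumes "continuous_map (prod_topology X Y) Z (\<lambda>(x, y). F x y)" "x \<in> topspace X"
  shows "continuous_map Y Z (F x)"
proof -
  have "continuous_map Y (prod_topology X Y) (\<lambda>y. (x, y))"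
    using assms(2) by (intro continuous_map_pairedI) auto
  from continuous_map_compose[OF this assms(1)] show ?thesis by (simp add: o_def)
qed

lemma continuous_map_swap_args:
  assumes "continuous_map (prod_topology X Y) Z (\<lambda>(x, y). F x y)"
  shows "continuous_map (prod_topology Y X) Z (\<lambda>(y, x). F x y)"
proof -
  have "continuous_map (prod_topology Y X) (prod_topology X Y) (\<lambda>(y, x). (x, y))"
    by (auto simp: case_prod_unfold intro!: continuous_map_pairedI continuous_map_snd continuous_map_fst)
  from continuous_map_compose[OF this assms] show ?thesis by (simp add: o_def case_prod_unfold)
qed

text \<open>The locale covers both a Borel measure and its completion.\<close>

locale borel_top =
  fixes T :: "'a topology" and M :: "'a measure"
  assumes space_M: "space M = topspace T" and open_sets: "openin T U \<Longrightarrow> U \<in> sets M"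
begin

lemma closed_sets: "closedin T C \<Longrightarrow> C \<in> sets M"
  by (metis closedin_def double_diff open_sets order_refl sets.compl_sets space_M)

lemma continuous_measurable:
  assumes "continuous_map T euclidean f" shows "f \<in> borel_measurable M"
proof (rule borel_measurableI)
  fix S :: "'b set" assume "open S"
  then have "openin T {x \<in> topspace T. f x \<in> S}"
    using assms by (simp add: openin_continuous_map_preimage)
  moreover have "{x \<in> topspace T. f x \<in> S} = f -` S \<inter> space M" by (auto simp: space_M)
  ultimately show "f -` S \<inter> space M \<in> sets M" using open_sets by metis
qed

lemma integrable_compact_support:
  fixes f :: "'a \<Rightarrow> 'b::{banach, second_countable_topology}"
  assumes f: "continuous_map T euclidean f" and L: "compactin T L" "L \<in> sets M" "emeasure M L < \<infinity>"
    and z: "\<And>y. y \<in> topspace T - L \<Longrightarrow> f y = 0"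
  shows "integrable M f"
proof -
  obtain B where "\<forall>y\<in>L. norm (f y) \<le> B"
    using compactin_bounded_image[OF L(1) f] by (auto simp: bounded_iff)
  then have "integrable M (\<lambda>x. indicator L x *\<^sub>R f x)"
    using L continuous_measurable[OF f] by (intro integrableI_bounded_set_indicator[where B = B]) auto
  also have "?this \<longleftrightarrow> integrable M f"
    using z by (intro Bochner_Integration.integrable_cong) (auto simp: space_M indicator_def)
  finally show ?thesis .
qed

text \<open>The compact set that carries the integrand may move with \<open>x\<close>, as it does for the integrals of a
  function with compact support over the cosets of a subgroup.\<close>

lemma continuous_integral_param:
  fixes F :: "'x \<Rightarrow> 'a \<Rightarrow> complex"
  assumes F: "continuous_map (prod_topology X T) euclidean (\<lambda>(x, y). F x y)"
    and loc: "\<And>x. x \<in> topspace X \<Longrightarrow> \<exists>U L. openin X U \<and> x \<in> U \<and> compactin T L \<and> L \<in> sets M \<and>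
      emeasure M L < \<infinity> \<and> (\<forall>x\<in>U. \<forall>y\<in>topspace T - L. F x y = 0)"
  shows "continuous_map X euclidean (\<lambda>x. \<integral>y. F x y \<partial>M)"
  unfolding continuous_map_metric_iff
proof (intro ballI allI impI)
  fix x0 and e :: real assume x0: "x0 \<in> topspace X" and e: "e > 0"
  obtain U L where U: "openin X U" "x0 \<in> U" and L: "compactin T L" "L \<in> sets M" "emeasure M L < \<infinity>"
    and z: "\<And>x y. x \<in> U \<Longrightarrow> y \<in> topspace T - L \<Longrightarrow> F x y = 0" using loc[OF x0] by blast
  define d where "d = e / (measure M L + 1)"
  have d: "d > 0" using e by (simp add: d_def add_nonneg_pos)
  obtain V where V: "openin X V" "x0 \<in> V" "\<And>x y. x \<in> V \<Longrightarrow> y \<in> L \<Longrightarrow> dist (F x y) (F x0 y) < d"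
    using tube_uniform[OF F x0 L(1) d] by metis
  have int: "integrable M (F x)" if "x \<in> U" for x
    using that openin_subset[OF U(1)] z
    by (intro integrable_compact_support[OF continuous_map_slice[OF F] L]) auto
  have "dist (\<integral>y. F x y \<partial>M) (\<integral>y. F x0 y \<partial>M) < e" if x: "x \<in> U" "x \<in> V" for x
  proof -
    have "dist (\<integral>y. F x y \<partial>M) (\<integral>y. F x0 y \<partial>M) = norm (\<integral>y. F x y - F x0 y \<partial>M)"
      using int x(1) U(2) by (simp add: dist_norm)
    also have "\<dots> \<le> (\<integral>y. norm (F x y - F x0 y) \<partial>M)" by (rule integral_norm_bound)
    also have "\<dots> \<le> (\<integral>y. indicator L y * d \<partial>M)"
    proof (rule integral_mono)
      show "integrable M (\<lambda>y. norm (F x y - F x0 y))" using int x(1) U(2) by simp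
      show "integrable M (\<lambda>y. indicator L y * d)" using L by simp
      fix y assume "y \<in> space M"
      then show "norm (F x y - F x0 y) \<le> indicator L y * d"
        using V(3)[OF x(2), of y] z[of x y] z[of x0 y] x(1) U(2)
        by (cases "y \<in> L") (auto simp: dist_norm space_M)
    qed
    also have "\<dots> = measure M L * d" using L(2) sets.sets_into_space[OF L(2)] by (simp add: Int_absorb2)
    also have "\<dots> < e"
    proof -
      have "measure M L * d < (measure M L + 1) * d" using d by simp
      also have "\<dots> = e" using measure_nonneg[of M L] unfolding d_def by (simp add: field_simps add_nonneg_eq_0_iff)
      finally show ?thesis .
    qed
    finally show ?thesis .
  qed
  then show "\<exists>U. openin X U \<and> x0 \<in> U \<and>
      (\<forall>y\<in>U. dist (\<integral>z. F y z \<partial>M) (\<integral>z. F x0 z \<partial>M) < e)"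
    using U V by (intro exI[of _ "U \<inter> V"]) auto
qed

end

lemma integral_restrict_support:
  fixes f :: "'a \<Rightarrow> 'b::{banach, second_countable_topology}"
  assumes "K \<in> sets M" "\<And>x. x \<in> space M - K \<Longrightarrow> f x = 0"
  shows "integral\<^sup>L (restrict_space M K) f = integral\<^sup>L M f"
proof -
  have "K \<inter> space M \<in> sets M" using assms(1) by auto
  then have "integral\<^sup>L (restrict_space M K) f = (\<integral>x. indicator K x *\<^sub>R f x \<partial>M)"
    by (rule integral_restrict_space)
  also have "\<dots> = integral\<^sup>L M f"
    using assms(2) by (intro Bochner_Integration.integral_cong) (auto simp: indicator_def)
  finally show ?thesis .
qed

text \<open>On non-separable spaces a continuous function on the product need not be measurable for the
  product \<open>\<sigma>\<close>-algebra. On a product of two compact sets it is: it is a uniform limit of functions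
  that depend on the second variable through finitely many sample points only.\<close>

lemma compact_kernel_measurable:
  fixes F :: "'x \<Rightarrow> 'y \<Rightarrow> complex"
  assumes X: "borel_top X A" and Y: "borel_top Y B"
    and F: "continuous_map (prod_topology X Y) euclidean (\<lambda>(x, y). F x y)"
    and K: "compactin X K" and L: "compactin Y L"
  shows "(\<lambda>(x, y). F x y) \<in> borel_measurable (restrict_space A K \<Otimes>\<^sub>M restrict_space B L)"
proof -
  interpret X: borel_top X A by fact
  interpret Y: borel_top Y B by fact
  have KL: "K \<subseteq> topspace X" "L \<subseteq> topspace Y" using K L by (auto dest: compactin_subset_topspace)
  have sp: "space (restrict_space A K) = K" "space (restrict_space B L) = L"
    using KL by (auto simp: space_restrict_space X.space_M Y.space_M)
  have "\<exists>H. H \<in> borel_measurable (restrict_space A K \<Otimes>\<^sub>M restrict_space B L) \<and>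
      (\<forall>x\<in>K. \<forall>y\<in>L. dist (H (x, y)) (F x y) < e)" if e: "e > 0" for e :: real
  proof -
    have "\<exists>V. openin Y V \<and> (y0 \<in> L \<longrightarrow> y0 \<in> V) \<and> (\<forall>x\<in>K. \<forall>y\<in>V. dist (F x y) (F x y0) < e)" for y0
    proof (cases "y0 \<in> L")
      case True
      then show ?thesis
        using tube_uniform[OF continuous_map_swap_args[OF F] _ K e] KL by (metis subsetD)
    qed (auto intro: exI[of _ "{}"])
    then obtain V where V: "\<And>y0. openin Y (V y0)" "\<And>y0. y0 \<in> L \<Longrightarrow> y0 \<in> V y0"
      "\<And>y0 x y. x \<in> K \<Longrightarrow> y \<in> V y0 \<Longrightarrow> dist (F x y) (F x y0) < e" by metis
    have "\<And>U. U \<in> V ` L \<Longrightarrow> openin Y U" "L \<subseteq> \<Union>(V ` L)" using V by auto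
    from compactinD[OF L this] obtain \<F> where "finite \<F>" "\<F> \<subseteq> V ` L" "L \<subseteq> \<Union>\<F>" by blast
    then obtain D where D: "finite D" "D \<subseteq> L" "L \<subseteq> \<Union>(V ` D)" by (metis finite_subset_image)
    define z where "z = from_nat_into D"
    define j where "j y = (LEAST i. z i \<in> L \<and> y \<in> V (z i))" for y
    have j: "z (j y) \<in> L \<and> y \<in> V (z (j y))" if y: "y \<in> L" for y
    proof -
      obtain d where d: "d \<in> D" "y \<in> V d" using D(3) y by blast
      then obtain i where "z i = d" using from_nat_into_surj[OF countable_finite[OF D(1)]] z_def by metis
      with d D(2) have "z i \<in> L \<and> y \<in> V (z i)" by auto
      then show ?thesis unfolding j_def by (rule LeastI)
    qed
    have Vm: "V y0 \<inter> L \<in> sets (restrict_space B L)" for y0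
      using Y.open_sets[OF V(1)[of y0]] by (auto simp: sets_restrict_space image_iff Int_commute)
    have "(\<lambda>y. z i \<in> L \<and> y \<in> V (z i)) \<in> measurable (restrict_space B L) (count_space UNIV)" for i
    proof (cases "z i \<in> L")
      case True
      have "{y \<in> space (restrict_space B L). y \<in> V (z i)} = V (z i) \<inter> L" using sp by auto
      then show ?thesis using True Vm[of "z i"] by (simp add: pred_def)
    qed simp
    then have "j \<in> measurable (restrict_space B L) (count_space UNIV)"
      unfolding j_def by (rule measurable_Least)
    then have jm: "(\<lambda>p. j (snd p)) \<in> measurable (restrict_space A K \<Otimes>\<^sub>M restrict_space B L) (count_space UNIV)"
      by measurable
    have "(\<lambda>p. if z i \<in> L then F (fst p) (z i) else 0) \<in>
        borel_measurable (restrict_space A K \<Otimes>\<^sub>M restrict_space B L)" for i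
    proof (cases "z i \<in> L")
      case True
      then have "(\<lambda>x. F x (z i)) \<in> borel_measurable A"
        using KL by (intro X.continuous_measurable continuous_map_slice[OF continuous_map_swap_args[OF F]]) auto
      then have "(\<lambda>x. F x (z i)) \<in> borel_measurable (restrict_space A K)" by (rule measurable_restrict_space1)
      then show ?thesis using True by simp
    qed simp
    from measurable_compose_countable[OF this jm]
    have "(\<lambda>p. if z (j (snd p)) \<in> L then F (fst p) (z (j (snd p))) else 0) \<in>
        borel_measurable (restrict_space A K \<Otimes>\<^sub>M restrict_space B L)" .
    then show ?thesis using j V(3)
      by (intro exI[of _ "\<lambda>p. if z (j (snd p)) \<in> L then F (fst p) (z (j (snd p))) else 0"])
        (auto simp: dist_commute)
  qed
  then have "\<forall>n. \<exists>H. H \<in> borel_measurable (restrict_space A K \<Otimes>\<^sub>M restrict_space B L) \<and>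
      (\<forall>x\<in>K. \<forall>y\<in>L. dist (H (x, y)) (F x y) < 1 / real (Suc n))" by simp
  then obtain H where H: "\<And>n. H n \<in> borel_measurable (restrict_space A K \<Otimes>\<^sub>M restrict_space B L)"
    "\<And>n x y. x \<in> K \<Longrightarrow> y \<in> L \<Longrightarrow> dist (H n (x, y)) (F x y) < 1 / real (Suc n)" by metis
  show ?thesis
  proof (rule borel_measurable_LIMSEQ_metric[OF H(1)])
    fix p assume "p \<in> space (restrict_space A K \<Otimes>\<^sub>M restrict_space B L)"
    then obtain x y where p: "p = (x, y)" "x \<in> K" "y \<in> L" by (auto simp: space_pair_measure sp)
    have "(\<lambda>n. dist (H n (x, y)) (F x y)) \<longlonglongrightarrow> 0"
      by (rule tendsto_sandwich[OF _ _ tendsto_const LIMSEQ_inverse_real_of_nat])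
        (use H(2)[OF p(2,3)] in \<open>auto intro!: always_eventually less_imp_le simp: inverse_eq_divide\<close>)
    then show "(\<lambda>n. H n p) \<longlonglongrightarrow> (case p of (x, y) \<Rightarrow> F x y)"
      using p(1) tendsto_dist_iff by auto
  qed
qed

text \<open>The weight \<open>w\<close> is merely integrable on \<open>K\<close>. Only the kernel, which depends on both
  variables, has to be continuous.\<close>

lemma fubini_compact_kernel:
  fixes F :: "'x \<Rightarrow> 'y \<Rightarrow> complex" and w :: "'x \<Rightarrow> complex"
  assumes X: "borel_top X A" and Y: "borel_top Y B"
    and F: "continuous_map (prod_topology X Y) euclidean (\<lambda>(x, y). F x y)"
    and K: "compactin X K" "K \<in> sets A" "emeasure A K < \<infinity>"
    and L: "compactin Y L" "L \<in> sets B" "emeasure B L < \<infinity>"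
    and z: "\<And>x y. x \<in> topspace X \<Longrightarrow> y \<in> topspace Y \<Longrightarrow> F x y \<noteq> 0 \<Longrightarrow> x \<in> K \<and> y \<in> L"
    and w: "integrable A (\<lambda>x. indicator K x *\<^sub>R w x)"
  shows "(\<integral>x. w x * (\<integral>y. F x y \<partial>B) \<partial>A) = (\<integral>y. (\<integral>x. w x * F x y \<partial>A) \<partial>B)"
proof -
  interpret X: borel_top X A by fact
  interpret Y: borel_top Y B by fact
  define A' B' where "A' = restrict_space A K" and "B' = restrict_space B L"
  have KL: "K \<subseteq> topspace X" "L \<subseteq> topspace Y" using K L by (auto dest: compactin_subset_topspace)
  have KLi: "K \<inter> space A = K" "L \<inter> space B = L" using KL by (auto simp: X.space_M Y.space_M)
  have sp: "space A' = K" "space B' = L" using KLi by (auto simp: A'_def B'_def space_restrict_space)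
  interpret A': finite_measure A' using K KLi
    by (intro finite_measureI) (simp add: sp A'_def emeasure_restrict_space)
  interpret B': finite_measure B' using L KLi
    by (intro finite_measureI) (simp add: sp B'_def emeasure_restrict_space)
  interpret P: pair_sigma_finite A' B' ..
  have wi: "integrable A' w"
    using w K KLi by (simp add: A'_def integrable_restrict_space)
  then have wm [measurable]: "w \<in> borel_measurable A'" by simp
  have Fm [measurable]: "(\<lambda>(x, y). F x y) \<in> borel_measurable (A' \<Otimes>\<^sub>M B')"
    unfolding A'_def B'_def by (rule compact_kernel_measurable[OF X Y F K(1) L(1)])
  have hm [measurable]: "(\<lambda>(x, y). w x * F x y) \<in> borel_measurable (A' \<Otimes>\<^sub>M B')"
    using borel_measurable_times[OF measurable_compose[OF measurable_fst wm] Fm]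
    by (simp add: case_prod_unfold)
  have "bounded ((\<lambda>(x, y). F x y) ` (K \<times> L))"
    using K(1) L(1) by (intro compactin_bounded_image[OF _ F]) (simp add: compactin_Times)
  then obtain C where C: "\<And>x y. x \<in> K \<Longrightarrow> y \<in> L \<Longrightarrow> cmod (F x y) \<le> C" unfolding bounded_iff by auto
  have C': "cmod (w x * F x y) \<le> cmod (w x) * \<bar>C\<bar>" if "x \<in> K" "y \<in> L" for x y
    using C[OF that] by (simp add: norm_mult mult_left_mono)
  have Fx: "(\<lambda>y. w x * F x y) \<in> borel_measurable B'" if "x \<in> K" for x
  proof -
    have "F x \<in> borel_measurable B" using that KL
      by (intro Y.continuous_measurable continuous_map_slice[OF F]) auto
    then show ?thesis unfolding B'_def by (intro measurable_restrict_space1) simp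
  qed
  have i2: "integrable B' (\<lambda>y. w x * F x y)" if "x \<in> K" for x
    using C'[OF that] Fx[OF that] by (intro B'.integrable_const_bound[of _ "cmod (w x) * \<bar>C\<bar>"]) (auto simp: sp)
  have nm: "(\<lambda>(x, y). norm (w x * F x y)) \<in> borel_measurable (A' \<Otimes>\<^sub>M B')"
    using measurable_compose[OF hm borel_measurable_norm] by (simp add: case_prod_unfold)
  have i1: "integrable A' (\<lambda>x. \<integral>y. norm (w x * F x y) \<partial>B')"
  proof (rule Bochner_Integration.integrable_bound)
    show "integrable A' (\<lambda>x. norm (w x) * (\<bar>C\<bar> * measure B' (space B')))"
      by (intro integrable_mult_left integrable_norm wi)
    show "(\<lambda>x. \<integral>y. norm (w x * F x y) \<partial>B') \<in> borel_measurable A'"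
      by (rule B'.borel_measurable_lebesgue_integral[OF nm])
    have "norm (\<integral>y. norm (w x * F x y) \<partial>B') \<le> norm (norm (w x) * (\<bar>C\<bar> * measure B' (space B')))"
      if x: "x \<in> K" for x
    proof -
      have "(\<integral>y. norm (w x * F x y) \<partial>B') \<le> (\<integral>y. norm (w x) * \<bar>C\<bar> \<partial>B')"
        using i2[OF x] C'[OF x] by (intro integral_mono integrable_norm) (auto simp: sp)
      then show ?thesis by (simp add: abs_mult mult_ac)
    qed
    then show "AE x in A'. norm (\<integral>y. norm (w x * F x y) \<partial>B') \<le>
        norm (norm (w x) * (\<bar>C\<bar> * measure B' (space B')))"
      by (intro AE_I2) (simp only: sp)
  qed
  have "integrable (A' \<Otimes>\<^sub>M B') (\<lambda>(x, y). w x * F x y)"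
    by (rule P.Fubini_integrable[OF hm]) (use i1 i2 in \<open>auto simp: sp\<close>)
  from P.Fubini_integral[OF this]
  have eq: "(\<integral>y. (\<integral>x. w x * F x y \<partial>A') \<partial>B') = (\<integral>x. (\<integral>y. w x * F x y \<partial>B') \<partial>A')" .
  have 1: "(\<integral>x. w x * F x y \<partial>A') = (\<integral>x. w x * F x y \<partial>A)" if "y \<in> topspace Y" for y
    unfolding A'_def using z[OF _ that] by (intro integral_restrict_support K) (auto simp: X.space_M)
  have 2: "(\<integral>y. F x y \<partial>B') = (\<integral>y. F x y \<partial>B)" if "x \<in> topspace X" for x
    unfolding B'_def using z[OF that] by (intro integral_restrict_support L) (auto simp: Y.space_M)
  have "(\<integral>x. w x * (\<integral>y. F x y \<partial>B) \<partial>A) = (\<integral>x. w x * (\<integral>y. F x y \<partial>B') \<partial>A)"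
    using 2 by (intro Bochner_Integration.integral_cong) (auto simp: X.space_M)
  also have "\<dots> = (\<integral>x. w x * (\<integral>y. F x y \<partial>B') \<partial>A')"
  proof -
    have "(\<integral>y. F x y \<partial>B') = 0" if "x \<in> space A - K" for x
    proof -
      have "(\<integral>y. F x y \<partial>B') = (\<integral>y. 0 \<partial>B')"
        using that z[of x] KL by (intro Bochner_Integration.integral_cong) (auto simp: sp X.space_M)
      then show ?thesis by simp
    qed
    then show ?thesis unfolding A'_def by (intro integral_restrict_support[symmetric] K) auto
  qed
  also have "\<dots> = (\<integral>y. (\<integral>x. w x * F x y \<partial>A') \<partial>B')" by (simp add: eq)
  also have "\<dots> = (\<integral>y. (\<integral>x. w x * F x y \<partial>A) \<partial>B')"
    by (rule Bochner_Integration.integral_cong[OF refl]) (simp add: sp 1[OF subsetD[OF KL(2)]])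
  also have "\<dots> = (\<integral>y. (\<integral>x. w x * F x y \<partial>A) \<partial>B)"
  proof -
    have "(\<integral>x. w x * F x y \<partial>A) = 0" if "y \<in> space B - L" for y
    proof -
      have "(\<integral>x. w x * F x y \<partial>A) = (\<integral>x. 0 \<partial>A)"
        using that z[of _ y] by (intro Bochner_Integration.integral_cong) (auto simp: X.space_M Y.space_M)
      then show ?thesis by simp
    qed
    then show ?thesis unfolding B'_def by (intro integral_restrict_support L) auto
  qed
  finally show ?thesis .
qed

section \<open>Densities\<close>

text \<open>The set where a function exceeds \<open>c\<close> is null if its mean there is at most \<open>c\<close>.\<close>

lemma integral_le_imp_AE_le:
  fixes g :: "'a \<Rightarrow> real"
  assumes E: "E \<in> sets M" "emeasure M E < \<infinity>" and g: "integrable M (\<lambda>x. indicator E x * g x)"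
    and gt: "\<And>x. x \<in> E \<Longrightarrow> g x > c" and le: "(\<integral>x. indicator E x * g x \<partial>M) \<le> c * measure M E"
  shows "AE x in M. x \<notin> E"
proof -
  have Ei: "E \<inter> space M = E" using sets.sets_into_space[OF E(1)] by auto
  have i: "integrable M (\<lambda>x. indicator E x * (g x - c))"
    using Bochner_Integration.integrable_diff[OF g, of "\<lambda>x. indicator E x * c"] E
    by (simp add: right_diff_distrib)
  have "(\<integral>x. indicator E x * (g x - c) \<partial>M) = (\<integral>x. indicator E x * g x \<partial>M) - c * measure M E"
    using Bochner_Integration.integral_diff[OF g, of "\<lambda>x. indicator E x * c"] E
    by (simp add: right_diff_distrib Ei mult.commute)
  moreover have nn: "0 \<le> indicator E x * (g x - c)" for x using gt[of x] by (auto simp: indicator_def)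
  ultimately have "(\<integral>x. indicator E x * (g x - c) \<partial>M) = 0"
    using le Bochner_Integration.integral_nonneg[of M "\<lambda>x. indicator E x * (g x - c)"] by auto
  then have "AE x in M. indicator E x * (g x - c) = 0"
    using nn by (subst (asm) integral_nonneg_eq_0_iff_AE[OF i]) auto
  then show ?thesis by eventually_elim (use gt in \<open>fastforce simp: indicator_def split: if_splits\<close>)
qed

text \<open>A set function dominated by the measure has a bounded density: adding \<open>C\<close> times the measure
  makes it positive, so the theorem of Radon and Nikodym for positive measures applies.\<close>

lemma dominated_set_function_density:
  fixes m :: "'a set \<Rightarrow> real"
  assumes P: "P \<in> sets M" "emeasure M P < \<infinity>" and C: "0 \<le> C"
    and add: "\<And>A B. A \<in> sets M \<Longrightarrow> B \<in> sets M \<Longrightarrow> A \<subseteq> P \<Longrightarrow> B \<subseteq> P \<Longrightarrow> A \<inter> B = {} \<Longrightarrow> m (A \<union> B) = m A + m B"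
    and bd: "\<And>A. A \<in> sets M \<Longrightarrow> A \<subseteq> P \<Longrightarrow> \<bar>m A\<bar> \<le> C * measure M A"
  obtains g where "g \<in> borel_measurable M" "\<And>x. \<bar>g x\<bar> \<le> C"
    "\<And>A. A \<in> sets M \<Longrightarrow> A \<subseteq> P \<Longrightarrow> m A = (\<integral>x. indicator A x * g x \<partial>M)"
proof -
  \<comment> \<open>\<open>R\<close> is the restriction of the measure to \<open>P\<close>, and \<open>n\<close> is \<open>m\<close> made positive.\<close>
  define R where "R = density M (\<lambda>x. ennreal (indicator P x))"
  have R: "emeasure R A = emeasure M (P \<inter> A)" "measure R A = measure M (P \<inter> A)" if "A \<in> sets M" for A
    unfolding R_def measure_def using that P(1)
    by (simp_all add: emeasure_density ennreal_indicator flip: indicator_inter_arith)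
  have sR [simp]: "sets R = sets M" "space R = space M" by (simp_all add: R_def)
  have mR: "borel_measurable R = (borel_measurable M :: ('a \<Rightarrow> real) set)"
    by (rule measurable_cong_sets) simp_all
  interpret R: finite_measure R
    using P by (intro finite_measureI) (simp add: R sets.sets_into_space Int_absorb2)
  define n where "n A = m (P \<inter> A) + C * measure R A" for A
  have n0: "0 \<le> n A" and n2: "n A \<le> 2 * C * measure R A" if "A \<in> sets M" for A
    using bd[of "P \<inter> A"] that P by (auto simp: n_def R abs_le_iff)
  have nadd: "n (A \<union> B) = n A + n B" if "A \<in> sets M" "B \<in> sets M" "A \<inter> B = {}" for A B
    using add[of "P \<inter> A" "P \<inter> B"] that P(1) R.finite_measure_Union[of A B]
    by (auto simp: n_def Int_Un_distrib algebra_simps)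
  define N where "N = measure_of (space M) (sets M) (\<lambda>A. ennreal (n A))"
  have sN [simp]: "sets N = sets M" "space N = space M" by (auto simp: N_def)
  have N: "emeasure N A = ennreal (n A)" if "A \<in> sets M" for A
    unfolding N_def
  proof (rule emeasure_measure_of_sigma)
    show "sigma_algebra (space M) (sets M)" ..
    show "positive (sets M) (\<lambda>A. ennreal (n A))"
      using n2[of "{}"] n0[of "{}"] by (simp add: positive_def)
    show "countably_additive (sets M) (\<lambda>A. ennreal (n A))"
    proof (rule countably_additiveI)
      fix A :: "nat \<Rightarrow> 'a set" assume A: "range A \<subseteq> sets M" "disjoint_family A" "(\<Union>i. A i) \<in> sets M"
      have Am: "A i \<in> sets M" for i using A(1) by auto
      have fin: "n (\<Union>i<k. A i) = (\<Sum>i<k. n (A i))" for k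
      proof (induction k)
        case 0
        then show ?case using n2[of "{}"] n0[of "{}"] by simp
      next
        case (Suc k)
        have "A k \<inter> A i = {}" if "i < k" for i
          using disjoint_family_onD[OF A(2), of k i] that by simp
        then have "A k \<inter> (\<Union>i<k. A i) = {}" by blast
        then show ?case using Suc nadd[of "A k" "\<Union>i<k. A i"] Am by (simp add: lessThan_Suc add.commute)
      qed
      have dec: "n (\<Union>i. A i) - (\<Sum>i<k. n (A i)) \<le> 2 * C * (measure R (\<Union>i. A i) - (\<Sum>i<k. measure R (A i)))"
        and nn: "0 \<le> n (\<Union>i. A i) - (\<Sum>i<k. n (A i))" for k
      proof -
        let ?B = "\<Union>i<k. A i" and ?D = "(\<Union>i. A i) - (\<Union>i<k. A i)"
        have B: "?B \<in> sets M" "?D \<in> sets M" using Am by auto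
        have "?D \<union> ?B = (\<Union>i. A i)" by auto
        then have 1: "n (\<Union>i. A i) = n ?D + n ?B" using nadd[of ?D ?B] B by auto
        have "measure R ?B = (\<Sum>i<k. measure R (A i))"
          using A(2) Am by (intro R.finite_measure_finite_Union) (auto simp: disjoint_family_on_def)
        moreover have "measure R ?D = measure R (\<Union>i. A i) - measure R ?B"
          using B A(3) by (intro R.finite_measure_Diff) auto
        ultimately show "n (\<Union>i. A i) - (\<Sum>i<k. n (A i)) \<le> 2 * C * (measure R (\<Union>i. A i) - (\<Sum>i<k. measure R (A i)))"
          and "0 \<le> n (\<Union>i. A i) - (\<Sum>i<k. n (A i))"
          using 1 n2[OF B(2)] n0[OF B(2)] by (simp_all add: fin)
      qed
      have "(\<lambda>i. measure R (A i)) sums measure R (\<Union>i. A i)"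
        using A by (intro R.finite_measure_UNION) auto
      then have l: "(\<lambda>k. 2 * C * (measure R (\<Union>i. A i) - (\<Sum>i<k. measure R (A i)))) \<longlonglongrightarrow> 0"
        unfolding sums_def by (auto intro!: tendsto_eq_intros)
      have "(\<lambda>k. n (\<Union>i. A i) - (\<Sum>i<k. n (A i))) \<longlonglongrightarrow> 0"
        by (rule tendsto_sandwich[OF _ _ tendsto_const l]) (rule always_eventually, rule allI, (rule nn dec))+
      then have "(\<lambda>k. \<Sum>i<k. n (A i)) \<longlonglongrightarrow> n (\<Union>i. A i)"
        using tendsto_diff[OF tendsto_const[of "n (\<Union>i. A i)"]] by fastforce
      then have "(\<lambda>i. n (A i)) sums n (\<Union>i. A i)" by (simp add: sums_def)
      then show "(\<Sum>i. ennreal (n (A i))) = ennreal (n (\<Union>i. A i))"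
        using Am n0 by (intro suminf_ennreal_eq) auto
    qed
  qed (use that in auto)
  interpret N: finite_measure N by (intro finite_measureI) (simp add: N)
  have ac: "absolutely_continuous R N"
  proof (unfold absolutely_continuous_def, rule subsetI)
    fix A assume "A \<in> null_sets R"
    then have "A \<in> sets M" "measure R A = 0" by (auto simp: null_sets_def measure_def)
    then show "A \<in> null_sets N" using n2[of A] by (simp add: null_sets_def N ennreal_eq_0_iff)
  qed
  have sNR: "sets N = sets R" by simp
  obtain D where D: "D \<in> borel_measurable R" "AE x in R. RN_deriv R N x = ennreal (D x)" "\<And>x. 0 \<le> D x"
    by (rule R.real_RN_deriv[OF N.finite_measure_axioms ac sNR]) (rule that; assumption)
  have ND: "emeasure N A = (\<integral>\<^sup>+x. ennreal (indicator A x * D x) \<partial>R)" if "A \<in> sets M" for A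
  proof -
    have "emeasure N A = (\<integral>\<^sup>+x. RN_deriv R N x * indicator A x \<partial>R)"
      using that by (subst R.density_RN_deriv[OF ac sNR, symmetric]) (simp add: emeasure_density)
    also have "\<dots> = (\<integral>\<^sup>+x. ennreal (indicator A x * D x) \<partial>R)"
      by (rule nn_integral_cong_AE) (use D(2) in eventually_elim, auto simp: indicator_def)
    finally show ?thesis .
  qed
  have Dm: "D \<in> borel_measurable M" using D(1) by (simp add: R_def)
  have iD: "has_bochner_integral R (\<lambda>x. indicator A x * D x) (n A)" if "A \<in> sets M" for A
  proof (rule has_bochner_integral_nn_integral)
    have "A \<in> sets R" using that by simp
    then show "(\<lambda>x. indicator A x * D x) \<in> borel_measurable R" using D(1) by measurable
  qed (use ND[OF that] N[OF that] n0[OF that] D(3) in auto)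
  \<comment> \<open>The truncation alters \<open>D - C\<close> on a null set only and makes the bound hold everywhere.\<close>
  define g where "g x = max (- C) (min C (D x - C))" for x
  have "AE x in R. x \<notin> {x \<in> space M. D x > 2 * C}"
  proof (rule integral_le_imp_AE_le[where c = "2 * C" and g = D])
    show E: "{x \<in> space M. D x > 2 * C} \<in> sets R" using Dm by simp
    show "emeasure R {x \<in> space M. D x > 2 * C} < \<infinity>" by (simp add: less_top[symmetric])
    show "integrable R (\<lambda>x. indicator {x \<in> space M. D x > 2 * C} x * D x)"
      using iD E by (auto simp: has_bochner_integral_iff)
    show "(\<integral>x. indicator {x \<in> space M. D x > 2 * C} x * D x \<partial>R) \<le>
        2 * C * measure R {x \<in> space M. D x > 2 * C}"
      using iD[of "{x \<in> space M. D x > 2 * C}"] n2[of "{x \<in> space M. D x > 2 * C}"] E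
      by (simp add: has_bochner_integral_iff)
  qed auto
  with AE_space[of R] have Dg: "AE x in R. D x - C = g x"
    by eventually_elim (use D(3) C in \<open>auto simp: g_def not_less\<close>)
  have gm: "g \<in> borel_measurable M" using Dm unfolding g_def by measurable
  show thesis
  proof (rule that[OF gm])
    show "\<bar>g x\<bar> \<le> C" for x using C by (auto simp: g_def abs_le_iff)
    fix A assume A: "A \<in> sets M" "A \<subseteq> P"
    have "m A = n A - C * measure R A" using A(2) by (simp add: n_def Int_absorb1)
    also have "\<dots> = (\<integral>x. indicator A x * D x \<partial>R) - (\<integral>x. indicator A x * C \<partial>R)"
      using iD[OF A(1)] sets.sets_into_space[OF A(1)] by (simp add: has_bochner_integral_iff Int_absorb2)
    also have "\<dots> = (\<integral>x. indicator A x * D x - indicator A x * C \<partial>R)"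
      using iD[OF A(1)] A(1) by (intro Bochner_Integration.integral_diff[symmetric])
        (auto simp: has_bochner_integral_iff less_top[symmetric])
    also have "\<dots> = (\<integral>x. indicator A x * g x \<partial>R)"
      using A(1) Dm gm by (intro integral_cong_AE) (use Dg in \<open>auto simp: mR simp flip: right_diff_distrib\<close>)
    also have "\<dots> = (\<integral>x. indicator P x *\<^sub>R (indicator A x * g x) \<partial>M)"
      unfolding R_def using A(1) P(1) gm by (intro integral_density) auto
    also have "\<dots> = (\<integral>x. indicator A x * g x \<partial>M)"
      using A(2) by (intro Bochner_Integration.integral_cong) (auto simp: indicator_def)
    finally show "m A = (\<integral>x. indicator A x * g x \<partial>M)" .
  qed
qed

section \<open>Functions with compact support on locally compact spaces\<close>

text \<open>Urysohn's lemma, applied to a neighbourhood of \<open>K\<close> that lies in a compact subset of \<open>U\<close>, gives a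
  function whose support is compact.\<close>

lemma compact_bump:
  assumes T: "Hausdorff_space T" "locally_compact_space T"
    and K: "compactin T K" and U: "openin T U" "K \<subseteq> U"
  obtains h :: "'a \<Rightarrow> real" and L where "continuous_map T euclidean h"
    "\<And>x. 0 \<le> h x" "\<And>x. h x \<le> 1" "\<And>x. x \<in> K \<Longrightarrow> h x = 1"
    "compactin T L" "L \<subseteq> U" "\<And>x. x \<notin> L \<Longrightarrow> h x = 0"
proof -
  have "neighbourhood_base_of (compactin T) T"
    using T by (simp add: locally_compact_space_neighbourhood_base)
  then have "\<exists>V C. openin T V \<and> compactin T C \<and> x \<in> V \<and> V \<subseteq> C \<and> C \<subseteq> U" if "x \<in> K" for x
    using U that unfolding neighbourhood_base_of by blast
  then obtain V C where VC: "\<And>x. x \<in> K \<Longrightarrow> openin T (V x) \<and> compactin T (C x) \<and> x \<in> V x \<and> V x \<subseteq> C x \<and> C x \<subseteq> U"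
    by metis
  have "\<And>W. W \<in> V ` K \<Longrightarrow> openin T W" "K \<subseteq> \<Union>(V ` K)" using VC by auto
  from compactinD[OF K this] obtain \<F> where "finite \<F>" "\<F> \<subseteq> V ` K" "K \<subseteq> \<Union>\<F>" by blast
  then obtain D where D: "finite D" "D \<subseteq> K" "K \<subseteq> \<Union>(V ` D)" by (metis finite_subset_image)
  define L where "L = \<Union>(C ` D)"
  have L: "compactin T L" using D VC unfolding L_def by (intro compactin_Union) auto
  have LU: "L \<subseteq> U" using D(2) VC unfolding L_def by (meson UN_least subsetD)
  have W: "openin T (\<Union>(V ` D))" "\<Union>(V ` D) \<subseteq> L"
  proof -
    have "openin T (V x)" "V x \<subseteq> C x" if "x \<in> D" for x using that D(2) VC by blast+
    then show "openin T (\<Union>(V ` D))" "\<Union>(V ` D) \<subseteq> L" unfolding L_def by (auto intro!: openin_Union)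
  qed
  have "closedin T (topspace T - \<Union>(V ` D))" using W(1) by blast
  moreover have "disjnt K (topspace T - \<Union>(V ` D))" using D(3) by (auto simp: disjnt_def)
  ultimately obtain f where f: "continuous_map T (top_of_set {0..1::real}) f"
    "f ` (topspace T - \<Union>(V ` D)) \<subseteq> {0}" "f ` K \<subseteq> {1}"
    using Urysohn_completely_regular_compact_closed[of 0 1 T K "topspace T - \<Union>(V ` D)"] K T
      locally_compact_regular_imp_completely_regular_space[of T] by force
  define h where "h x = (if x \<in> topspace T then f x else 0)" for x
  have "continuous_map T euclidean f" using f(1) by (rule continuous_map_into_fulltopology)
  then have "continuous_map T euclidean h" by (rule continuous_map_eq) (simp add: h_def)
  moreover have "f x \<in> {0..1}" if "x \<in> topspace T" for x
    using f(1) that by (auto simp: continuous_map_in_subtopology)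
  moreover have "K \<subseteq> topspace T" using K by (rule compactin_subset_topspace)
  moreover have "f x = 0" if "x \<in> topspace T" "x \<notin> L" for x
  proof -
    have "x \<in> topspace T - \<Union>(V ` D)" using that W(2) by blast
    then show ?thesis using f(2) by blast
  qed
  ultimately show thesis
    using L LU f(3) by (intro that[of h L]) (auto simp: h_def image_subset_iff)
qed

text \<open>Functions are defined on a whole type; their values outside of the space are ignored.\<close>

definition Cc :: "'a topology \<Rightarrow> ('a \<Rightarrow> complex) set" where
  "Cc T = {f. continuous_map T euclidean f \<and> (\<exists>K. compactin T K \<and> (\<forall>x\<in>topspace T - K. f x = 0))}"

lemma Cc_continuous: "f \<in> Cc T \<Longrightarrow> continuous_map T euclidean f" by (simp add: Cc_def)

lemma CcE:
  assumes "f \<in> Cc T" obtains K where "compactin T K" "\<And>x. x \<in> topspace T \<Longrightarrow> f x \<noteq> 0 \<Longrightarrow> x \<in> K"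
  using assms by (auto simp: Cc_def)

lemma CcI:
  "continuous_map T euclidean f \<Longrightarrow> compactin T K \<Longrightarrow>
    (\<And>x. x \<in> topspace T \<Longrightarrow> x \<notin> K \<Longrightarrow> f x = 0) \<Longrightarrow> f \<in> Cc T"
  by (auto simp: Cc_def)

lemma Cc_mult: "f \<in> Cc T \<Longrightarrow> continuous_map T euclidean g \<Longrightarrow> (\<lambda>x. f x * g x) \<in> Cc T"
  by (force simp: Cc_def intro: continuous_map_mult)

lemma Cc_scale: "f \<in> Cc T \<Longrightarrow> (\<lambda>x. c * f x) \<in> Cc T"
  using Cc_mult[of f T "\<lambda>_. c"] by (simp add: mult.commute)

lemma Cc_add: assumes "f \<in> Cc T" "g \<in> Cc T" shows "(\<lambda>x. f x + g x) \<in> Cc T"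
proof -
  obtain K where K: "compactin T K" "\<And>x. x \<in> topspace T \<Longrightarrow> f x \<noteq> 0 \<Longrightarrow> x \<in> K"
    using assms(1) by (rule CcE) blast
  obtain L where L: "compactin T L" "\<And>x. x \<in> topspace T \<Longrightarrow> g x \<noteq> 0 \<Longrightarrow> x \<in> L"
    using assms(2) by (rule CcE) blast
  show ?thesis
  proof (rule CcI)
    show "continuous_map T euclidean (\<lambda>x. f x + g x)"
      using assms by (intro continuous_map_add Cc_continuous)
    show "compactin T (K \<union> L)" using K L by (intro compactin_Un)
    show "f x + g x = 0" if "x \<in> topspace T" "x \<notin> K \<union> L" for x
      using K(2)[OF that(1)] L(2)[OF that(1)] that(2) by (cases "f x = 0"; cases "g x = 0") auto
  qed
qed

lemma Cc_diff: "f \<in> Cc T \<Longrightarrow> g \<in> Cc T \<Longrightarrow> (\<lambda>x. f x - g x) \<in> Cc T"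
  using Cc_add[of f T "\<lambda>x. -1 * g x"] Cc_scale[of g T "-1"] by simp

lemma Cc_zero: "(\<lambda>_. 0) \<in> Cc T" by (auto simp: Cc_def intro!: exI[of _ "{}"])

text \<open>The substitute for \<open>\<sigma>\<close>-finiteness. Functions that are measurable on each piece are measurable on
  every set of finite measure, because only countably many pieces meet it.\<close>

definition localizing :: "'a measure \<Rightarrow> 'a set set \<Rightarrow> bool" where
  "localizing M \<P> \<longleftrightarrow> \<P> \<subseteq> sets M \<and> (\<forall>P\<in>\<P>. emeasure M P < \<infinity>) \<and> disjoint \<P> \<and> \<Union>\<P> = space M \<and>
     (\<forall>F\<in>sets M. emeasure M F < \<infinity> \<longrightarrow> countable {P \<in> \<P>. P \<inter> F \<noteq> {}})"

text \<open>Representatives of elements of \<open>L\<^sup>\<infinity>\<close> of norm at most \<open>B\<close>, when \<open>M\<close> is the completion of the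
  measure in question.\<close>

definition loc_bounded :: "'a measure \<Rightarrow> ('a \<Rightarrow> complex) \<Rightarrow> real \<Rightarrow> bool" where
  "loc_bounded M a B \<longleftrightarrow> (\<forall>F\<in>sets M. emeasure M F < \<infinity> \<longrightarrow>
     (\<lambda>x. indicator F x *\<^sub>R a x) \<in> borel_measurable M \<and> (AE x in M. x \<in> F \<longrightarrow> cmod (a x) \<le> B))"

lemma loc_bounded_integrable:
  assumes a: "loc_bounded M a B" and f: "integrable M f"
    and F: "F \<in> sets M" "emeasure M F < \<infinity>" "\<And>x. x \<in> space M \<Longrightarrow> f x \<noteq> 0 \<Longrightarrow> x \<in> F"
  shows "integrable M (\<lambda>x. f x * a x)" "cmod (\<integral>x. f x * a x \<partial>M) \<le> B * (\<integral>x. cmod (f x) \<partial>M)"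
proof -
  have m: "(\<lambda>x. indicator F x *\<^sub>R a x) \<in> borel_measurable M" and b: "AE x in M. x \<in> F \<longrightarrow> cmod (a x) \<le> B"
    using a F by (auto simp: loc_bounded_def)
  have "(\<lambda>x. f x * (indicator F x *\<^sub>R a x)) \<in> borel_measurable M"
    by (rule borel_measurable_times[OF _ m]) (use f in auto)
  also have "?this \<longleftrightarrow> (\<lambda>x. f x * a x) \<in> borel_measurable M"
    using F(3) by (intro measurable_cong) (auto simp: indicator_def)
  finally have fm: "(\<lambda>x. f x * a x) \<in> borel_measurable M" .
  have ae: "AE x in M. cmod (f x * a x) \<le> B * cmod (f x)"
    using b AE_space
  proof eventually_elim
    case (elim x)
    then show ?case using F(3)[of x] by (cases "f x = 0") (auto simp: norm_mult mult.commute[of B] mult_left_mono)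
  qed
  have i: "integrable M (\<lambda>x. B * cmod (f x))" using f by simp
  show int: "integrable M (\<lambda>x. f x * a x)"
    by (rule Bochner_Integration.integrable_bound[OF i fm]) (use ae in \<open>eventually_elim, auto\<close>)
  have "cmod (\<integral>x. f x * a x \<partial>M) \<le> (\<integral>x. cmod (f x * a x) \<partial>M)" by (rule integral_norm_bound)
  also have "\<dots> \<le> (\<integral>x. B * cmod (f x) \<partial>M)"
    by (rule integral_mono_AE[OF integrable_norm[OF int] i ae])
  finally show "cmod (\<integral>x. f x * a x \<partial>M) \<le> B * (\<integral>x. cmod (f x) \<partial>M)" by simp
qed

lemma integrable_indicator_complex:
  assumes "A \<in> sets M" "emeasure M A < \<infinity>" shows "integrable M (\<lambda>x. indicator A x :: complex)"
proof -
  have "(\<lambda>x. indicator A x :: complex) = (\<lambda>x. complex_of_real (indicator A x))"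
    by (auto simp: indicator_def fun_eq_iff)
  then show ?thesis using assms by (simp add: less_top[symmetric])
qed

text \<open>These conditions hold for a Haar measure and also for its completion: outer regularity for all
  measurable sets, inner regularity for the open ones.\<close>

locale radon = borel_top +
  assumes hausdorff: "Hausdorff_space T" and loc_compact: "locally_compact_space T"
    and compact_finite: "compactin T K \<Longrightarrow> emeasure M K < \<infinity>"
    and outer: "A \<in> sets M \<Longrightarrow> emeasure M A = (INF U\<in>{U. openin T U \<and> A \<subseteq> U}. emeasure M U)"
    and inner: "openin T U \<Longrightarrow> emeasure M U = (SUP K\<in>{K. compactin T K \<and> K \<subseteq> U}. emeasure M K)"
begin

lemma compact_closed: "compactin T K \<Longrightarrow> closedin T K"
  using hausdorff by (rule compactin_imp_closedin)

lemma compact_sets: "compactin T K \<Longrightarrow> K \<in> sets M"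
  by (intro closed_sets compact_closed)

lemma Cc_integrable: assumes f: "f \<in> Cc T" shows "integrable M f"
proof -
  obtain K where K: "compactin T K" "\<And>x. x \<in> topspace T \<Longrightarrow> f x \<noteq> 0 \<Longrightarrow> x \<in> K"
    using f by (rule CcE) blast
  show "integrable M f"
    by (rule integrable_compact_support[OF Cc_continuous[OF f] K(1) compact_sets[OF K(1)] compact_finite[OF K(1)]])
      (use K(2) in blast)
qed

text \<open>There are \<open>K \<subseteq> U \<supseteq> A\<close> with \<open>U\<close> close to \<open>A\<close> by outer regularity and \<open>K\<close> close to \<open>U\<close> by inner
  regularity of the open set \<open>U\<close>. A bump function between \<open>K\<close> and \<open>U\<close> is then close to the indicator
  of \<open>A\<close>, although \<open>K\<close> need not lie in \<open>A\<close>.\<close>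

lemma Cc_indicator_dense:
  assumes A: "A \<in> sets M" "emeasure M A < \<infinity>" and e: "e > 0"
  obtains h where "h \<in> Cc T" "integrable M (\<lambda>x. indicator A x - h x)"
    "(\<integral>x. cmod (indicator A x - h x) \<partial>M) < e"
proof -
  have "emeasure M A < emeasure M A + ennreal (e/2)"
    using A(2) e by (simp add: ennreal_add_left_cancel_less less_top)
  then have "(INF U\<in>{U. openin T U \<and> A \<subseteq> U}. emeasure M U) < emeasure M A + ennreal (e/2)"
    using outer[OF A(1)] by simp
  then obtain U where U: "openin T U" "A \<subseteq> U" "emeasure M U < emeasure M A + ennreal (e/2)"
    by (auto simp: INF_less_iff)
  have Um: "U \<in> sets M" by (rule open_sets[OF U(1)])
  have Uf: "emeasure M U < \<infinity>" using U(3) A(2) by (auto simp: less_top[symmetric] top_unique)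
  have eU: "emeasure M U = ennreal (measure M U)" "emeasure M A = ennreal (measure M A)"
    using Uf A(2) by (auto simp: emeasure_eq_ennreal_measure less_top)
  have mU: "measure M U < measure M A + e/2"
    using U(3) e by (simp add: eU ennreal_less_iff flip: ennreal_plus)
  have "\<exists>K. compactin T K \<and> K \<subseteq> U \<and> measure M U - e/2 < measure M K"
  proof (rule ccontr)
    assume "\<not> ?thesis"
    then have le: "measure M K \<le> measure M U - e/2" if "compactin T K" "K \<subseteq> U" for K
      using that by (meson not_le)
    have "0 \<le> measure M U - e/2" using le[of "{}"] by simp
    have "emeasure M U \<le> ennreal (measure M U - e/2)"
    proof (subst inner[OF U(1)], rule SUP_least)
      fix K assume K: "K \<in> {K. compactin T K \<and> K \<subseteq> U}"
      then have "emeasure M K = ennreal (measure M K)"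
        using compact_finite by (intro emeasure_eq_ennreal_measure) (auto simp: less_top)
      then show "emeasure M K \<le> ennreal (measure M U - e/2)" using le[of K] K by (simp add: ennreal_leI)
    qed
    then show False using eU(1) \<open>0 \<le> measure M U - e/2\<close> e by (simp add: ennreal_le_iff)
  qed
  then obtain K where K: "compactin T K" "K \<subseteq> U" "measure M U - e/2 < measure M K" by blast
  obtain h L where h: "continuous_map T euclidean (h :: 'a \<Rightarrow> real)"
    "\<And>x. 0 \<le> h x" "\<And>x. h x \<le> 1" "\<And>x. x \<in> K \<Longrightarrow> h x = 1"
    "compactin T L" "L \<subseteq> U" "\<And>x. x \<notin> L \<Longrightarrow> h x = 0"
    by (rule compact_bump[OF hausdorff loc_compact K(1) U(1) K(2)]) (rule that; assumption)
  let ?h = "\<lambda>x. complex_of_real (h x)"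
  have hC: "?h \<in> Cc T" by (rule CcI[OF continuous_map_of_real[OF h(1)] h(5)]) (simp add: h(7))
  have iA: "integrable M (\<lambda>x. indicator A x :: complex)" using A by (rule integrable_indicator_complex)
  have i: "integrable M (\<lambda>x. indicator A x - ?h x)"
    by (rule Bochner_Integration.integrable_diff[OF iA Cc_integrable[OF hC]])
  have m: "U - A \<in> sets M" "U - K \<in> sets M" "emeasure M (U - A) < \<infinity>" "emeasure M (U - K) < \<infinity>"
    using Um A(1) compact_sets[OF K(1)] Uf emeasure_mono[of "U - A" U M] emeasure_mono[of "U - K" U M]
    by (auto intro: le_less_trans)
  have iX: "integrable M (indicator (U - A) :: 'a \<Rightarrow> real)" "integrable M (indicator (U - K) :: 'a \<Rightarrow> real)"
    using m by (auto simp: less_top[symmetric])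
  have "(\<integral>x. cmod (indicator A x - ?h x) \<partial>M) \<le> (\<integral>x. indicator (U - A) x + indicator (U - K) x \<partial>M)"
  proof (rule integral_mono[OF integrable_norm[OF i] Bochner_Integration.integrable_add[OF iX]])
    fix x
    have "cmod (1 - ?h x) = 1 - h x" using h(3)[of x] by (metis abs_of_nonneg diff_ge_0_iff_ge norm_of_real of_real_1 of_real_diff)
    then show "cmod (indicator A x - ?h x) \<le> indicator (U - A) x + indicator (U - K) x"
      using h(2-4)[of x] h(6,7) U(2) by (auto simp: indicator_def)
  qed
  also have "\<dots> = measure M (U - A) + measure M (U - K)"
    using iX m sets.sets_into_space[OF m(1)] sets.sets_into_space[OF m(2)]
    by (simp add: Bochner_Integration.integral_add Int_absorb2)
  also have "\<dots> = (measure M U - measure M A) + (measure M U - measure M K)"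
    using Um Uf A(1) U(2) K(2) compact_sets[OF K(1)] by (simp add: measure_Diff)
  also have "\<dots> < e" using mU K(3) by simp
  finally show thesis using that[OF hC i] by simp
qed

lemma Cc_dense:
  fixes f :: "'a \<Rightarrow> complex"
  assumes "integrable M f" "e > 0"
  shows "\<exists>h\<in>Cc T. (\<integral>x. cmod (f x - h x) \<partial>M) < e"
  using assms
proof (induction f arbitrary: e rule: integrable_induct)
  case (base A c)
  then have "e / (cmod c + 1) > 0" by (simp add: add_nonneg_pos)
  then obtain h where h: "h \<in> Cc T" "(\<integral>x. cmod (indicator A x - h x) \<partial>M) < e / (cmod c + 1)"
    using Cc_indicator_dense[OF base(1,2)] by metis
  have "(\<integral>x. cmod (indicator A x *\<^sub>R c - c * h x) \<partial>M) = (\<integral>x. cmod c * cmod (indicator A x - h x) \<partial>M)"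
    by (intro Bochner_Integration.integral_cong)
      (auto simp: right_diff_distrib indicator_def simp flip: norm_mult)
  also have "\<dots> \<le> (cmod c + 1) * (\<integral>x. cmod (indicator A x - h x) \<partial>M)"
    by (simp add: mult_right_mono integral_nonneg)
  also have "\<dots> < e" using h(2) by (simp add: pos_less_divide_eq add_nonneg_pos mult.commute)
  finally show ?case using Cc_scale[OF h(1), of c] by (intro bexI[of _ "\<lambda>x. c * h x"])
next
  case (add f g)
  obtain h k where h: "h \<in> Cc T" "(\<integral>x. cmod (f x - h x) \<partial>M) < e/2"
    and k: "k \<in> Cc T" "(\<integral>x. cmod (g x - k x) \<partial>M) < e/2"
    using add.IH[of "e/2"] add.prems by auto
  have i: "integrable M (\<lambda>x. f x - h x)" "integrable M (\<lambda>x. g x - k x)"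
    using add.hyps Cc_integrable h(1) k(1) by auto
  have "(\<integral>x. cmod (f x + g x - (h x + k x)) \<partial>M) \<le> (\<integral>x. cmod (f x - h x) + cmod (g x - k x) \<partial>M)"
  proof (rule integral_mono)
    show "integrable M (\<lambda>x. cmod (f x + g x - (h x + k x)))"
      using Bochner_Integration.integrable_add[OF i] by (intro integrable_norm) (simp add: algebra_simps)
    show "cmod (f x + g x - (h x + k x)) \<le> cmod (f x - h x) + cmod (g x - k x)" for x
      by (metis add_diff_add norm_triangle_ineq)
  qed (use i in auto)
  also have "\<dots> = (\<integral>x. cmod (f x - h x) \<partial>M) + (\<integral>x. cmod (g x - k x) \<partial>M)" using i by simp
  also have "\<dots> < e" using h(2) k(2) by simp
  finally show ?case using Cc_add[OF h(1) k(1)] by (intro bexI[of _ "\<lambda>x. h x + k x"])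
next
  case (lim f s)
  have "(\<lambda>i. \<integral>x. cmod (f x - s i x) \<partial>M) \<longlonglongrightarrow> (\<integral>x. 0 \<partial>M)"
  proof (rule integral_dominated_convergence[where w = "\<lambda>x. 3 * cmod (f x)"])
    show "AE x in M. (\<lambda>i. cmod (f x - s i x)) \<longlonglongrightarrow> 0"
      using lim.hyps(2) by (intro AE_I2) (auto intro!: tendsto_eq_intros)
    show "AE x in M. norm (cmod (f x - s i x)) \<le> 3 * cmod (f x)" for i
      using lim.hyps(3) by (intro AE_I2) (smt (verit) norm_triangle_ineq4 real_norm_def norm_ge_zero)
  qed (use lim.hyps in auto)
  then have "\<forall>\<^sub>F i in sequentially. (\<integral>x. cmod (f x - s i x) \<partial>M) < e/2"
    using lim.prems by (intro order_tendstoD) auto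
  then obtain i where s: "(\<integral>x. cmod (f x - s i x) \<partial>M) < e/2" by (auto simp: eventually_sequentially)
  obtain h where h: "h \<in> Cc T" "(\<integral>x. cmod (s i x - h x) \<partial>M) < e/2"
    using lim.IH[of "e/2" i] lim.prems by auto
  have i: "integrable M (\<lambda>x. f x - s i x)" "integrable M (\<lambda>x. s i x - h x)"
    using lim.hyps Cc_integrable h(1) by auto
  have "(\<integral>x. cmod (f x - h x) \<partial>M) \<le> (\<integral>x. cmod (f x - s i x) + cmod (s i x - h x) \<partial>M)"
  proof (rule integral_mono)
    show "integrable M (\<lambda>x. cmod (f x - h x))"
      using Bochner_Integration.integrable_add[OF i] by (intro integrable_norm) simp
    show "cmod (f x - h x) \<le> cmod (f x - s i x) + cmod (s i x - h x)" for x
      using norm_triangle_ineq[of "f x - s i x" "s i x - h x"] by simp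
  qed (use i in auto)
  also have "\<dots> = (\<integral>x. cmod (f x - s i x) \<partial>M) + (\<integral>x. cmod (s i x - h x) \<partial>M)" using i by simp
  also have "\<dots> < e" using h(2) s by simp
  finally show ?case using h(1) by blast
qed

section \<open>Functionals on integrable functions\<close>

text \<open>The norm of \<open>a\<close> in \<open>L\<^sup>\<infinity>\<close> is determined by its integrals against \<open>C\<^sub>c\<close>: on the set where
  \<open>a\<close> exceeds the bound, the phase of \<open>a\<close> can be approximated in \<open>L\<^sup>1\<close>.\<close>

lemma loc_bounded_of_Cc:
  assumes a: "loc_bounded M a B" and C: "0 \<le> C"
    and le: "\<And>f. f \<in> Cc T \<Longrightarrow> cmod (\<integral>x. f x * a x \<partial>M) \<le> C * (\<integral>x. cmod (f x) \<partial>M)"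
  shows "loc_bounded M a C"
  unfolding loc_bounded_def
proof (intro ballI impI conjI)
  fix F assume F: "F \<in> sets M" "emeasure M F < \<infinity>"
  show m: "(\<lambda>x. indicator F x *\<^sub>R a x) \<in> borel_measurable M" using a F by (simp add: loc_bounded_def)
  define E where "E = {x \<in> space M. C < cmod (indicator F x *\<^sub>R a x)}"
  have E: "E \<in> sets M" unfolding E_def using m by measurable
  have EF: "E \<subseteq> F" using C by (auto simp: E_def indicator_def split: if_splits)
  have Ef: "emeasure M E < \<infinity>" using emeasure_mono[OF EF F(1)] F(2) by (auto intro: le_less_trans)
  have aE: "cmod (a x) > C" "a x \<noteq> 0" if "x \<in> E" for x
    using that EF C by (auto simp: E_def indicator_def split: if_splits)
  define f where "f x = indicator E x * cnj (sgn (indicator F x *\<^sub>R a x))" for x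
  have sgnm: "(\<lambda>x. sgn (indicator F x *\<^sub>R a x)) \<in> borel_measurable M"
    using m unfolding sgn_div_norm by measurable
  have cf: "cmod (f x) = indicator E x" for x
    using aE(2)[of x] EF by (auto simp: f_def indicator_def norm_sgn)
  have fi: "integrable M f"
  proof (rule Bochner_Integration.integrable_bound[OF integrable_indicator_complex[OF E Ef]])
    have "(\<lambda>x. cnj (sgn (indicator F x *\<^sub>R a x))) \<in> borel_measurable M"
      using measurable_compose[OF sgnm, of cnj borel]
      by (simp add: borel_measurable_continuous_onI continuous_on_cnj)
    then show "f \<in> borel_measurable M"
      unfolding f_def by (intro borel_measurable_times borel_measurable_indicator E)
  qed (auto simp: cf indicator_def)
  have fa: "f x * a x = complex_of_real (indicator E x * cmod (a x))" for x
  proof (cases "x \<in> E")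
    case True
    then have "f x * a x = cnj (sgn (a x)) * a x" using EF by (auto simp: f_def)
    also have "\<dots> = complex_of_real (cmod (a x))"
      using aE(2)[OF True] complex_norm_square[of "a x"]
      by (simp add: sgn_div_norm scaleR_conv_of_real field_simps power2_eq_square)
    finally show ?thesis using True by simp
  qed (simp add: f_def)
  have fEi: "integrable M (\<lambda>x. f x * a x)"
    by (rule loc_bounded_integrable[OF a fi F]) (use EF in \<open>auto simp: f_def indicator_def split: if_splits\<close>)
  have "(\<integral>x. indicator E x * cmod (a x) \<partial>M) \<le> C * measure M E + e" if "e > 0" for e
  proof -
    \<comment> \<open>An approximation of \<open>f\<close> up to \<open>d\<close> costs at most \<open>\<bar>B\<bar> d + C d\<close>.\<close>
    define d where "d = e / (\<bar>B\<bar> + C + 1)"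
    have p: "\<bar>B\<bar> + C + 1 > 0" using C by linarith
    have d: "d > 0" using that p by (simp add: d_def)
    obtain h where h: "h \<in> Cc T" "(\<integral>x. cmod (f x - h x) \<partial>M) < d" using Cc_dense[OF fi d] by blast
    obtain K where K: "compactin T K" "\<And>x. x \<in> topspace T \<Longrightarrow> h x \<noteq> 0 \<Longrightarrow> x \<in> K"
      using h(1) by (rule CcE) blast
    have hs: "x \<in> F \<union> K" if "x \<in> space M" "h x \<noteq> 0" for x using K(2) that by (auto simp: space_M)
    have fs: "x \<in> F \<union> K" if "x \<in> space M" "f x - h x \<noteq> 0" for x
      using that hs[OF that(1)] EF by (cases "h x = 0") (auto simp: f_def indicator_def split: if_splits)
    have hi: "integrable M h" by (rule Cc_integrable[OF h(1)])
    have di: "integrable M (\<lambda>x. f x - h x)" using fi hi by simp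
    have KF: "F \<union> K \<in> sets M" "emeasure M (F \<union> K) < \<infinity>"
      using F compact_sets[OF K(1)] compact_finite[OF K(1)] emeasure_subadditive[of F M K]
      by (auto intro: le_less_trans)
    have "(\<integral>x. indicator E x * cmod (a x) \<partial>M) = cmod (\<integral>x. f x * a x \<partial>M)"
      unfolding fa integral_complex_of_real norm_of_real
      by (rule abs_of_nonneg[symmetric]) (simp add: integral_nonneg)
    also have "(\<integral>x. f x * a x \<partial>M) = (\<integral>x. (f x - h x) * a x \<partial>M) + (\<integral>x. h x * a x \<partial>M)"
    proof -
      have "integrable M (\<lambda>x. (f x - h x) * a x)" "integrable M (\<lambda>x. h x * a x)"
        by (rule loc_bounded_integrable(1)[OF a di KF], erule (1) fs)
          (rule loc_bounded_integrable(1)[OF a hi KF], erule (1) hs)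
      then show ?thesis by (simp add: left_diff_distrib flip: Bochner_Integration.integral_add)
    qed
    also have "cmod \<dots> \<le> B * (\<integral>x. cmod (f x - h x) \<partial>M) + C * (\<integral>x. cmod (h x) \<partial>M)"
      by (rule norm_triangle_mono[OF loc_bounded_integrable(2)[OF a di KF fs] le[OF h(1)]])
    also have "\<dots> \<le> \<bar>B\<bar> * d + C * (measure M E + d)"
    proof (intro add_mono)
      have "(\<integral>x. cmod (f x - h x) \<partial>M) \<ge> 0" by (simp add: integral_nonneg)
      then show "B * (\<integral>x. cmod (f x - h x) \<partial>M) \<le> \<bar>B\<bar> * d"
        using h(2) by (intro mult_mono) auto
      have "(\<integral>x. cmod (h x) \<partial>M) \<le> (\<integral>x. cmod (f x) + cmod (f x - h x) \<partial>M)"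
      proof (rule integral_mono)
        show "cmod (h x) \<le> cmod (f x) + cmod (f x - h x)" for x
          by (metis norm_minus_commute norm_triangle_sub)
      qed (use hi fi in auto)
      also have "\<dots> = measure M E + (\<integral>x. cmod (f x - h x) \<partial>M)"
        using fi di E Ef sets.sets_into_space[OF E]
        by (subst Bochner_Integration.integral_add) (auto simp: cf Int_absorb2)
      finally show "C * (\<integral>x. cmod (h x) \<partial>M) \<le> C * (measure M E + d)"
        using h(2) C by (intro mult_left_mono) auto
    qed
    also have "\<dots> \<le> C * measure M E + (\<bar>B\<bar> + C + 1) * d" using d by (simp add: algebra_simps)
    also have "\<dots> = C * measure M E + e" using p by (simp add: d_def)
    finally show ?thesis .
  qed
  then have "(\<integral>x. indicator E x * cmod (a x) \<partial>M) \<le> C * measure M E" by (rule field_le_epsilon)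
  moreover have "integrable M (\<lambda>x. indicator E x * cmod (a x))"
    using integrable_norm[OF fEi] unfolding fa norm_of_real by (simp add: abs_mult)
  ultimately have "AE x in M. x \<notin> E"
    using aE(1) by (intro integral_le_imp_AE_le[OF E Ef]) auto
  then show "AE x in M. x \<in> F \<longrightarrow> cmod (a x) \<le> C"
    using AE_space by eventually_elim (auto simp: E_def not_less)
qed

end

locale L1_functional = radon +
  fixes \<Lambda> :: "('a \<Rightarrow> complex) \<Rightarrow> complex" and C :: real
  assumes C: "0 \<le> C"
    and functional_add: "f \<in> Cc T \<Longrightarrow> g \<in> Cc T \<Longrightarrow> \<Lambda> (\<lambda>x. f x + g x) = \<Lambda> f + \<Lambda> g"
    and functional_scale: "f \<in> Cc T \<Longrightarrow> \<Lambda> (\<lambda>x. c * f x) = c * \<Lambda> f"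
    and functional_bound: "f \<in> Cc T \<Longrightarrow> cmod (\<Lambda> f) \<le> C * (\<integral>x. cmod (f x) \<partial>M)"
begin

definition approx :: "('a \<Rightarrow> complex) \<Rightarrow> nat \<Rightarrow> 'a \<Rightarrow> complex" where
  "approx f n = (SOME h. h \<in> Cc T \<and> (\<integral>x. cmod (f x - h x) \<partial>M) < 1 / real (Suc n))"

definition L1_extension :: "('a \<Rightarrow> complex) \<Rightarrow> complex" where
  "L1_extension f = lim (\<lambda>n. \<Lambda> (approx f n))"

lemma approx:
  assumes "integrable M f"
  shows "approx f n \<in> Cc T" "(\<integral>x. cmod (f x - approx f n x) \<partial>M) < 1 / real (Suc n)"
proof -
  have "\<exists>h. h \<in> Cc T \<and> (\<integral>x. cmod (f x - h x) \<partial>M) < 1 / real (Suc n)"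
    using Cc_dense[OF assms, of "1 / real (Suc n)"] by auto
  from someI_ex[OF this] show "approx f n \<in> Cc T" "(\<integral>x. cmod (f x - approx f n x) \<partial>M) < 1 / real (Suc n)"
    by (auto simp: approx_def)
qed

lemma approx_lim:
  assumes "integrable M f" shows "(\<lambda>n. \<integral>x. cmod (f x - approx f n x) \<partial>M) \<longlonglongrightarrow> 0"
  by (rule tendsto_sandwich[OF _ _ tendsto_const LIMSEQ_inverse_real_of_nat])
    (use approx(2)[OF assms] in \<open>auto intro!: always_eventually less_imp_le integral_nonneg simp: inverse_eq_divide\<close>)

lemma L1_triangle:
  assumes "integrable M f" "integrable M g" "integrable M h"
  shows "(\<integral>x. cmod (g x - h x) \<partial>M) \<le> (\<integral>x. cmod (f x - g x) \<partial>M) + (\<integral>x. cmod (f x - h x) \<partial>M)"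
proof -
  have "(\<integral>x. cmod (g x - h x) \<partial>M) \<le> (\<integral>x. cmod (f x - g x) + cmod (f x - h x) \<partial>M)"
  proof (rule integral_mono)
    show "cmod (g x - h x) \<le> cmod (f x - g x) + cmod (f x - h x)" for x
      using norm_triangle_ineq4[of "f x - h x" "f x - g x"] by simp
  qed (use assms in auto)
  also have "\<dots> = (\<integral>x. cmod (f x - g x) \<partial>M) + (\<integral>x. cmod (f x - h x) \<partial>M)"
    using assms by simp
  finally show ?thesis .
qed

lemma functional_diff: "f \<in> Cc T \<Longrightarrow> g \<in> Cc T \<Longrightarrow> \<Lambda> (\<lambda>x. f x - g x) = \<Lambda> f - \<Lambda> g"
  using functional_add[of f "\<lambda>x. -1 * g x"] functional_scale[of g "-1"] Cc_scale[of g T "-1"] by simp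

lemma functional_dist:
  assumes "f \<in> Cc T" "g \<in> Cc T"
  shows "cmod (\<Lambda> f - \<Lambda> g) \<le> C * (\<integral>x. cmod (f x - g x) \<partial>M)"
  using functional_bound[OF Cc_diff[OF assms]] by (simp add: functional_diff assms)

text \<open>Any approximating sequence computes the extension, because two of them are close to each other in
  \<open>L\<^sup>1\<close>. This makes the extension linear.\<close>

lemma extension_limit:
  assumes f: "integrable M f" and h: "\<And>n. h n \<in> Cc T"
    and l: "(\<lambda>n. \<integral>x. cmod (f x - h n x) \<partial>M) \<longlonglongrightarrow> 0"
  shows "(\<lambda>n. \<Lambda> (h n)) \<longlonglongrightarrow> L1_extension f"
proof -
  have le: "cmod (\<Lambda> (g n) - \<Lambda> (k m)) \<le> C * ((\<integral>x. cmod (f x - g n x) \<partial>M) + (\<integral>x. cmod (f x - k m x) \<partial>M))"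
    if "\<And>n. g n \<in> Cc T" "\<And>n. k n \<in> Cc T" for g k :: "nat \<Rightarrow> _" and m n
    using functional_dist[OF that] L1_triangle[OF f Cc_integrable Cc_integrable, OF that] C
    by (meson mult_left_mono order_trans)
  have "Cauchy (\<lambda>n. \<Lambda> (approx f n))"
  proof (rule metric_CauchyI)
    fix e :: real assume "e > 0"
    define d where "d = e / (C + 1) / 2"
    have d: "d > 0" using \<open>e > 0\<close> C by (simp add: d_def)
    then obtain N where N: "\<And>n. n \<ge> N \<Longrightarrow> (\<integral>x. cmod (f x - approx f n x) \<partial>M) < d"
      using order_tendstoD(2)[OF approx_lim[OF f] d] by (auto simp: eventually_sequentially)
    have "dist (\<Lambda> (approx f m)) (\<Lambda> (approx f n)) < e" if "m \<ge> N" "n \<ge> N" for m n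
    proof -
      have "cmod (\<Lambda> (approx f m) - \<Lambda> (approx f n)) \<le> C * (d + d)"
        using le[of "approx f" "approx f" m n] approx(1)[OF f] N[OF that(1)] N[OF that(2)] C
        by (smt (verit) mult_left_mono)
      also have "\<dots> < (C + 1) * (d + d)" using d by simp
      also have "d + d = e / (C + 1)" unfolding d_def by (rule field_sum_of_halves)
      finally show ?thesis using C by (simp add: dist_norm)
    qed
    then show "\<exists>N. \<forall>m\<ge>N. \<forall>n\<ge>N. dist (\<Lambda> (approx f m)) (\<Lambda> (approx f n)) < e" by blast
  qed
  then have 1: "(\<lambda>n. \<Lambda> (approx f n)) \<longlonglongrightarrow> L1_extension f"
    unfolding L1_extension_def by (simp add: Cauchy_convergent_iff convergent_LIMSEQ_iff)
  have "(\<lambda>n. C * ((\<integral>x. cmod (f x - h n x) \<partial>M) + (\<integral>x. cmod (f x - approx f n x) \<partial>M))) \<longlonglongrightarrow> 0"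
    by (intro tendsto_mult_right_zero tendsto_add_zero l approx_lim[OF f])
  then have "(\<lambda>n. \<Lambda> (h n) - \<Lambda> (approx f n)) \<longlonglongrightarrow> 0"
    by (rule Lim_null_comparison[OF always_eventually, rotated])
      (use le[of h "approx f", OF h approx(1)[OF f]] in auto)
  from tendsto_add[OF this 1] show ?thesis by simp
qed

lemma extension_Cc: "f \<in> Cc T \<Longrightarrow> L1_extension f = \<Lambda> f"
  using extension_limit[OF Cc_integrable, of f "\<lambda>_. f"] by (simp add: LIMSEQ_const_iff)

lemma extension_add:
  assumes "integrable M f" "integrable M g"
  shows "L1_extension (\<lambda>x. f x + g x) = L1_extension f + L1_extension g"
proof -
  note m = approx(1)[OF assms(1)] approx(1)[OF assms(2)]
  have le: "(\<integral>x. cmod (f x + g x - (approx f n x + approx g n x)) \<partial>M) \<le>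
      (\<integral>x. cmod (f x - approx f n x) \<partial>M) + (\<integral>x. cmod (g x - approx g n x) \<partial>M)" for n
  proof -
    have "(\<integral>x. cmod (f x + g x - (approx f n x + approx g n x)) \<partial>M) \<le>
      (\<integral>x. cmod (f x - approx f n x) + cmod (g x - approx g n x) \<partial>M)"
      using assms Cc_integrable[OF m(1)] Cc_integrable[OF m(2)]
      by (intro integral_mono) (auto simp: add_diff_add norm_triangle_ineq)
    also have "\<dots> = (\<integral>x. cmod (f x - approx f n x) \<partial>M) + (\<integral>x. cmod (g x - approx g n x) \<partial>M)"
      using assms Cc_integrable[OF m(1)] Cc_integrable[OF m(2)] by simp
    finally show ?thesis .
  qed
  have l: "(\<lambda>n. \<integral>x. cmod (f x + g x - (approx f n x + approx g n x)) \<partial>M) \<longlonglongrightarrow> 0"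
    by (rule tendsto_sandwich[OF _ _ tendsto_const
          tendsto_add_zero[OF approx_lim[OF assms(1)] approx_lim[OF assms(2)]]])
      (use le in \<open>auto intro!: always_eventually integral_nonneg\<close>)
  have "(\<lambda>n. \<Lambda> (\<lambda>x. approx f n x + approx g n x)) \<longlonglongrightarrow> L1_extension (\<lambda>x. f x + g x)"
    using assms m by (intro extension_limit[OF _ _ l]) (auto intro: Cc_add)
  moreover have "(\<lambda>n. \<Lambda> (\<lambda>x. approx f n x + approx g n x)) \<longlonglongrightarrow> L1_extension f + L1_extension g"
    using tendsto_add[OF extension_limit[OF assms(1) m(1) approx_lim] extension_limit[OF assms(2) m(2) approx_lim]]
      assms m by (simp add: functional_add)
  ultimately show ?thesis by (rule LIMSEQ_unique)
qed

lemma extension_scale: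
  assumes "integrable M f" shows "L1_extension (\<lambda>x. c * f x) = c * L1_extension f"
proof -
  note m = approx(1)[OF assms(1)]
  have "(\<integral>x. cmod (c * f x - c * approx f n x) \<partial>M) = cmod c * (\<integral>x. cmod (f x - approx f n x) \<partial>M)" for n
    by (simp add: norm_mult flip: right_diff_distrib)
  then have l: "(\<lambda>n. \<integral>x. cmod (c * f x - c * approx f n x) \<partial>M) \<longlonglongrightarrow> 0"
    by (simp add: tendsto_mult_right_zero approx_lim assms)
  have "(\<lambda>n. \<Lambda> (\<lambda>x. c * approx f n x)) \<longlonglongrightarrow> L1_extension (\<lambda>x. c * f x)"
    using assms m by (intro extension_limit[OF _ _ l]) (auto intro: Cc_scale)
  moreover have "(\<lambda>n. \<Lambda> (\<lambda>x. c * approx f n x)) \<longlonglongrightarrow> c * L1_extension f"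
    using tendsto_mult_left[OF extension_limit[OF assms m approx_lim[OF assms]]] m
    by (simp add: functional_scale)
  ultimately show ?thesis by (rule LIMSEQ_unique)
qed

lemma extension_bound:
  assumes f: "integrable M f" shows "cmod (L1_extension f) \<le> C * (\<integral>x. cmod (f x) \<partial>M)"
proof -
  have "(\<lambda>n. cmod (\<Lambda> (approx f n))) \<longlonglongrightarrow> cmod (L1_extension f)"
    by (intro tendsto_norm extension_limit f approx approx_lim)
  moreover have "(\<lambda>n. C * ((\<integral>x. cmod (f x) \<partial>M) + (\<integral>x. cmod (f x - approx f n x) \<partial>M)))
      \<longlonglongrightarrow> C * ((\<integral>x. cmod (f x) \<partial>M) + 0)"
    by (intro tendsto_intros approx_lim f)
  moreover have "cmod (\<Lambda> (approx f n)) \<le> C * ((\<integral>x. cmod (f x) \<partial>M) + (\<integral>x. cmod (f x - approx f n x) \<partial>M))" for n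
  proof -
    have i: "integrable M (approx f n)" by (intro Cc_integrable approx f)
    have "(\<integral>x. cmod (approx f n x) \<partial>M) \<le> (\<integral>x. cmod (f x) + cmod (f x - approx f n x) \<partial>M)"
    proof (rule integral_mono)
      show "cmod (approx f n x) \<le> cmod (f x) + cmod (f x - approx f n x)" for x
        by (metis norm_minus_commute norm_triangle_sub)
    qed (use f i in auto)
    also have "\<dots> = (\<integral>x. cmod (f x) \<partial>M) + (\<integral>x. cmod (f x - approx f n x) \<partial>M)" using f i by simp
    finally show ?thesis using functional_bound[OF approx(1)[OF f], of n] C
      by (meson mult_left_mono order_trans)
  qed
  ultimately have "cmod (L1_extension f) \<le> C * ((\<integral>x. cmod (f x) \<partial>M) + 0)"
    by (intro LIMSEQ_le) auto
  then show ?thesis by simp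
qed

lemma extension_diff:
  assumes "integrable M f" "integrable M g"
  shows "L1_extension (\<lambda>x. f x - g x) = L1_extension f - L1_extension g"
  using extension_add[OF assms(1), of "\<lambda>x. -1 * g x"] extension_scale[OF assms(2), of "-1"] assms(2) by simp

text \<open>Two functionals that are continuous in \<open>L\<^sup>1\<close> agree on the limit of a dominated sequence.\<close>

lemma extension_limit_eq:
  assumes a: "loc_bounded M a B" and F: "F \<in> sets M" "emeasure M F < \<infinity>"
    and s: "\<And>i. integrable M (s i)" "\<And>i x. x \<in> space M \<Longrightarrow> s i x \<noteq> 0 \<Longrightarrow> x \<in> F"
    and f: "integrable M f" "\<And>x. x \<in> space M \<Longrightarrow> f x \<noteq> 0 \<Longrightarrow> x \<in> F"
    and l: "\<And>x. x \<in> space M \<Longrightarrow> (\<lambda>i. s i x) \<longlonglongrightarrow> f x"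
    and d: "\<And>i x. x \<in> space M \<Longrightarrow> cmod (s i x) \<le> 2 * cmod (f x)"
    and eq: "\<And>i. L1_extension (s i) = (\<integral>x. s i x * a x \<partial>M)"
  shows "L1_extension f = (\<integral>x. f x * a x \<partial>M)"
proof -
  have "(\<lambda>i. \<integral>x. cmod (f x - s i x) \<partial>M) \<longlonglongrightarrow> (\<integral>x. 0 \<partial>M)"
  proof (rule integral_dominated_convergence[where w = "\<lambda>x. 3 * cmod (f x)"])
    show "AE x in M. (\<lambda>i. cmod (f x - s i x)) \<longlonglongrightarrow> 0"
      using l by (intro AE_I2) (auto intro!: tendsto_eq_intros)
    show "AE x in M. norm (cmod (f x - s i x)) \<le> 3 * cmod (f x)" for i
      using d by (intro AE_I2) (smt (verit) norm_triangle_ineq4 real_norm_def norm_ge_zero)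
  qed (use f s in auto)
  then have 0: "(\<lambda>i. \<integral>x. cmod (f x - s i x) \<partial>M) \<longlonglongrightarrow> 0" by simp
  have "cmod (L1_extension f - L1_extension (s i)) \<le> C * (\<integral>x. cmod (f x - s i x) \<partial>M)" for i
    using extension_bound[of "\<lambda>x. f x - s i x"] f s by (simp add: extension_diff)
  then have 1: "(\<lambda>i. L1_extension f - L1_extension (s i)) \<longlonglongrightarrow> 0"
    by (intro Lim_null_comparison[OF always_eventually tendsto_mult_right_zero[OF 0, of C]]) auto
  have "cmod ((\<integral>x. f x * a x \<partial>M) - (\<integral>x. s i x * a x \<partial>M)) \<le> B * (\<integral>x. cmod (f x - s i x) \<partial>M)" for i
  proof -
    have "integrable M (\<lambda>x. f x * a x)" "integrable M (\<lambda>x. s i x * a x)"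
      using f s by (auto intro!: loc_bounded_integrable[OF a _ F])
    then have "(\<integral>x. f x * a x \<partial>M) - (\<integral>x. s i x * a x \<partial>M) = (\<integral>x. (f x - s i x) * a x \<partial>M)"
      by (simp add: left_diff_distrib)
    moreover have "x \<in> F" if "x \<in> space M" "f x - s i x \<noteq> 0" for x
      using that f(2)[of x] s(2)[of x i] by (cases "f x = 0") auto
    ultimately show ?thesis using f s loc_bounded_integrable(2)[OF a _ F, of "\<lambda>x. f x - s i x"] by auto
  qed
  then have "(\<lambda>i. (\<integral>x. f x * a x \<partial>M) - (\<integral>x. s i x * a x \<partial>M)) \<longlonglongrightarrow> 0"
    by (intro Lim_null_comparison[OF always_eventually tendsto_mult_right_zero[OF 0, of B]]) auto
  from tendsto_diff[OF 1 this] show ?thesis by (simp add: eq LIMSEQ_const_iff)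
qed

end

text \<open>On a set of finite measure the function is put together from countably many measurable pieces.\<close>

lemma loc_bounded_measurable_pieces:
  assumes P: "localizing M \<P>"
    and a: "\<And>P. P \<in> \<P> \<Longrightarrow> (\<lambda>x. indicator P x *\<^sub>R a x) \<in> borel_measurable M" and b: "\<And>x. cmod (a x) \<le> B"
  shows "loc_bounded M a B"
  unfolding loc_bounded_def
proof (intro ballI impI conjI AE_I2)
  fix F assume F: "F \<in> sets M" "emeasure M F < \<infinity>"
  show "(\<lambda>x. indicator F x *\<^sub>R a x) \<in> borel_measurable M"
  proof (rule borel_measurableI)
    fix S :: "complex set" assume S: "open S"
    let ?Q = "{P \<in> \<P>. P \<inter> F \<noteq> {}}"
    have Q: "countable ?Q" "?Q \<subseteq> sets M" using P F by (auto simp: localizing_def)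
    have "F \<subseteq> \<Union>\<P>" using P sets.sets_into_space[OF F(1)] by (simp add: localizing_def)
    then have cov: "\<exists>P\<in>?Q. x \<in> P" if "x \<in> F" for x using that by blast
    have Fs: "F \<subseteq> space M" by (rule sets.sets_into_space[OF F(1)])
    have "(\<lambda>x. indicator F x *\<^sub>R a x) -` S \<inter> space M =
        (\<Union>P\<in>?Q. F \<inter> (P \<inter> ((\<lambda>x. indicator P x *\<^sub>R a x) -` S \<inter> space M))) \<union>
        (if 0 \<in> S then space M - F else {})" (is "?L = ?R")
    proof (rule Set.set_eqI)
      fix x
      show "x \<in> ?L \<longleftrightarrow> x \<in> ?R"
      proof (cases "x \<in> F")
        case True
        have "x \<in> ?R \<longleftrightarrow> (\<exists>P\<in>?Q. x \<in> P \<and> a x \<in> S)" using True Fs by (auto simp: indicator_def)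
        also have "\<dots> \<longleftrightarrow> a x \<in> S" using cov[OF True] by blast
        also have "\<dots> \<longleftrightarrow> x \<in> ?L" using True Fs by auto
        finally show ?thesis ..
      qed auto
    qed
    moreover have "F \<inter> (P \<inter> ((\<lambda>x. indicator P x *\<^sub>R a x) -` S \<inter> space M)) \<in> sets M" if "P \<in> ?Q" for P
      using F(1) Q(2) that measurable_sets[OF a[of P] borel_open[OF S]] by auto
    then have "(\<Union>P\<in>?Q. F \<inter> (P \<inter> ((\<lambda>x. indicator P x *\<^sub>R a x) -` S \<inter> space M))) \<in> sets M"
      by (intro sets.countable_UN' Q(1)) auto
    ultimately show "(\<lambda>x. indicator F x *\<^sub>R a x) -` S \<inter> space M \<in> sets M"
      using F(1) by (simp add: sets.Un sets.compl_sets)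
  qed
qed (simp add: b)

context L1_functional
begin

text \<open>The real and the imaginary part of the extension at indicator functions are set functions that
  are dominated by \<open>C\<close> times the measure.\<close>

lemma extension_density_piece:
  assumes P: "P \<in> sets M" "emeasure M P < \<infinity>"
  obtains g where "g \<in> borel_measurable M" "\<And>x. cmod (g x) \<le> 2 * C"
    "\<And>A. A \<in> sets M \<Longrightarrow> A \<subseteq> P \<Longrightarrow> L1_extension (indicator A) = (\<integral>x. indicator A x * g x \<partial>M)"
proof -
  have fin: "emeasure M A < \<infinity>" if "A \<in> sets M" "A \<subseteq> P" for A
    using emeasure_mono[OF that(2) P(1)] P(2) by (auto intro: le_less_trans)
  have i: "integrable M (indicator A :: 'a \<Rightarrow> complex)" if "A \<in> sets M" "A \<subseteq> P" for A
    using integrable_indicator_complex[OF that(1) fin[OF that]] .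
  have bd: "cmod (L1_extension (indicator A)) \<le> C * measure M A" if "A \<in> sets M" "A \<subseteq> P" for A
  proof -
    have "(\<lambda>x. cmod (indicator A x)) = indicator A" by (auto simp: indicator_def)
    then show ?thesis using extension_bound[OF i[OF that]] sets.sets_into_space[OF that(1)] that(1)
      by (simp add: Int_absorb2)
  qed
  have add: "L1_extension (indicator (A \<union> B)) = L1_extension (indicator A) + L1_extension (indicator B)"
    if "A \<in> sets M" "B \<in> sets M" "A \<subseteq> P" "B \<subseteq> P" "A \<inter> B = {}" for A B
  proof -
    have "(indicator (A \<union> B) :: 'a \<Rightarrow> complex) = (\<lambda>x. indicator A x + indicator B x)"
      using that(5) by (auto simp: indicator_def fun_eq_iff)
    then show ?thesis using extension_add[OF i i] that by simp
  qed
  obtain u where u: "u \<in> borel_measurable M" "\<And>x. \<bar>u x\<bar> \<le> C"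
    "\<And>A. A \<in> sets M \<Longrightarrow> A \<subseteq> P \<Longrightarrow> Re (L1_extension (indicator A)) = (\<integral>x. indicator A x * u x \<partial>M)"
    by (rule dominated_set_function_density[OF P C, of "\<lambda>A. Re (L1_extension (indicator A))"])
      (auto simp: add intro: that order_trans[OF abs_Re_le_cmod bd])
  obtain v where v: "v \<in> borel_measurable M" "\<And>x. \<bar>v x\<bar> \<le> C"
    "\<And>A. A \<in> sets M \<Longrightarrow> A \<subseteq> P \<Longrightarrow> Im (L1_extension (indicator A)) = (\<integral>x. indicator A x * v x \<partial>M)"
    by (rule dominated_set_function_density[OF P C, of "\<lambda>A. Im (L1_extension (indicator A))"])
      (auto simp: add intro: that order_trans[OF abs_Im_le_cmod bd])
  show thesis
  proof (rule that[of "\<lambda>x. Complex (u x) (v x)"])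
    have "(\<lambda>x. Complex (u x) (v x)) = (\<lambda>x. complex_of_real (u x) + \<i> * complex_of_real (v x))"
      by (simp add: complex_eq_iff fun_eq_iff)
    then show "(\<lambda>x. Complex (u x) (v x)) \<in> borel_measurable M" using u(1) v(1) by simp
    show "cmod (Complex (u x) (v x)) \<le> 2 * C" for x
      using cmod_le[of "Complex (u x) (v x)"] u(2)[of x] v(2)[of x] by simp
    fix A assume A: "A \<in> sets M" "A \<subseteq> P"
    have iu: "integrable M (\<lambda>x. indicator A x * w x)"
      if "w \<in> borel_measurable M" "\<And>x. \<bar>w x\<bar> \<le> C" for w :: "'a \<Rightarrow> real"
      using integrableI_bounded_set_indicator[OF A(1) that(1) fin[OF A], of C] that(2) by simp
    have "(\<integral>x. indicator A x * Complex (u x) (v x) \<partial>M) =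
        (\<integral>x. complex_of_real (indicator A x * u x) + \<i> * complex_of_real (indicator A x * v x) \<partial>M)"
      by (intro Bochner_Integration.integral_cong) (auto simp: complex_eq_iff indicator_def)
    also have "\<dots> = complex_of_real (\<integral>x. indicator A x * u x \<partial>M) + \<i> * complex_of_real (\<integral>x. indicator A x * v x \<partial>M)"
      using iu[OF u(1,2)] iu[OF v(1,2)]
      by (subst Bochner_Integration.integral_add)
        (auto simp del: of_real_mult simp: integral_complex_of_real)
    also have "\<dots> = L1_extension (indicator A)" using u(3)[OF A] v(3)[OF A] by (simp add: complex_eq_iff)
    finally show "L1_extension (indicator A) = (\<integral>x. indicator A x * Complex (u x) (v x) \<partial>M)" ..
  qed
qed

text \<open>The set is exhausted by its intersections with finitely many pieces.\<close>

lemma extension_density_indicator: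
  assumes P: "localizing M \<P>" and a: "loc_bounded M a B"
    and piece: "\<And>P A. P \<in> \<P> \<Longrightarrow> A \<in> sets M \<Longrightarrow> A \<subseteq> P \<Longrightarrow>
      L1_extension (indicator A) = (\<integral>x. indicator A x * a x \<partial>M)"
    and A: "A \<in> sets M" "emeasure M A < \<infinity>"
  shows "L1_extension (indicator A) = (\<integral>x. indicator A x * a x \<partial>M)"
proof -
  let ?Q = "{P \<in> \<P>. P \<inter> A \<noteq> {}}"
  have Q: "countable ?Q" "?Q \<subseteq> sets M" using P A by (auto simp: localizing_def)
  have "A \<subseteq> \<Union>\<P>" using P sets.sets_into_space[OF A(1)] by (simp add: localizing_def)
  then have cov: "A \<subseteq> \<Union>?Q" by blast
  show ?thesis
  proof (cases "?Q = {}")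
    case True
    then have "A = {}" using cov by auto
    moreover have "L1_extension (\<lambda>x. 0) = 0" using extension_scale[of "\<lambda>_. 0" 0] by simp
    moreover have "(indicator {} :: 'a \<Rightarrow> complex) = (\<lambda>x. 0)" by (auto simp: indicator_def)
    ultimately show ?thesis by simp
  next
    case False
    define E where "E = from_nat_into ?Q"
    have E: "E i \<in> ?Q" for i unfolding E_def by (rule from_nat_into[OF False])
    have Eu: "\<Union>(range E) = \<Union>?Q" unfolding E_def using range_from_nat_into[OF False Q(1)] by simp
    have Em: "E i \<in> sets M" for i using E Q(2) by blast
    define S where "S n = A \<inter> (\<Union>i<n. E i)" for n
    have Sm: "S n \<in> sets M" for n unfolding S_def using A(1) Em by auto
    have SA: "S n \<subseteq> A" for n by (auto simp: S_def)
    have fin: "emeasure M B < \<infinity>" if "B \<subseteq> A" for B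
      using emeasure_mono[OF that A(1)] A(2) by (auto intro: le_less_trans)
    have i: "integrable M (indicator B :: 'a \<Rightarrow> complex)" if "B \<in> sets M" "B \<subseteq> A" for B
      using integrable_indicator_complex[OF that(1) fin[OF that(2)]] .
    have ia: "integrable M (\<lambda>x. indicator B x * a x)" if "B \<in> sets M" "B \<subseteq> A" for B
      using loc_bounded_integrable(1)[OF a i[OF that] A] that(2) by (auto simp: indicator_def split: if_splits)
    have eq: "L1_extension (indicator (S n)) = (\<integral>x. indicator (S n) x * a x \<partial>M)" for n
    proof (induction n)
      case 0
      have "L1_extension (\<lambda>x. 0) = 0" using extension_scale[of "\<lambda>_. 0" 0] by simp
      moreover have "(indicator {} :: 'a \<Rightarrow> complex) = (\<lambda>x. 0)" by (auto simp: indicator_def)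
      ultimately show ?case by (simp add: S_def)
    next
      case (Suc n)
      define D where "D = A \<inter> E n - S n"
      have D: "D \<in> sets M" "D \<subseteq> A" "D \<subseteq> E n" using A(1) Em Sm by (auto simp: D_def)
      have "(indicator (S (Suc n)) :: 'a \<Rightarrow> complex) = (\<lambda>x. indicator (S n) x + indicator D x)"
        by (auto simp: indicator_def fun_eq_iff S_def D_def lessThan_Suc)
      moreover have "L1_extension (indicator D) = (\<integral>x. indicator D x * a x \<partial>M)"
        using E[of n] D by (intro piece[of "E n"]) auto
      ultimately show ?case
        using Suc extension_add[OF i[OF Sm SA] i[OF D(1,2)]] ia[OF Sm SA] ia[OF D(1,2)]
        by (simp add: distrib_right)
    qed
    show ?thesis
    proof (rule extension_limit_eq[OF a A, where s = "\<lambda>n. indicator (S n)"])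
      fix x
      show "(\<lambda>n. indicator (S n) x) \<longlonglongrightarrow> (indicator A x :: complex)"
      proof (cases "x \<in> A")
        case True
        then obtain k where "x \<in> E k" using cov Eu by blast
        then have "indicator (S n) x = (indicator A x :: complex)" if "n \<ge> Suc k" for n
          using True that by (auto simp: S_def indicator_def)
        then show ?thesis by (intro tendsto_eventually) (auto simp: eventually_sequentially)
      next
        case False
        then have "x \<notin> S n" for n using SA by blast
        then show ?thesis using False by (simp add: indicator_def)
      qed
    qed (use i[OF Sm SA] i[OF A(1)] SA eq in \<open>auto simp: indicator_def split: if_splits\<close>)
  qed
qed

text \<open>The densities on the pieces are glued to one function, which represents the functional first
  on indicator functions and then on limits of simple functions.\<close>

lemma L1_functional_density:
  assumes P: "localizing M \<P>"
  obtains a where "loc_bounded M a (2 * C)" "\<And>f. f \<in> Cc T \<Longrightarrow> \<Lambda> f = (\<integral>x. f x * a x \<partial>M)"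
proof -
  have "\<exists>g. g \<in> borel_measurable M \<and> (\<forall>x. cmod (g x) \<le> 2 * C) \<and>
    (\<forall>A\<in>sets M. A \<subseteq> P \<longrightarrow> L1_extension (indicator A) = (\<integral>x. indicator A x * g x \<partial>M))" if "P \<in> \<P>" for P
    using extension_density_piece[of P] that P unfolding localizing_def by (metis subsetD)
  then obtain g where g: "\<And>P. P \<in> \<P> \<Longrightarrow> g P \<in> borel_measurable M" "\<And>P x. P \<in> \<P> \<Longrightarrow> cmod (g P x) \<le> 2 * C"
    "\<And>P A. P \<in> \<P> \<Longrightarrow> A \<in> sets M \<Longrightarrow> A \<subseteq> P \<Longrightarrow> L1_extension (indicator A) = (\<integral>x. indicator A x * g P x \<partial>M)"
    by metis
  define a where "a x = (if x \<in> \<Union>\<P> then g (THE P. P \<in> \<P> \<and> x \<in> P) x else 0)" for x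
  have aP: "a x = g P x" if "P \<in> \<P>" "x \<in> P" for P x
  proof -
    have "(THE P. P \<in> \<P> \<and> x \<in> P) = P"
      using that P unfolding localizing_def disjoint_def by (intro the_equality) blast+
    then show ?thesis using that by (auto simp: a_def)
  qed
  have b: "cmod (a x) \<le> 2 * C" for x
  proof (cases "x \<in> \<Union>\<P>")
    case True
    then obtain P where "P \<in> \<P>" "x \<in> P" by blast
    then show ?thesis using aP g(2) by simp
  qed (simp add: a_def C)
  have "(\<lambda>x. indicator P x *\<^sub>R a x) \<in> borel_measurable M" if "P \<in> \<P>" for P
  proof -
    have "(\<lambda>x. indicator P x *\<^sub>R g P x) \<in> borel_measurable M"
      using g(1)[OF that] that P by (intro borel_measurable_scaleR) (auto simp: localizing_def)
    also have "(\<lambda>x. indicator P x *\<^sub>R g P x) = (\<lambda>x. indicator P x *\<^sub>R a x)"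
      using aP[OF that] by (auto simp: indicator_def fun_eq_iff)
    finally show ?thesis .
  qed
  then have a: "loc_bounded M a (2 * C)" using b by (rule loc_bounded_measurable_pieces[OF P])
  have piece: "L1_extension (indicator A) = (\<integral>x. indicator A x * a x \<partial>M)"
    if "P \<in> \<P>" "A \<in> sets M" "A \<subseteq> P" for P A
  proof -
    have "(\<integral>x. indicator A x * g P x \<partial>M) = (\<integral>x. indicator A x * a x \<partial>M)"
      using aP[OF that(1)] that(3) by (intro Bochner_Integration.integral_cong) (auto simp: indicator_def)
    then show ?thesis using g(3)[OF that] by simp
  qed
  have ind: "L1_extension (indicator A) = (\<integral>x. indicator A x * a x \<partial>M)"
    if "A \<in> sets M" "emeasure M A < \<infinity>" for A
    by (rule extension_density_indicator[OF P a piece that])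
  have "L1_extension (\<lambda>x. indicator F x * f x) = (\<integral>x. indicator F x * f x * a x \<partial>M)"
    if "integrable M f" and F: "F \<in> sets M" "emeasure M F < \<infinity>" for f F
    using that(1)
  proof (induction f rule: integrable_induct)
    case (base A c)
    have AF: "A \<inter> F \<in> sets M" "emeasure M (A \<inter> F) < \<infinity>"
      using base F(1) emeasure_mono[of "A \<inter> F" A M] by (auto intro: le_less_trans)
    have e: "indicator F x * (indicator A x *\<^sub>R c) = c * indicator (A \<inter> F) x" for x
      by (auto simp: indicator_def)
    show ?case
      unfolding e mult.assoc integral_mult_right_zero ind[OF AF, symmetric]
      by (rule extension_scale[OF integrable_indicator_complex[OF AF]])
  next
    case (add f g)
    have i: "integrable M (\<lambda>x. indicator F x * h x)" if "integrable M h" for h :: "'a \<Rightarrow> complex"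
    proof -
      have "(\<lambda>x. indicator F x * h x) = (\<lambda>x. indicator F x *\<^sub>R h x)" by (auto simp: indicator_def)
      then show ?thesis using integrable_mult_indicator[OF F(1) that] by simp
    qed
    have ia: "integrable M (\<lambda>x. indicator F x * h x * a x)" if "integrable M h" for h
      by (rule loc_bounded_integrable(1)[OF a i[OF that] F]) (auto simp: indicator_def split: if_splits)
    show ?case
      unfolding distrib_left distrib_right extension_add[OF i[OF add.hyps(1)] i[OF add.hyps(2)]]
        Bochner_Integration.integral_add[OF ia[OF add.hyps(1)] ia[OF add.hyps(2)]] add.IH ..
  next
    case (lim f s)
    have i: "integrable M (\<lambda>x. indicator F x * h x)" if "integrable M h" for h :: "'a \<Rightarrow> complex"
    proof -
      have "(\<lambda>x. indicator F x * h x) = (\<lambda>x. indicator F x *\<^sub>R h x)" by (auto simp: indicator_def)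
      then show ?thesis using integrable_mult_indicator[OF F(1) that] by simp
    qed
    show ?case
    proof (rule extension_limit_eq[OF a F, where s = "\<lambda>i x. indicator F x * s i x"])
      show "(\<lambda>i. indicator F x * s i x) \<longlonglongrightarrow> indicator F x * f x" if "x \<in> space M" for x
        using lim.hyps(2)[OF that] by (rule tendsto_mult_left)
      show "cmod (indicator F x * s i x) \<le> 2 * cmod (indicator F x * f x)" if "x \<in> space M" for i x
        using lim.hyps(3)[OF that] by (auto simp: indicator_def)
      show "L1_extension (\<lambda>x. indicator F x * s i x) = (\<integral>x. indicator F x * s i x * a x \<partial>M)" for i
        by (rule lim.IH)
      show "integrable M (\<lambda>x. indicator F x * s i x)" for i by (rule i[OF lim.hyps(1)])
      show "integrable M (\<lambda>x. indicator F x * f x)" by (rule i[OF lim.hyps(4)])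
    qed (auto simp: indicator_def split: if_splits)
  qed
  note all = this
  show thesis
  proof (rule that[OF a])
    fix f assume f: "f \<in> Cc T"
    obtain K where K: "compactin T K" "\<And>x. x \<in> topspace T \<Longrightarrow> f x \<noteq> 0 \<Longrightarrow> x \<in> K"
      using f by (rule CcE) blast
    define f' where "f' x = indicator K x * f x" for x
    have e: "f' x = f x" if "x \<in> topspace T" for x using K(2)[OF that] by (auto simp: f'_def indicator_def)
    have "f' \<in> Cc T"
      using continuous_map_eq[OF Cc_continuous[OF f], of f'] e
      by (intro CcI[OF _ K(1)]) (auto simp: f'_def)
    have "\<Lambda> f = \<Lambda> f'"
    proof -
      have z: "(\<lambda>x. f x - f' x) \<in> Cc T" by (rule Cc_diff[OF f \<open>f' \<in> Cc T\<close>])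
      have "(\<integral>x. cmod (f x - f' x) \<partial>M) = (\<integral>x. 0 \<partial>M)"
        by (intro Bochner_Integration.integral_cong) (auto simp: e space_M)
      then show ?thesis using functional_dist[OF f \<open>f' \<in> Cc T\<close>] by simp
    qed
    also have "\<Lambda> f' = (\<integral>x. f' x * a x \<partial>M)"
      using all[OF Cc_integrable[OF f] compact_sets[OF K(1)] compact_finite[OF K(1)]]
      by (simp add: extension_Cc[OF \<open>f' \<in> Cc T\<close>] flip: f'_def)
    also have "\<dots> = (\<integral>x. f x * a x \<partial>M)"
      by (intro Bochner_Integration.integral_cong) (auto simp: e space_M)
    finally show "\<Lambda> f = (\<integral>x. f x * a x \<partial>M)" .
  qed
qed

end

section \<open>Locally compact groups\<close>

locale lc_group =
  fixes G :: "('a, 'b) monoid_scheme" (structure) and T :: "'a topology"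
  assumes lc_group: "locally_compact_group G T"

sublocale lc_group \<subseteq> group G
  using lc_group by (simp add: locally_compact_group_def)

context lc_group
begin

lemma topspace_T: "topspace T = carrier G"
  and Hausdorff: "Hausdorff_space T" and locally_compact: "locally_compact_space T"
  using lc_group by (auto simp: locally_compact_group_def)

lemma continuous_map_group_mult:
  assumes "continuous_map X T f" "continuous_map X T g"
  shows "continuous_map X T (\<lambda>x. f x \<otimes> g x)"
proof -
  have "continuous_map X T ((\<lambda>(x, y). x \<otimes> y) \<circ> (\<lambda>x. (f x, g x)))"
    using lc_group assms
    by (intro continuous_map_compose[of _ "prod_topology T T"] continuous_map_pairedI)
      (auto simp: locally_compact_group_def)
  then show ?thesis by (simp add: o_def)
qed

lemma continuous_map_group_inv:
  assumes "continuous_map X T f" shows "continuous_map X T (\<lambda>x. inv (f x))"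
proof -
  have "continuous_map X T ((\<lambda>x. inv x) \<circ> f)"
    using lc_group assms by (intro continuous_map_compose) (auto simp: locally_compact_group_def)
  then show ?thesis by (simp add: o_def)
qed

lemma continuous_map_const_T: "c \<in> carrier G \<Longrightarrow> continuous_map X T (\<lambda>_. c)"
  by (simp add: topspace_T)

lemma continuous_map_id_T: "continuous_map T T (\<lambda>x. x)" by simp

lemmas group_continuous = continuous_map_group_mult continuous_map_group_inv
  continuous_map_const_T continuous_map_id_T continuous_map_fst continuous_map_snd

lemma l_coset_image: "g <# A = (\<lambda>x. g \<otimes> x) ` A" by (auto simp: l_coset_def)

lemma l_coset_preimage:
  assumes "g \<in> carrier G" "A \<subseteq> carrier G"
  shows "g <# A = {x \<in> carrier G. inv g \<otimes> x \<in> A}"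
proof (intro Set.set_eqI iffI)
  fix x assume "x \<in> {x \<in> carrier G. inv g \<otimes> x \<in> A}"
  then have "x = g \<otimes> (inv g \<otimes> x)" "inv g \<otimes> x \<in> A" using assms by (auto simp flip: m_assoc)
  then show "x \<in> g <# A" by (auto simp: l_coset_image)
qed (use assms in \<open>auto simp: l_coset_image subset_iff simp flip: m_assoc\<close>)

lemma openin_l_coset:
  assumes g: "g \<in> carrier G" and U: "openin T U" shows "openin T (g <# U)"
proof -
  have "continuous_map T T (\<lambda>x. inv g \<otimes> x)" using g by (intro group_continuous) auto
  from openin_continuous_map_preimage[OF this U] show ?thesis
    using g openin_subset[OF U] by (simp add: l_coset_preimage topspace_T)
qed

lemma compactin_carrier: "compactin T K \<Longrightarrow> K \<subseteq> carrier G"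
  using compactin_subset_topspace topspace_T by blast

lemma compactin_mult:
  assumes "compactin T K" "compactin T L" shows "compactin T {x \<otimes> y |x y. x \<in> K \<and> y \<in> L}"
proof -
  have "continuous_map (prod_topology T T) T (\<lambda>(x, y). x \<otimes> y)"
    using lc_group by (simp add: locally_compact_group_def)
  then have "compactin T ((\<lambda>(x, y). x \<otimes> y) ` (K \<times> L))"
    using assms by (intro image_compactin[of "prod_topology T T"]) (simp_all add: compactin_Times)
  moreover have "(\<lambda>(x, y). x \<otimes> y) ` (K \<times> L) = {x \<otimes> y |x y. x \<in> K \<and> y \<in> L}" by auto
  ultimately show ?thesis by simp
qed

lemma compactin_inv: "compactin T K \<Longrightarrow> compactin T ((\<lambda>x. inv x) ` K)"
  by (rule image_compactin[OF _ continuous_map_group_inv[OF continuous_map_id_T]])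

lemma compact_neighbourhood:
  assumes "x \<in> carrier G" obtains U C where "openin T U" "compactin T C" "x \<in> U" "U \<subseteq> C"
  using locally_compact assms unfolding locally_compact_space_def topspace_T by blast

lemma bump:
  assumes "compactin T K"
  obtains h :: "'a \<Rightarrow> real" where "continuous_map T euclidean h" "\<And>x. 0 \<le> h x" "\<And>x. h x \<le> 1"
    "\<And>x. x \<in> K \<Longrightarrow> h x = 1" "(\<lambda>x. complex_of_real (h x)) \<in> Cc T"
proof -
  obtain h :: "'a \<Rightarrow> real" and L where h: "continuous_map T euclidean h"
    "\<And>x. 0 \<le> h x" "\<And>x. h x \<le> 1" "\<And>x. x \<in> K \<Longrightarrow> h x = 1"
    "compactin T L" "L \<subseteq> topspace T" "\<And>x. x \<notin> L \<Longrightarrow> h x = 0"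
    using compactin_subset_topspace[OF assms]
    by (rule compact_bump[OF Hausdorff locally_compact assms openin_topspace]) (rule that; assumption)
  moreover have "(\<lambda>x. complex_of_real (h x)) \<in> Cc T"
    by (rule CcI[OF continuous_map_of_real[OF h(1)] h(5)]) (simp add: h(7))
  ultimately show thesis by (intro that)
qed

text \<open>Starting from a symmetric compact neighbourhood of the unit, repeated squaring exhausts an
  open subgroup.\<close>

lemma open_sigma_compact_subgroup:
  obtains H P where "subgroup H G" "openin T H" "\<And>n::nat. compactin T (P n)" "H = (\<Union>n. P n)"
proof -
  obtain U C where UC: "openin T U" "compactin T C" "\<one> \<in> U" "U \<subseteq> C"
    using compact_neighbourhood[OF one_closed] .
  define P where "P = rec_nat (C \<union> (\<lambda>x. inv x) ` C) (\<lambda>_ Q. {x \<otimes> y |x y. x \<in> Q \<and> y \<in> Q})"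
  have P0: "P 0 = C \<union> (\<lambda>x. inv x) ` C" and PS: "P (Suc n) = {x \<otimes> y |x y. x \<in> P n \<and> y \<in> P n}" for n
    by (simp_all add: P_def)
  have Pc: "compactin T (P n)" for n
    by (induction n) (auto simp: P0 PS intro: compactin_Un compactin_inv compactin_mult UC)
  have PG: "P n \<subseteq> carrier G" for n by (rule compactin_carrier[OF Pc])
  have one: "\<one> \<in> P n" for n
  proof (induction n)
    case (Suc n)
    then have "\<one> \<otimes> \<one> \<in> P (Suc n)" unfolding PS by blast
    then show ?case by simp
  qed (use UC in \<open>auto simp: P0\<close>)
  have "P n \<subseteq> P (Suc n)" for n
  proof
    fix x assume x: "x \<in> P n"
    then have "x \<otimes> \<one> \<in> P (Suc n)" unfolding PS using one by blast
    then show "x \<in> P (Suc n)" using PG[of n] x by auto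
  qed
  then have mono: "P m \<subseteq> P n" if "m \<le> n" for m n using that by (rule lift_Suc_mono_le)
  have sym: "inv x \<in> P n" if "x \<in> P n" for x n
    using that
  proof (induction n arbitrary: x)
    case 0
    then show ?case using compactin_carrier[OF UC(2)] by (auto simp: P0 subset_iff)
  next
    case (Suc n)
    then obtain a b where ab: "x = a \<otimes> b" "a \<in> P n" "b \<in> P n" by (auto simp: PS)
    then have "inv x = inv b \<otimes> inv a" using PG[of n] by (auto intro: inv_mult_group)
    then show ?case using Suc.IH ab by (auto simp: PS)
  qed
  define H where "H = (\<Union>n. P n)"
  have mul: "x \<otimes> y \<in> H" if xy: "x \<in> H" "y \<in> H" for x y
  proof -
    obtain m n where "x \<in> P m" "y \<in> P n" using xy by (auto simp: H_def)
    then have "x \<in> P (max m n)" "y \<in> P (max m n)" using mono[of m "max m n"] mono[of n "max m n"] by auto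
    then have "x \<otimes> y \<in> P (Suc (max m n))" unfolding PS by blast
    then show ?thesis by (auto simp: H_def)
  qed
  have HG: "subgroup H G"
  proof (rule subgroupI)
    show "H \<subseteq> carrier G" "H \<noteq> {}" using PG one unfolding H_def by blast+
    show "inv x \<in> H" if "x \<in> H" for x using sym that unfolding H_def by blast
  qed (rule mul)
  have UH: "U \<subseteq> H" using UC P0 unfolding H_def by blast
  have "openin T H"
  proof (subst openin_subopen, intro ballI)
    fix x assume x: "x \<in> H"
    then have xG: "x \<in> carrier G" using HG by (rule subgroup.mem_carrier[rotated])
    have "x \<otimes> \<one> \<in> x <# U" unfolding l_coset_image using UC(3) by blast
    then have "x \<in> x <# U" using xG by simp
    moreover have "x <# U \<subseteq> H" using UH mul x by (auto simp: l_coset_image)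
    ultimately show "\<exists>V. openin T V \<and> x \<in> V \<and> V \<subseteq> H" using openin_l_coset[OF xG UC(1)] by blast
  qed
  then show thesis using that[OF HG _ Pc H_def] by blast
qed

end

section \<open>Haar measures\<close>

lemma borel_of_top_generators: "{U. openin T U} \<subseteq> Pow (topspace T)"
  using openin_subset by blast

lemma sets_borel_of_top: "sets (borel_of_top T) = sigma_sets (topspace T) {U. openin T U}"
  and space_borel_of_top: "space (borel_of_top T) = topspace T"
  by (simp_all add: borel_of_top_def sets_measure_of[OF borel_of_top_generators]
    space_measure_of[OF borel_of_top_generators])

lemma (in borel_top) continuous_map_borel_measurable:
  assumes N: "sets N = sets (borel_of_top S)" and f: "continuous_map T S f"
  shows "f \<in> measurable M N"
proof -
  have "f \<in> measurable M (borel_of_top S)"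
    unfolding borel_of_top_def
  proof (rule measurable_measure_of[OF borel_of_top_generators])
    show "f \<in> space M \<rightarrow> topspace S" using f by (auto simp: space_M continuous_map_def)
    fix U assume "U \<in> {U. openin S U}"
    then have "openin T {x \<in> topspace T. f x \<in> U}" using f by (simp add: openin_continuous_map_preimage)
    moreover have "{x \<in> topspace T. f x \<in> U} = f -` U \<inter> space M" by (auto simp: space_M)
    ultimately show "f -` U \<inter> space M \<in> sets M" using open_sets by metis
  qed
  then show ?thesis using measurable_cong_sets[OF refl N] by blast
qed

locale haar = lc_group +
  fixes M :: "'a measure"
  assumes haar: "left_haar_measure G T M"
begin

lemma sets_M: "sets M = sets (borel_of_top T)"
  and left_inv: "g \<in> carrier G \<Longrightarrow> A \<in> sets M \<Longrightarrow> emeasure M (g <# A) = emeasure M A"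
  using haar by (auto simp: left_haar_measure_def)

sublocale radon T M
proof
  show "space M = topspace T" using sets_eq_imp_space_eq[OF sets_M] by (simp add: space_borel_of_top)
  show "U \<in> sets M" if "openin T U" for U using that by (auto simp: sets_M sets_borel_of_top)
qed (use haar Hausdorff locally_compact in \<open>auto simp: left_haar_measure_def\<close>)

lemma space_carrier: "space M = carrier G" by (simp add: space_M topspace_T)

lemma sets_carrier: "A \<in> sets M \<Longrightarrow> A \<subseteq> carrier G" using sets.sets_into_space space_carrier by blast

lemma translate_measurable: "g \<in> carrier G \<Longrightarrow> (\<lambda>x. g \<otimes> x) \<in> measurable M M"
  "g \<in> carrier G \<Longrightarrow> (\<lambda>x. x \<otimes> g) \<in> measurable M M"
  by (auto intro!: continuous_map_borel_measurable[OF sets_M] group_continuous)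

lemma sets_l_coset: "g \<in> carrier G \<Longrightarrow> A \<in> sets M \<Longrightarrow> g <# A \<in> sets M"
  using measurable_sets[OF translate_measurable(1)[of "inv g"], of A] sets_carrier[of A]
  by (simp add: l_coset_preimage vimage_def Int_def space_carrier conj_commute)

lemma distr_left: assumes g: "g \<in> carrier G" shows "distr M M (\<lambda>x. g \<otimes> x) = M"
proof (rule measure_eqI)
  fix A assume "A \<in> sets (distr M M (\<lambda>x. g \<otimes> x))"
  then have A: "A \<in> sets M" by simp
  have "(\<lambda>x. g \<otimes> x) -` A \<inter> space M = inv g <# A"
    using g sets_carrier[OF A] by (auto simp: l_coset_preimage space_carrier)
  then show "emeasure (distr M M (\<lambda>x. g \<otimes> x)) A = emeasure M A"
    using A g translate_measurable by (simp add: emeasure_distr left_inv)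
qed simp

lemma integral_left:
  fixes f :: "'a \<Rightarrow> 'c::{banach, second_countable_topology}"
  assumes "g \<in> carrier G" "f \<in> borel_measurable M"
  shows "(\<integral>x. f (g \<otimes> x) \<partial>M) = (\<integral>x. f x \<partial>M)"
  using integral_distr[OF translate_measurable(1)[OF assms(1)] assms(2)] by (simp add: distr_left assms(1))

text \<open>Finitely many translates of a null open set would cover any compact set, so that the whole
  group would be null by inner regularity.\<close>

lemma open_pos:
  assumes U: "openin T U" "U \<noteq> {}" shows "emeasure M U > 0"
proof (rule ccontr)
  assume "\<not> emeasure M U > 0"
  then have U0: "emeasure M U = 0" by (simp add: zero_less_iff_neq_zero)
  have UG: "U \<subseteq> carrier G" using openin_subset[OF U(1)] topspace_T by simp
  obtain u where u: "u \<in> U" using U(2) by blast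
  have "emeasure M K = 0" if K: "compactin T K" for K
  proof -
    have KG: "K \<subseteq> carrier G" by (rule compactin_carrier[OF K])
    let ?g = "\<lambda>x. x \<otimes> inv u"
    have g: "?g x \<in> carrier G" "x \<in> ?g x <# U" if "x \<in> K" for x
    proof -
      show "?g x \<in> carrier G" using that KG u UG by auto
      have "u \<in> carrier G" "x \<in> carrier G" using that KG u UG by auto
      then have "?g x \<otimes> u = x" by (simp add: m_assoc)
      moreover have "?g x \<otimes> u \<in> ?g x <# U" using u by (simp add: l_coset_image)
      ultimately show "x \<in> ?g x <# U" by simp
    qed
    have "\<And>W. W \<in> (\<lambda>x. ?g x <# U) ` K \<Longrightarrow> openin T W" "K \<subseteq> \<Union>((\<lambda>x. ?g x <# U) ` K)"
      using g openin_l_coset[OF _ U(1)] by auto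
    from compactinD[OF K this] obtain \<F> where "finite \<F>" "\<F> \<subseteq> (\<lambda>x. ?g x <# U) ` K" "K \<subseteq> \<Union>\<F>" by blast
    then obtain D where D: "finite D" "D \<subseteq> K" "K \<subseteq> (\<Union>x\<in>D. ?g x <# U)" by (metis finite_subset_image)
    have n: "?g x <# U \<in> null_sets M" if "x \<in> D" for x
      using g(1)[of x] D(2) that U0 open_sets[OF U(1)] by (auto simp: null_sets_def left_inv sets_l_coset)
    have "(\<Union>x\<in>D. ?g x <# U) \<in> null_sets M"
      using D(1) n by (intro null_sets_UN' countable_finite) auto
    then have "K \<in> null_sets M" by (rule null_sets_subset) (use D compact_sets[OF K] in auto)
    then show ?thesis by (simp add: null_sets_def)
  qed
  then have "(SUP K\<in>{K. compactin T K \<and> K \<subseteq> topspace T}. emeasure M K) = 0"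
    by (intro SUP_eq_const) (auto intro: exI[of _ "{}"])
  then have "emeasure M (topspace T) = 0" using inner[OF openin_topspace] by simp
  then show False using haar by (simp add: left_haar_measure_def space_M)
qed

lemma integral_pos:
  fixes h :: "'a \<Rightarrow> real"
  assumes h: "continuous_map T euclidean h" "integrable M h" "\<And>x. x \<in> carrier G \<Longrightarrow> 0 \<le> h x"
    and x: "x \<in> carrier G" "h x > 0"
  shows "(\<integral>x. h x \<partial>M) > 0"
proof (rule ccontr)
  assume "\<not> (\<integral>x. h x \<partial>M) > 0"
  moreover have nn: "AE x in M. 0 \<le> h x" using h(3) by (intro AE_I2) (simp add: space_carrier)
  ultimately have "(\<integral>x. h x \<partial>M) = 0" using integral_nonneg_AE[OF nn] by simp
  then have ae: "AE x in M. h x = 0" using integral_nonneg_eq_0_iff_AE[OF h(2) nn] by simp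
  have U: "openin T {x \<in> topspace T. h x \<in> {0<..}}"
    by (rule openin_continuous_map_preimage[OF h(1)]) simp
  then have "emeasure M {x \<in> topspace T. h x \<in> {0<..}} = 0"
  proof -
    have "AE x in M. \<not> 0 < h x" using ae by eventually_elim simp
    then show ?thesis using AE_iff_measurable[OF open_sets[OF U], of "\<lambda>x. \<not> 0 < h x"]
      by (simp add: space_M)
  qed
  moreover have "x \<in> {x \<in> topspace T. h x \<in> {0<..}}" using x by (simp add: topspace_T)
  ultimately show False using open_pos[OF U] by force
qed

text \<open>The function is tested against its own conjugate, cut off near \<open>x\<close>.\<close>

lemma continuous_zero_of_Cc:
  assumes k: "continuous_map T euclidean (k :: 'a \<Rightarrow> complex)"
    and z: "\<And>h. h \<in> Cc T \<Longrightarrow> (\<integral>x. h x * k x \<partial>M) = 0" and x: "x \<in> carrier G"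
  shows "k x = 0"
proof (rule ccontr)
  assume "k x \<noteq> 0"
  obtain h :: "'a \<Rightarrow> real" where h: "continuous_map T euclidean h" "\<And>x. 0 \<le> h x" "\<And>x. h x \<le> 1"
    "\<And>y. y \<in> {x} \<Longrightarrow> h y = 1" "(\<lambda>x. complex_of_real (h x)) \<in> Cc T"
    by (rule bump[of "{x}"]) (use x in \<open>auto simp: topspace_T\<close>)
  let ?g = "\<lambda>x. h x * (cmod (k x))\<^sup>2"
  have e: "complex_of_real (?g y) = complex_of_real (h y) * cnj (k y) * k y" for y
    using complex_norm_square[of "k y"] by (simp add: mult_ac)
  have C: "(\<lambda>x. complex_of_real (h x) * cnj (k x)) \<in> Cc T"
    by (rule Cc_mult[OF h(5) continuous_map_cnj[OF k]])
  have "(\<lambda>x. complex_of_real (?g x)) \<in> Cc T" unfolding e by (rule Cc_mult[OF C k])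
  then have i: "integrable M (\<lambda>x. complex_of_real (?g x))" by (rule Cc_integrable)
  then have "integrable M ?g" using complex_of_real_integrable_eq by blast
  moreover have "continuous_map T euclidean ?g"
    using h(1) continuous_map_norm[OF k] by (intro continuous_map_real_mult continuous_map_real_pow)
  ultimately have "(\<integral>x. ?g x \<partial>M) > 0" using h(2) h(4)[of x] x \<open>k x \<noteq> 0\<close> by (intro integral_pos) auto
  moreover have "complex_of_real (\<integral>x. ?g x \<partial>M) = 0"
    using z[OF C] by (simp only: integral_complex_of_real[symmetric] e)
  ultimately show False by simp
qed

lemma Cc_right: assumes "g \<in> carrier G" "f \<in> Cc T" shows "(\<lambda>x. f (x \<otimes> g)) \<in> Cc T"
proof -
  obtain K where K: "compactin T K" "\<And>x. x \<in> topspace T \<Longrightarrow> f x \<noteq> 0 \<Longrightarrow> x \<in> K"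
    using assms(2) by (rule CcE) blast
  have "continuous_map T T (\<lambda>x. x \<otimes> g)" using assms(1) by (intro group_continuous)
  from continuous_map_compose[OF this Cc_continuous[OF assms(2)]]
  have c: "continuous_map T euclidean (\<lambda>x. f (x \<otimes> g))" by (simp add: o_def)
  show ?thesis
  proof (rule CcI[OF c compactin_mult[OF K(1), of "{inv g}"]])
    show "compactin T {inv g}" using assms(1) by (simp add: topspace_T)
    fix x assume x: "x \<in> topspace T" "x \<notin> {y \<otimes> z |y z. y \<in> K \<and> z \<in> {inv g}}"
    then have xG: "x \<in> carrier G" by (simp add: topspace_T)
    then have "x = (x \<otimes> g) \<otimes> inv g" using assms(1) by (simp add: m_assoc)
    then have "x \<otimes> g \<notin> K" using x(2) by blast
    then show "f (x \<otimes> g) = 0" using K(2)[of "x \<otimes> g"] assms(1) xG by (auto simp: topspace_T)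
  qed
qed

end

lemma fubini_radon:
  fixes F :: "'x \<Rightarrow> 'y \<Rightarrow> complex"
  assumes A: "radon X A" and B: "radon Y B"
    and F: "continuous_map (prod_topology X Y) euclidean (\<lambda>(x, y). F x y)"
    and K: "compactin X K" and L: "compactin Y L"
    and z: "\<And>x y. x \<in> topspace X \<Longrightarrow> y \<in> topspace Y \<Longrightarrow> F x y \<noteq> 0 \<Longrightarrow> x \<in> K \<and> y \<in> L"
  shows "(\<integral>x. (\<integral>y. F x y \<partial>B) \<partial>A) = (\<integral>y. (\<integral>x. F x y \<partial>A) \<partial>B)"
proof -
  interpret A: radon X A by fact
  interpret B: radon Y B by fact
  have "(\<lambda>x. indicator K x *\<^sub>R (1::complex)) = indicator K" by (auto simp: indicator_def)
  then have "integrable A (\<lambda>x. indicator K x *\<^sub>R (1::complex))"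
    using integrable_indicator_complex[OF A.compact_sets[OF K] A.compact_finite[OF K]] by simp
  from fubini_compact_kernel[OF A.borel_top_axioms B.borel_top_axioms F K A.compact_sets[OF K]
      A.compact_finite[OF K] L B.compact_sets[OF L] B.compact_finite[OF L] z this]
  show ?thesis by simp
qed

lemma continuous_map_comp2:
  "continuous_map Y euclidean f \<Longrightarrow> continuous_map X Y g \<Longrightarrow> continuous_map X euclidean (\<lambda>x. f (g x))"
  using continuous_map_compose[of X Y g euclidean f] by (simp add: o_def)

subsection \<open>Uniqueness of Haar measure\<close>

text \<open>Integrate \<open>f(x) h(y\<inverse>x)\<close> in both orders. The inner integral over \<open>y\<close> does not depend
  on \<open>x\<close>, and after the substitution \<open>x \<mapsto> yx\<close> the other order gives a measure
  with a continuous density with respect to \<open>M1\<close>.\<close>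

lemma haar_convolution:
  assumes M1: "haar G T M1" and M2: "haar G T M2" and f: "f \<in> Cc T" and h: "h \<in> Cc T"
  shows "(\<integral>x. f x \<partial>M1) * (\<integral>y. h (inv\<^bsub>G\<^esub> y) \<partial>M2) = (\<integral>x. h x * (\<integral>y. f (y \<otimes>\<^bsub>G\<^esub> x) \<partial>M2) \<partial>M1)"
proof -
  interpret M1: haar G T M1 by fact
  interpret M2: haar G T M2 by fact
  note ax = M1.radon_axioms M2.radon_axioms
  obtain K where K: "compactin T K" "\<And>x. x \<in> topspace T \<Longrightarrow> f x \<noteq> 0 \<Longrightarrow> x \<in> K"
    using f by (rule CcE) blast
  obtain L where L: "compactin T L" "\<And>x. x \<in> topspace T \<Longrightarrow> h x \<noteq> 0 \<Longrightarrow> x \<in> L"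
    using h by (rule CcE) blast
  define Q where "Q = {x \<otimes>\<^bsub>G\<^esub> y |x y. x \<in> K \<and> y \<in> (\<lambda>x. inv\<^bsub>G\<^esub> x) ` L}"
  have Q: "compactin T Q" unfolding Q_def by (intro M1.compactin_mult M1.compactin_inv K L)
  note [simp] = M1.topspace_T
  have KG: "K \<subseteq> carrier G" "L \<subseteq> carrier G" using M1.compactin_carrier K(1) L(1) by auto
  have c1: "continuous_map (prod_topology T T) euclidean (\<lambda>(x, y). f x * h (inv\<^bsub>G\<^esub> y \<otimes>\<^bsub>G\<^esub> x))"
    unfolding case_prod_unfold
    by (intro continuous_map_mult continuous_map_comp2[OF Cc_continuous[OF f]]
        continuous_map_comp2[OF Cc_continuous[OF h]] M1.group_continuous)
  have c2: "continuous_map (prod_topology T T) euclidean (\<lambda>(y, x). h x * f (y \<otimes>\<^bsub>G\<^esub> x))"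
    unfolding case_prod_unfold
    by (intro continuous_map_mult continuous_map_comp2[OF Cc_continuous[OF f]]
        continuous_map_comp2[OF Cc_continuous[OF h]] M1.group_continuous)
  have inner: "(\<integral>y. h (inv\<^bsub>G\<^esub> y \<otimes>\<^bsub>G\<^esub> x) \<partial>M2) = (\<integral>y. h (inv\<^bsub>G\<^esub> y) \<partial>M2)" if x: "x \<in> carrier G" for x
  proof -
    have m: "(\<lambda>y. h (inv\<^bsub>G\<^esub> y)) \<in> borel_measurable M2"
      by (intro M2.continuous_measurable continuous_map_comp2[OF Cc_continuous[OF h]] M1.group_continuous)
    have "(\<integral>y. h (inv\<^bsub>G\<^esub> y \<otimes>\<^bsub>G\<^esub> x) \<partial>M2) = (\<integral>y. h (inv\<^bsub>G\<^esub> (inv\<^bsub>G\<^esub> x \<otimes>\<^bsub>G\<^esub> y)) \<partial>M2)"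
      using x by (intro Bochner_Integration.integral_cong) (auto simp: M2.space_carrier M1.inv_mult_group)
    also have "\<dots> = (\<integral>y. h (inv\<^bsub>G\<^esub> y) \<partial>M2)" using M2.integral_left[OF _ m, of "inv\<^bsub>G\<^esub> x"] x by simp
    finally show ?thesis .
  qed
  have "(\<integral>x. f x \<partial>M1) * (\<integral>y. h (inv\<^bsub>G\<^esub> y) \<partial>M2) = (\<integral>x. (\<integral>y. f x * h (inv\<^bsub>G\<^esub> y \<otimes>\<^bsub>G\<^esub> x) \<partial>M2) \<partial>M1)"
  proof -
    have "(\<integral>x. (\<integral>y. f x * h (inv\<^bsub>G\<^esub> y \<otimes>\<^bsub>G\<^esub> x) \<partial>M2) \<partial>M1) = (\<integral>x. f x * (\<integral>y. h (inv\<^bsub>G\<^esub> y) \<partial>M2) \<partial>M1)"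
      using inner by (intro Bochner_Integration.integral_cong) (auto simp: M1.space_carrier)
    then show ?thesis by simp
  qed
  also have "\<dots> = (\<integral>y. (\<integral>x. f x * h (inv\<^bsub>G\<^esub> y \<otimes>\<^bsub>G\<^esub> x) \<partial>M1) \<partial>M2)"
  proof (rule fubini_radon[OF ax c1 K(1) Q])
    fix x y assume xy: "x \<in> topspace T" "y \<in> topspace T" "f x * h (inv\<^bsub>G\<^esub> y \<otimes>\<^bsub>G\<^esub> x) \<noteq> 0"
    then have "x \<in> K" "inv\<^bsub>G\<^esub> y \<otimes>\<^bsub>G\<^esub> x \<in> L" using K(2) L(2) by auto
    moreover have "y = x \<otimes>\<^bsub>G\<^esub> inv\<^bsub>G\<^esub> (inv\<^bsub>G\<^esub> y \<otimes>\<^bsub>G\<^esub> x)"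
      using xy by (simp add: M1.inv_mult_group flip: M1.m_assoc)
    ultimately show "x \<in> K \<and> y \<in> Q" unfolding Q_def by blast
  qed
  also have "\<dots> = (\<integral>y. (\<integral>x. h x * f (y \<otimes>\<^bsub>G\<^esub> x) \<partial>M1) \<partial>M2)"
  proof (rule Bochner_Integration.integral_cong[OF refl])
    fix y assume "y \<in> space M2"
    then have y: "y \<in> carrier G" by (simp add: M2.space_carrier)
    have m: "(\<lambda>x. f x * h (inv\<^bsub>G\<^esub> y \<otimes>\<^bsub>G\<^esub> x)) \<in> borel_measurable M1"
      using y by (intro M1.continuous_measurable continuous_map_mult continuous_map_comp2[OF Cc_continuous[OF f]]
        continuous_map_comp2[OF Cc_continuous[OF h]] M1.group_continuous) auto
    have "(\<integral>x. f x * h (inv\<^bsub>G\<^esub> y \<otimes>\<^bsub>G\<^esub> x) \<partial>M1) = (\<integral>x. f (y \<otimes>\<^bsub>G\<^esub> x) * h (inv\<^bsub>G\<^esub> y \<otimes>\<^bsub>G\<^esub> (y \<otimes>\<^bsub>G\<^esub> x)) \<partial>M1)"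
      by (rule M1.integral_left[OF y m, symmetric])
    also have "\<dots> = (\<integral>x. h x * f (y \<otimes>\<^bsub>G\<^esub> x) \<partial>M1)"
      using y by (intro Bochner_Integration.integral_cong) (auto simp: M1.space_carrier simp flip: M1.m_assoc)
    finally show "(\<integral>x. f x * h (inv\<^bsub>G\<^esub> y \<otimes>\<^bsub>G\<^esub> x) \<partial>M1) = (\<integral>x. h x * f (y \<otimes>\<^bsub>G\<^esub> x) \<partial>M1)" .
  qed
  also have "\<dots> = (\<integral>x. (\<integral>y. h x * f (y \<otimes>\<^bsub>G\<^esub> x) \<partial>M2) \<partial>M1)"
  proof (rule fubini_radon[OF ax(2,1) c2 Q L(1)])
    fix y x assume xy: "y \<in> topspace T" "x \<in> topspace T" "h x * f (y \<otimes>\<^bsub>G\<^esub> x) \<noteq> 0"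
    then have "x \<in> L" "y \<otimes>\<^bsub>G\<^esub> x \<in> K" using K(2) L(2) by auto
    moreover have "y = (y \<otimes>\<^bsub>G\<^esub> x) \<otimes>\<^bsub>G\<^esub> inv\<^bsub>G\<^esub> x" using xy by (simp add: M1.m_assoc)
    ultimately show "y \<in> Q \<and> x \<in> L" unfolding Q_def by blast
  qed
  finally show ?thesis by simp
qed

text \<open>By the convolution identity, \<open>r f\<close> divided by the \<open>M1\<close>-integral of \<open>f\<close> has the same integrals
  against all \<open>h\<close> for every \<open>f\<close>. By continuity it is the same function for all \<open>f\<close>, and its value at the
  unit is the quotient of the two integrals of \<open>f\<close>.\<close>

lemma haar_unique_Cc:
  assumes M1: "haar G T M1" and M2: "haar G T M2"
  obtains c where "c > 0" "\<And>f. f \<in> Cc T \<Longrightarrow> (\<integral>x. f x \<partial>M2) = complex_of_real c * (\<integral>x. f x \<partial>M1)"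
proof -
  interpret M1: haar G T M1 by fact
  interpret M2: haar G T M2 by fact
  note [simp] = M1.topspace_T
  define r where "r f x = (\<integral>y. f (y \<otimes>\<^bsub>G\<^esub> x) \<partial>M2)" for f :: "'a \<Rightarrow> complex" and x
  have rc: "continuous_map T euclidean (r f)" if f: "f \<in> Cc T" for f
    unfolding r_def
  proof (rule M2.continuous_integral_param)
    show "continuous_map (prod_topology T T) euclidean (\<lambda>(x, y). f (y \<otimes>\<^bsub>G\<^esub> x))"
      unfolding case_prod_unfold
      by (intro continuous_map_comp2[OF Cc_continuous[OF f]] M1.group_continuous)
    fix x assume "x \<in> topspace T"
    then obtain U C where UC: "openin T U" "compactin T C" "x \<in> U" "U \<subseteq> C"
      using M1.compact_neighbourhood[of x] by auto
    obtain K where K: "compactin T K" "\<And>x. x \<in> topspace T \<Longrightarrow> f x \<noteq> 0 \<Longrightarrow> x \<in> K"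
      using f by (rule CcE) blast
    define Q where "Q = {x \<otimes>\<^bsub>G\<^esub> y |x y. x \<in> K \<and> y \<in> (\<lambda>x. inv\<^bsub>G\<^esub> x) ` C}"
    have Q: "compactin T Q" unfolding Q_def by (intro M1.compactin_mult M1.compactin_inv K UC)
    have "f (y \<otimes>\<^bsub>G\<^esub> z) = 0" if z: "z \<in> U" and y: "y \<in> topspace T - Q" for z y
    proof (rule ccontr)
      have zC: "z \<in> C" "z \<in> carrier G" using z UC M1.compactin_carrier[OF UC(2)] by auto
      assume "f (y \<otimes>\<^bsub>G\<^esub> z) \<noteq> 0"
      then have "y \<otimes>\<^bsub>G\<^esub> z \<in> K" using K(2) y zC by simp
      moreover have "y = (y \<otimes>\<^bsub>G\<^esub> z) \<otimes>\<^bsub>G\<^esub> inv\<^bsub>G\<^esub> z" using y zC by (simp add: M1.m_assoc)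
      ultimately have "y \<in> Q" unfolding Q_def using zC(1) by blast
      then show False using y by simp
    qed
    then show "\<exists>U L. openin T U \<and> x \<in> U \<and> compactin T L \<and> L \<in> sets M2 \<and> emeasure M2 L < \<infinity> \<and>
        (\<forall>x\<in>U. \<forall>y\<in>topspace T - L. f (y \<otimes>\<^bsub>G\<^esub> x) = 0)"
      using UC Q M2.compact_sets[OF Q] M2.compact_finite[OF Q] by blast
  qed
  obtain b :: "'a \<Rightarrow> real" where b: "continuous_map T euclidean b" "\<And>x. 0 \<le> b x" "\<And>x. b x \<le> 1"
    "\<And>y. y \<in> {\<one>\<^bsub>G\<^esub>} \<Longrightarrow> b y = 1" "(\<lambda>x. complex_of_real (b x)) \<in> Cc T"
    by (rule M1.bump[of "{\<one>\<^bsub>G\<^esub>}"]) auto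
  let ?b = "\<lambda>x. complex_of_real (b x)"
  define a1 a2 where "a1 = (\<integral>x. b x \<partial>M1)" and "a2 = (\<integral>x. b x \<partial>M2)"
  have i: "integrable M1 b" "integrable M2 b"
    using M1.Cc_integrable[OF b(5)] M2.Cc_integrable[OF b(5)] by (simp_all add: complex_of_real_integrable_eq)
  have a: "a1 > 0" "a2 > 0"
    unfolding a1_def a2_def using b
    by (auto intro!: M1.integral_pos[OF b(1) i(1), of "\<one>\<^bsub>G\<^esub>"] M2.integral_pos[OF b(1) i(2), of "\<one>\<^bsub>G\<^esub>"])
  have bi: "(\<integral>x. ?b x \<partial>M1) = complex_of_real a1" "(\<integral>x. ?b x \<partial>M2) = complex_of_real a2"
    by (simp_all add: a1_def a2_def integral_complex_of_real)
  show thesis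
  proof (rule that[of "a2 / a1"])
    fix f assume f: "f \<in> Cc T"
    define k where "k x = a1 * r f x - (\<integral>x. f x \<partial>M1) * r ?b x" for x
    have kc: "continuous_map T euclidean k"
      unfolding k_def using rc[OF f] rc[OF b(5)]
      by (auto simp: continuous_map_atin intro!: tendsto_intros)
    have "(\<integral>x. h x * k x \<partial>M1) = 0" if h: "h \<in> Cc T" for h
    proof -
      have i: "integrable M1 (\<lambda>x. h x * r f x)" "integrable M1 (\<lambda>x. h x * r ?b x)"
        by (intro M1.Cc_integrable Cc_mult h rc f b)+
      have "(\<integral>x. h x * k x \<partial>M1) = (\<integral>x. a1 * (h x * r f x) - (\<integral>x. f x \<partial>M1) * (h x * r ?b x) \<partial>M1)"
        by (intro Bochner_Integration.integral_cong) (auto simp: k_def algebra_simps)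
      also have "\<dots> = a1 * (\<integral>x. h x * r f x \<partial>M1) - (\<integral>x. f x \<partial>M1) * (\<integral>x. h x * r ?b x \<partial>M1)"
        using i by simp
      also have "\<dots> = 0"
      proof -
        have "(\<integral>x. h x * r f x \<partial>M1) = (\<integral>x. f x \<partial>M1) * (\<integral>y. h (inv\<^bsub>G\<^esub> y) \<partial>M2)"
          unfolding r_def by (rule haar_convolution[OF M1 M2 f h, symmetric])
        moreover have "(\<integral>x. h x * r ?b x \<partial>M1) = a1 * (\<integral>y. h (inv\<^bsub>G\<^esub> y) \<partial>M2)"
          unfolding r_def bi(1)[symmetric] by (rule haar_convolution[OF M1 M2 b(5) h, symmetric])
        ultimately show ?thesis by (simp only:) simp
      qed
      finally show ?thesis .
    qed
    then have "k \<one>\<^bsub>G\<^esub> = 0" by (intro M1.continuous_zero_of_Cc[OF kc]) auto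
    moreover have "r g \<one>\<^bsub>G\<^esub> = (\<integral>x. g x \<partial>M2)" for g
      unfolding r_def by (intro Bochner_Integration.integral_cong) (auto simp: M2.space_carrier)
    ultimately have "a1 * (\<integral>x. f x \<partial>M2) = (\<integral>x. f x \<partial>M1) * a2"
      by (simp add: k_def a2_def)
    then show "(\<integral>x. f x \<partial>M2) = complex_of_real (a2 / a1) * (\<integral>x. f x \<partial>M1)"
      using a by (simp add: field_simps)
  qed (use a in simp)
qed

text \<open>The inequality passes from bump functions to open sets by inner regularity, and from these to all
  measurable sets by outer regularity.\<close>

lemma radon_le:
  assumes M1: "radon T M1" and M2: "radon T M2" and s: "sets M1 = sets M2" and c: "c > 0"
    and le: "\<And>f. f \<in> Cc T \<Longrightarrow> (\<integral>x. f x \<partial>M2) = complex_of_real c * (\<integral>x. f x \<partial>M1)"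
    and A: "A \<in> sets M1"
  shows "emeasure M2 A \<le> ennreal c * emeasure M1 A"
proof -
  interpret M1: radon T M1 by fact
  interpret M2: radon T M2 by fact
  have op: "emeasure M2 U \<le> ennreal c * emeasure M1 U" if U: "openin T U" for U
  proof (subst M2.inner[OF U], rule SUP_least)
    fix K assume "K \<in> {K. compactin T K \<and> K \<subseteq> U}"
    then have K: "compactin T K" "K \<subseteq> U" by auto
    obtain h :: "'a \<Rightarrow> real" and L where h: "continuous_map T euclidean h"
      "\<And>x. 0 \<le> h x" "\<And>x. h x \<le> 1" "\<And>x. x \<in> K \<Longrightarrow> h x = 1"
      "compactin T L" "L \<subseteq> U" "\<And>x. x \<notin> L \<Longrightarrow> h x = 0"
      by (rule compact_bump[OF M1.hausdorff M1.loc_compact K(1) U K(2)]) (rule that; assumption)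
    have C: "(\<lambda>x. complex_of_real (h x)) \<in> Cc T"
      by (rule CcI[OF continuous_map_of_real[OF h(1)] h(5)]) (simp add: h(7))
    have hU: "h x = 0" if "x \<notin> U" for x using h(6,7) that by blast
    have i: "integrable M1 h" "integrable M2 h"
      using M1.Cc_integrable[OF C] M2.Cc_integrable[OF C] by (simp_all add: complex_of_real_integrable_eq)
    have "complex_of_real (\<integral>x. h x \<partial>M2) = complex_of_real (c * (\<integral>x. h x \<partial>M1))"
      using le[OF C] by (simp add: integral_complex_of_real)
    then have e: "(\<integral>x. h x \<partial>M2) = c * (\<integral>x. h x \<partial>M1)" using of_real_eq_iff by blast
    have "emeasure M2 K = (\<integral>\<^sup>+x. indicator K x \<partial>M2)" using M2.compact_sets[OF K(1)] by simp
    also have "\<dots> \<le> (\<integral>\<^sup>+x. ennreal (h x) \<partial>M2)"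
      using h(2,4) by (intro nn_integral_mono) (auto simp: indicator_def)
    also have "\<dots> = ennreal c * (\<integral>\<^sup>+x. ennreal (h x) \<partial>M1)"
      using i h(2) c e by (simp add: nn_integral_eq_integral ennreal_mult integral_nonneg)
    also have "\<dots> \<le> ennreal c * (\<integral>\<^sup>+x. indicator U x \<partial>M1)"
      using h(3) hU by (intro mult_left_mono nn_integral_mono) (auto simp: indicator_def)
    also have "\<dots> = ennreal c * emeasure M1 U" using M1.open_sets[OF U] by simp
    finally show "emeasure M2 K \<le> ennreal c * emeasure M1 U" .
  qed
  have cc: "ennreal (1/c) * (ennreal c * x) = x" "ennreal c * (ennreal (1/c) * x) = x" for x
    using c by (simp_all add: mult.assoc[symmetric] ennreal_mult[symmetric])
  have "ennreal (1/c) * emeasure M2 A \<le> emeasure M1 A"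
  proof (subst M1.outer[OF A], rule INF_greatest)
    fix U assume "U \<in> {U. openin T U \<and> A \<subseteq> U}"
    then have U: "openin T U" "A \<subseteq> U" by auto
    have "emeasure M2 A \<le> ennreal c * emeasure M1 U"
      using emeasure_mono[OF U(2) M2.open_sets[OF U(1)]] op[OF U(1)] by (rule order_trans)
    then have "ennreal (1/c) * emeasure M2 A \<le> ennreal (1/c) * (ennreal c * emeasure M1 U)"
      by (rule mult_left_mono) simp
    then show "ennreal (1/c) * emeasure M2 A \<le> emeasure M1 U" by (simp add: cc)
  qed
  then have "ennreal c * (ennreal (1/c) * emeasure M2 A) \<le> ennreal c * emeasure M1 A"
    by (rule mult_left_mono) simp
  then show ?thesis by (simp add: cc)
qed

theorem haar_unique:
  assumes M1: "haar G T M1" and M2: "haar G T M2"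
  obtains c where "c > 0" "M2 = density M1 (\<lambda>_. ennreal c)"
proof -
  interpret M1: haar G T M1 by fact
  interpret M2: haar G T M2 by fact
  obtain c where c: "c > 0" "\<And>f. f \<in> Cc T \<Longrightarrow> (\<integral>x. f x \<partial>M2) = complex_of_real c * (\<integral>x. f x \<partial>M1)"
    by (rule haar_unique_Cc[OF M1 M2]) (rule that; assumption)
  have s: "sets M1 = sets M2" by (simp add: M1.sets_M M2.sets_M)
  have "M2 = density M1 (\<lambda>_. ennreal c)"
  proof (rule measure_eqI)
    fix A assume "A \<in> sets M2"
    then have A: "A \<in> sets M1" by (simp add: s)
    have "emeasure M1 A \<le> ennreal (1/c) * emeasure M2 A"
    proof (rule radon_le[OF M2.radon_axioms M1.radon_axioms s[symmetric]])
      show "(\<integral>x. f x \<partial>M1) = complex_of_real (1/c) * (\<integral>x. f x \<partial>M2)" if "f \<in> Cc T" for f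
        using c that by simp
    qed (use c A s in auto)
    then have "ennreal c * emeasure M1 A \<le> ennreal c * (ennreal (1/c) * emeasure M2 A)"
      by (rule mult_left_mono) simp
    also have "\<dots> = emeasure M2 A" using c by (simp add: mult.assoc[symmetric] ennreal_mult[symmetric])
    finally have "emeasure M2 A = ennreal c * emeasure M1 A"
      using radon_le[OF M1.radon_axioms M2.radon_axioms s c A] by (rule order_antisym[rotated])
    then show "emeasure M2 A = emeasure (density M1 (\<lambda>_. ennreal c)) A"
      using A by (simp add: emeasure_density_const)
  qed (simp add: s)
  then show thesis using c(1) that by blast
qed

subsection \<open>Right translations\<close>

context haar
begin

lemma right_preimage:
  assumes "s \<in> carrier G" "A \<subseteq> carrier G"
  shows "{x \<in> carrier G. x \<otimes> inv s \<in> A} = (\<lambda>x. x \<otimes> s) ` A"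
proof (intro Set.set_eqI iffI)
  fix x assume "x \<in> {x \<in> carrier G. x \<otimes> inv s \<in> A}"
  then have "x = (x \<otimes> inv s) \<otimes> s" "x \<otimes> inv s \<in> A" using assms by (auto simp: m_assoc)
  then show "x \<in> (\<lambda>x. x \<otimes> s) ` A" by blast
qed (use assms in \<open>auto simp: subset_iff m_assoc\<close>)

lemma haar_right:
  assumes s: "s \<in> carrier G" shows "haar G T (distr M M (\<lambda>x. x \<otimes> inv s))"
proof
  let ?R = "\<lambda>A. (\<lambda>x. x \<otimes> s) ` A"
  have e: "emeasure (distr M M (\<lambda>x. x \<otimes> inv s)) A = emeasure M (?R A)" if "A \<in> sets M" for A
  proof -
    have "(\<lambda>x. x \<otimes> inv s) -` A \<inter> space M = ?R A"
      using right_preimage[OF s sets_carrier[OF that]] by (auto simp: space_carrier)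
    then show ?thesis using that s translate_measurable by (simp add: emeasure_distr)
  qed
  have R: "?R A \<in> sets M" if "A \<in> sets M" for A
    using measurable_sets[OF translate_measurable(2)[of "inv s"] that] s
      right_preimage[OF s sets_carrier[OF that]] by (simp add: vimage_def Int_def space_carrier conj_commute)
  have hom: "homeomorphic_map T T (\<lambda>x. x \<otimes> s)"
  proof (rule homeomorphic_maps_imp_map[of _ _ _ "\<lambda>x. x \<otimes> inv s"])
    show "homeomorphic_maps T T (\<lambda>x. x \<otimes> s) (\<lambda>x. x \<otimes> inv s)"
      using s by (auto simp: homeomorphic_maps_def topspace_T m_assoc intro!: group_continuous)
  qed
  have op: "openin T (?R U) \<longleftrightarrow> openin T U" "compactin T (?R U) \<longleftrightarrow> compactin T U" if "U \<subseteq> carrier G" for U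
    using that hom by (simp_all add: homeomorphic_map_openness homeomorphic_map_compactness topspace_T)
  have RR: "?R ((\<lambda>x. x \<otimes> inv s) ` A) = A" "(\<lambda>x. x \<otimes> inv s) ` ?R A = A" if "A \<subseteq> carrier G" for A
    using that s by (force simp: image_image m_assoc subset_iff)+
  have RI: "?R A \<subseteq> U \<longleftrightarrow> A \<subseteq> (\<lambda>x. x \<otimes> inv s) ` U" "U \<subseteq> ?R A \<longleftrightarrow> (\<lambda>x. x \<otimes> inv s) ` U \<subseteq> A"
    if "A \<subseteq> carrier G" "U \<subseteq> carrier G" for A U
    using RR that by (metis image_mono)+
  have inG: "(\<lambda>x. x \<otimes> inv s) ` A \<subseteq> carrier G" if "A \<subseteq> carrier G" for A using that s by auto
  have opG: "U \<subseteq> carrier G" if "openin T U" for U using openin_subset[OF that] topspace_T by simp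
  have im: "?R ` {U. openin T U \<and> A \<subseteq> U} = {U. openin T U \<and> ?R A \<subseteq> U}" if A: "A \<subseteq> carrier G" for A
  proof (intro Set.set_eqI iffI)
    fix U assume "U \<in> {U. openin T U \<and> ?R A \<subseteq> U}"
    then have U: "openin T U" "?R A \<subseteq> U" by auto
    let ?V = "(\<lambda>x. x \<otimes> inv s) ` U"
    have "U = ?R ?V" "openin T ?V" "A \<subseteq> ?V"
      using RR(1)[OF opG[OF U(1)]] op(1)[OF inG[OF opG[OF U(1)]]] U RI(1)[OF A opG[OF U(1)]] by auto
    then show "U \<in> ?R ` {U. openin T U \<and> A \<subseteq> U}" by blast
  qed (use op opG in auto)
  have im2: "?R ` {K. compactin T K \<and> K \<subseteq> A} = {K. compactin T K \<and> K \<subseteq> ?R A}" if A: "A \<subseteq> carrier G" for A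
  proof (intro Set.set_eqI iffI)
    fix K assume "K \<in> {K. compactin T K \<and> K \<subseteq> ?R A}"
    then have K: "compactin T K" "K \<subseteq> ?R A" by auto
    let ?V = "(\<lambda>x. x \<otimes> inv s) ` K"
    have "K = ?R ?V" "compactin T ?V" "?V \<subseteq> A"
      using RR(1)[OF compactin_carrier[OF K(1)]] op(2)[OF inG[OF compactin_carrier[OF K(1)]]]
        K RI(2)[OF A compactin_carrier[OF K(1)]] by auto
    then show "K \<in> ?R ` {K. compactin T K \<and> K \<subseteq> A}" by blast
  qed (use op compactin_carrier in auto)
  show "left_haar_measure G T (distr M M (\<lambda>x. x \<otimes> inv s))"
    unfolding left_haar_measure_def
  proof (intro conjI ballI allI impI)
    show "sets (distr M M (\<lambda>x. x \<otimes> inv s)) = sets (borel_of_top T)" by (simp add: sets_M)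
    have "?R (carrier G) = carrier G" using right_preimage[OF s, of "carrier G"] s by auto
    moreover have "carrier G \<in> sets M" using sets.top[of M] by (simp add: space_carrier)
    ultimately have "emeasure (distr M M (\<lambda>x. x \<otimes> inv s)) (carrier G) = emeasure M (space M)"
      using e[of "carrier G"] by (simp only: space_carrier)
    moreover have "emeasure M (space M) \<noteq> 0" using haar by (simp add: left_haar_measure_def)
    ultimately show "emeasure (distr M M (\<lambda>x. x \<otimes> inv s)) (space (distr M M (\<lambda>x. x \<otimes> inv s))) \<noteq> 0"
      by (simp only: space_distr space_carrier not_False_eq_True)
    fix K assume K: "compactin T K"
    then show "emeasure (distr M M (\<lambda>x. x \<otimes> inv s)) K < \<infinity>"
      using e[OF compact_sets[OF K]] op(2)[OF compactin_carrier[OF K]] compact_finite[of "?R K"] by simp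
  next
    fix A assume "A \<in> sets (distr M M (\<lambda>x. x \<otimes> inv s))"
    then have A: "A \<in> sets M" by simp
    have "emeasure M (?R A) = (INF U\<in>{U. openin T U \<and> ?R A \<subseteq> U}. emeasure M U)" by (rule outer[OF R[OF A]])
    also have "\<dots> = (INF U\<in>{U. openin T U \<and> A \<subseteq> U}. emeasure M (?R U))"
      by (simp add: im[OF sets_carrier[OF A], symmetric] image_image)
    also have "\<dots> = (INF U\<in>{U. openin T U \<and> A \<subseteq> U}. emeasure (distr M M (\<lambda>x. x \<otimes> inv s)) U)"
      by (intro INF_cong refl) (simp add: e open_sets)
    finally show "emeasure (distr M M (\<lambda>x. x \<otimes> inv s)) A =
        (INF U\<in>{U. openin T U \<and> A \<subseteq> U}. emeasure (distr M M (\<lambda>x. x \<otimes> inv s)) U)"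
      by (simp add: e A)
  next
    fix U assume U: "openin T U"
    have "emeasure M (?R U) = (SUP K\<in>{K. compactin T K \<and> K \<subseteq> ?R U}. emeasure M K)"
      using U op(1)[OF opG[OF U]] by (intro inner) simp
    also have "\<dots> = (SUP K\<in>{K. compactin T K \<and> K \<subseteq> U}. emeasure M (?R K))"
      by (simp add: im2[OF opG[OF U], symmetric] image_image)
    also have "\<dots> = (SUP K\<in>{K. compactin T K \<and> K \<subseteq> U}. emeasure (distr M M (\<lambda>x. x \<otimes> inv s)) K)"
      by (intro SUP_cong refl) (simp add: e compact_sets)
    finally show "emeasure (distr M M (\<lambda>x. x \<otimes> inv s)) U =
        (SUP K\<in>{K. compactin T K \<and> K \<subseteq> U}. emeasure (distr M M (\<lambda>x. x \<otimes> inv s)) K)"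
      by (simp add: e open_sets U)
  next
    fix g A assume g: "g \<in> carrier G" and "A \<in> sets (distr M M (\<lambda>x. x \<otimes> inv s))"
    then have A: "A \<in> sets M" by simp
    have "?R (g <# A) = g <# ?R A"
      using g s sets_carrier[OF A] by (force simp: l_coset_image image_image m_assoc subset_iff)
    then show "emeasure (distr M M (\<lambda>x. x \<otimes> inv s)) (g <# A) = emeasure (distr M M (\<lambda>x. x \<otimes> inv s)) A"
      using e[OF sets_l_coset[OF g A]] e[OF A] left_inv[OF g R[OF A]] by simp
  qed
qed

definition modular :: "'a \<Rightarrow> real" where
  "modular s = (SOME c. c > 0 \<and> distr M M (\<lambda>x. x \<otimes> inv s) = density M (\<lambda>_. ennreal c))"

lemma modular:
  assumes "s \<in> carrier G"
  shows "modular s > 0" "distr M M (\<lambda>x. x \<otimes> inv s) = density M (\<lambda>_. ennreal (modular s))"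
proof -
  have "\<exists>c. c > 0 \<and> distr M M (\<lambda>x. x \<otimes> inv s) = density M (\<lambda>_. ennreal c)"
    using haar_unique[OF haar_axioms haar_right[OF assms]] by metis
  from someI_ex[OF this]
  show "modular s > 0" "distr M M (\<lambda>x. x \<otimes> inv s) = density M (\<lambda>_. ennreal (modular s))"
    by (auto simp: modular_def)
qed

lemma distr_completion_right:
  assumes s: "s \<in> carrier G"
  shows "(\<lambda>x. x \<otimes> inv s) \<in> measurable (completion M) (completion M)"
    and "distr (completion M) (completion M) (\<lambda>x. x \<otimes> inv s) = density (completion M) (\<lambda>_. ennreal (modular s))"
proof -
  let ?R = "\<lambda>x. x \<otimes> inv s"
  have R: "?R \<in> measurable (completion M) M"
    using s translate_measurable(2)[of "inv s"] by (simp add: measurable_completion)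
  have d: "distr (completion M) M ?R = density M (\<lambda>_. ennreal (modular s))"
    using s translate_measurable(2)[of "inv s"] by (simp add: distr_completion modular(2))
  have n: "null_sets (distr (completion M) M ?R) = null_sets M"
    unfolding d using modular(1)[OF s] by (auto simp: null_sets_def emeasure_density_const ennreal_zero_less_mult_iff)
  show "?R \<in> measurable (completion M) (completion M)"
    using n by (intro completion.measurable_completion2[OF R]) simp
  have "distr (completion M) (completion M) ?R = completion (distr (completion M) M ?R)"
    by (rule completion.completion_distr_eq[OF R n, symmetric])
  also have "\<dots> = density (completion M) (\<lambda>_. ennreal (modular s))"
    unfolding d using modular(1)[OF s] by (intro completion_density_eq) auto
  finally show "distr (completion M) (completion M) ?R = density (completion M) (\<lambda>_. ennreal (modular s))" .
qed

lemma integral_right: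
  fixes f :: "'a \<Rightarrow> complex"
  assumes s: "s \<in> carrier G" and f: "f \<in> borel_measurable (completion M)"
  shows "(\<integral>x. f (x \<otimes> inv s) \<partial>completion M) = modular s * (\<integral>x. f x \<partial>completion M)"
proof -
  have "(\<integral>x. f (x \<otimes> inv s) \<partial>completion M) = (\<integral>x. f x \<partial>density (completion M) (\<lambda>_. ennreal (modular s)))"
    using integral_distr[OF distr_completion_right(1)[OF s] f] by (simp add: distr_completion_right(2)[OF s])
  also have "\<dots> = (\<integral>x. modular s *\<^sub>R f x \<partial>completion M)"
    using modular(1)[OF s] f by (intro integral_density) auto
  finally show ?thesis by (simp add: scaleR_conv_of_real)
qed

lemma integral_right_Cc:
  fixes f :: "'a \<Rightarrow> complex"
  assumes s: "s \<in> carrier G" and f: "f \<in> Cc T"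
  shows "(\<integral>x. f (x \<otimes> inv s) \<partial>M) = modular s * (\<integral>x. f x \<partial>M)"
proof -
  have m: "f \<in> borel_measurable M" "(\<lambda>x. f (x \<otimes> inv s)) \<in> borel_measurable M"
    using f Cc_right[OF _ f, of "inv s"] s by (auto intro!: continuous_measurable Cc_continuous)
  show ?thesis using integral_right[OF s measurable_completion[OF m(1)]] m by (simp add: integral_completion)
qed

lemma modular_continuous: "continuous_map T euclidean modular"
  and modular_mult: "s \<in> carrier G \<Longrightarrow> t \<in> carrier G \<Longrightarrow> modular (s \<otimes> t) = modular s * modular t"
proof -
  obtain b :: "'a \<Rightarrow> real" where b: "continuous_map T euclidean b" "\<And>x. 0 \<le> b x" "\<And>x. b x \<le> 1"
    "\<And>y. y \<in> {\<one>} \<Longrightarrow> b y = 1" "(\<lambda>x. complex_of_real (b x)) \<in> Cc T"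
    by (rule bump[of "{\<one>}"]) (auto simp: topspace_T)
  let ?b = "\<lambda>x. complex_of_real (b x)"
  have bi: "integrable M b" using Cc_integrable[OF b(5)] by (simp add: complex_of_real_integrable_eq)
  have pos: "(\<integral>x. b x \<partial>M) > 0" using b by (intro integral_pos[OF b(1) bi, of \<one>]) auto
  then have nz: "(\<integral>x. ?b x \<partial>M) \<noteq> 0" by (simp add: integral_complex_of_real)
  have mod: "complex_of_real (modular s) = (\<integral>x. ?b (x \<otimes> inv s) \<partial>M) / (\<integral>x. ?b x \<partial>M)" if "s \<in> carrier G" for s
    using integral_right_Cc[OF that b(5)] nz by simp
  have "continuous_map T euclidean (\<lambda>s. \<integral>x. ?b (x \<otimes> inv s) \<partial>M)"
  proof (rule continuous_integral_param)
    show "continuous_map (prod_topology T T) euclidean (\<lambda>(s, x). ?b (x \<otimes> inv s))"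
      unfolding case_prod_unfold
      by (intro continuous_map_comp2[OF Cc_continuous[OF b(5)]] group_continuous)
    fix x assume "x \<in> topspace T"
    then obtain U C where UC: "openin T U" "compactin T C" "x \<in> U" "U \<subseteq> C"
      using compact_neighbourhood[of x] by (auto simp: topspace_T)
    obtain K where K: "compactin T K" "\<And>x. x \<in> topspace T \<Longrightarrow> ?b x \<noteq> 0 \<Longrightarrow> x \<in> K"
      using b(5) by (rule CcE) blast
    define Q where "Q = {x \<otimes> y |x y. x \<in> K \<and> y \<in> C}"
    have Q: "compactin T Q" unfolding Q_def by (intro compactin_mult K UC)
    have "?b (y \<otimes> inv z) = 0" if z: "z \<in> U" and y: "y \<in> topspace T - Q" for z y
    proof (rule ccontr)
      have zC: "z \<in> C" "z \<in> carrier G" "y \<in> carrier G"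
        using z y UC compactin_carrier[OF UC(2)] by (auto simp: topspace_T)
      assume "?b (y \<otimes> inv z) \<noteq> 0"
      then have "y \<otimes> inv z \<in> K" using K(2)[of "y \<otimes> inv z"] zC by (simp add: topspace_T)
      moreover have "y = (y \<otimes> inv z) \<otimes> z" using zC by (simp add: m_assoc)
      ultimately have "y \<in> Q" unfolding Q_def using zC(1) by blast
      then show False using y by simp
    qed
    then show "\<exists>U L. openin T U \<and> x \<in> U \<and> compactin T L \<and> L \<in> sets M \<and> emeasure M L < \<infinity> \<and>
        (\<forall>x\<in>U. \<forall>y\<in>topspace T - L. ?b (y \<otimes> inv x) = 0)"
      using UC Q compact_sets[OF Q] compact_finite[OF Q] by blast
  qed
  then have "continuous_map T euclidean (\<lambda>s. (\<integral>x. ?b (x \<otimes> inv s) \<partial>M) / (\<integral>x. ?b x \<partial>M))"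
    using nz by (intro continuous_map_cdivide) auto
  then have "continuous_map T euclidean (\<lambda>s. complex_of_real (modular s))"
    by (rule continuous_map_eq) (simp add: mod topspace_T)
  then show "continuous_map T euclidean modular"
    by (simp add: continuous_map_atin tendsto_of_real_iff)
  assume s: "s \<in> carrier G" and t: "t \<in> carrier G"
  have "complex_of_real (modular (s \<otimes> t)) * (\<integral>x. ?b x \<partial>M) = (\<integral>x. ?b (x \<otimes> inv (s \<otimes> t)) \<partial>M)"
    using integral_right_Cc[OF m_closed[OF s t] b(5)] by simp
  also have "\<dots> = (\<integral>x. ?b (x \<otimes> inv t \<otimes> inv s) \<partial>M)"
    using s t by (intro Bochner_Integration.integral_cong) (auto simp: space_carrier inv_mult_group m_assoc)
  also have "\<dots> = modular t * (modular s * (\<integral>x. ?b x \<partial>M))"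
    using integral_right_Cc[OF t, of "\<lambda>x. ?b (x \<otimes> inv s)"] Cc_right[OF _ b(5), of "inv s"] s
      integral_right_Cc[OF s b(5)] by simp
  finally have "complex_of_real (modular (s \<otimes> t)) = complex_of_real (modular s * modular t)"
    using nz by simp
  then show "modular (s \<otimes> t) = modular s * modular t" using of_real_eq_iff by blast
qed

end

section \<open>Bounded functions modulo locally null sets\<close>

context haar
begin

text \<open>A set of finite measure lies in an open one, and that meets only countably many cosets of an
  open subgroup because each intersection has positive measure.\<close>

lemma localizing_cosets:
  fixes P :: "nat \<Rightarrow> 'a set"
  assumes H: "subgroup H G" "openin T H" and P: "\<And>n. compactin T (P n)" "H = (\<Union>n. P n)"
  obtains \<P> where "localizing M \<P>" "\<And>A. A \<in> \<P> \<Longrightarrow> \<exists>x\<in>carrier G. A \<subseteq> x <# H"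
proof -
  define E where "E = disjointed P"
  have Es: "E n \<in> sets M" for n
    using sets.range_disjointed_sets[of P M] compact_sets[OF P(1)] by (auto simp: E_def)
  have Efin: "emeasure M (E n) < \<infinity>" for n
  proof -
    have "emeasure M (E n) \<le> emeasure M (P n)"
      unfolding E_def by (rule emeasure_mono[OF disjointed_subset compact_sets[OF P(1)]])
    then show ?thesis using compact_finite[OF P(1)] by (rule le_less_trans)
  qed
  have EH: "(\<Union>n. E n) = H" unfolding E_def UN_disjointed_eq P(2) ..
  have Edis: "E m \<inter> E n = {}" if "m \<noteq> n" for m n
    using disjoint_family_disjointed[of P] that by (auto simp: E_def disjoint_family_on_def)
  define \<C> where "\<C> = (\<lambda>x. x <# H) ` carrier G"
  define rep where "rep c = (SOME x. x \<in> c)" for c :: "'a set"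
  have HG: "H \<subseteq> carrier G" by (rule subgroup.subset[OF H(1)])
  have cs: "c = x <# H" "x \<in> carrier G" if c: "c \<in> \<C>" "x \<in> c" for c x
  proof -
    obtain y where y: "y \<in> carrier G" "c = y <# H" using c(1) by (auto simp: \<C>_def)
    then show "c = x <# H" "x \<in> carrier G"
      using l_repr_independence[of x y H] l_coset_carrier[of x y H] c(2) H(1) by auto
  qed
  have self: "x \<in> x <# H" if "x \<in> carrier G" for x
  proof -
    have "x \<otimes> \<one> \<in> x <# H" unfolding l_coset_image using subgroup.one_closed[OF H(1)] by blast
    then show ?thesis using that by simp
  qed
  have rep: "rep c \<in> c" "rep c \<in> carrier G" "c = rep c <# H" if "c \<in> \<C>" for c
  proof -
    have "\<exists>x. x \<in> c" using that self by (auto simp: \<C>_def)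
    then show r: "rep c \<in> c" unfolding rep_def by (rule someI_ex)
    show "rep c \<in> carrier G" "c = rep c <# H" using cs[OF that r] by auto
  qed
  define \<P> where "\<P> = (\<lambda>(c, n). rep c <# E n) ` (\<C> \<times> UNIV)"
  have EsubH: "E n \<subseteq> H" for n using EH by blast
  have sub: "rep c <# E n \<subseteq> c" if "c \<in> \<C>" for c n
    using rep(3)[OF that] EsubH[of n] unfolding l_coset_image by blast
  have "localizing M \<P>"
    unfolding localizing_def
  proof (intro conjI ballI impI)
    show "\<P> \<subseteq> sets M" using rep(2) by (auto simp: \<P>_def intro!: sets_l_coset Es)
    show "emeasure M A < \<infinity>" if "A \<in> \<P>" for A
      using that rep(2) Efin by (auto simp: \<P>_def left_inv Es)
    show "disjoint \<P>"
    proof (rule disjointI)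
      fix A B assume AB: "A \<in> \<P>" "B \<in> \<P>" "A \<noteq> B"
      then obtain c m d n where cd: "c \<in> \<C>" "d \<in> \<C>" "A = rep c <# E m" "B = rep d <# E n"
        by (auto simp: \<P>_def)
      show "A \<inter> B = {}"
      proof (rule ccontr)
        assume "A \<inter> B \<noteq> {}"
        then obtain z where z: "z \<in> A" "z \<in> B" by blast
        then have "z \<in> c" "z \<in> d" using sub cd by blast+
        then have eq: "c = d" using cs(1)[OF cd(1)] cs(1)[OF cd(2)] by blast
        obtain e where e: "z = rep c \<otimes> e" "e \<in> E m" using z(1) cd(3) by (auto simp: l_coset_image)
        obtain f where f: "z = rep c \<otimes> f" "f \<in> E n" using z(2) cd(4) eq by (auto simp: l_coset_image)
        note ef = e f
        have "e \<in> carrier G" "f \<in> carrier G" using ef EsubH HG by blast+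
        then have "inv (rep c) \<otimes> z = e" "inv (rep c) \<otimes> z = f"
          using ef(1) ef(3) rep(2)[OF cd(1)] by (simp_all flip: m_assoc)
        then have "e = f" by simp
        with ef have "m = n" using Edis[of m n] by blast
        then show False using AB(3) cd eq by simp
      qed
    qed
    show "\<Union>\<P> = space M"
    proof
      show "\<Union>\<P> \<subseteq> space M"
        using rep(2) sets_l_coset[OF _ Es] sets.sets_into_space by (fastforce simp: \<P>_def)
      show "space M \<subseteq> \<Union>\<P>"
      proof
        fix x assume "x \<in> space M"
        then have x: "x \<in> carrier G" by (simp add: space_carrier)
        let ?c = "x <# H"
        have c: "?c \<in> \<C>" using x by (auto simp: \<C>_def)
        have "x \<in> rep ?c <# H" using self[OF x] rep(3)[OF c] by simp
        then obtain h where "h \<in> H" "x = rep ?c \<otimes> h" by (auto simp: l_coset_image)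
        then obtain n where "x \<in> rep ?c <# E n" using EH by (auto simp: l_coset_image)
        then show "x \<in> \<Union>\<P>" using c by (auto simp: \<P>_def)
      qed
    qed
    fix F assume F: "F \<in> sets M" "emeasure M F < \<infinity>"
    then have "(INF U\<in>{U. openin T U \<and> F \<subseteq> U}. emeasure M U) < \<infinity>" using outer by simp
    then obtain U where U: "openin T U" "F \<subseteq> U" "emeasure M U < \<infinity>" by (auto simp: INF_less_iff)
    have cU: "openin T (c \<inter> U)" if "c \<in> \<C>" for c
      using that U(1) H(2) by (auto simp: \<C>_def intro: openin_l_coset)
    have fin: "emeasure M (c \<inter> U) < \<infinity>" for c
      using emeasure_mono[OF Int_lower2 open_sets[OF U(1)]] U(3) by (auto intro: le_less_trans)
    have "(\<lambda>c. measure M (c \<inter> U)) summable_on \<C>"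
    proof (rule nonneg_bdd_above_summable_on)
      show "bdd_above (sum (\<lambda>c. measure M (c \<inter> U)) ` {D. D \<subseteq> \<C> \<and> finite D})"
      proof (rule bdd_aboveI2)
        fix D assume "D \<in> {D. D \<subseteq> \<C> \<and> finite D}"
        then have D: "D \<subseteq> \<C>" "finite D" by auto
        have "disjoint_family_on (\<lambda>c. c \<inter> U) D"
          unfolding disjoint_family_on_def using cs(1) D(1) by blast
        then have "(\<Sum>c\<in>D. measure M (c \<inter> U)) = measure M (\<Union>c\<in>D. c \<inter> U)"
        proof (intro measure_finite_Union[symmetric] D)
          show "(\<lambda>c. c \<inter> U) ` D \<subseteq> sets M" using D(1) cU open_sets by blast
          show "emeasure M (c \<inter> U) \<noteq> \<infinity>" if "c \<in> D" for c
            using fin[of c] by (metis less_irrefl)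
        qed
        also have "\<dots> \<le> measure M U"
        proof (rule measure_mono_fmeasurable)
          show "(\<Union>c\<in>D. c \<inter> U) \<in> sets M" using D cU open_sets by (intro sets.finite_UN) auto
          show "U \<in> fmeasurable M" using U open_sets by (auto simp: fmeasurable_def)
        qed blast
        finally show "(\<Sum>c\<in>D. measure M (c \<inter> U)) \<le> measure M U" .
      qed
    qed simp
    then have "countable {c \<in> \<C>. measure M (c \<inter> U) \<noteq> 0}" by (rule summable_countable_real)
    moreover have "measure M (c \<inter> U) \<noteq> 0" if "c \<in> \<C>" "c \<inter> U \<noteq> {}" for c
      using open_pos[OF cU[OF that(1)] that(2)] fin[of c]
      by (auto simp: measure_def enn2real_eq_0_iff)
    ultimately have "countable {c \<in> \<C>. c \<inter> U \<noteq> {}}" by (rule_tac countable_subset) auto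
    then have "countable ((\<lambda>(c, n). rep c <# E n) ` ({c \<in> \<C>. c \<inter> U \<noteq> {}} \<times> UNIV))" by blast
    moreover have "{A \<in> \<P>. A \<inter> F \<noteq> {}} \<subseteq> (\<lambda>(c, n). rep c <# E n) ` ({c \<in> \<C>. c \<inter> U \<noteq> {}} \<times> UNIV)"
      using sub U(2) by (fastforce simp: \<P>_def)
    ultimately show "countable {A \<in> \<P>. A \<inter> F \<noteq> {}}" by (rule countable_subset[rotated])
  qed
  moreover have "\<exists>x\<in>carrier G. A \<subseteq> x <# H" if "A \<in> \<P>" for A
    using that rep sub by (fastforce simp: \<P>_def)
  ultimately show thesis by (rule that)
qed

lemma completion_finite_cover:
  assumes "F \<in> sets (completion M)" "emeasure (completion M) F < \<infinity>"
  obtains F' where "F' \<in> sets M" "F \<subseteq> F'" "emeasure M F' < \<infinity>"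
proof -
  obtain A where "A \<in> sets M" "F \<subseteq> A" "emeasure (completion M) F = emeasure M A"
    using completion_upper[OF assms(1)] by blast
  then show thesis using assms(2) by (intro that[of A]) (simp_all only:)
qed

sublocale completed: radon T "completion M"
proof
  show "space (completion M) = topspace T" by (simp add: space_M)
  show "U \<in> sets (completion M)" if "openin T U" for U using open_sets[OF that] by simp
  show "emeasure (completion M) K < \<infinity>" if "compactin T K" for K
    using compact_sets[OF that] compact_finite[OF that] by simp
  show "emeasure (completion M) U = (SUP K\<in>{K. compactin T K \<and> K \<subseteq> U}. emeasure (completion M) K)"
    if U: "openin T U" for U
  proof -
    have "(SUP K\<in>{K. compactin T K \<and> K \<subseteq> U}. emeasure (completion M) K) =
        (SUP K\<in>{K. compactin T K \<and> K \<subseteq> U}. emeasure M K)"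
      using compact_sets by (intro SUP_cong) auto
    then show ?thesis using inner[OF U] open_sets[OF U] by simp
  qed
  show "emeasure (completion M) A = (INF U\<in>{U. openin T U \<and> A \<subseteq> U}. emeasure (completion M) U)"
    if A: "A \<in> sets (completion M)" for A
  proof (rule antisym)
    show "emeasure (completion M) A \<le> (INF U\<in>{U. openin T U \<and> A \<subseteq> U}. emeasure (completion M) U)"
      using open_sets by (intro INF_greatest emeasure_mono) auto
    obtain A' where A': "A' \<in> sets M" "A \<subseteq> A'" "emeasure (completion M) A = emeasure M A'"
      using completion_upper[OF A] by blast
    have "(INF U\<in>{U. openin T U \<and> A \<subseteq> U}. emeasure (completion M) U) \<le>
        (INF U\<in>{U. openin T U \<and> A' \<subseteq> U}. emeasure (completion M) U)"
      using A'(2) by (intro INF_superset_mono) auto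
    also have "\<dots> = (INF U\<in>{U. openin T U \<and> A' \<subseteq> U}. emeasure M U)"
      using open_sets by (intro INF_cong) auto
    also have "\<dots> = emeasure (completion M) A" using outer[OF A'(1)] A'(3) by simp
    finally show "(INF U\<in>{U. openin T U \<and> A \<subseteq> U}. emeasure (completion M) U) \<le> emeasure (completion M) A" .
  qed
qed (use Hausdorff locally_compact in auto)

lemma localizing_completion:
  assumes "localizing M \<P>" shows "localizing (completion M) \<P>"
  unfolding localizing_def
proof (intro conjI ballI impI)
  fix F assume F: "F \<in> sets (completion M)" "emeasure (completion M) F < \<infinity>"
  obtain F' where F': "F' \<in> sets M" "F \<subseteq> F'" "emeasure M F' < \<infinity>" using completion_finite_cover[OF F] .
  then have "countable {P \<in> \<P>. P \<inter> F' \<noteq> {}}" using assms by (simp add: localizing_def)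
  then show "countable {P \<in> \<P>. P \<inter> F \<noteq> {}}" by (rule countable_subset[rotated]) (use F' in auto)
next
  show "\<P> \<subseteq> sets (completion M)" using assms by (auto simp: localizing_def)
  show "emeasure (completion M) A < \<infinity>" if "A \<in> \<P>" for A
    using assms that by (auto simp: localizing_def)
  show "disjoint \<P>" "\<Union>\<P> = space (completion M)" using assms by (simp_all add: localizing_def)
qed

subsection \<open>Local properties in terms of the completion\<close>

text \<open>For finite measure sets, locally null means null for the completion. This reduces local
  statements to almost everywhere statements.\<close>

lemma lae_iff:
  "lae M P \<longleftrightarrow> (\<forall>F\<in>sets (completion M). emeasure (completion M) F < \<infinity> \<longrightarrow>
    (AE x in completion M. x \<in> F \<longrightarrow> P x))"
proof -
  have e: "{x \<in> space M. \<not> P x} \<inter> F \<in> null_sets (completion M) \<longleftrightarrow> (AE x in completion M. x \<in> F \<longrightarrow> P x)"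
    if "F \<subseteq> space M" for F
  proof -
    have "{x \<in> space M. \<not> P x} \<inter> F = {x \<in> space (completion M). \<not> (x \<in> F \<longrightarrow> P x)}" using that by auto
    then show ?thesis using completion.AE_iff_null_sets[where M = M and P = "\<lambda>x. x \<in> F \<longrightarrow> P x"] by (simp only:)
  qed
  show ?thesis
  proof (intro iffI ballI impI)
    fix F assume l: "lae M P" and F: "F \<in> sets (completion M)" "emeasure (completion M) F < \<infinity>"
    obtain F' where F': "F' \<in> sets M" "F \<subseteq> F'" "emeasure M F' < \<infinity>" using completion_finite_cover[OF F] .
    then have "AE x in completion M. x \<in> F' \<longrightarrow> P x"
      using l F'(1,3) e[OF sets.sets_into_space[OF F'(1)]] unfolding lae_def locally_null_def by blast
    then show "AE x in completion M. x \<in> F \<longrightarrow> P x" by eventually_elim (use F'(2) in auto)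
  next
    assume r: "\<forall>F\<in>sets (completion M). emeasure (completion M) F < \<infinity> \<longrightarrow> (AE x in completion M. x \<in> F \<longrightarrow> P x)"
    show "lae M P"
      unfolding lae_def locally_null_def
    proof (intro conjI ballI impI)
      fix F assume F: "F \<in> sets M" "emeasure M F < \<infinity>"
      show "{x \<in> space M. \<not> P x} \<inter> F \<in> null_sets (completion M)"
        unfolding e[OF sets.sets_into_space[OF F(1)]]
        by (rule r[THEN bspec, THEN mp]) (use F in auto)
    qed auto
  qed
qed

lemma lae_conj: assumes "lae M P" "lae M Q" shows "lae M (\<lambda>x. P x \<and> Q x)"
  unfolding lae_iff
proof (intro ballI impI)
  fix F assume F: "F \<in> sets (completion M)" "emeasure (completion M) F < \<infinity>"
  have "AE x in completion M. x \<in> F \<longrightarrow> P x" "AE x in completion M. x \<in> F \<longrightarrow> Q x"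
    using assms F unfolding lae_iff by blast+
  then show "AE x in completion M. x \<in> F \<longrightarrow> P x \<and> Q x" by eventually_elim simp
qed

lemma lae_mono: "lae M P \<Longrightarrow> (\<And>x. x \<in> carrier G \<Longrightarrow> P x \<Longrightarrow> Q x) \<Longrightarrow> lae M Q"
  unfolding lae_iff
proof (intro ballI impI)
  fix F assume 1: "\<And>x. x \<in> carrier G \<Longrightarrow> P x \<Longrightarrow> Q x" and F: "F \<in> sets (completion M)" "emeasure (completion M) F < \<infinity>"
    and 2: "\<forall>F\<in>sets (completion M). emeasure (completion M) F < \<infinity> \<longrightarrow> (AE x in completion M. x \<in> F \<longrightarrow> P x)"
  from 2 F have "AE x in completion M. x \<in> F \<longrightarrow> P x" by simp
  then show "AE x in completion M. x \<in> F \<longrightarrow> Q x"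
    using AE_space by eventually_elim (use 1 in \<open>auto simp: space_carrier\<close>)
qed

lemma lae_I: "(\<And>x. x \<in> carrier G \<Longrightarrow> P x) \<Longrightarrow> lae M P"
  unfolding lae_iff by (auto intro!: AE_I2 simp: space_carrier)

lemma locally_measurable_iff:
  "locally_measurable M f \<longleftrightarrow> (\<forall>F\<in>sets (completion M). emeasure (completion M) F < \<infinity> \<longrightarrow>
    (\<lambda>x. indicator F x *\<^sub>R f x) \<in> borel_measurable (completion M))"
proof (intro iffI ballI impI)
  fix F assume l: "locally_measurable M f" and F: "F \<in> sets (completion M)" "emeasure (completion M) F < \<infinity>"
  obtain F' where F': "F' \<in> sets M" "F \<subseteq> F'" "emeasure M F' < \<infinity>" using completion_finite_cover[OF F] .
  show "(\<lambda>x. indicator F x *\<^sub>R f x) \<in> borel_measurable (completion M)"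
  proof (rule borel_measurableI)
    fix S :: "complex set" assume S: "open S"
    then have "f -` S \<inter> F' \<in> sets (completion M)" using l F' by (auto simp: locally_measurable_def)
    then have "(f -` S \<inter> F') \<inter> F \<in> sets (completion M)" using F(1) by (rule sets.Int)
    moreover have "(\<lambda>x. indicator F x *\<^sub>R f x) -` S \<inter> space (completion M) =
        (f -` S \<inter> F') \<inter> F \<union> (if 0 \<in> S then space (completion M) - F else {})"
      using F'(2) sets.sets_into_space[OF F(1)] by (auto simp: indicator_def of_bool_def split: if_splits)
    ultimately show "(\<lambda>x. indicator F x *\<^sub>R f x) -` S \<inter> space (completion M) \<in> sets (completion M)"
      using F(1) by auto
  qed
next
  assume r: "\<forall>F\<in>sets (completion M). emeasure (completion M) F < \<infinity> \<longrightarrow>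
    (\<lambda>x. indicator F x *\<^sub>R f x) \<in> borel_measurable (completion M)"
  show "locally_measurable M f"
    unfolding locally_measurable_def
  proof (intro ballI impI)
    fix B F assume B: "B \<in> sets (borel :: complex measure)" and F: "F \<in> sets M" "emeasure M F < \<infinity>"
    then have m: "(\<lambda>x. indicator F x *\<^sub>R f x) \<in> borel_measurable (completion M)" using r by simp
    have "f -` B \<inter> F = ((\<lambda>x. indicator F x *\<^sub>R f x) -` B \<inter> space (completion M)) \<inter> F"
      using sets.sets_into_space[OF F(1)] by auto
    then show "f -` B \<inter> F \<in> sets (completion M)" using measurable_sets[OF m B] F(1) by auto
  qed
qed

lemma loc_bounded_iff:
  "loc_bounded (completion M) f B \<longleftrightarrow> locally_measurable M f \<and> lae M (\<lambda>x. cmod (f x) \<le> B)"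
  unfolding loc_bounded_def lae_iff locally_measurable_iff by (simp only: imp_conjR ball_conj_distrib)

lemma Linfty_funs_iff:
  "f \<in> Linfty_funs M \<longleftrightarrow> f \<in> extensional (carrier G) \<and> (\<exists>B. loc_bounded (completion M) f B)"
  unfolding Linfty_funs_def loc_bounded_iff space_carrier by simp

lemma locally_measurable_cong:
  assumes "\<And>x. x \<in> carrier G \<Longrightarrow> f x = g x" shows "locally_measurable M f \<longleftrightarrow> locally_measurable M g"
proof -
  have "(\<lambda>x. indicator F x *\<^sub>R f x) \<in> borel_measurable (completion M) \<longleftrightarrow>
      (\<lambda>x. indicator F x *\<^sub>R g x) \<in> borel_measurable (completion M)" for F
    using assms by (intro measurable_cong) (simp add: space_carrier)
  then show ?thesis by (simp add: locally_measurable_iff)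
qed

lemma loc_bounded_cong:
  assumes "\<And>x. x \<in> carrier G \<Longrightarrow> f x = g x"
  shows "loc_bounded (completion M) f B \<longleftrightarrow> loc_bounded (completion M) g B"
proof -
  have "lae M (\<lambda>x. cmod (f x) \<le> B) \<longleftrightarrow> lae M (\<lambda>x. cmod (g x) \<le> B)"
    using assms by (metis (mono_tags, lifting) lae_mono)
  then show ?thesis unfolding loc_bounded_iff using locally_measurable_cong[OF assms] by simp
qed

lemma locally_measurable_add:
  assumes "locally_measurable M f" "locally_measurable M g" shows "locally_measurable M (\<lambda>x. f x + g x)"
  unfolding locally_measurable_iff scaleR_add_right
proof (intro ballI impI borel_measurable_add)
  fix F assume F: "F \<in> sets (completion M)" "emeasure (completion M) F < \<infinity>"
  show "(\<lambda>x. indicator F x *\<^sub>R f x) \<in> borel_measurable (completion M)"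
    "(\<lambda>x. indicator F x *\<^sub>R g x) \<in> borel_measurable (completion M)"
    using assms F unfolding locally_measurable_iff by blast+
qed

lemma locally_measurable_mult:
  assumes "locally_measurable M f" "locally_measurable M g" shows "locally_measurable M (\<lambda>x. f x * g x)"
proof -
  have e: "indicator F x *\<^sub>R (f x * g x) = (indicator F x *\<^sub>R f x) * (indicator F x *\<^sub>R g x)" for F and x :: 'a
    by (simp add: indicator_def)
  show ?thesis
    unfolding locally_measurable_iff e
  proof (intro ballI impI borel_measurable_times)
    fix F assume F: "F \<in> sets (completion M)" "emeasure (completion M) F < \<infinity>"
    show "(\<lambda>x. indicator F x *\<^sub>R f x) \<in> borel_measurable (completion M)"
      "(\<lambda>x. indicator F x *\<^sub>R g x) \<in> borel_measurable (completion M)"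
      using assms F unfolding locally_measurable_iff by blast+
  qed
qed

lemma locally_measurable_cnj:
  assumes "locally_measurable M f" shows "locally_measurable M (\<lambda>x. cnj (f x))"
proof -
  have e: "indicator F x *\<^sub>R cnj (f x) = cnj (indicator F x *\<^sub>R f x)" for F and x :: 'a
    by (simp add: indicator_def)
  have c: "cnj \<in> borel_measurable borel" by (intro borel_measurable_continuous_onI continuous_on_cnj continuous_on_id)
  show ?thesis
    unfolding locally_measurable_iff e
  proof (intro ballI impI)
    fix F assume F: "F \<in> sets (completion M)" "emeasure (completion M) F < \<infinity>"
    then have m: "(\<lambda>x. indicator F x *\<^sub>R f x) \<in> borel_measurable (completion M)"
      using assms unfolding locally_measurable_iff by blast
    show "(\<lambda>x. cnj (indicator F x *\<^sub>R f x)) \<in> borel_measurable (completion M)"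
      by (rule measurable_compose[OF m c])
  qed
qed

lemma locally_measurable_const: "locally_measurable M (\<lambda>_. c)"
  unfolding locally_measurable_iff
proof (intro ballI impI)
  fix F assume "F \<in> sets (completion M)"
  then show "(\<lambda>x. indicator F x *\<^sub>R c) \<in> borel_measurable (completion M)"
    by (intro borel_measurable_scaleR borel_measurable_indicator borel_measurable_const)
qed

lemma loc_bounded_mult:
  assumes "loc_bounded (completion M) f B" "locally_measurable M g" "\<And>x. x \<in> carrier G \<Longrightarrow> cmod (g x) \<le> 1"
  shows "loc_bounded (completion M) (\<lambda>x. f x * g x) B"
  unfolding loc_bounded_iff
proof
  show "locally_measurable M (\<lambda>x. f x * g x)"
    using assms by (intro locally_measurable_mult) (auto simp: loc_bounded_iff)
  have "lae M (\<lambda>x. cmod (f x) \<le> B)" using assms(1) by (simp add: loc_bounded_iff)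
  then show "lae M (\<lambda>x. cmod (f x * g x) \<le> B)"
  proof (rule lae_mono)
    fix x assume "x \<in> carrier G" "cmod (f x) \<le> B"
    then have "cmod (f x) * cmod (g x) \<le> cmod (f x)"
      using assms(3)[of x] by (simp add: mult_left_le)
    then show "cmod (f x * g x) \<le> B" using \<open>cmod (f x) \<le> B\<close> by (simp add: norm_mult)
  qed
qed

lemma translate_finite:
  assumes k: "k \<in> carrier G" and F: "F \<in> sets (completion M)" "emeasure (completion M) F < \<infinity>"
  shows "{y \<in> carrier G. y \<otimes> inv k \<in> F} \<in> sets (completion M)"
    "emeasure (completion M) {y \<in> carrier G. y \<otimes> inv k \<in> F} < \<infinity>"
proof -
  have e: "{y \<in> carrier G. y \<otimes> inv k \<in> F} = (\<lambda>y. y \<otimes> inv k) -` F \<inter> space (completion M)"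
    by (auto simp: space_carrier)
  show "{y \<in> carrier G. y \<otimes> inv k \<in> F} \<in> sets (completion M)"
    unfolding e by (rule measurable_sets[OF distr_completion_right(1)[OF k] F(1)])
  have "emeasure (completion M) {y \<in> carrier G. y \<otimes> inv k \<in> F} = ennreal (modular k) * emeasure (completion M) F"
    unfolding e using F(1) arg_cong[OF distr_completion_right(2)[OF k], of "\<lambda>N. emeasure N F"]
    by (simp add: emeasure_distr distr_completion_right(1)[OF k] emeasure_density_const)
  also have "\<dots> < \<infinity>" using F(2) by (simp add: ennreal_mult_less_top)
  finally show "emeasure (completion M) {y \<in> carrier G. y \<otimes> inv k \<in> F} < \<infinity>" .
qed

lemma right_measurable: "k \<in> carrier G \<Longrightarrow> (\<lambda>x. x \<otimes> k) \<in> measurable (completion M) (completion M)"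
  using distr_completion_right(1)[of "inv k"] by simp

lemma AE_right:
  assumes k: "k \<in> carrier G" and "AE x in completion M. P x" shows "AE x in completion M. P (x \<otimes> k)"
proof -
  have d: "distr (completion M) (completion M) (\<lambda>x. x \<otimes> k) = density (completion M) (\<lambda>_. ennreal (modular (inv k)))"
    using distr_completion_right(2)[of "inv k"] k by simp
  have "AE x in density (completion M) (\<lambda>_. ennreal (modular (inv k))). P x"
    using assms(2) by (simp add: AE_density)
  then show ?thesis unfolding d[symmetric] by (rule AE_distrD[OF right_measurable[OF k]])
qed

lemma lae_right:
  assumes k: "k \<in> carrier G" and "lae M P" shows "lae M (\<lambda>x. P (x \<otimes> k))"
  unfolding lae_iff
proof (intro ballI impI)
  fix F assume F: "F \<in> sets (completion M)" "emeasure (completion M) F < \<infinity>"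
  let ?F = "{y \<in> carrier G. y \<otimes> inv k \<in> F}"
  have "AE y in completion M. y \<in> ?F \<longrightarrow> P y"
    using assms(2) translate_finite[OF k F] unfolding lae_iff by blast
  from AE_right[OF k this] AE_space show "AE x in completion M. x \<in> F \<longrightarrow> P (x \<otimes> k)"
    by eventually_elim (use k in \<open>auto simp: space_carrier m_assoc\<close>)
qed

lemma locally_measurable_right:
  assumes k: "k \<in> carrier G" and f: "locally_measurable M f" shows "locally_measurable M (\<lambda>x. f (x \<otimes> k))"
  unfolding locally_measurable_iff
proof (intro ballI impI)
  fix F assume F: "F \<in> sets (completion M)" "emeasure (completion M) F < \<infinity>"
  let ?F = "{y \<in> carrier G. y \<otimes> inv k \<in> F}"
  have "(\<lambda>x. indicator ?F x *\<^sub>R f x) \<in> borel_measurable (completion M)"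
    using f translate_finite[OF k F] unfolding locally_measurable_iff by blast
  from measurable_compose[OF right_measurable[OF k] this]
  have "(\<lambda>x. indicator ?F (x \<otimes> k) *\<^sub>R f (x \<otimes> k)) \<in> borel_measurable (completion M)" .
  also have "?this \<longleftrightarrow> (\<lambda>x. indicator F x *\<^sub>R f (x \<otimes> k)) \<in> borel_measurable (completion M)"
    using k by (intro measurable_cong) (auto simp: space_carrier indicator_def m_assoc)
  finally show "(\<lambda>x. indicator F x *\<^sub>R f (x \<otimes> k)) \<in> borel_measurable (completion M)" .
qed

lemma loc_bounded_right:
  "k \<in> carrier G \<Longrightarrow> loc_bounded (completion M) f B \<Longrightarrow> loc_bounded (completion M) (\<lambda>x. f (x \<otimes> k)) B"
  unfolding loc_bounded_iff using locally_measurable_right lae_right[of k "\<lambda>x. cmod (f x) \<le> B"] by simp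

end

subsection \<open>The quotient space\<close>

context haar
begin

lemma lae_rel_iff: "(f, g) \<in> lae_rel M \<longleftrightarrow> f \<in> Linfty_funs M \<and> g \<in> Linfty_funs M \<and> lae M (\<lambda>x. f x = g x)"
  by (simp add: lae_rel_def)

lemma equiv_lae_rel: "equiv (Linfty_funs M) (lae_rel M)"
proof (rule equivI)
  show "lae_rel M \<subseteq> Linfty_funs M \<times> Linfty_funs M" by (auto simp: lae_rel_iff)
  show "refl_on (Linfty_funs M) (lae_rel M)" by (auto simp: refl_on_def lae_rel_iff intro: lae_I)
  show "sym (lae_rel M)" by (rule symI) (auto simp: lae_rel_iff elim: lae_mono)
  show "trans (lae_rel M)"
  proof (rule transI)
    fix f g h assume "(f, g) \<in> lae_rel M" "(g, h) \<in> lae_rel M"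
    then show "(f, h) \<in> lae_rel M"
      using lae_mono[OF lae_conj, of "\<lambda>x. f x = g x" "\<lambda>x. g x = h x" "\<lambda>x. f x = h x"]
      by (auto simp: lae_rel_iff)
  qed
qed

abbreviation ae_class where "ae_class g \<equiv> lae_rel M `` {g}"

lemma ae_class_eq_iff:
  "f \<in> Linfty_funs M \<Longrightarrow> g \<in> Linfty_funs M \<Longrightarrow> ae_class f = ae_class g \<longleftrightarrow> lae M (\<lambda>x. f x = g x)"
  using eq_equiv_class_iff[OF equiv_lae_rel, of f g] by (simp add: lae_rel_iff)

lemma restrict_Linfty: "loc_bounded (completion M) f B \<Longrightarrow> (\<lambda>x\<in>carrier G. f x) \<in> Linfty_funs M"
  unfolding Linfty_funs_iff using loc_bounded_cong[of "\<lambda>x\<in>carrier G. f x" f B] by auto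

lemma Linfty_add:
  assumes "f \<in> Linfty_funs M" "g \<in> Linfty_funs M"
  shows "(\<lambda>x\<in>carrier G. f x + g x) \<in> Linfty_funs M"
proof -
  obtain B C where "loc_bounded (completion M) f B" "loc_bounded (completion M) g C"
    using assms by (auto simp: Linfty_funs_iff)
  then have b: "locally_measurable M f" "locally_measurable M g"
    "lae M (\<lambda>x. cmod (f x) \<le> B)" "lae M (\<lambda>x. cmod (g x) \<le> C)" by (auto simp: loc_bounded_iff)
  have "lae M (\<lambda>x. cmod (f x + g x) \<le> B + C)"
    using lae_conj[OF b(3,4)] by (rule lae_mono) (auto intro: norm_triangle_mono)
  then have "loc_bounded (completion M) (\<lambda>x. f x + g x) (B + C)"
    using b by (simp add: loc_bounded_iff locally_measurable_add)
  then show ?thesis by (rule restrict_Linfty)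
qed

lemma Linfty_scale:
  assumes "f \<in> Linfty_funs M" shows "(\<lambda>x\<in>carrier G. c * f x) \<in> Linfty_funs M"
proof -
  obtain B where "loc_bounded (completion M) f B" using assms by (auto simp: Linfty_funs_iff)
  then have b: "locally_measurable M f" "lae M (\<lambda>x. cmod (f x) \<le> B)" by (auto simp: loc_bounded_iff)
  have "lae M (\<lambda>x. cmod (c * f x) \<le> cmod c * B)"
    using b(2) by (rule lae_mono) (auto simp: norm_mult mult_left_mono)
  then have "loc_bounded (completion M) (\<lambda>x. c * f x) (cmod c * B)"
    using b locally_measurable_mult[OF locally_measurable_const b(1)] by (simp add: loc_bounded_iff)
  then show ?thesis by (rule restrict_Linfty)
qed

lemma Linfty_right:
  assumes "f \<in> Linfty_funs M" "k \<in> carrier G" shows "(\<lambda>x\<in>carrier G. f (x \<otimes> k)) \<in> Linfty_funs M"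
  using assms loc_bounded_right by (auto simp: Linfty_funs_iff[of f] intro: restrict_Linfty)

lemma vset_Linfty: "vset (Linfty M) = Linfty_funs M // lae_rel M"
  by (simp add: Linfty_def quotient_space_def)

lemma ae_class_add:
  assumes f: "f \<in> Linfty_funs M" and g: "g \<in> Linfty_funs M"
  shows "vadd (Linfty M) (ae_class f) (ae_class g) = ae_class (\<lambda>x\<in>carrier G. f x + g x)"
proof -
  have "(\<lambda>f g. ae_class (\<lambda>x\<in>carrier G. f x + g x)) respects2 lae_rel M"
  proof (rule congruent2I')
    fix f f' g g' assume "(f, f') \<in> lae_rel M" "(g, g') \<in> lae_rel M"
    then show "ae_class (\<lambda>x\<in>carrier G. f x + g x) = ae_class (\<lambda>x\<in>carrier G. f' x + g' x)"
      using lae_mono[OF lae_conj, of "\<lambda>x. f x = f' x" "\<lambda>x. g x = g' x"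
          "\<lambda>x. (\<lambda>x\<in>carrier G. f x + g x) x = (\<lambda>x\<in>carrier G. f' x + g' x) x"]
      by (auto simp: lae_rel_iff ae_class_eq_iff Linfty_add)
  qed
  from UN_equiv_class2[OF equiv_lae_rel equiv_lae_rel this f g] show ?thesis
    by (simp add: Linfty_def quotient_space_def space_carrier)
qed

lemma ae_class_scale:
  assumes f: "f \<in> Linfty_funs M"
  shows "vscale (Linfty M) c (ae_class f) = ae_class (\<lambda>x\<in>carrier G. c * f x)"
proof -
  have "(\<lambda>f. ae_class (\<lambda>x\<in>carrier G. c * f x)) respects lae_rel M"
  proof (rule congruentI)
    fix f f' assume "(f, f') \<in> lae_rel M"
    then show "ae_class (\<lambda>x\<in>carrier G. c * f x) = ae_class (\<lambda>x\<in>carrier G. c * f' x)"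
      using lae_mono[of "\<lambda>x. f x = f' x" "\<lambda>x. (\<lambda>x\<in>carrier G. c * f x) x = (\<lambda>x\<in>carrier G. c * f' x) x"]
      by (auto simp: lae_rel_iff ae_class_eq_iff Linfty_scale)
  qed
  from UN_equiv_class[OF equiv_lae_rel this f] show ?thesis
    by (simp add: Linfty_def quotient_space_def space_carrier)
qed

lemma ae_class_norm:
  assumes f: "f \<in> Linfty_funs M"
  shows "vnorm (Linfty M) (ae_class f) = Inf {t. lae M (\<lambda>x. cmod (f x) \<le> t)}"
proof -
  let ?n = "\<lambda>f. Inf {t. lae M (\<lambda>x. cmod (f x) \<le> t)}"
  have n: "?n g = ?n f" if "(f, g) \<in> lae_rel M" for g
  proof -
    have eq: "lae M (\<lambda>x. f x = g x)" using that by (simp add: lae_rel_iff)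
    have "lae M (\<lambda>x. cmod (g x) \<le> t)" if "lae M (\<lambda>x. cmod (f x) \<le> t)" for t
      by (rule lae_mono[OF lae_conj[OF eq that]]) auto
    moreover have "lae M (\<lambda>x. cmod (f x) \<le> t)" if "lae M (\<lambda>x. cmod (g x) \<le> t)" for t
      by (rule lae_mono[OF lae_conj[OF eq that]]) auto
    ultimately have "lae M (\<lambda>x. cmod (g x) \<le> t) \<longleftrightarrow> lae M (\<lambda>x. cmod (f x) \<le> t)" for t by blast
    then show ?thesis by simp
  qed
  have "?n ` ae_class f \<subseteq> {?n f}"
  proof
    fix r assume "r \<in> ?n ` ae_class f"
    then obtain g where "(f, g) \<in> lae_rel M" "r = ?n g" by blast
    then show "r \<in> {?n f}" using n[of g] by simp
  qed
  moreover have "?n f \<in> ?n ` ae_class f" using equiv_class_self[OF equiv_lae_rel f] by blast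
  ultimately have "?n ` ae_class f = {?n f}" by blast
  then show ?thesis by (simp add: Linfty_def quotient_space_def)
qed

lemma right_translate_ae_class:
  assumes f: "f \<in> Linfty_funs M" and k: "k \<in> carrier G"
  shows "right_translate G M k (ae_class f) = ae_class (\<lambda>x\<in>carrier G. f (x \<otimes> k))"
proof -
  have "(\<lambda>f. ae_class (\<lambda>x\<in>carrier G. f (x \<otimes> k))) respects lae_rel M"
  proof (rule congruentI)
    fix f f' assume "(f, f') \<in> lae_rel M"
    then have "f \<in> Linfty_funs M" "f' \<in> Linfty_funs M" "lae M (\<lambda>x. f (x \<otimes> k) = f' (x \<otimes> k))"
      using lae_right[OF k, of "\<lambda>x. f x = f' x"] by (auto simp: lae_rel_iff)
    then show "ae_class (\<lambda>x\<in>carrier G. f (x \<otimes> k)) = ae_class (\<lambda>x\<in>carrier G. f' (x \<otimes> k))"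
      using lae_mono[of "\<lambda>x. f (x \<otimes> k) = f' (x \<otimes> k)"
          "\<lambda>x. (\<lambda>x\<in>carrier G. f (x \<otimes> k)) x = (\<lambda>x\<in>carrier G. f' (x \<otimes> k)) x"]
      by (auto simp: ae_class_eq_iff Linfty_right k)
  qed
  from UN_equiv_class[OF equiv_lae_rel this f] show ?thesis
    by (simp add: right_translate_def)
qed

text \<open>The group is not locally null, since a compact neighbourhood of the unit has positive finite
  measure.\<close>

lemma lae_bound_nonneg:
  assumes "lae M (\<lambda>x. cmod (f x) \<le> t)" shows "0 \<le> t"
proof (rule ccontr)
  assume "\<not> 0 \<le> t"
  then have *: "\<not> cmod (f x) \<le> t" for x by (metis norm_ge_zero order_trans)
  obtain U C where UC: "openin T U" "compactin T C" "\<one> \<in> U" "U \<subseteq> C"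
    using compact_neighbourhood[OF one_closed] .
  have "AE x in completion M. x \<in> C \<longrightarrow> cmod (f x) \<le> t"
    using assms completed.compact_sets[OF UC(2)] completed.compact_finite[OF UC(2)] unfolding lae_iff by blast
  then have "AE x in M. x \<notin> C" using * by (simp add: AE_completion_iff)
  then have "emeasure M C = 0"
    using AE_iff_measurable[OF compact_sets[OF UC(2)], of "\<lambda>x. x \<notin> C"] compactin_carrier[OF UC(2)]
    by (auto simp: space_carrier)
  moreover have "emeasure M U \<le> emeasure M C" by (rule emeasure_mono[OF UC(4) compact_sets[OF UC(2)]])
  ultimately show False using open_pos[OF UC(1)] UC(3) by auto
qed

end

section \<open>Integration over the cosets of a normal subgroup\<close>

locale coset_integration =
  fixes G :: "('a, 'b) monoid_scheme" (structure) and T :: "'a topology" and N :: "'a set"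
    and \<mu>G \<mu>N :: "'a measure" and \<mu>Q :: "'a set measure"
  assumes lcg: "locally_compact_group G T"
    and normalN: "N \<lhd> G" and closedN: "closedin T N"
    and haarG: "left_haar_measure G T \<mu>G"
    and haarN: "left_haar_measure (subgroup_of G N) (subtopology T N) \<mu>N"
    and haarQ: "left_haar_measure (G Mod N) (quot_topology G T N) \<mu>Q"
    and weil: "weil_formula G \<mu>G \<mu>N \<mu>Q"

sublocale coset_integration \<subseteq> haar G T \<mu>G
  using lcg haarG by unfold_locales

context coset_integration
begin

abbreviation TN where "TN \<equiv> subtopology T N"
abbreviation GN where "GN \<equiv> G\<lparr>carrier := N\<rparr>"
abbreviation TQ where "TQ \<equiv> quot_topology G T N"

lemma subgroupN: "subgroup N G" using normalN by (rule normal_imp_subgroup)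

lemma N_carrier: "N \<subseteq> carrier G" by (rule subgroup.subset[OF subgroupN])

lemma N_mem: "k \<in> N \<Longrightarrow> k \<in> carrier G" using N_carrier by blast

lemma topspace_TN: "topspace T \<inter> N = N" using N_carrier topspace_T by auto

lemma inv_GN: "k \<in> N \<Longrightarrow> inv\<^bsub>GN\<^esub> k = inv k" by (rule m_inv_consistent[OF subgroupN])

lemma lc_group_N: "locally_compact_group GN TN"
  unfolding locally_compact_group_def
proof (intro conjI)
  show "group GN" by (rule subgroup.subgroup_is_group[OF subgroupN group_axioms])
  show "topspace TN = carrier GN" by (simp add: topspace_TN)
  have s: "prod_topology TN TN = subtopology (prod_topology T T) (N \<times> N)" by (rule subtopology_Times[symmetric])
  have "continuous_map (prod_topology TN TN) T (\<lambda>(x, y). x \<otimes> y)"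
    unfolding s using lcg by (intro continuous_map_from_subtopology) (simp add: locally_compact_group_def)
  then show "continuous_map (prod_topology TN TN) TN (\<lambda>(x, y). x \<otimes>\<^bsub>GN\<^esub> y)"
    using subgroup.m_closed[OF subgroupN] by (auto simp: continuous_map_in_subtopology topspace_TN)
  have "continuous_map TN T (\<lambda>x. inv x)"
    using lcg by (intro continuous_map_from_subtopology) (simp add: locally_compact_group_def)
  then have "continuous_map TN TN (\<lambda>x. inv x)"
    using subgroup.m_inv_closed[OF subgroupN] by (auto simp: continuous_map_in_subtopology topspace_TN)
  then show "continuous_map TN TN (\<lambda>x. inv\<^bsub>GN\<^esub> x)"
    by (rule continuous_map_eq) (simp add: topspace_TN inv_GN)
  show "Hausdorff_space TN" by (rule Hausdorff_space_subtopology[OF Hausdorff])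
  show "locally_compact_space TN" by (rule locally_compact_space_closed_subset[OF locally_compact closedN])
qed

end

sublocale coset_integration \<subseteq> N: haar "G\<lparr>carrier := N\<rparr>" "subtopology T N" \<mu>N
  using lc_group_N haarN by unfold_locales

context coset_integration
begin

lemma continuous_map_N: "continuous_map T Y f \<Longrightarrow> continuous_map TN Y f"
  by (rule continuous_map_from_subtopology)

lemma continuous_map_snd_N: "continuous_map (prod_topology X TN) T snd"
  using continuous_map_compose[OF continuous_map_snd continuous_map_N[OF continuous_map_id_T]] by (simp add: o_def)

lemma compactin_N: "compactin T K \<Longrightarrow> compactin TN (N \<inter> K)"
  unfolding compactin_subtopology by (auto intro: closed_Int_compactin closedN)

lemma space_N: "space \<mu>N = N" using N.space_carrier by simp

subsection \<open>The quotient\<close>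

lemma coset_mem: assumes "x \<in> carrier G" shows "x \<in> x <# N"
proof -
  have "x \<otimes> \<one> \<in> x <# N" unfolding l_coset_image using subgroup.one_closed[OF subgroupN] by blast
  then show ?thesis using assms by simp
qed

lemma carrier_Mod: "carrier (G Mod N) = (\<lambda>x. x <# N) ` carrier G"
  using normal.coset_eq[OF normalN] by (auto simp: FactGroup_def RCOSETS_def)

lemma topspace_TQ: "topspace TQ = carrier (G Mod N)"
proof
  show "topspace TQ \<subseteq> carrier (G Mod N)"
    using openin_topspace[of TQ] unfolding openin_quot_topology by blast
  have "{x \<in> topspace T. quot_map G N x \<in> carrier (G Mod N)} = topspace T"
    by (auto simp: carrier_Mod quot_map_def topspace_T)
  then have "openin TQ (carrier (G Mod N))" unfolding openin_quot_topology by simp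
  then show "carrier (G Mod N) \<subseteq> topspace TQ" by (rule openin_subset)
qed

lemma space_Q: "space \<mu>Q = carrier (G Mod N)"
proof -
  have "sets \<mu>Q = sets (borel_of_top TQ)" using haarQ by (simp add: left_haar_measure_def)
  from sets_eq_imp_space_eq[OF this] show ?thesis by (simp add: space_borel_of_top topspace_TQ)
qed

lemma borel_top_Q: "borel_top TQ \<mu>Q"
proof
  show "space \<mu>Q = topspace TQ" by (simp add: space_Q topspace_TQ)
  show "U \<in> sets \<mu>Q" if "openin TQ U" for U
    using haarQ that by (auto simp: left_haar_measure_def sets_borel_of_top)
qed

lemma on_coset:
  assumes "\<And>x k. x \<in> carrier G \<Longrightarrow> k \<in> N \<Longrightarrow> f (x \<otimes> k) = f x" and x: "x \<in> carrier G"
  shows "on_coset f (x <# N) = f x"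
proof -
  have "f ` (x <# N) = {f x}"
    using assms coset_mem[OF x] by (fastforce simp: l_coset_image)
  then show ?thesis by (simp add: on_coset_def)
qed

lemma on_coset_cong: "(\<And>x. x \<in> carrier G \<Longrightarrow> f x = g x) \<Longrightarrow> Y \<in> carrier (G Mod N) \<Longrightarrow> on_coset f Y = on_coset g Y"
  unfolding on_coset_def carrier_Mod
  by (intro arg_cong[where f = the_elem] image_cong) (use N_carrier in \<open>auto simp: l_coset_image\<close>)

lemma on_coset_continuous:
  fixes f :: "'a \<Rightarrow> 'c::topological_space"
  assumes inv: "\<And>x k. x \<in> carrier G \<Longrightarrow> k \<in> N \<Longrightarrow> f (x \<otimes> k) = f x" and f: "continuous_map T euclidean f"
  shows "continuous_map TQ euclidean (on_coset f)"
  unfolding continuous_map_def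
proof (intro conjI allI impI)
  fix S :: "'c set" assume "openin euclidean S"
  then have "openin T {x \<in> topspace T. f x \<in> S}" using f by (simp add: openin_continuous_map_preimage)
  moreover have "{x \<in> topspace T. quot_map G N x \<in> {Y \<in> topspace TQ. on_coset f Y \<in> S}} = {x \<in> topspace T. f x \<in> S}"
    by (auto simp: topspace_TQ topspace_T quot_map_def carrier_Mod on_coset[where f = f, OF inv])
  ultimately show "openin TQ {Y \<in> topspace TQ. on_coset f Y \<in> S}"
    unfolding openin_quot_topology by (auto simp: topspace_TQ)
qed simp

text \<open>Compact sets of cosets lift to compact sets: the images of open sets with compact closure form
  an open cover.\<close>

lemma compact_lift:
  assumes S: "S \<subseteq> carrier G" and c: "compactin TQ (quot_map G N ` S)"
  obtains K where "compactin T K" "\<And>x. x \<in> S \<Longrightarrow> \<exists>k\<in>N. x \<otimes> k \<in> K"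
proof -
  have "\<forall>x\<in>S. \<exists>U C. openin T U \<and> compactin T C \<and> x \<in> U \<and> U \<subseteq> C"
    using S locally_compact unfolding locally_compact_space_def topspace_T by blast
  then obtain U C where UC: "\<And>x. x \<in> S \<Longrightarrow> openin T (U x) \<and> compactin T (C x) \<and> x \<in> U x \<and> U x \<subseteq> C x"
    by metis
  define V where "V x = {Y \<in> carrier (G Mod N). Y \<inter> U x \<noteq> {}}" for x
  have pre: "{y \<in> topspace T. quot_map G N y \<in> V x} = (\<Union>k\<in>N. {y \<in> topspace T. y \<otimes> k \<in> U x})" if "x \<in> S" for x
    by (auto simp: V_def quot_map_def topspace_T carrier_Mod l_coset_image)
  have Vo: "openin TQ (V x)" if x: "x \<in> S" for x
    unfolding openin_quot_topology pre[OF x]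
  proof
    show "V x \<subseteq> carrier (G Mod N)" by (auto simp: V_def)
    have "openin T {y \<in> topspace T. y \<otimes> k \<in> U x}" if "k \<in> N" for k
      using UC[OF x] N_mem[OF that] by (intro openin_continuous_map_preimage[of T T]) (auto intro!: group_continuous)
    then show "openin T (\<Union>k\<in>N. {y \<in> topspace T. y \<otimes> k \<in> U x})" by blast
  qed
  have "quot_map G N x \<in> V x" if "x \<in> S" for x
    using that UC[OF that] coset_mem[of x] S by (auto simp: V_def quot_map_def carrier_Mod)
  then have cov: "quot_map G N ` S \<subseteq> \<Union>(V ` S)" by blast
  have "\<And>W. W \<in> V ` S \<Longrightarrow> openin TQ W" using Vo by auto
  from compactinD[OF c this cov]
  obtain \<F> where F: "finite \<F>" "\<F> \<subseteq> V ` S" "quot_map G N ` S \<subseteq> \<Union>\<F>" by blast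
  obtain D where D: "finite D" "D \<subseteq> S" "\<F> = V ` D" using finite_subset_image[OF F(1,2)] by blast
  show thesis
  proof (rule that)
    show "compactin T (\<Union>(C ` D))" using D UC by (intro compactin_Union) auto
    fix x assume x: "x \<in> S"
    then obtain d where d: "d \<in> D" "quot_map G N x \<in> V d" using F(3) D(3) by blast
    then obtain k where k: "k \<in> N" "x \<otimes> k \<in> U d" by (auto simp: V_def quot_map_def l_coset_image)
    then show "\<exists>k\<in>N. x \<otimes> k \<in> \<Union>(C ` D)" using UC[of d] D(2) d(1) by blast
  qed
qed

subsection \<open>Averaging against a character\<close>

text \<open>For the trivial character this is the integral over the coset of \<open>x\<close>.\<close>

definition average :: "('a \<Rightarrow> complex) \<Rightarrow> ('a \<Rightarrow> complex) \<Rightarrow> 'a \<Rightarrow> complex" where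
  "average \<eta> f x = (\<integral>s. f (x \<otimes> s) * cnj (\<eta> s) \<partial>\<mu>N)"

abbreviation chars where "chars \<equiv> characters GN TN"

lemma char:
  assumes "\<eta> \<in> chars"
  shows "continuous_map TN euclidean \<eta>" "\<And>s. s \<in> N \<Longrightarrow> cmod (\<eta> s) = 1"
    "\<And>s t. s \<in> N \<Longrightarrow> t \<in> N \<Longrightarrow> \<eta> (s \<otimes> t) = \<eta> s * \<eta> t"
  using assms by (auto simp: characters_def circle_group_def hom_def)

lemma char_cnj: assumes "\<eta> \<in> chars" "s \<in> N" shows "\<eta> s * cnj (\<eta> s) = 1" "cnj (\<eta> s) * \<eta> s = 1"
  using char(2)[OF assms] complex_norm_square[of "\<eta> s"] by (simp_all add: mult.commute)

lemma char_inv: assumes "\<eta> \<in> chars" "s \<in> N" shows "\<eta> (inv s) = cnj (\<eta> s)"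
proof -
  have i: "inv s \<in> N" using assms(2) by (rule subgroup.m_inv_closed[OF subgroupN])
  have "\<eta> \<one> * \<eta> \<one> = \<eta> \<one>" using char(3)[OF assms(1), of \<one> \<one>] subgroup.one_closed[OF subgroupN] by simp
  moreover have "\<eta> \<one> \<noteq> 0" using char(2)[OF assms(1) subgroup.one_closed[OF subgroupN]] by auto
  ultimately have "\<eta> \<one> = 1" by simp
  then have "\<eta> s * \<eta> (inv s) = 1" using char(3)[OF assms i] N_mem[OF assms(2)] by simp
  then have "cnj (\<eta> s) * (\<eta> s * \<eta> (inv s)) = cnj (\<eta> s)" by simp
  then show ?thesis using char_cnj(2)[OF assms] by (simp add: mult.assoc[symmetric])
qed

lemma char_one: "(\<lambda>_. 1) \<in> chars"
  by (auto simp: characters_def circle_group_def hom_def)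

lemma average_integrand_continuous:
  assumes e: "\<eta> \<in> chars" and f: "f \<in> Cc T"
  shows "continuous_map (prod_topology T TN) euclidean (\<lambda>(x, s). f (x \<otimes> s) * cnj (\<eta> s))"
  unfolding case_prod_unfold
  by (intro continuous_map_mult continuous_map_comp2[OF Cc_continuous[OF f]] continuous_map_group_mult
      continuous_map_snd_N continuous_map_cnj continuous_map_comp2[OF char(1)[OF e]] continuous_map_fst continuous_map_snd)

lemma coset_support:
  assumes C: "compactin T C" and K: "compactin T K"
  obtains L where "compactin TN L" "\<And>x s. x \<in> C \<Longrightarrow> s \<in> N \<Longrightarrow> x \<otimes> s \<in> K \<Longrightarrow> s \<in> L"
proof
  let ?Q = "{x \<otimes> y |x y. x \<in> (\<lambda>x. inv x) ` C \<and> y \<in> K}"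
  show "compactin TN (N \<inter> ?Q)" by (intro compactin_N compactin_mult compactin_inv C K)
  fix x s assume x: "x \<in> C" and s: "s \<in> N" "x \<otimes> s \<in> K"
  have "s = inv x \<otimes> (x \<otimes> s)" using x compactin_carrier[OF C] N_mem[OF s(1)] by (auto simp flip: m_assoc)
  then show "s \<in> N \<inter> ?Q" using x s by blast
qed

lemma average_continuous:
  assumes e: "\<eta> \<in> chars" and f: "f \<in> Cc T"
  shows "continuous_map T euclidean (average \<eta> f)"
  unfolding average_def
proof (rule N.continuous_integral_param[OF average_integrand_continuous[OF e f]])
  fix x assume "x \<in> topspace T"
  then obtain U C where UC: "openin T U" "compactin T C" "x \<in> U" "U \<subseteq> C"
    using compact_neighbourhood[of x] by (auto simp: topspace_T)
  obtain K where K: "compactin T K" "\<And>x. x \<in> topspace T \<Longrightarrow> f x \<noteq> 0 \<Longrightarrow> x \<in> K"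
    using f by (rule CcE) blast
  obtain L where L: "compactin TN L" "\<And>x s. x \<in> C \<Longrightarrow> s \<in> N \<Longrightarrow> x \<otimes> s \<in> K \<Longrightarrow> s \<in> L"
    using coset_support[OF UC(2) K(1)] by metis
  have "f (y \<otimes> s) * cnj (\<eta> s) = 0" if "y \<in> U" "s \<in> topspace TN - L" for y s
  proof -
    have y: "y \<in> C" "y \<in> carrier G" "s \<in> N" using that UC(4) compactin_carrier[OF UC(2)] by (auto simp: topspace_TN)
    then have "y \<otimes> s \<notin> K" using L(2) that(2) by blast
    then show ?thesis using K(2)[of "y \<otimes> s"] y N_mem by (auto simp: topspace_T)
  qed
  then show "\<exists>U L. openin T U \<and> x \<in> U \<and> compactin TN L \<and> L \<in> sets \<mu>N \<and> emeasure \<mu>N L < \<infinity> \<and>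
      (\<forall>x\<in>U. \<forall>y\<in>topspace TN - L. f (x \<otimes> y) * cnj (\<eta> y) = 0)"
    using UC L(1) N.compact_sets[OF L(1)] N.compact_finite[OF L(1)] by blast
qed

lemma average_integrand_Cc:
  assumes e: "\<eta> \<in> chars" and f: "f \<in> Cc T" and x: "x \<in> carrier G"
  shows "(\<lambda>s. f (x \<otimes> s) * cnj (\<eta> s)) \<in> Cc TN"
proof -
  obtain K where K: "compactin T K" "\<And>x. x \<in> topspace T \<Longrightarrow> f x \<noteq> 0 \<Longrightarrow> x \<in> K"
    using f by (rule CcE) blast
  have "compactin T {x}" using x by (simp add: topspace_T)
  then obtain L where L: "compactin TN L" "\<And>y s. y \<in> {x} \<Longrightarrow> s \<in> N \<Longrightarrow> y \<otimes> s \<in> K \<Longrightarrow> s \<in> L"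
    using coset_support[OF _ K(1), of "{x}"] by metis
  have "continuous_map TN euclidean (\<lambda>s. f (x \<otimes> s) * cnj (\<eta> s))"
    using continuous_map_slice[OF average_integrand_continuous[OF e f]] x by (simp add: topspace_T)
  then show ?thesis
  proof (rule CcI[OF _ L(1)])
    fix s assume s: "s \<in> topspace TN" "s \<notin> L"
    then have "x \<otimes> s \<notin> K" "s \<in> N" using L(2)[of x s] by (auto simp: topspace_TN)
    then show "f (x \<otimes> s) * cnj (\<eta> s) = 0" using K(2)[of "x \<otimes> s"] x N_mem by (auto simp: topspace_T)
  qed
qed

lemma average_covariant:
  assumes e: "\<eta> \<in> chars" and f: "f \<in> Cc T" and x: "x \<in> carrier G" and k: "k \<in> N"
  shows "average \<eta> f (x \<otimes> k) = \<eta> k * average \<eta> f x"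
proof -
  let ?\<phi> = "\<lambda>s. f (x \<otimes> s) * cnj (\<eta> (inv k \<otimes> s))"
  have ki: "inv k \<in> N" using k by (rule subgroup.m_inv_closed[OF subgroupN])
  have eq: "?\<phi> s = \<eta> k * (f (x \<otimes> s) * cnj (\<eta> s))" if "s \<in> N" for s
    using char(3)[OF e ki that] char_inv[OF e k] by simp
  have m: "?\<phi> \<in> borel_measurable \<mu>N"
  proof -
    have "(\<lambda>s. \<eta> k * (f (x \<otimes> s) * cnj (\<eta> s))) \<in> borel_measurable \<mu>N"
      by (intro N.continuous_measurable Cc_continuous Cc_scale average_integrand_Cc e f x)
    also have "?this \<longleftrightarrow> ?thesis" by (rule measurable_cong) (simp only: space_N eq)
    finally show ?thesis .
  qed
  have "average \<eta> f (x \<otimes> k) = (\<integral>s. ?\<phi> (k \<otimes> s) \<partial>\<mu>N)"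
    unfolding average_def
  proof (rule Bochner_Integration.integral_cong[OF refl])
    fix s assume "s \<in> space \<mu>N"
    then have s: "s \<in> N" by (simp add: space_N)
    have c: "x \<in> carrier G" "k \<in> carrier G" "s \<in> carrier G" using x k s N_mem by auto
    then have "x \<otimes> k \<otimes> s = x \<otimes> (k \<otimes> s)" "inv k \<otimes> (k \<otimes> s) = s" by (simp add: m_assoc) (simp flip: m_assoc add: c)
    then show "f (x \<otimes> k \<otimes> s) * cnj (\<eta> s) = ?\<phi> (k \<otimes> s)" by simp
  qed
  also have "\<dots> = (\<integral>s. ?\<phi> s \<partial>\<mu>N)" using N.integral_left[OF _ m, of k] k by simp
  also have "\<dots> = (\<integral>s. \<eta> k * (f (x \<otimes> s) * cnj (\<eta> s)) \<partial>\<mu>N)"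
    using eq by (intro Bochner_Integration.integral_cong) (auto simp: space_N)
  finally show ?thesis by (simp add: average_def)
qed

lemma average_one_invariant:
  "f \<in> Cc T \<Longrightarrow> x \<in> carrier G \<Longrightarrow> k \<in> N \<Longrightarrow> average (\<lambda>_. 1) f (x \<otimes> k) = average (\<lambda>_. 1) f x"
  using average_covariant[OF char_one] by simp

text \<open>A factor that is covariant along the coset can be pulled out. It turns an average against one
  character into an average against another one.\<close>

lemma average_mult:
  assumes "\<And>s. s \<in> N \<Longrightarrow> g (x \<otimes> s) * cnj (\<eta> s) = c * cnj (\<theta> s)"
  shows "average \<eta> (\<lambda>y. f y * g y) x = c * average \<theta> f x"
proof -
  have "average \<eta> (\<lambda>y. f y * g y) x = (\<integral>s. c * (f (x \<otimes> s) * cnj (\<theta> s)) \<partial>\<mu>N)"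
    unfolding average_def
    by (rule Bochner_Integration.integral_cong[OF refl]) (use assms in \<open>simp add: space_N mult_ac\<close>)
  then show ?thesis by (simp add: average_def)
qed

lemma average_add:
  assumes "\<eta> \<in> chars" "f \<in> Cc T" "g \<in> Cc T" "x \<in> carrier G"
  shows "average \<eta> (\<lambda>y. f y + g y) x = average \<eta> f x + average \<eta> g x"
  unfolding average_def distrib_right
  by (intro Bochner_Integration.integral_add N.Cc_integrable average_integrand_Cc assms)

lemma average_scale: "average \<eta> (\<lambda>y. c * f y) x = c * average \<eta> f x"
  by (simp add: average_def mult.assoc)

text \<open>For these functions the inner integral exists on every coset, and the completions of the
  measures on \<open>G\<close> and \<open>N\<close> can be dropped.\<close>

lemma weil_Cc:
  assumes f: "f \<in> Cc T"
  shows "integrable (completion \<mu>Q) (on_coset (average (\<lambda>_. 1) f))"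
    "(\<integral>Y. on_coset (average (\<lambda>_. 1) f) Y \<partial>completion \<mu>Q) = (\<integral>x. f x \<partial>\<mu>G)"
proof -
  have i: "integrable (completion \<mu>G) f" by (rule completed.Cc_integrable[OF f])
  have "on_coset (\<lambda>x. LINT s|completion \<mu>N. f (x \<otimes> s)) Y = on_coset (average (\<lambda>_. 1) f) Y"
    if "Y \<in> space (completion \<mu>Q)" for Y
  proof (rule on_coset_cong)
    fix x assume x: "x \<in> carrier G"
    have "(\<lambda>s. f (x \<otimes> s)) \<in> borel_measurable \<mu>N"
      using N.continuous_measurable[OF Cc_continuous[OF average_integrand_Cc[OF char_one f x]]] by simp
    then show "(LINT s|completion \<mu>N. f (x \<otimes> s)) = average (\<lambda>_. 1) f x"
      by (simp add: average_def integral_completion)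
  qed (use that in \<open>simp add: space_Q\<close>)
  note eq = this
  have w: "integrable (completion \<mu>Q) (on_coset (\<lambda>x. LINT s|completion \<mu>N. f (x \<otimes> s)))"
    "(LINT Y|completion \<mu>Q. on_coset (\<lambda>x. LINT s|completion \<mu>N. f (x \<otimes> s)) Y) = (LINT x|completion \<mu>G. f x)"
    using weil i unfolding weil_formula_def by blast+
  have "integrable (completion \<mu>Q) (on_coset (\<lambda>x. LINT s|completion \<mu>N. f (x \<otimes> s))) \<longleftrightarrow>
      integrable (completion \<mu>Q) (on_coset (average (\<lambda>_. 1) f))"
    by (rule Bochner_Integration.integrable_cong[OF refl eq])
  then show "integrable (completion \<mu>Q) (on_coset (average (\<lambda>_. 1) f))" using w(1) by blast
  have "(\<integral>Y. on_coset (average (\<lambda>_. 1) f) Y \<partial>completion \<mu>Q) =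
      (LINT Y|completion \<mu>Q. on_coset (\<lambda>x. LINT s|completion \<mu>N. f (x \<otimes> s)) Y)"
    by (rule Bochner_Integration.integral_cong[OF refl eq[symmetric]])
  also have "\<dots> = (LINT x|completion \<mu>G. f x)" by (rule w(2))
  also have "\<dots> = (\<integral>x. f x \<partial>\<mu>G)"
    using continuous_measurable[OF Cc_continuous[OF f]] by (rule integral_completion)
  finally show "(\<integral>Y. on_coset (average (\<lambda>_. 1) f) Y \<partial>completion \<mu>Q) = (\<integral>x. f x \<partial>\<mu>G)" .
qed

text \<open>Both sides are the integral over the quotient of the product of the two averages.\<close>

lemma average_symmetric:
  assumes f: "f \<in> Cc T" and h: "h \<in> Cc T"
  shows "(\<integral>x. f x * average (\<lambda>_. 1) h x \<partial>\<mu>G) = (\<integral>x. h x * average (\<lambda>_. 1) f x \<partial>\<mu>G)"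
proof -
  let ?P = "average (\<lambda>_. 1)"
  note c = average_continuous[OF char_one]
  have 1: "(\<lambda>x. f x * ?P h x) \<in> Cc T" "(\<lambda>x. h x * ?P f x) \<in> Cc T" by (intro Cc_mult c f h)+
  have "?P (\<lambda>x. f x * ?P h x) x = ?P (\<lambda>x. h x * ?P f x) x" if x: "x \<in> carrier G" for x
  proof -
    have "?P (\<lambda>x. f x * ?P h x) x = ?P h x * ?P f x"
      by (rule average_mult) (simp add: average_one_invariant h x)
    moreover have "?P (\<lambda>x. h x * ?P f x) x = ?P f x * ?P h x"
      by (rule average_mult) (simp add: average_one_invariant f x)
    ultimately show ?thesis by (simp add: mult.commute)
  qed
  then have "(\<integral>Y. on_coset (?P (\<lambda>x. f x * ?P h x)) Y \<partial>completion \<mu>Q) =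
      (\<integral>Y. on_coset (?P (\<lambda>x. h x * ?P f x)) Y \<partial>completion \<mu>Q)"
    by (intro Bochner_Integration.integral_cong on_coset_cong) (auto simp: space_Q)
  then show ?thesis using weil_Cc(2)[OF 1(1)] weil_Cc(2)[OF 1(2)] by simp
qed

end

text \<open>At a zero of \<open>P\<close> the numerator vanishes in a neighbourhood, and so does the quotient since
  \<open>0 / 0 = 0\<close>.\<close>

lemma continuous_map_divide_support:
  fixes f P :: "'a \<Rightarrow> complex"
  assumes f: "continuous_map T euclidean f" and P: "continuous_map T euclidean P" and S: "closedin T S"
    and z: "\<And>x. x \<in> topspace T - S \<Longrightarrow> f x = 0" and nz: "\<And>x. x \<in> S \<Longrightarrow> P x \<noteq> 0"
  shows "continuous_map T euclidean (\<lambda>x. f x / P x)"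
  unfolding continuous_map_atin limitin_canonical_iff
proof
  fix x assume x: "x \<in> topspace T"
  show "((\<lambda>x. f x / P x) \<longlongrightarrow> f x / P x) (atin T x)"
  proof (cases "P x = 0")
    case False
    then show ?thesis using f P x by (auto simp: continuous_map_atin intro!: tendsto_divide)
  next
    case True
    then have "x \<in> topspace T - S" "openin T (topspace T - S)" using nz x S by (auto simp: closedin_def)
    then have "\<forall>\<^sub>F y in atin T x. f y / P y = 0"
      unfolding eventually_atin using z by (intro disjI2 exI[of _ "topspace T - S"]) auto
    then show ?thesis using True by (simp add: tendsto_eventually)
  qed
qed

context coset_integration
begin

subsection \<open>Lifting covariant functions\<close>

lemma C_xiD:
  assumes "\<psi> \<in> C_xi G T N \<eta>"
  shows "continuous_map T euclidean \<psi>" "\<psi> \<in> extensional (carrier G)"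
    "compactin TQ (quot_map G N ` (T closure_of {x \<in> carrier G. \<psi> x \<noteq> 0}))"
    "\<And>x k. x \<in> carrier G \<Longrightarrow> k \<in> N \<Longrightarrow> \<psi> (x \<otimes> k) = \<eta> k * \<psi> x"
  using assms by (auto simp: C_xi_def)

text \<open>A bump function that is one on \<open>K\<close> has a positive integral over each coset that meets \<open>K\<close>.\<close>

lemma positive_average:
  assumes K: "compactin T K"
  obtains h p :: "'a \<Rightarrow> real" where "(\<lambda>x. complex_of_real (h x)) \<in> Cc T" "\<And>x. 0 \<le> h x"
    "\<And>x. average (\<lambda>_. 1) (\<lambda>x. complex_of_real (h x)) x = complex_of_real (p x)" "\<And>x. 0 \<le> p x"
    "\<And>x k. x \<in> carrier G \<Longrightarrow> k \<in> N \<Longrightarrow> x \<otimes> k \<in> K \<Longrightarrow> p x > 0"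
proof -
  obtain h :: "'a \<Rightarrow> real" where h: "continuous_map T euclidean h" "\<And>x. 0 \<le> h x" "\<And>x. h x \<le> 1"
    "\<And>x. x \<in> K \<Longrightarrow> h x = 1" "(\<lambda>x. complex_of_real (h x)) \<in> Cc T"
    by (rule bump[OF K]) (rule that; assumption)
  define p where "p x = (\<integral>s. h (x \<otimes> s) \<partial>\<mu>N)" for x
  show thesis
  proof (rule that[of h p])
    show "(\<lambda>x. complex_of_real (h x)) \<in> Cc T" "\<And>x. 0 \<le> h x" by (rule h)+
    show "average (\<lambda>_. 1) (\<lambda>x. complex_of_real (h x)) x = complex_of_real (p x)" for x
      by (simp add: average_def p_def integral_complex_of_real)
    show "0 \<le> p x" for x by (simp add: p_def integral_nonneg h(2))
    fix x k assume x: "x \<in> carrier G" and k: "k \<in> N" "x \<otimes> k \<in> K"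
    have C: "(\<lambda>s. complex_of_real (h (x \<otimes> s))) \<in> Cc TN"
      using average_integrand_Cc[OF char_one h(5) x] by simp
    have "continuous_map TN T (\<lambda>s. x \<otimes> s)"
      by (intro continuous_map_N continuous_map_group_mult continuous_map_const_T continuous_map_id_T x)
    then have "continuous_map TN euclidean (\<lambda>s. h (x \<otimes> s))" by (rule continuous_map_comp2[OF h(1)])
    moreover have "integrable \<mu>N (\<lambda>s. h (x \<otimes> s))"
      using N.Cc_integrable[OF C] by (simp add: complex_of_real_integrable_eq)
    ultimately show "p x > 0"
      unfolding p_def using h(2) h(4)[OF k(2)] k(1) by (intro N.integral_pos[where x = k]) auto
  qed
qed

definition coset_norm :: "('a \<Rightarrow> complex) \<Rightarrow> real" where
  "coset_norm \<psi> = (\<integral>Y. on_coset (\<lambda>y. cmod (\<psi> y)) Y \<partial>\<mu>Q)"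

lemma cmod_covariant:
  assumes "\<eta> \<in> chars" "\<psi> \<in> C_xi G T N \<eta>" "x \<in> carrier G" "k \<in> N"
  shows "cmod (\<psi> (x \<otimes> k)) = cmod (\<psi> x)"
  using C_xiD(4)[OF assms(2-4)] char(2)[OF assms(1,4)] by (simp add: norm_mult)

lemma Cc_cmod: "f \<in> Cc T \<Longrightarrow> (\<lambda>x. complex_of_real (cmod (f x))) \<in> Cc T"
  by (force simp: Cc_def intro: continuous_map_of_real continuous_map_norm)

text \<open>The preimage is \<open>h \<psi> / p\<close>, where \<open>p\<close> is the average of a bump function \<open>h\<close> and is positive on the
  support of \<open>\<psi>\<close>. Being constant on cosets up to the character, \<open>\<psi> / p\<close> can be pulled out of the average.
  The modulus of the preimage averages to the modulus of \<open>\<psi>\<close>, and Weil's formula gives the norm.\<close>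

lemma covariant_lift:
  assumes e: "\<eta> \<in> chars" and psi: "\<psi> \<in> C_xi G T N \<eta>"
  obtains f where "f \<in> Cc T" "\<And>x. x \<in> carrier G \<Longrightarrow> average \<eta> f x = \<psi> x"
    "(\<integral>x. cmod (f x) \<partial>\<mu>G) = coset_norm \<psi>" "integrable \<mu>Q (on_coset (\<lambda>y. cmod (\<psi> y)))"
proof -
  define S where "S = T closure_of {x \<in> carrier G. \<psi> x \<noteq> 0}"
  have S: "closedin T S" "S \<subseteq> carrier G"
    using closure_of_subset_topspace[of T] topspace_T by (auto simp: S_def)
  have psiS: "\<psi> x = 0" if "x \<in> carrier G" "x \<notin> S" for x
    using closure_of_subset[of "{x \<in> carrier G. \<psi> x \<noteq> 0}" T] that topspace_T by (auto simp: S_def)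
  obtain K where K: "compactin T K" "\<And>x. x \<in> S \<Longrightarrow> \<exists>k\<in>N. x \<otimes> k \<in> K"
    by (rule compact_lift[OF S(2) C_xiD(3)[OF psi, folded S_def]]) (rule that; assumption)
  obtain h p :: "'a \<Rightarrow> real" where h: "(\<lambda>x. complex_of_real (h x)) \<in> Cc T" "\<And>x. 0 \<le> h x"
    "\<And>x. average (\<lambda>_. 1) (\<lambda>x. complex_of_real (h x)) x = complex_of_real (p x)" "\<And>x. 0 \<le> p x"
    "\<And>x k. x \<in> carrier G \<Longrightarrow> k \<in> N \<Longrightarrow> x \<otimes> k \<in> K \<Longrightarrow> p x > 0"
    by (rule positive_average[OF K(1)]) (rule that; assumption)
  have pS: "p x > 0" if "x \<in> S" for x using K(2)[OF that] h(5) S(2) that by blast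
  have pinv: "p (x \<otimes> k) = p x" if "x \<in> carrier G" "k \<in> N" for x k
    using average_one_invariant[OF h(1) that] by (simp add: h(3))
  have pc: "continuous_map T euclidean (\<lambda>x. complex_of_real (p x))"
    using average_continuous[OF char_one h(1)] by (simp add: h(3)[abs_def])
  define f where "f x = complex_of_real (h x) * (\<psi> x / complex_of_real (p x))" for x
  have qc: "continuous_map T euclidean (\<lambda>x. \<psi> x / complex_of_real (p x))"
    using psiS pS by (intro continuous_map_divide_support[OF C_xiD(1)[OF psi] pc S(1)]) (force simp: topspace_T)+
  have fC: "f \<in> Cc T" unfolding f_def by (rule Cc_mult[OF h(1) qc])
  have av: "average \<eta> f x = \<psi> x" if x: "x \<in> carrier G" for x
  proof -
    have "average \<eta> f x = (\<psi> x / p x) * average (\<lambda>_. 1) (\<lambda>x. complex_of_real (h x)) x"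
      unfolding f_def
    proof (rule average_mult)
      fix s assume s: "s \<in> N"
      show "\<psi> (x \<otimes> s) / complex_of_real (p (x \<otimes> s)) * cnj (\<eta> s) = \<psi> x / complex_of_real (p x) * cnj 1"
        using C_xiD(4)[OF psi x s] pinv[OF x s] char_cnj(1)[OF e s] by (simp add: mult_ac)
    qed
    also have "\<dots> = \<psi> x" using psiS[OF x] pS[of x] by (cases "x \<in> S") (auto simp: h(3))
    finally show ?thesis .
  qed
  have cf: "complex_of_real (cmod (f x)) = complex_of_real (h x) * complex_of_real (cmod (\<psi> x) / p x)" for x
    using h(2)[of x] h(4)[of x] by (simp add: f_def norm_mult norm_divide)
  have avn: "average (\<lambda>_. 1) (\<lambda>x. complex_of_real (cmod (f x))) x = complex_of_real (cmod (\<psi> x))"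
    if x: "x \<in> carrier G" for x
  proof -
    have "average (\<lambda>_. 1) (\<lambda>x. complex_of_real (cmod (f x))) x =
        complex_of_real (cmod (\<psi> x) / p x) * average (\<lambda>_. 1) (\<lambda>x. complex_of_real (h x)) x"
      unfolding cf
      by (rule average_mult) (simp add: cmod_covariant[OF e psi x] pinv[OF x])
    also have "\<dots> = complex_of_real (cmod (\<psi> x))" using psiS[OF x] pS[of x] by (cases "x \<in> S") (auto simp: h(3))
    finally show ?thesis .
  qed
  have oc: "on_coset (average (\<lambda>_. 1) (\<lambda>x. complex_of_real (cmod (f x)))) Y = complex_of_real (on_coset (\<lambda>y. cmod (\<psi> y)) Y)"
    if Y: "Y \<in> space (completion \<mu>Q)" for Y
  proof -
    obtain x where x: "x \<in> carrier G" "Y = x <# N" using Y by (auto simp: space_Q carrier_Mod)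
    have "on_coset (\<lambda>y. cmod (\<psi> y)) Y = cmod (\<psi> x)"
      unfolding x(2) by (rule on_coset[where f = "\<lambda>y. cmod (\<psi> y)", OF _ x(1)]) (rule cmod_covariant[OF e psi])
    moreover have "on_coset (average (\<lambda>_. 1) (\<lambda>x. complex_of_real (cmod (f x)))) Y = complex_of_real (cmod (\<psi> x))"
      unfolding x(2) avn[OF x(1), symmetric]
      by (rule on_coset[OF average_one_invariant[OF Cc_cmod[OF fC]] x(1)])
    ultimately show ?thesis by simp
  qed
  note w = weil_Cc[OF Cc_cmod[OF fC]]
  have "continuous_map TQ euclidean (on_coset (\<lambda>y. cmod (\<psi> y)))"
    using C_xiD(1)[OF psi] cmod_covariant[OF e psi] by (intro on_coset_continuous continuous_map_norm)
  then have m: "on_coset (\<lambda>y. cmod (\<psi> y)) \<in> borel_measurable \<mu>Q"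
    by (rule borel_top.continuous_measurable[OF borel_top_Q])
  have "integrable (completion \<mu>Q) (\<lambda>Y. complex_of_real (on_coset (\<lambda>y. cmod (\<psi> y)) Y))"
  proof -
    have "integrable (completion \<mu>Q) (on_coset (average (\<lambda>_. 1) (\<lambda>x. complex_of_real (cmod (f x))))) \<longleftrightarrow>
        integrable (completion \<mu>Q) (\<lambda>Y. complex_of_real (on_coset (\<lambda>y. cmod (\<psi> y)) Y))"
      by (rule Bochner_Integration.integrable_cong[OF refl oc])
    then show ?thesis using w(1) by blast
  qed
  then have i: "integrable (completion \<mu>Q) (on_coset (\<lambda>y. cmod (\<psi> y)))" by (simp only: complex_of_real_integrable_eq)
  have "complex_of_real (\<integral>x. cmod (f x) \<partial>\<mu>G) = (\<integral>x. complex_of_real (cmod (f x)) \<partial>\<mu>G)"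
    by (rule integral_complex_of_real[symmetric])
  also have "\<dots> = (\<integral>Y. complex_of_real (on_coset (\<lambda>y. cmod (\<psi> y)) Y) \<partial>completion \<mu>Q)"
    unfolding w(2)[symmetric] by (rule Bochner_Integration.integral_cong[OF refl oc])
  also have "\<dots> = complex_of_real (\<integral>Y. on_coset (\<lambda>y. cmod (\<psi> y)) Y \<partial>completion \<mu>Q)"
    by (rule integral_complex_of_real)
  also have "(\<integral>Y. on_coset (\<lambda>y. cmod (\<psi> y)) Y \<partial>completion \<mu>Q) = coset_norm \<psi>"
    unfolding coset_norm_def by (rule integral_completion[OF m])
  finally have n: "(\<integral>x. cmod (f x) \<partial>\<mu>G) = coset_norm \<psi>" using of_real_eq_iff by blast
  have "integrable \<mu>Q (on_coset (\<lambda>y. cmod (\<psi> y)))" using i integrable_completion[OF m] by blast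
  then show thesis using that[OF fC av n] by blast
qed

text \<open>The tube lemma, for the open set of all \<open>(a, y)\<close> such that \<open>inv a \<otimes> y\<close> is not in \<open>N\<close>, separates a
  point from the product of a compact set with the closed subgroup \<open>N\<close>.\<close>

lemma saturation_closed:
  assumes K: "compactin T K" shows "closedin T {x \<in> carrier G. \<exists>k\<in>N. x \<otimes> k \<in> K}" (is "closedin T ?S")
proof -
  have "openin T (topspace T - ?S)"
  proof (subst openin_subopen, intro ballI)
    fix x assume "x \<in> topspace T - ?S"
    then have x: "x \<in> carrier G" "\<And>k. k \<in> N \<Longrightarrow> x \<otimes> k \<notin> K" by (auto simp: topspace_T)
    have KG: "K \<subseteq> carrier G" by (rule compactin_carrier[OF K])
    define W where "W = {z \<in> topspace (prod_topology T T). inv (fst z) \<otimes> snd z \<in> topspace T - N}"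
    have "openin (prod_topology T T) W"
      unfolding W_def
    proof (rule openin_continuous_map_preimage)
      show "continuous_map (prod_topology T T) T (\<lambda>z. inv (fst z) \<otimes> snd z)" by (intro group_continuous)
      show "openin T (topspace T - N)" using closedN by blast
    qed
    moreover have "K \<times> {x} \<subseteq> W"
    proof
      fix z assume "z \<in> K \<times> {x}"
      then obtain a where a: "z = (a, x)" "a \<in> K" by auto
      have aG: "a \<in> carrier G" using a(2) KG by blast
      have "inv a \<otimes> x \<notin> N"
      proof
        assume n: "inv a \<otimes> x \<in> N"
        then have "inv (inv a \<otimes> x) \<in> N" by (rule subgroup.m_inv_closed[OF subgroupN])
        moreover have "x \<otimes> inv (inv a \<otimes> x) = a" using x aG by (simp add: inv_mult_group flip: m_assoc)
        ultimately show False using x(2) a(2) by metis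
      qed
      then show "z \<in> W" using a aG x by (simp add: W_def topspace_T)
    qed
    ultimately obtain U V where UV: "openin T U" "openin T V" "K \<subseteq> U" "x \<in> V" "U \<times> V \<subseteq> W"
      using tube_lemma_left[OF _ K, of T W x] x(1) by (auto simp: topspace_T)
    have "V \<subseteq> topspace T - ?S"
    proof
      fix y assume y: "y \<in> V"
      then have yG: "y \<in> carrier G" using openin_subset[OF UV(2)] by (auto simp: topspace_T)
      have "y \<otimes> k \<notin> K" if k: "k \<in> N" for k
      proof
        assume "y \<otimes> k \<in> K"
        then have "(y \<otimes> k, y) \<in> W" using UV y by blast
        then have "inv (y \<otimes> k) \<otimes> y \<notin> N" by (simp add: W_def)
        moreover have "inv (y \<otimes> k) \<otimes> y = inv k" using yG N_mem[OF k] by (simp add: inv_mult_group m_assoc)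
        ultimately show False using subgroup.m_inv_closed[OF subgroupN k] by simp
      qed
      then show "y \<in> topspace T - ?S" using yG by (auto simp: topspace_T)
    qed
    then show "\<exists>V. openin T V \<and> x \<in> V \<and> V \<subseteq> topspace T - ?S" using UV by blast
  qed
  then show ?thesis by (auto simp: closedin_def topspace_T)
qed

lemma quot_map_continuous: "continuous_map T TQ (quot_map G N)"
  unfolding continuous_map_def
  by (auto simp: topspace_TQ topspace_T quot_map_def carrier_Mod openin_quot_topology)

text \<open>The average vanishes outside of \<open>KN\<close>, where \<open>K\<close> carries \<open>f\<close>. Its support is closed, contained in \<open>KN\<close> and a
  union of cosets, so its image in the quotient is the image of a compact subset of \<open>K\<close>.\<close>

lemma average_C_xi:
  assumes e: "\<eta> \<in> chars" and f: "f \<in> Cc T"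
  shows "(\<lambda>x\<in>carrier G. average \<eta> f x) \<in> C_xi G T N \<eta>"
proof -
  let ?a = "\<lambda>x\<in>carrier G. average \<eta> f x"
  obtain K where K: "compactin T K" "\<And>x. x \<in> topspace T \<Longrightarrow> f x \<noteq> 0 \<Longrightarrow> x \<in> K"
    using f by (rule CcE) blast
  let ?S = "{x \<in> carrier G. \<exists>k\<in>N. x \<otimes> k \<in> K}"
  define A where "A = {x \<in> carrier G. ?a x \<noteq> 0}"
  have cov: "?a (x \<otimes> k) = \<eta> k * ?a x" if "x \<in> carrier G" "k \<in> N" for x k
    using average_covariant[OF e f that] that N_mem by simp
  have "average \<eta> f x = 0" if x: "x \<in> carrier G" "x \<notin> ?S" for x
  proof -
    have "f (x \<otimes> s) * cnj (\<eta> s) = 0" if s: "s \<in> N" for s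
    proof -
      have "x \<otimes> s \<notin> K" using x s by blast
      then show ?thesis using K(2)[of "x \<otimes> s"] x(1) N_mem[OF s] by (auto simp: topspace_T)
    qed
    then have "average \<eta> f x = (\<integral>s. 0 \<partial>\<mu>N)"
      unfolding average_def by (intro Bochner_Integration.integral_cong) (auto simp: space_N)
    then show ?thesis by simp
  qed
  then have "A \<subseteq> ?S" by (auto simp: A_def)
  then have clS: "T closure_of A \<subseteq> ?S" by (rule closure_of_minimal[OF _ saturation_closed[OF K(1)]])
  have sat: "x \<otimes> k \<in> T closure_of A" if x: "x \<in> T closure_of A" and k: "k \<in> N" for x k
  proof -
    have "continuous_map T T (\<lambda>x. x \<otimes> k)" using N_mem[OF k] by (intro group_continuous)
    from continuous_map_image_closure_subset[OF this, of A] x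
    have "x \<otimes> k \<in> T closure_of ((\<lambda>x. x \<otimes> k) ` A)" by blast
    moreover have "(\<lambda>x. x \<otimes> k) ` A \<subseteq> A"
      using cov char(2)[OF e k] k N_mem[OF k] by (fastforce simp: A_def)
    ultimately show ?thesis using closure_of_mono by blast
  qed
  have "quot_map G N ` (T closure_of A) = quot_map G N ` (T closure_of A \<inter> K)"
  proof (intro equalityI subsetI)
    fix Y assume "Y \<in> quot_map G N ` (T closure_of A)"
    then obtain x where x: "x \<in> T closure_of A" "Y = x <# N" by (auto simp: quot_map_def)
    then obtain k where k: "k \<in> N" "x \<otimes> k \<in> K" and xG: "x \<in> carrier G" using clS by blast
    have "x <# N = (x \<otimes> k) <# N"
      using k(1) by (intro l_repr_independence[OF _ xG subgroupN]) (auto simp: l_coset_image)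
    then have "Y = quot_map G N (x \<otimes> k)" by (simp add: quot_map_def x(2))
    then show "Y \<in> quot_map G N ` (T closure_of A \<inter> K)" using sat[OF x(1) k(1)] k(2) by blast
  qed blast
  moreover have "compactin T (T closure_of A \<inter> K)" by (rule closed_Int_compactin[OF closedin_closure_of K(1)])
  ultimately have "compactin TQ (quot_map G N ` (T closure_of A))"
    using image_compactin[OF _ quot_map_continuous] by metis
  moreover have "continuous_map T euclidean ?a"
    by (rule continuous_map_eq[OF average_continuous[OF e f]]) (simp add: topspace_T)
  ultimately show ?thesis using cov unfolding C_xi_def A_def by auto
qed

text \<open>Pointwise, the modulus of the average is at most the average of the modulus.\<close>

lemma coset_norm_average:
  assumes e: "\<eta> \<in> chars" and f: "f \<in> Cc T"
  shows "coset_norm (\<lambda>x\<in>carrier G. average \<eta> f x) \<le> (\<integral>x. cmod (f x) \<partial>\<mu>G)"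
proof -
  let ?a = "\<lambda>x\<in>carrier G. average \<eta> f x"
  let ?f = "\<lambda>x. complex_of_real (cmod (f x))"
  note a = average_C_xi[OF e f]
  have i: "integrable \<mu>Q (on_coset (\<lambda>y. cmod (?a y)))" by (rule covariant_lift[OF e a])
  then have m: "on_coset (\<lambda>y. cmod (?a y)) \<in> borel_measurable \<mu>Q" by simp
  note w = weil_Cc[OF Cc_cmod[OF f]]
  have "coset_norm ?a = (\<integral>Y. on_coset (\<lambda>y. cmod (?a y)) Y \<partial>completion \<mu>Q)"
    unfolding coset_norm_def by (rule integral_completion[OF m, symmetric])
  also have "\<dots> \<le> (\<integral>Y. Re (on_coset (average (\<lambda>_. 1) ?f) Y) \<partial>completion \<mu>Q)"
  proof (rule integral_mono)
    show "integrable (completion \<mu>Q) (on_coset (\<lambda>y. cmod (?a y)))" using i integrable_completion[OF m] by blast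
    show "integrable (completion \<mu>Q) (\<lambda>Y. Re (on_coset (average (\<lambda>_. 1) ?f) Y))" using w(1) by (rule integrable_Re)
    fix Y assume "Y \<in> space (completion \<mu>Q)"
    then obtain x where x: "x \<in> carrier G" "Y = x <# N" by (auto simp: space_Q carrier_Mod)
    have 1: "on_coset (\<lambda>y. cmod (?a y)) Y = cmod (?a x)"
      unfolding x(2) by (rule on_coset[where f = "\<lambda>y. cmod (?a y)", OF _ x(1)]) (rule cmod_covariant[OF e a])
    have 2: "on_coset (average (\<lambda>_. 1) ?f) Y = average (\<lambda>_. 1) ?f x"
      unfolding x(2) by (rule on_coset[OF average_one_invariant[OF Cc_cmod[OF f]] x(1)])
    have "cmod (average \<eta> f x) \<le> (\<integral>s. cmod (f (x \<otimes> s) * cnj (\<eta> s)) \<partial>\<mu>N)"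
      unfolding average_def by (rule integral_norm_bound)
    also have "\<dots> = (\<integral>s. cmod (f (x \<otimes> s)) \<partial>\<mu>N)"
      using char(2)[OF e] by (intro Bochner_Integration.integral_cong) (auto simp: space_N norm_mult)
    also have "\<dots> = Re (average (\<lambda>_. 1) ?f x)" by (simp add: average_def integral_complex_of_real)
    finally show "on_coset (\<lambda>y. cmod (?a y)) Y \<le> Re (on_coset (average (\<lambda>_. 1) ?f) Y)"
      unfolding 1 2 using x(1) by simp
  qed
  also have "\<dots> = Re (\<integral>Y. on_coset (average (\<lambda>_. 1) ?f) Y \<partial>completion \<mu>Q)" using w(1) by (rule integral_Re)
  also have "\<dots> = (\<integral>x. cmod (f x) \<partial>\<mu>G)" unfolding w(2) by (simp add: integral_complex_of_real)
  finally show ?thesis .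
qed

subsection \<open>Functions in the kernel of the averaging map\<close>

text \<open>The substitution \<open>x \<mapsto> x s\<inverse>\<close> on \<open>G\<close> produces this form of the average.\<close>

definition right_average :: "('a \<Rightarrow> complex) \<Rightarrow> ('a \<Rightarrow> complex) \<Rightarrow> 'a \<Rightarrow> complex" where
  "right_average \<eta> f x = (\<integral>s. complex_of_real (1 / modular s) * \<eta> s * f (x \<otimes> inv s) \<partial>\<mu>N)"

lemma modular_nonzero: "s \<in> carrier G \<Longrightarrow> modular s \<noteq> 0"
  using modular(1)[of s] by simp

lemma right_integrand_continuous:
  assumes e: "\<eta> \<in> chars" and f: "f \<in> Cc T"
  shows "continuous_map (prod_topology T TN) euclidean
    (\<lambda>(x, s). complex_of_real (1 / modular s) * \<eta> s * f (x \<otimes> inv s))"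
proof -
  have "continuous_map TN euclidean (\<lambda>s. complex_of_real (1 / modular s))"
    using continuous_map_N[OF modular_continuous] modular_nonzero N_mem
    by (intro continuous_map_of_real continuous_map_cdivide) (auto simp: topspace_TN)
  then show ?thesis
    unfolding case_prod_unfold
    by (intro continuous_map_mult continuous_map_comp2[OF Cc_continuous[OF f]] continuous_map_group_mult
      continuous_map_group_inv continuous_map_snd_N continuous_map_comp2[OF char(1)[OF e]]
      continuous_map_comp2[OF _ continuous_map_snd] continuous_map_fst continuous_map_snd)
qed

lemma coset_support_inv:
  assumes C: "compactin T C" and K: "compactin T K"
  obtains L where "compactin TN L" "\<And>x s. x \<in> C \<Longrightarrow> s \<in> N \<Longrightarrow> x \<otimes> inv s \<in> K \<Longrightarrow> s \<in> L"
proof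
  let ?Q = "{x \<otimes> y |x y. x \<in> (\<lambda>x. inv x) ` K \<and> y \<in> C}"
  show "compactin TN (N \<inter> ?Q)" by (intro compactin_N compactin_mult compactin_inv C K)
  fix x s assume x: "x \<in> C" and s: "s \<in> N" "x \<otimes> inv s \<in> K"
  have "x \<in> carrier G" "s \<in> carrier G" using x compactin_carrier[OF C] N_mem[OF s(1)] by auto
  then have "s = inv (x \<otimes> inv s) \<otimes> x" by (simp add: inv_mult_group m_assoc)
  then show "s \<in> N \<inter> ?Q" using x s by blast
qed

lemma right_average_continuous:
  assumes e: "\<eta> \<in> chars" and f: "f \<in> Cc T"
  shows "continuous_map T euclidean (right_average \<eta> f)"
  unfolding right_average_def
proof (rule N.continuous_integral_param[OF right_integrand_continuous[OF e f]])
  fix x assume "x \<in> topspace T"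
  then obtain U C where UC: "openin T U" "compactin T C" "x \<in> U" "U \<subseteq> C"
    using compact_neighbourhood[of x] by (auto simp: topspace_T)
  obtain K where K: "compactin T K" "\<And>x. x \<in> topspace T \<Longrightarrow> f x \<noteq> 0 \<Longrightarrow> x \<in> K"
    using f by (rule CcE) blast
  obtain L where L: "compactin TN L" "\<And>x s. x \<in> C \<Longrightarrow> s \<in> N \<Longrightarrow> x \<otimes> inv s \<in> K \<Longrightarrow> s \<in> L"
    using coset_support_inv[OF UC(2) K(1)] by metis
  have "complex_of_real (1 / modular s) * \<eta> s * f (y \<otimes> inv s) = 0" if "y \<in> U" "s \<in> topspace TN - L" for y s
  proof -
    have y: "y \<in> C" "y \<in> carrier G" "s \<in> N" using that UC(4) compactin_carrier[OF UC(2)] by (auto simp: topspace_TN)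
    then have "y \<otimes> inv s \<notin> K" using L(2) that(2) by blast
    then show ?thesis using K(2)[of "y \<otimes> inv s"] y N_mem by (auto simp: topspace_T)
  qed
  then show "\<exists>U L. openin T U \<and> x \<in> U \<and> compactin TN L \<and> L \<in> sets \<mu>N \<and> emeasure \<mu>N L < \<infinity> \<and>
      (\<forall>x\<in>U. \<forall>s\<in>topspace TN - L. complex_of_real (1 / modular s) * \<eta> s * f (x \<otimes> inv s) = 0)"
    using UC L(1) N.compact_sets[OF L(1)] N.compact_finite[OF L(1)] by blast
qed

end

lemma continuous_map_Re:
  "continuous_map X euclidean f \<Longrightarrow> continuous_map X euclidean (\<lambda>x. Re (f x))"
  by (simp add: continuous_map_atin tendsto_Re)

context coset_integration
begin

text \<open>The exceptional locally null set may depend on \<open>k\<close>.\<close>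

definition covariant_ae :: "('a \<Rightarrow> complex) \<Rightarrow> ('a \<Rightarrow> complex) \<Rightarrow> bool" where
  "covariant_ae \<eta> w \<longleftrightarrow> (\<forall>k\<in>N. lae \<mu>G (\<lambda>x. w (x \<otimes> k) = cnj (\<eta> k) * w x))"

lemma weighted_integrable:
  assumes w: "loc_bounded (completion \<mu>G) w B" and f: "f \<in> Cc T"
  shows "integrable (completion \<mu>G) (\<lambda>x. f x * w x)" "cmod (\<integral>x. f x * w x \<partial>completion \<mu>G) \<le> B * (\<integral>x. cmod (f x) \<partial>\<mu>G)"
proof -
  obtain K where K: "compactin T K" "\<And>x. x \<in> topspace T \<Longrightarrow> f x \<noteq> 0 \<Longrightarrow> x \<in> K"
    using f by (rule CcE) blast
  have s: "x \<in> K" if "x \<in> space (completion \<mu>G)" "f x \<noteq> 0" for x using that K(2) by (simp add: space_M)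
  note l = loc_bounded_integrable[OF w completed.Cc_integrable[OF f] completed.compact_sets[OF K(1)] completed.compact_finite[OF K(1)] s]
  show "integrable (completion \<mu>G) (\<lambda>x. f x * w x)" by (rule l)
  have "(\<lambda>x. cmod (f x)) \<in> borel_measurable \<mu>G"
    using continuous_measurable[OF Cc_continuous[OF f]] by simp
  then have "(\<integral>x. cmod (f x) \<partial>completion \<mu>G) = (\<integral>x. cmod (f x) \<partial>\<mu>G)" by (rule integral_completion)
  then show "cmod (\<integral>x. f x * w x \<partial>completion \<mu>G) \<le> B * (\<integral>x. cmod (f x) \<partial>\<mu>G)" using l(2) by simp
qed

text \<open>Fubini's theorem moves the integration over \<open>N\<close> outside; there the substitution
  \<open>x \<mapsto> x s\<inverse>\<close> uses the covariance of \<open>w\<close> for one \<open>s\<close> at a time, so that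
  the exceptional null set may depend on \<open>s\<close>.\<close>

lemma covariant_adjoint:
  assumes e: "\<eta> \<in> chars" and w: "loc_bounded (completion \<mu>G) w B" and cov: "covariant_ae \<eta> w"
    and f: "f \<in> Cc T" and h: "h \<in> Cc T"
  shows "(\<integral>x. f x * average (\<lambda>_. 1) h x * w x \<partial>completion \<mu>G) =
    (\<integral>x. h x * right_average \<eta> f x * w x \<partial>completion \<mu>G)"
proof -
  let ?M = "completion \<mu>G"
  obtain K where K: "compactin T K" "\<And>x. x \<in> topspace T \<Longrightarrow> f x \<noteq> 0 \<Longrightarrow> x \<in> K"
    using f by (rule CcE) blast
  obtain H where H: "compactin T H" "\<And>x. x \<in> topspace T \<Longrightarrow> h x \<noteq> 0 \<Longrightarrow> x \<in> H"
    using h by (rule CcE) blast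
  obtain L1 where L1: "compactin TN L1" "\<And>x s. x \<in> K \<Longrightarrow> s \<in> N \<Longrightarrow> x \<otimes> s \<in> H \<Longrightarrow> s \<in> L1"
    using coset_support[OF K(1) H(1)] by metis
  obtain L2 where L2: "compactin TN L2" "\<And>x s. x \<in> H \<Longrightarrow> s \<in> N \<Longrightarrow> x \<otimes> inv s \<in> K \<Longrightarrow> s \<in> L2"
    using coset_support_inv[OF H(1) K(1)] by metis
  define F1 where "F1 x s = f x * h (x \<otimes> s)" for x s
  define F2 where "F2 x s = h x * (complex_of_real (1 / modular s) * \<eta> s * f (x \<otimes> inv s))" for x s
  have wi: "integrable ?M (\<lambda>x. indicator C x *\<^sub>R w x)" if C: "compactin T C" for C
  proof -
    have "integrable ?M (\<lambda>x. indicator C x * w x)"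
      by (rule loc_bounded_integrable(1)[OF w integrable_indicator_complex[OF completed.compact_sets[OF C]
          completed.compact_finite[OF C]] completed.compact_sets[OF C] completed.compact_finite[OF C]])
        (simp add: indicator_def split: if_splits)
    also have "(\<lambda>x. indicator C x * w x) = (\<lambda>x. indicator C x *\<^sub>R w x)" by (auto simp: indicator_def)
    finally show ?thesis .
  qed
  have c1: "continuous_map (prod_topology T TN) euclidean (\<lambda>(x, s). F1 x s)"
    unfolding F1_def case_prod_unfold
    by (intro continuous_map_mult continuous_map_comp2[OF Cc_continuous[OF f]] continuous_map_comp2[OF Cc_continuous[OF h]]
        continuous_map_group_mult continuous_map_snd_N continuous_map_fst)
  have c2: "continuous_map (prod_topology T TN) euclidean (\<lambda>(x, s). F2 x s)"
    using right_integrand_continuous[OF e f] unfolding F2_def case_prod_unfold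
    by (rule continuous_map_mult[OF continuous_map_comp2[OF Cc_continuous[OF h] continuous_map_fst]])
  have "(\<integral>x. f x * average (\<lambda>_. 1) h x * w x \<partial>?M) = (\<integral>x. w x * (\<integral>s. F1 x s \<partial>\<mu>N) \<partial>?M)"
    by (simp add: F1_def average_def mult_ac)
  also have "\<dots> = (\<integral>s. (\<integral>x. w x * F1 x s \<partial>?M) \<partial>\<mu>N)"
  proof (rule fubini_compact_kernel[OF completed.borel_top_axioms N.borel_top_axioms c1 K(1) completed.compact_sets[OF K(1)]
        completed.compact_finite[OF K(1)] L1(1) N.compact_sets[OF L1(1)] N.compact_finite[OF L1(1)] _ wi[OF K(1)]])
    fix x s assume x: "x \<in> topspace T" "s \<in> topspace TN" "F1 x s \<noteq> 0"
    then have "x \<in> K" "s \<in> N" using K(2) by (auto simp: F1_def topspace_TN)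
    moreover from this x have "x \<otimes> s \<in> H" using N_mem by (intro H(2)) (auto simp: F1_def topspace_T)
    ultimately show "x \<in> K \<and> s \<in> L1" using L1(2) by blast
  qed
  also have "\<dots> = (\<integral>s. (\<integral>x. w x * F2 x s \<partial>?M) \<partial>\<mu>N)"
  proof (rule Bochner_Integration.integral_cong[OF refl])
    fix s assume "s \<in> space \<mu>N"
    then have s: "s \<in> N" "s \<in> carrier G" "inv s \<in> N" "inv s \<in> carrier G"
      using N_mem subgroup.m_inv_closed[OF subgroupN] by (auto simp: space_N)
    have C1: "(\<lambda>x. F1 x s) \<in> Cc T"
      unfolding F1_def by (rule Cc_mult[OF f Cc_continuous[OF Cc_right[OF s(2) h]]])
    have C2: "(\<lambda>x. h x * f (x \<otimes> inv s)) \<in> Cc T"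
      by (rule Cc_mult[OF h Cc_continuous[OF Cc_right[OF s(4) f]]])
    have m1: "(\<lambda>x. F1 x s * w x) \<in> borel_measurable ?M" using weighted_integrable(1)[OF w C1] by simp
    have m2: "(\<lambda>x. h x * f (x \<otimes> inv s) * w x) \<in> borel_measurable ?M" using weighted_integrable(1)[OF w C2] by simp
    have "AE x in ?M. x \<in> H \<longrightarrow> w (x \<otimes> inv s) = cnj (\<eta> (inv s)) * w x"
      using cov s(3) completed.compact_sets[OF H(1)] completed.compact_finite[OF H(1)]
      unfolding covariant_ae_def lae_iff by blast
    then have ae: "AE x in ?M. F1 (x \<otimes> inv s) s * w (x \<otimes> inv s) = \<eta> s * (h x * f (x \<otimes> inv s) * w x)"
      using AE_space
    proof eventually_elim
      case (elim x)
      then have x: "x \<in> carrier G" by (simp add: space_carrier)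
      have F: "F1 (x \<otimes> inv s) s = f (x \<otimes> inv s) * h x" using x s by (simp add: F1_def m_assoc)
      show ?case
      proof (cases "h x = 0")
        case False
        then have "x \<in> H" using H(2) x by (simp add: topspace_T)
        then show ?thesis using elim(1) char_inv[OF e s(1)] by (simp add: F)
      qed (simp add: F)
    qed
    have "modular s * (\<integral>x. F1 x s * w x \<partial>?M) = (\<integral>x. F1 (x \<otimes> inv s) s * w (x \<otimes> inv s) \<partial>?M)"
      by (rule integral_right[OF s(2) m1, symmetric])
    also have "\<dots> = (\<integral>x. \<eta> s * (h x * f (x \<otimes> inv s) * w x) \<partial>?M)"
    proof (rule integral_cong_AE[OF _ _ ae])
      show "(\<lambda>x. F1 (x \<otimes> inv s) s * w (x \<otimes> inv s)) \<in> borel_measurable ?M"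
        by (rule measurable_compose[OF right_measurable[OF s(4)] m1])
      show "(\<lambda>x. \<eta> s * (h x * f (x \<otimes> inv s) * w x)) \<in> borel_measurable ?M"
        by (rule borel_measurable_times[OF borel_measurable_const m2])
    qed
    finally have eq: "modular s * (\<integral>x. F1 x s * w x \<partial>?M) = \<eta> s * (\<integral>x. h x * f (x \<otimes> inv s) * w x \<partial>?M)" by simp
    have "(\<integral>x. w x * F2 x s \<partial>?M) = (\<integral>x. (1 / modular s * \<eta> s) * (h x * f (x \<otimes> inv s) * w x) \<partial>?M)"
      by (intro Bochner_Integration.integral_cong) (auto simp: F2_def)
    also have "\<dots> = 1 / modular s * (\<eta> s * (\<integral>x. h x * f (x \<otimes> inv s) * w x \<partial>?M))"
      by (simp only: integral_mult_right_zero mult.assoc)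
    also have "\<dots> = (\<integral>x. F1 x s * w x \<partial>?M)" unfolding eq[symmetric] using modular_nonzero[OF s(2)] by simp
    finally show "(\<integral>x. w x * F1 x s \<partial>?M) = (\<integral>x. w x * F2 x s \<partial>?M)" by (simp add: mult.commute)
  qed
  also have "\<dots> = (\<integral>x. w x * (\<integral>s. F2 x s \<partial>\<mu>N) \<partial>?M)"
  proof (rule fubini_compact_kernel[OF completed.borel_top_axioms N.borel_top_axioms c2 H(1) completed.compact_sets[OF H(1)]
        completed.compact_finite[OF H(1)] L2(1) N.compact_sets[OF L2(1)] N.compact_finite[OF L2(1)] _ wi[OF H(1)], symmetric])
    fix x s assume x: "x \<in> topspace T" "s \<in> topspace TN" "F2 x s \<noteq> 0"
    then have "x \<in> H" "s \<in> N" using H(2) by (auto simp: F2_def topspace_TN)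
    moreover from this x have "x \<otimes> inv s \<in> K" using N_mem by (intro K(2)) (auto simp: F2_def topspace_T)
    ultimately show "x \<in> H \<and> s \<in> L2" using L2(2) by blast
  qed
  also have "\<dots> = (\<integral>x. h x * right_average \<eta> f x * w x \<partial>?M)"
  proof -
    have "(\<integral>s. F2 x s \<partial>\<mu>N) = h x * right_average \<eta> f x" for x
      unfolding F2_def right_average_def by (rule integral_mult_right_zero)
    then show ?thesis by (simp add: mult_ac)
  qed
  finally show ?thesis .
qed

text \<open>A bump function at \<open>x\<close> is chosen so narrow that the real part of the character is positive where
  the integrand does not vanish.\<close>

lemma average_nonvanishing:
  assumes e: "\<eta> \<in> chars" and x: "x \<in> carrier G"
  obtains b where "b \<in> Cc T" "average \<eta> b x \<noteq> 0"
proof -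
  have "openin TN {s \<in> topspace TN. \<eta> s \<in> {z. Re z > 0}}"
    using char(1)[OF e] by (intro openin_continuous_map_preimage[of TN euclidean]) (simp_all add: open_halfspace_Re_gt)
  then obtain W where W: "openin T W" "{s \<in> topspace TN. \<eta> s \<in> {z. Re z > 0}} = W \<inter> N"
    by (auto simp: openin_subtopology)
  have one: "\<one> \<in> N" by (rule subgroup.one_closed[OF subgroupN])
  have e1: "\<eta> \<one> = 1"
  proof -
    have "\<eta> \<one> * \<eta> \<one> = \<eta> \<one>" using char(3)[OF e one one] by simp
    then show ?thesis using char(2)[OF e one] by auto
  qed
  have "\<one> \<in> {s \<in> topspace TN. \<eta> s \<in> {z. Re z > 0}}" using one e1 by (simp add: topspace_TN topspace_T)
  then have oW: "\<one> \<in> W" unfolding W(2) by blast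
  have xW: "openin T (x <# W)" by (rule openin_l_coset[OF x W(1)])
  have "x \<otimes> \<one> \<in> x <# W" using oW by (auto simp: l_coset_image)
  then have sub: "{x} \<subseteq> x <# W" using x by simp
  have cx: "compactin T {x}" using x by (simp add: topspace_T)
  obtain h :: "'a \<Rightarrow> real" and L where h: "continuous_map T euclidean h"
    "\<And>y. 0 \<le> h y" "\<And>y. h y \<le> 1" "\<And>y. y \<in> {x} \<Longrightarrow> h y = 1"
    "compactin T L" "L \<subseteq> x <# W" "\<And>y. y \<notin> L \<Longrightarrow> h y = 0"
    by (rule compact_bump[OF Hausdorff locally_compact cx xW sub]) (rule that; assumption)
  let ?h = "\<lambda>x. complex_of_real (h x)"
  have C: "?h \<in> Cc T" by (rule CcI[OF continuous_map_of_real[OF h(1)] h(5)]) (simp add: h(7))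
  note Ci = average_integrand_Cc[OF e C x]
  have "Re (average \<eta> ?h x) = (\<integral>s. Re (?h (x \<otimes> s) * cnj (\<eta> s)) \<partial>\<mu>N)"
    unfolding average_def by (rule integral_Re[symmetric, OF N.Cc_integrable[OF Ci]])
  also have "\<dots> > 0"
  proof (rule N.integral_pos)
    show "continuous_map TN euclidean (\<lambda>s. Re (?h (x \<otimes> s) * cnj (\<eta> s)))"
      by (rule continuous_map_Re[OF Cc_continuous[OF Ci]])
    show "integrable \<mu>N (\<lambda>s. Re (?h (x \<otimes> s) * cnj (\<eta> s)))" by (rule integrable_Re[OF N.Cc_integrable[OF Ci]])
    show "\<one> \<in> carrier GN" using one by simp
    show "Re (?h (x \<otimes> \<one>) * cnj (\<eta> \<one>)) > 0" using h(4)[of x] x e1 by simp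
    fix s assume "s \<in> carrier GN"
    then have s: "s \<in> N" "s \<in> carrier G" using N_mem by auto
    show "0 \<le> Re (?h (x \<otimes> s) * cnj (\<eta> s))"
    proof (cases "x \<otimes> s \<in> x <# W")
      case True
      then obtain o' where o': "o' \<in> W" "x \<otimes> s = x \<otimes> o'" by (auto simp: l_coset_image)
      have "o' \<in> carrier G" using o'(1) openin_subset[OF W(1)] topspace_T by auto
      then have "inv x \<otimes> (x \<otimes> s) = s" "inv x \<otimes> (x \<otimes> o') = o'" using x s by (simp_all flip: m_assoc)
      then have "s \<in> W" using o' by metis
      then have "Re (\<eta> s) > 0" using W(2) s(1) by blast
      then show ?thesis using h(2)[of "x \<otimes> s"] by simp
    next
      case False
      then have "h (x \<otimes> s) = 0" using h(6,7) by blast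
      then show ?thesis by simp
    qed
  qed
  finally have "average \<eta> ?h x \<noteq> 0" by auto
  then show thesis using that[OF C] by blast
qed

text \<open>Both averages of \<open>f\<close> agree: inversion on \<open>N\<close> and the modular factor of \<open>G\<close> compensate.
  For the trivial character this follows by testing against \<open>h\<close> and the symmetry of Weil's
  formula; a function that transforms under \<open>\<eta>\<close> reduces the general case to it.\<close>

lemma right_average_eq:
  assumes e: "\<eta> \<in> chars" and f: "f \<in> Cc T" and x: "x \<in> carrier G"
  shows "right_average \<eta> f x = average \<eta> f x"
proof -
  have triv: "right_average (\<lambda>_. 1) f x = average (\<lambda>_. 1) f x" if f: "f \<in> Cc T" for f
  proof -
    let ?k = "\<lambda>x. right_average (\<lambda>_. 1) f x - average (\<lambda>_. 1) f x"
    note c = right_average_continuous[OF char_one f] average_continuous[OF char_one f]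
    have kc: "continuous_map T euclidean ?k" using c by (simp add: continuous_map_atin tendsto_diff)
    have lb: "loc_bounded (completion \<mu>G) (\<lambda>_. 1) 1"
      unfolding loc_bounded_iff by (auto intro: locally_measurable_const lae_I)
    have cv: "covariant_ae (\<lambda>_. 1) (\<lambda>_. 1)" by (auto simp: covariant_ae_def intro: lae_I)
    have "(\<integral>x. h x * ?k x \<partial>\<mu>G) = 0" if h: "h \<in> Cc T" for h
    proof -
      have C: "(\<lambda>x. h x * right_average (\<lambda>_. 1) f x) \<in> Cc T" "(\<lambda>x. h x * average (\<lambda>_. 1) f x) \<in> Cc T"
        "(\<lambda>x. f x * average (\<lambda>_. 1) h x) \<in> Cc T"
        by (intro Cc_mult h f c average_continuous char_one)+
      have ic: "(\<integral>x. g x \<partial>completion \<mu>G) = (\<integral>x. g x \<partial>\<mu>G)" if "g \<in> Cc T" for g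
        by (rule integral_completion[OF continuous_measurable[OF Cc_continuous[OF that]]])
      have "(\<integral>x. h x * right_average (\<lambda>_. 1) f x \<partial>\<mu>G) = (\<integral>x. f x * average (\<lambda>_. 1) h x \<partial>\<mu>G)"
        using covariant_adjoint[OF char_one lb cv f h] ic[OF C(1)] ic[OF C(3)] by simp
      also have "\<dots> = (\<integral>x. h x * average (\<lambda>_. 1) f x \<partial>\<mu>G)" by (rule average_symmetric[OF f h])
      finally show ?thesis
        using Cc_integrable[OF C(1)] Cc_integrable[OF C(2)] by (simp add: right_diff_distrib)
    qed
    from continuous_zero_of_Cc[OF kc this x] show ?thesis by simp
  qed
  obtain b where b: "b \<in> Cc T" "average \<eta> b x \<noteq> 0" using average_nonvanishing[OF e x] .
  define g where "g y = cnj (average \<eta> b y)" for y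
  have gc: "continuous_map T euclidean g"
    unfolding g_def by (rule continuous_map_cnj[OF average_continuous[OF e b(1)]])
  have gcov: "g (x \<otimes> s) = cnj (\<eta> s) * g x" if "s \<in> N" for s
    using average_covariant[OF e b(1) x that] by (simp add: g_def)
  have "average (\<lambda>_. 1) (\<lambda>y. f y * g y) x = g x * average \<eta> f x"
    by (rule average_mult) (simp add: gcov)
  moreover have "right_average (\<lambda>_. 1) (\<lambda>y. f y * g y) x = g x * right_average \<eta> f x"
  proof -
    have "right_average (\<lambda>_. 1) (\<lambda>y. f y * g y) x =
        (\<integral>s. g x * (complex_of_real (1 / modular s) * \<eta> s * f (x \<otimes> inv s)) \<partial>\<mu>N)"
      unfolding right_average_def
    proof (rule Bochner_Integration.integral_cong[OF refl])
      fix s assume "s \<in> space \<mu>N"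
      then have s: "s \<in> N" "inv s \<in> N" using subgroup.m_inv_closed[OF subgroupN] by (auto simp: space_N)
      show "complex_of_real (1 / modular s) * 1 * (f (x \<otimes> inv s) * g (x \<otimes> inv s)) =
          g x * (complex_of_real (1 / modular s) * \<eta> s * f (x \<otimes> inv s))"
        using gcov[OF s(2)] char_inv[OF e s(1)] by simp
    qed
    also have "\<dots> = g x * right_average \<eta> f x"
      unfolding right_average_def by (rule integral_mult_right_zero)
    finally show ?thesis .
  qed
  moreover have "g x \<noteq> 0" using b(2) by (simp add: g_def)
  ultimately show ?thesis using triv[OF Cc_mult[OF f gc]] by simp
qed

text \<open>Write \<open>f = f1 \<cdot> p\<close>, where \<open>p\<close> is the average of a bump function \<open>h\<close> and is positive on the support of
  \<open>f\<close>. The adjoint formula replaces \<open>f1 \<cdot> p\<close> by \<open>h\<close> times the average of \<open>f1\<close>, and this average vanishes with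
  that of \<open>f\<close>.\<close>

lemma covariant_annihilates_kernel:
  assumes e: "\<eta> \<in> chars" and w: "loc_bounded (completion \<mu>G) w B" and cov: "covariant_ae \<eta> w"
    and f: "f \<in> Cc T" and z: "\<And>x. x \<in> carrier G \<Longrightarrow> average \<eta> f x = 0"
  shows "(\<integral>x. f x * w x \<partial>completion \<mu>G) = 0"
proof -
  obtain K where K: "compactin T K" "\<And>x. x \<in> topspace T \<Longrightarrow> f x \<noteq> 0 \<Longrightarrow> x \<in> K"
    using f by (rule CcE) blast
  obtain h p :: "'a \<Rightarrow> real" where h: "(\<lambda>x. complex_of_real (h x)) \<in> Cc T" "\<And>x. 0 \<le> h x"
    "\<And>x. average (\<lambda>_. 1) (\<lambda>x. complex_of_real (h x)) x = complex_of_real (p x)" "\<And>x. 0 \<le> p x"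
    "\<And>x k. x \<in> carrier G \<Longrightarrow> k \<in> N \<Longrightarrow> x \<otimes> k \<in> K \<Longrightarrow> p x > 0"
    by (rule positive_average[OF K(1)]) (rule that; assumption)
  have pK: "p x \<noteq> 0" if "x \<in> K" for x
    using h(5)[of x \<one>] subgroup.one_closed[OF subgroupN] compactin_carrier[OF K(1)] that by force
  have pc: "continuous_map T euclidean (\<lambda>x. complex_of_real (p x))"
    using average_continuous[OF char_one h(1)] by (simp add: h(3)[abs_def])
  have pinv: "p (x \<otimes> k) = p x" if "x \<in> carrier G" "k \<in> N" for x k
    using average_one_invariant[OF h(1) that] by (simp add: h(3))
  define f1 where "f1 x = f x / complex_of_real (p x)" for x
  have "continuous_map T euclidean f1"
    unfolding f1_def using K(2) pK
    by (intro continuous_map_divide_support[OF Cc_continuous[OF f] pc compact_closed[OF K(1)]]) auto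
  then have f1: "f1 \<in> Cc T" by (rule CcI[OF _ K(1)]) (use K(2) in \<open>auto simp: f1_def\<close>)
  have "average \<eta> f1 x = 0" if x: "x \<in> carrier G" for x
  proof -
    have "average \<eta> (\<lambda>y. f y * (1 / complex_of_real (p y))) x = 1 / complex_of_real (p x) * average \<eta> f x"
      by (rule average_mult) (simp add: pinv[OF x])
    then show ?thesis using z[OF x] by (simp add: f1_def[abs_def])
  qed
  then have r0: "right_average \<eta> f1 x = 0" if "x \<in> carrier G" for x
    using right_average_eq[OF e f1 that] that by simp
  have "(\<integral>x. f x * w x \<partial>completion \<mu>G) =
      (\<integral>x. f1 x * average (\<lambda>_. 1) (\<lambda>x. complex_of_real (h x)) x * w x \<partial>completion \<mu>G)"
  proof (rule Bochner_Integration.integral_cong[OF refl])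
    fix x assume "x \<in> space (completion \<mu>G)"
    then have "f x = f1 x * p x" using K(2)[of x] pK[of x] by (cases "x \<in> K") (auto simp: f1_def space_M)
    then show "f x * w x = f1 x * average (\<lambda>_. 1) (\<lambda>x. complex_of_real (h x)) x * w x" by (simp add: h(3))
  qed
  also have "\<dots> = (\<integral>x. complex_of_real (h x) * right_average \<eta> f1 x * w x \<partial>completion \<mu>G)"
    by (rule covariant_adjoint[OF e w cov f1 h(1)])
  also have "\<dots> = (\<integral>x. 0 \<partial>completion \<mu>G)"
    by (rule Bochner_Integration.integral_cong[OF refl]) (simp add: r0 space_carrier)
  finally show ?thesis by simp
qed

text \<open>In the form with \<open>x s\<inverse>\<close> a right translation of \<open>f\<close> is undone by the substitution
  \<open>s \<mapsto> ks\<close>.\<close>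

lemma average_right_translate:
  assumes e: "\<eta> \<in> chars" and f: "f \<in> Cc T" and x: "x \<in> carrier G" and k: "k \<in> N"
  shows "average \<eta> (\<lambda>y. f (y \<otimes> inv k)) x = modular k * cnj (\<eta> k) * average \<eta> f x"
proof -
  have kG: "k \<in> carrier G" "inv k \<in> N" "inv k \<in> carrier G"
    using k N_mem subgroup.m_inv_closed[OF subgroupN] by auto
  let ?\<phi> = "\<lambda>s. complex_of_real (1 / modular s) * \<eta> s * f (x \<otimes> inv s)"
  have eq: "complex_of_real (1 / modular s) * \<eta> s * f (x \<otimes> inv s \<otimes> inv k) = (modular k * cnj (\<eta> k)) * ?\<phi> (k \<otimes> s)"
    if s: "s \<in> N" for s
  proof -
    have sG: "s \<in> carrier G" by (rule N_mem[OF s])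
    have 1: "cnj (\<eta> k) * \<eta> (k \<otimes> s) = \<eta> s"
      using char(3)[OF e k s] char_cnj(2)[OF e k] by (simp add: mult.assoc[symmetric])
    have 2: "x \<otimes> inv (k \<otimes> s) = x \<otimes> inv s \<otimes> inv k" using x kG sG by (simp add: inv_mult_group m_assoc)
    have 3: "complex_of_real (modular k) * complex_of_real (1 / modular (k \<otimes> s)) = complex_of_real (1 / modular s)"
      using modular_mult[OF kG(1) sG] modular_nonzero[OF kG(1)] modular_nonzero[OF sG] by simp
    have "(modular k * cnj (\<eta> k)) * ?\<phi> (k \<otimes> s) = (complex_of_real (modular k) *
        complex_of_real (1 / modular (k \<otimes> s))) * (cnj (\<eta> k) * \<eta> (k \<otimes> s)) * f (x \<otimes> inv (k \<otimes> s))"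
      by (simp only: mult_ac)
    then show ?thesis by (simp only: 1 2 3)
  qed
  have m: "?\<phi> \<in> borel_measurable \<mu>N"
    using continuous_map_slice[OF right_integrand_continuous[OF e f]] x
    by (intro N.continuous_measurable) (simp add: topspace_T)
  have "average \<eta> (\<lambda>y. f (y \<otimes> inv k)) x = right_average \<eta> (\<lambda>y. f (y \<otimes> inv k)) x"
    by (rule right_average_eq[OF e Cc_right[OF kG(3) f] x, symmetric])
  also have "\<dots> = (\<integral>s. (modular k * cnj (\<eta> k)) * ?\<phi> (k \<otimes> s) \<partial>\<mu>N)"
    unfolding right_average_def
    by (rule Bochner_Integration.integral_cong[OF refl]) (simp only: space_N eq)
  also have "\<dots> = (modular k * cnj (\<eta> k)) * (\<integral>s. ?\<phi> (k \<otimes> s) \<partial>\<mu>N)" by (rule integral_mult_right_zero)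
  also have "(\<integral>s. ?\<phi> (k \<otimes> s) \<partial>\<mu>N) = (\<integral>s. ?\<phi> s \<partial>\<mu>N)" using N.integral_left[OF _ m, of k] k by simp
  also have "\<dots> = average \<eta> f x" using right_average_eq[OF e f x] by (simp add: right_average_def)
  finally show ?thesis .
qed

subsection \<open>A locally measurable phase\<close>

text \<open>Near each point a covariant function divided by its modulus is a continuous phase. Countably
  many of these cover an open subgroup that contains \<open>N\<close>, where the first one that does not vanish
  is taken; left translation extends the result to the other cosets of this subgroup.\<close>

lemma covariant_phase:
  assumes e: "\<eta> \<in> chars"
  obtains u where "locally_measurable \<mu>G u" "\<And>x. x \<in> carrier G \<Longrightarrow> cmod (u x) = 1"
    "\<And>x k. x \<in> carrier G \<Longrightarrow> k \<in> N \<Longrightarrow> u (x \<otimes> k) = \<eta> k * u x"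
proof -
  obtain H P where H: "subgroup H G" "openin T H" "\<And>n::nat. compactin T (P n)" "H = (\<Union>n. P n)"
    by (rule open_sigma_compact_subgroup) (rule that; assumption)
  have HG: "H \<subseteq> carrier G" by (rule subgroup.subset[OF H(1)])
  have "\<forall>x\<in>carrier G. \<exists>b. b \<in> Cc T \<and> average \<eta> b x \<noteq> 0" using average_nonvanishing[OF e] by metis
  then obtain b where b: "\<And>x. x \<in> carrier G \<Longrightarrow> b x \<in> Cc T \<and> average \<eta> (b x) x \<noteq> 0" by metis
  define V where "V x = {y \<in> topspace T. average \<eta> (b x) y \<in> - {0}}" for x
  have V: "openin T (V x)" "x \<in> V x" if x: "x \<in> carrier G" for x
  proof -
    show "openin T (V x)" unfolding V_def
      using b[OF x] by (intro openin_continuous_map_preimage[OF average_continuous[OF e]]) auto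
    show "x \<in> V x" using b[OF x] x by (simp add: V_def topspace_T)
  qed
  have "\<exists>D. finite D \<and> D \<subseteq> P n \<and> P n \<subseteq> \<Union>(V ` D)" for n
  proof -
    have PG: "P n \<subseteq> carrier G" by (rule compactin_carrier[OF H(3)])
    have "\<And>W. W \<in> V ` P n \<Longrightarrow> openin T W" "P n \<subseteq> \<Union>(V ` P n)" using V PG by auto
    from compactinD[OF H(3) this] obtain \<F> where "finite \<F>" "\<F> \<subseteq> V ` P n" "P n \<subseteq> \<Union>\<F>" by blast
    then show ?thesis by (metis finite_subset_image)
  qed
  then obtain D where D: "\<And>n. finite (D n)" "\<And>n. D n \<subseteq> P n" "\<And>n. P n \<subseteq> \<Union>(V ` D n)" by metis
  define z where "z = from_nat_into (\<Union>n. D n)"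
  have cD: "countable (\<Union>n. D n)" by (rule countable_UN[OF countableI_type countable_finite[OF D(1)]])
  have "\<one> \<in> (\<Union>n. P n)" using subgroup.one_closed[OF H(1)] H(4) by simp
  then have neD: "(\<Union>n. D n) \<noteq> {}" using D(3) by blast
  have zG: "z i \<in> carrier G" for i
  proof -
    have "(\<Union>n. D n) \<subseteq> H" using D(2) H(4) by blast
    then show ?thesis using from_nat_into[OF neD, of i] HG unfolding z_def by blast
  qed
  define a where "a i = average \<eta> (b (z i))" for i
  have ac: "continuous_map T euclidean (a i)" for i
    unfolding a_def using b[OF zG] by (intro average_continuous[OF e]) auto
  have acov: "a i (x \<otimes> k) = \<eta> k * a i x" if "x \<in> carrier G" "k \<in> N" for i x k
    unfolding a_def using b[OF zG] that by (intro average_covariant[OF e]) auto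
  have aH: "\<exists>i. a i x \<noteq> 0" if x: "x \<in> H" for x
  proof -
    obtain n d where d: "d \<in> D n" "x \<in> V d" using x D(3) H(4) by blast
    then obtain i where "z i = d" using from_nat_into_surj[OF cD, of d] by (auto simp: z_def)
    then show ?thesis using d(2) by (auto simp: V_def a_def)
  qed
  \<comment> \<open>The least index is constant on cosets of \<open>N\<close>, so \<open>v\<close> is covariant.\<close>
  define j where "j x = (LEAST i. a i x \<noteq> 0)" for x
  define v where "v x = sgn (a (j x) x)" for x
  have nz: "\<eta> k \<noteq> 0" if "k \<in> N" for k using char(2)[OF e that] by auto
  have vcov: "v (x \<otimes> k) = \<eta> k * v x" if x: "x \<in> carrier G" and k: "k \<in> N" for x k
  proof -
    have "j (x \<otimes> k) = j x" unfolding j_def using acov[OF x k] nz[OF k] by simp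
    then have "v (x \<otimes> k) = sgn (\<eta> k * a (j x) x)" using acov[OF x k] by (simp add: v_def)
    also have "\<dots> = sgn (\<eta> k) * v x" by (simp add: sgn_mult v_def)
    also have "sgn (\<eta> k) = \<eta> k" using char(2)[OF e k] by (simp add: sgn_div_norm)
    finally show ?thesis .
  qed
  have vm: "v \<in> borel_measurable \<mu>G"
  proof -
    have am: "a i \<in> borel_measurable \<mu>G" for i by (rule continuous_measurable[OF ac])
    have "j \<in> measurable \<mu>G (count_space UNIV)"
      unfolding j_def using am by (intro measurable_Least) measurable
    from measurable_compose_countable[OF am this] have "(\<lambda>x. a (j x) x) \<in> borel_measurable \<mu>G" .
    then show ?thesis unfolding v_def sgn_div_norm by measurable
  qed
  define H' where "H' = N <#> H"
  have H': "subgroup H' G" unfolding H'_def by (rule mult_norm_subgroup[OF normalN H(1)])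
  have NH': "N \<subseteq> H'" and HH': "H \<subseteq> H'"
  proof -
    have "k \<otimes> \<one> \<in> H'" if "k \<in> N" for k
      unfolding H'_def set_mult_def using that subgroup.one_closed[OF H(1)] by blast
    then show "N \<subseteq> H'" using N_mem by fastforce
    have "\<one> \<otimes> h \<in> H'" if "h \<in> H" for h
      unfolding H'_def set_mult_def using that subgroup.one_closed[OF subgroupN] by blast
    then show "H \<subseteq> H'" using HG by fastforce
  qed
  have v1: "cmod (v x) = 1" if x: "x \<in> H'" for x
  proof -
    obtain n h where nh: "n \<in> N" "h \<in> H" "x = n \<otimes> h" using x by (auto simp: H'_def set_mult_def)
    have c: "n \<in> carrier G" "h \<in> carrier G" using nh N_mem HG by auto
    have n': "inv h \<otimes> n \<otimes> h \<in> N" using normal.inv_op_closed1[OF normalN c(2) nh(1)] .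
    have "x = h \<otimes> (inv h \<otimes> n \<otimes> h)" using c nh(3) by (simp flip: m_assoc)
    then have "cmod (v x) = cmod (v h)" using vcov[OF c(2) n'] char(2)[OF e n'] by (simp add: norm_mult)
    moreover have "a (j h) h \<noteq> 0" unfolding j_def by (rule LeastI_ex[OF aH[OF nh(2)]])
    ultimately show ?thesis by (simp add: v_def norm_sgn)
  qed
  define rep where "rep c = (SOME x. x \<in> c)" for c :: "'a set"
  define u where "u x = v (inv (rep (x <# H')) \<otimes> x)" for x
  have rep: "rep (x <# H') \<in> carrier G" "inv (rep (x <# H')) \<otimes> x \<in> H'" if x: "x \<in> carrier G" for x
  proof -
    have "x \<otimes> \<one> \<in> x <# H'" unfolding l_coset_image using subgroup.one_closed[OF H'] by blast
    then have r: "rep (x <# H') \<in> x <# H'" unfolding rep_def by (rule someI)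
    then show rG: "rep (x <# H') \<in> carrier G" using l_coset_carrier[OF _ x H'] by blast
    have "x \<in> rep (x <# H') <# H'" by (rule l_coset_swap[OF r x H'])
    then obtain h where h: "h \<in> H'" "x = rep (x <# H') \<otimes> h" by (auto simp: l_coset_image)
    then have "inv (rep (x <# H')) \<otimes> x = h"
      using rG subgroup.mem_carrier[OF H' h(1)] by (metis inv_closed l_inv l_one m_assoc)
    then show "inv (rep (x <# H')) \<otimes> x \<in> H'" using h(1) by simp
  qed
  have coset: "y <# H' = x <# H'" if "x \<in> carrier G" "y \<in> x <# H'" for x y
    using l_repr_independence[OF that(2,1) H'] by simp
  obtain \<P> where P: "localizing \<mu>G \<P>" "\<And>A. A \<in> \<P> \<Longrightarrow> \<exists>x\<in>carrier G. A \<subseteq> x <# H"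
    by (rule localizing_cosets[OF H]) (rule that; assumption)
  have "loc_bounded (completion \<mu>G) u 1"
  proof (rule loc_bounded_measurable_pieces[OF localizing_completion[OF P(1)]])
    show "cmod (u x) \<le> 1" for x by (simp add: u_def v_def norm_sgn)
    fix A assume A: "A \<in> \<P>"
    obtain x where x: "x \<in> carrier G" "A \<subseteq> x <# H" using P(2)[OF A] by blast
    have As: "A \<in> sets \<mu>G" using A P(1) by (auto simp: localizing_def)
    let ?r = "rep (x <# H')"
    have "y <# H' = x <# H'" if "y \<in> A" for y
      using that x HH' by (intro coset[OF x(1)]) (auto simp: l_coset_image)
    then have "(\<lambda>y. indicator A y *\<^sub>R u y) = (\<lambda>y. indicator A y *\<^sub>R v (inv ?r \<otimes> y))"
      by (auto simp: indicator_def u_def fun_eq_iff)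
    moreover have "(\<lambda>y. v (inv ?r \<otimes> y)) \<in> borel_measurable \<mu>G"
      using rep(1)[OF x(1)] by (intro measurable_compose[OF translate_measurable(1) vm]) simp
    then have "(\<lambda>y. indicator A y *\<^sub>R v (inv ?r \<otimes> y)) \<in> borel_measurable \<mu>G"
      using As by (intro borel_measurable_scaleR borel_measurable_indicator)
    ultimately show "(\<lambda>y. indicator A y *\<^sub>R u y) \<in> borel_measurable (completion \<mu>G)"
      by (simp add: measurable_completion)
  qed
  then have um: "locally_measurable \<mu>G u" by (simp add: loc_bounded_iff)
  show thesis
  proof (rule that[OF um])
    fix x assume x: "x \<in> carrier G"
    show "cmod (u x) = 1" unfolding u_def by (rule v1[OF rep(2)[OF x]])
    fix k assume k: "k \<in> N"
    have "x \<otimes> k \<in> x <# H'" using k NH' by (auto simp: l_coset_image)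
    then have "(x \<otimes> k) <# H' = x <# H'" by (rule coset[OF x])
    moreover have "inv (rep (x <# H')) \<otimes> (x \<otimes> k) = inv (rep (x <# H')) \<otimes> x \<otimes> k"
      using x N_mem[OF k] rep(1)[OF x] by (simp add: m_assoc)
    moreover have "inv (rep (x <# H')) \<otimes> x \<in> carrier G" using x rep(1)[OF x] by simp
    ultimately show "u (x \<otimes> k) = \<eta> k * u x" using vcov[OF _ k] by (simp add: u_def)
  qed
qed

subsection \<open>The normed space of covariant functions\<close>

abbreviation covariant_average where
  "covariant_average \<eta> f \<equiv> (\<lambda>x\<in>carrier G. average \<eta> f x)"

abbreviation C_space where "C_space \<eta> \<equiv> C_xi_space G T N \<eta> \<mu>Q"

lemma C_space_simps:
  "vset (C_space \<eta>) = C_xi G T N \<eta>" "vnorm (C_space \<eta>) \<psi> = coset_norm \<psi>"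
  "vadd (C_space \<eta>) \<psi> \<omega> = (\<lambda>x\<in>carrier G. \<psi> x + \<omega> x)" "vscale (C_space \<eta>) c \<psi> = (\<lambda>x\<in>carrier G. c * \<psi> x)"
  by (simp_all add: C_xi_space_def coset_norm_def)

lemma C_xi_lift:
  assumes e: "\<eta> \<in> chars" and psi: "\<psi> \<in> C_xi G T N \<eta>"
  obtains f where "f \<in> Cc T" "covariant_average \<eta> f = \<psi>" "(\<integral>x. cmod (f x) \<partial>\<mu>G) = coset_norm \<psi>"
proof -
  obtain f where f: "f \<in> Cc T" "\<And>x. x \<in> carrier G \<Longrightarrow> average \<eta> f x = \<psi> x"
    "(\<integral>x. cmod (f x) \<partial>\<mu>G) = coset_norm \<psi>"
    by (rule covariant_lift[OF e psi]) (rule that; assumption)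
  have "covariant_average \<eta> f = \<psi>"
    by (rule extensionalityI[of _ "carrier G"]) (use C_xiD(2)[OF psi] f(2) in auto)
  then show thesis using that f by blast
qed

lemma covariant_average_add:
  assumes "\<eta> \<in> chars" "f \<in> Cc T" "g \<in> Cc T"
  shows "covariant_average \<eta> (\<lambda>x. f x + g x) = vadd (C_space \<eta>) (covariant_average \<eta> f) (covariant_average \<eta> g)"
  by (auto simp: C_space_simps fun_eq_iff average_add[OF assms])

lemma covariant_average_scale:
  "covariant_average \<eta> (\<lambda>x. c * f x) = vscale (C_space \<eta>) c (covariant_average \<eta> f)"
  by (auto simp: C_space_simps fun_eq_iff average_scale)

lemma on_coset_cmod:
  assumes e: "\<eta> \<in> chars" and psi: "\<psi> \<in> C_xi G T N \<eta>" and x: "x \<in> carrier G"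
  shows "on_coset (\<lambda>y. cmod (\<psi> y)) (x <# N) = cmod (\<psi> x)"
  by (rule on_coset[where f = "\<lambda>y. cmod (\<psi> y)", OF _ x]) (rule cmod_covariant[OF e psi])

lemma coset_norm_integrable:
  assumes "\<eta> \<in> chars" "\<psi> \<in> C_xi G T N \<eta>" shows "integrable \<mu>Q (on_coset (\<lambda>y. cmod (\<psi> y)))"
  by (rule covariant_lift[OF assms])

text \<open>Closure under the operations is inherited from functions with compact support through preimages
  under the averaging map.\<close>

lemma cnormed_C_space:
  assumes e: "\<eta> \<in> chars" shows "cnormed (C_space \<eta>)"
proof
  have ext: "(\<lambda>x\<in>carrier G. \<psi> x) = \<psi>" if "\<psi> \<in> vset (C_space \<eta>)" for \<psi>
    using C_xiD(2)[of \<psi> \<eta>] that by (simp add: C_space_simps extensional_restrict)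
  show add: "vadd (C_space \<eta>) \<psi> \<omega> \<in> vset (C_space \<eta>)"
    if "\<psi> \<in> vset (C_space \<eta>)" "\<omega> \<in> vset (C_space \<eta>)" for \<psi> \<omega>
  proof -
    obtain f where f: "f \<in> Cc T" "covariant_average \<eta> f = \<psi>"
      using C_xi_lift[OF e] \<open>\<psi> \<in> vset (C_space \<eta>)\<close> unfolding C_space_simps by metis
    obtain g where g: "g \<in> Cc T" "covariant_average \<eta> g = \<omega>"
      using C_xi_lift[OF e] \<open>\<omega> \<in> vset (C_space \<eta>)\<close> unfolding C_space_simps by metis
    have "covariant_average \<eta> (\<lambda>x. f x + g x) \<in> C_xi G T N \<eta>"
      by (rule average_C_xi[OF e Cc_add[OF f(1) g(1)]])
    then show ?thesis unfolding covariant_average_add[OF e f(1) g(1)] f(2) g(2) C_space_simps(1) .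
  qed
  show scale: "vscale (C_space \<eta>) c \<psi> \<in> vset (C_space \<eta>)" if "\<psi> \<in> vset (C_space \<eta>)" for \<psi> c
  proof -
    obtain f where f: "f \<in> Cc T" "covariant_average \<eta> f = \<psi>"
      using C_xi_lift[OF e] \<open>\<psi> \<in> vset (C_space \<eta>)\<close> unfolding C_space_simps by metis
    have "covariant_average \<eta> (\<lambda>x. c * f x) \<in> C_xi G T N \<eta>"
      by (rule average_C_xi[OF e Cc_scale[OF f(1)]])
    then show ?thesis unfolding covariant_average_scale f(2) C_space_simps(1) .
  qed
  show "vset (C_space \<eta>) \<noteq> {}" using average_C_xi[OF e Cc_zero] by (auto simp: C_space_simps)
  show "vadd (C_space \<eta>) \<psi> (vscale (C_space \<eta>) 0 \<omega>) = \<psi>" if "\<psi> \<in> vset (C_space \<eta>)" for \<psi> \<omega>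
    using ext[OF that] by (simp add: C_space_simps cong: restrict_cong)
  show "vscale (C_space \<eta>) 1 \<psi> = \<psi>" if "\<psi> \<in> vset (C_space \<eta>)" for \<psi>
    using ext[OF that] by (simp add: C_space_simps)
  show "vnorm (C_space \<eta>) (vadd (C_space \<eta>) \<psi> \<omega>) \<le> vnorm (C_space \<eta>) \<psi> + vnorm (C_space \<eta>) \<omega>"
    if p: "\<psi> \<in> vset (C_space \<eta>)" and c: "\<omega> \<in> vset (C_space \<eta>)" for \<psi> \<omega>
  proof -
    let ?s = "vadd (C_space \<eta>) \<psi> \<omega>"
    have s: "?s \<in> C_xi G T N \<eta>" and p': "\<psi> \<in> C_xi G T N \<eta>" and c': "\<omega> \<in> C_xi G T N \<eta>"
      using add[OF p c] p c by (auto simp: C_space_simps(1))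
    note i = coset_norm_integrable[OF e]
    have "coset_norm ?s \<le> (\<integral>Y. on_coset (\<lambda>y. cmod (\<psi> y)) Y + on_coset (\<lambda>y. cmod (\<omega> y)) Y \<partial>\<mu>Q)"
      unfolding coset_norm_def
    proof (rule integral_mono[OF i[OF s] Bochner_Integration.integrable_add[OF i[OF p'] i[OF c']]])
      fix Y assume "Y \<in> space \<mu>Q"
      then obtain x where x: "x \<in> carrier G" "Y = x <# N" by (auto simp: space_Q carrier_Mod)
      show "on_coset (\<lambda>y. cmod (?s y)) Y \<le> on_coset (\<lambda>y. cmod (\<psi> y)) Y + on_coset (\<lambda>y. cmod (\<omega> y)) Y"
        unfolding x(2) on_coset_cmod[OF e s x(1)] on_coset_cmod[OF e p' x(1)] on_coset_cmod[OF e c' x(1)]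
        using x(1) by (simp add: C_space_simps norm_triangle_ineq)
    qed
    also have "\<dots> = coset_norm \<psi> + coset_norm \<omega>"
      unfolding coset_norm_def by (rule Bochner_Integration.integral_add[OF i[OF p'] i[OF c']])
    finally show ?thesis by (simp only: C_space_simps(2))
  qed
  show "vnorm (C_space \<eta>) (vscale (C_space \<eta>) c \<psi>) = cmod c * vnorm (C_space \<eta>) \<psi>"
    if p: "\<psi> \<in> vset (C_space \<eta>)" for \<psi> c
  proof -
    let ?s = "vscale (C_space \<eta>) c \<psi>"
    have s: "?s \<in> C_xi G T N \<eta>" and p': "\<psi> \<in> C_xi G T N \<eta>"
      using scale[OF p] p by (auto simp: C_space_simps(1))
    have "coset_norm ?s = (\<integral>Y. cmod c * on_coset (\<lambda>y. cmod (\<psi> y)) Y \<partial>\<mu>Q)"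
      unfolding coset_norm_def
    proof (rule Bochner_Integration.integral_cong[OF refl])
      fix Y assume "Y \<in> space \<mu>Q"
      then obtain x where x: "x \<in> carrier G" "Y = x <# N" by (auto simp: space_Q carrier_Mod)
      show "on_coset (\<lambda>y. cmod (?s y)) Y = cmod c * on_coset (\<lambda>y. cmod (\<psi> y)) Y"
        unfolding x(2) on_coset_cmod[OF e s x(1)] on_coset_cmod[OF e p' x(1)]
        using x(1) by (simp add: C_space_simps norm_mult)
    qed
    then show ?thesis unfolding C_space_simps(2) by (simp add: coset_norm_def)
  qed
qed (auto simp: C_space_simps fun_eq_iff algebra_simps)

end

section \<open>The duality\<close>

locale covariant_duality = coset_integration +
  fixes \<xi> u
  assumes xi: "\<xi> \<in> characters (G\<lparr>carrier := N\<rparr>) (subtopology T N)"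
    and u_measurable: "locally_measurable \<mu>G u"
    and u_norm: "\<And>x. x \<in> carrier G \<Longrightarrow> cmod (u x) = 1"
    and u_cov: "\<And>x k. x \<in> carrier G \<Longrightarrow> k \<in> N \<Longrightarrow> u (x \<otimes> k) = \<xi> k * u x"
begin

abbreviation A where "A f \<equiv> covariant_average \<xi> f"

text \<open>The pairing of two functions that transform under \<open>\<xi>\<close> and under its conjugate is constant on cosets. The
  factor turns the first kind into the second one.\<close>

definition twist :: "('a \<Rightarrow> complex) \<Rightarrow> 'a \<Rightarrow> complex" where
  "twist g x = g x * (cnj (u x) * cnj (u x))"

definition pairing :: "('a \<Rightarrow> complex) \<Rightarrow> ('a \<Rightarrow> complex) \<Rightarrow> complex" where
  "pairing g f = (\<integral>x. f x * twist g x \<partial>completion \<mu>G)"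

text \<open>The bounded functions that represent \<open>\<phi>\<close>; they form one class of \<open>L\<^sup>\<infinity>\<close>.\<close>

definition representing :: "(('a \<Rightarrow> complex) \<Rightarrow> complex) \<Rightarrow> ('a \<Rightarrow> complex) set" where
  "representing \<phi> = {g \<in> Linfty_funs \<mu>G. \<forall>f\<in>Cc T. \<phi> (A f) = pairing g f}"

lemma u_unit: assumes "x \<in> carrier G" shows "u x * cnj (u x) = 1" "cnj (u x) * u x = 1"
  using u_norm[OF assms] complex_norm_square[of "u x"] by (simp_all add: mult.commute)

lemma cmod_twist: "x \<in> carrier G \<Longrightarrow> cmod (twist g x) = cmod (g x)"
  using u_norm by (simp add: twist_def norm_mult)

lemma twist_bounded: "loc_bounded (completion \<mu>G) g B \<Longrightarrow> loc_bounded (completion \<mu>G) (twist g) B"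
  unfolding twist_def
  by (rule loc_bounded_mult) (auto intro!: locally_measurable_mult locally_measurable_cnj u_measurable simp: norm_mult u_norm)

lemma pairing_bound:
  assumes "loc_bounded (completion \<mu>G) g B" "f \<in> Cc T"
  shows "cmod (pairing g f) \<le> B * (\<integral>x. cmod (f x) \<partial>\<mu>G)"
  unfolding pairing_def by (rule weighted_integrable(2)[OF twist_bounded[OF assms(1)] assms(2)])

lemma pairing_integrable:
  assumes "g \<in> Linfty_funs \<mu>G" "f \<in> Cc T"
  shows "integrable (completion \<mu>G) (\<lambda>x. f x * twist g x)"
  using assms weighted_integrable(1)[OF twist_bounded] by (auto simp: Linfty_funs_iff)

lemma cmod_completion: "f \<in> Cc T \<Longrightarrow> (\<integral>x. cmod (f x) \<partial>completion \<mu>G) = (\<integral>x. cmod (f x) \<partial>\<mu>G)"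
  using continuous_measurable[OF Cc_continuous, of f] by (intro integral_completion) simp

lemma bound_of_pairing:
  assumes g: "g \<in> Linfty_funs \<mu>G" and t: "0 \<le> t"
    and le: "\<And>f. f \<in> Cc T \<Longrightarrow> cmod (pairing g f) \<le> t * (\<integral>x. cmod (f x) \<partial>\<mu>G)"
  shows "lae \<mu>G (\<lambda>x. cmod (g x) \<le> t)"
proof -
  obtain B where B: "loc_bounded (completion \<mu>G) g B" using g by (auto simp: Linfty_funs_iff)
  have "loc_bounded (completion \<mu>G) (twist g) t"
    using le by (intro completed.loc_bounded_of_Cc[OF twist_bounded[OF B] t]) (simp add: pairing_def cmod_completion)
  then have "lae \<mu>G (\<lambda>x. cmod (twist g x) \<le> t)" by (simp add: loc_bounded_iff)
  then show ?thesis by (rule lae_mono) (simp add: cmod_twist)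
qed

lemma pairing_add:
  assumes "g \<in> Linfty_funs \<mu>G" "h \<in> Linfty_funs \<mu>G" "f \<in> Cc T"
  shows "pairing (\<lambda>x\<in>carrier G. g x + h x) f = pairing g f + pairing h f"
proof -
  have "pairing (\<lambda>x\<in>carrier G. g x + h x) f = (\<integral>x. f x * twist g x + f x * twist h x \<partial>completion \<mu>G)"
    unfolding pairing_def
    by (intro Bochner_Integration.integral_cong) (auto simp: twist_def space_carrier algebra_simps)
  then show ?thesis using assms by (simp add: pairing_def pairing_integrable)
qed

lemma pairing_scale: "pairing (\<lambda>x\<in>carrier G. c * g x) f = c * pairing g f"
proof -
  have "pairing (\<lambda>x\<in>carrier G. c * g x) f = (\<integral>x. c * (f x * twist g x) \<partial>completion \<mu>G)"
    unfolding pairing_def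
    by (intro Bochner_Integration.integral_cong) (auto simp: twist_def space_carrier algebra_simps)
  then show ?thesis by (simp add: pairing_def)
qed

lemma pairing_add_right:
  assumes "g \<in> Linfty_funs \<mu>G" "f \<in> Cc T" "h \<in> Cc T"
  shows "pairing g (\<lambda>x. f x + h x) = pairing g f + pairing g h"
  using assms by (simp add: pairing_def pairing_integrable distrib_right)

lemma pairing_scale_right: "pairing g (\<lambda>x. c * f x) = c * pairing g f"
  by (simp add: pairing_def mult.assoc)

lemma pairing_eq_iff:
  assumes g: "g \<in> Linfty_funs \<mu>G" and h: "h \<in> Linfty_funs \<mu>G"
  shows "(\<forall>f\<in>Cc T. pairing g f = pairing h f) \<longleftrightarrow> lae \<mu>G (\<lambda>x. g x = h x)"
proof
  assume eq: "\<forall>f\<in>Cc T. pairing g f = pairing h f"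
  let ?d = "\<lambda>x\<in>carrier G. g x + (\<lambda>x\<in>carrier G. -1 * h x) x"
  have h': "(\<lambda>x\<in>carrier G. -1 * h x) \<in> Linfty_funs \<mu>G" by (rule Linfty_scale[OF h])
  have "cmod (pairing ?d f) \<le> 0 * (\<integral>x. cmod (f x) \<partial>\<mu>G)" if "f \<in> Cc T" for f
    unfolding pairing_add[OF g h' that] pairing_scale using eq that by simp
  then have "lae \<mu>G (\<lambda>x. cmod (?d x) \<le> 0)"
    by (rule bound_of_pairing[OF Linfty_add[OF g h'] order_refl])
  then show "lae \<mu>G (\<lambda>x. g x = h x)" by (rule lae_mono) simp
next
  assume l: "lae \<mu>G (\<lambda>x. g x = h x)"
  show "\<forall>f\<in>Cc T. pairing g f = pairing h f"
  proof
    fix f assume f: "f \<in> Cc T"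
    obtain K where K: "compactin T K" "\<And>x. x \<in> topspace T \<Longrightarrow> f x \<noteq> 0 \<Longrightarrow> x \<in> K"
      using f by (rule CcE) blast
    have "AE x in completion \<mu>G. x \<in> K \<longrightarrow> g x = h x"
      using l completed.compact_sets[OF K(1)] completed.compact_finite[OF K(1)] unfolding lae_iff by blast
    with AE_space have "AE x in completion \<mu>G. f x * twist g x = f x * twist h x"
    proof eventually_elim
      case (elim x)
      then show ?case using K(2)[of x] by (cases "f x = 0") (auto simp: twist_def space_M)
    qed
    then show "pairing g f = pairing h f"
      unfolding pairing_def using pairing_integrable[OF g f] pairing_integrable[OF h f]
      by (intro integral_cong_AE) auto
  qed
qed

abbreviation dual where "dual \<equiv> dual_space (C_space \<xi>)"

lemma C_cnormed: "cnormed (C_space \<xi>)" by (rule cnormed_C_space[OF xi])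

lemma functionalD:
  assumes "\<phi> \<in> bounded_functionals (C_space \<xi>)" "f \<in> Cc T" "g \<in> Cc T"
  shows "\<phi> (A (\<lambda>x. f x + g x)) = \<phi> (A f) + \<phi> (A g)" "\<phi> (A (\<lambda>x. c * f x)) = c * \<phi> (A f)"
  using assms average_C_xi[OF xi]
  unfolding covariant_average_add[OF xi assms(2,3)] covariant_average_scale bounded_functionals_def
  by (auto simp: C_space_simps(1))

lemma functional_bound_A:
  assumes phi: "\<phi> \<in> bounded_functionals (C_space \<xi>)" and f: "f \<in> Cc T"
    and t: "0 \<le> t" "\<And>\<psi>. \<psi> \<in> C_xi G T N \<xi> \<Longrightarrow> cmod (\<phi> \<psi>) \<le> t * coset_norm \<psi>"
  shows "cmod (\<phi> (A f)) \<le> t * (\<integral>x. cmod (f x) \<partial>\<mu>G)"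
proof -
  have "cmod (\<phi> (A f)) \<le> t * coset_norm (A f)" by (rule t(2)[OF average_C_xi[OF xi f]])
  also have "\<dots> \<le> t * (\<integral>x. cmod (f x) \<partial>\<mu>G)"
    by (rule mult_left_mono[OF coset_norm_average[OF xi f] t(1)])
  finally show ?thesis .
qed

lemma dual_bound:
  assumes phi: "\<phi> \<in> bounded_functionals (C_space \<xi>)"
  shows "vnorm dual \<phi> \<le> t \<longleftrightarrow> 0 \<le> t \<and> (\<forall>\<psi>\<in>C_xi G T N \<xi>. cmod (\<phi> \<psi>) \<le> t * coset_norm \<psi>)"
  using cnormed.dual_norm_le_iff[OF C_cnormed phi] by (simp add: C_space_simps)

text \<open>Existence: a functional on covariant functions, composed with the averaging map, is a
  functional on \<open>L\<^sup>1(G)\<close>.\<close>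

lemma representing_nonempty:
  assumes phi: "\<phi> \<in> bounded_functionals (C_space \<xi>)"
  obtains g where "g \<in> representing \<phi>"
proof -
  define C where "C = vnorm dual \<phi>"
  have C: "0 \<le> C" "\<And>\<psi>. \<psi> \<in> C_xi G T N \<xi> \<Longrightarrow> cmod (\<phi> \<psi>) \<le> C * coset_norm \<psi>"
    using dual_bound[OF phi, of C] by (auto simp: C_def)
  interpret L1_functional T "completion \<mu>G" "\<lambda>f. \<phi> (A f)" C
  proof
    show "0 \<le> C" by (rule C)
    fix f assume f: "f \<in> Cc T"
    show "\<phi> (A (\<lambda>x. f x + g x)) = \<phi> (A f) + \<phi> (A g)" if "g \<in> Cc T" for g
      by (rule functionalD(1)[OF phi f that])
    show "\<phi> (A (\<lambda>x. c * f x)) = c * \<phi> (A f)" for c by (rule functionalD(2)[OF phi f f])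
    show "cmod (\<phi> (A f)) \<le> C * (\<integral>x. cmod (f x) \<partial>completion \<mu>G)"
      unfolding cmod_completion[OF f] by (rule functional_bound_A[OF phi f C])
  qed
  obtain H and P :: "nat \<Rightarrow> 'a set" where H: "subgroup H G" "openin T H" "\<And>n. compactin T (P n)" "H = (\<Union>n. P n)"
    by (rule open_sigma_compact_subgroup) (rule that; assumption)
  obtain \<P> where P: "localizing \<mu>G \<P>" by (rule localizing_cosets[OF H]) (rule that; assumption)
  obtain a where a: "loc_bounded (completion \<mu>G) a (2 * C)"
    "\<And>f. f \<in> Cc T \<Longrightarrow> \<phi> (A f) = (\<integral>x. f x * a x \<partial>completion \<mu>G)"
    by (rule L1_functional_density[OF localizing_completion[OF P]]) (rule that; assumption)
  define g where "g = (\<lambda>x\<in>carrier G. a x * (u x * u x))"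
  have "loc_bounded (completion \<mu>G) (\<lambda>x. a x * (u x * u x)) (2 * C)"
    by (rule loc_bounded_mult[OF a(1)]) (auto intro!: locally_measurable_mult u_measurable simp: norm_mult u_norm)
  then have g: "g \<in> Linfty_funs \<mu>G" unfolding g_def by (rule restrict_Linfty)
  have tw: "twist g x = a x" if x: "x \<in> carrier G" for x
  proof -
    have "twist g x = a x * ((u x * cnj (u x)) * (u x * cnj (u x)))"
      using x by (simp add: twist_def g_def mult_ac)
    then show ?thesis by (simp add: u_unit[OF x])
  qed
  have "\<phi> (A f) = pairing g f" if f: "f \<in> Cc T" for f
    unfolding a(2)[OF f] pairing_def
    by (rule Bochner_Integration.integral_cong[OF refl]) (simp add: tw space_carrier)
  then have "g \<in> representing \<phi>" using g by (simp add: representing_def)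
  then show thesis by (rule that)
qed

lemma representing_eq:
  assumes g: "g \<in> representing \<phi>" shows "representing \<phi> = ae_class g"
proof -
  have gL: "g \<in> Linfty_funs \<mu>G" and gp: "\<And>f. f \<in> Cc T \<Longrightarrow> \<phi> (A f) = pairing g f"
    using g by (auto simp: representing_def)
  have "h \<in> representing \<phi> \<longleftrightarrow> (g, h) \<in> lae_rel \<mu>G" for h
    using gL gp pairing_eq_iff[OF gL, of h] by (auto simp: representing_def lae_rel_iff)
  then show ?thesis by blast
qed

text \<open>The pairing bounds the functional, by preimages with the norm of \<open>\<psi>\<close>; and the functional bounds
  the pairing, because averaging does not increase the norm.\<close>

lemma representing_bound:
  assumes phi: "\<phi> \<in> bounded_functionals (C_space \<xi>)" and g: "g \<in> representing \<phi>"
  shows "lae \<mu>G (\<lambda>x. cmod (g x) \<le> t) \<longleftrightarrow> vnorm dual \<phi> \<le> t"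
proof
  have gL: "g \<in> Linfty_funs \<mu>G" and gp: "\<And>f. f \<in> Cc T \<Longrightarrow> \<phi> (A f) = pairing g f"
    using g by (auto simp: representing_def)
  {
    assume l: "lae \<mu>G (\<lambda>x. cmod (g x) \<le> t)"
    then have b: "loc_bounded (completion \<mu>G) g t"
      using gL by (auto simp: loc_bounded_iff Linfty_funs_def)
    have "cmod (\<phi> \<psi>) \<le> t * coset_norm \<psi>" if psi: "\<psi> \<in> C_xi G T N \<xi>" for \<psi>
    proof -
      obtain f where f: "f \<in> Cc T" "A f = \<psi>" "(\<integral>x. cmod (f x) \<partial>\<mu>G) = coset_norm \<psi>"
        by (rule C_xi_lift[OF xi psi])
      then show ?thesis using pairing_bound[OF b f(1)] gp[OF f(1)] by simp
    qed
    then show "vnorm dual \<phi> \<le> t" using lae_bound_nonneg[OF l] by (simp add: dual_bound[OF phi])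
  next
    assume "vnorm dual \<phi> \<le> t"
    then have t: "0 \<le> t" "\<And>\<psi>. \<psi> \<in> C_xi G T N \<xi> \<Longrightarrow> cmod (\<phi> \<psi>) \<le> t * coset_norm \<psi>"
      by (auto simp: dual_bound[OF phi])
    show "lae \<mu>G (\<lambda>x. cmod (g x) \<le> t)"
      using functional_bound_A[OF phi _ t] by (intro bound_of_pairing[OF gL t(1)]) (simp add: gp)
  }
qed

text \<open>Moving a translation by \<open>k\<close> from \<open>g\<close> to \<open>f\<close> multiplies the average of \<open>f\<close> by a scalar. So the translate of \<open>g\<close> and
  \<open>\<xi>(k) g\<close> have the same pairings, and they agree locally almost everywhere.\<close>

lemma representing_covariant:
  assumes phi: "\<phi> \<in> bounded_functionals (C_space \<xi>)" and g: "g \<in> representing \<phi>" and k: "k \<in> N"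
  shows "lae \<mu>G (\<lambda>x. g (x \<otimes> k) = \<xi> k * g x)"
proof -
  have gL: "g \<in> Linfty_funs \<mu>G" and gp: "\<And>f. f \<in> Cc T \<Longrightarrow> \<phi> (A f) = pairing g f"
    using g by (auto simp: representing_def)
  obtain B where B: "loc_bounded (completion \<mu>G) g B" using gL by (auto simp: Linfty_funs_iff)
  have kG: "k \<in> carrier G" "inv k \<in> carrier G" using N_mem[OF k] by auto
  have e: "twist g (x \<otimes> k) = twist (\<lambda>x. g (x \<otimes> k)) x * (cnj (\<xi> k) * cnj (\<xi> k))" if "x \<in> carrier G" for x
    using u_cov[OF that k] by (simp add: twist_def mult_ac)
  let ?l = "\<lambda>x\<in>carrier G. g (x \<otimes> k)" and ?r = "\<lambda>x\<in>carrier G. \<xi> k * g x"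
  have l: "?l \<in> Linfty_funs \<mu>G" by (rule Linfty_right[OF gL kG(1)])
  have r: "?r \<in> Linfty_funs \<mu>G" by (rule Linfty_scale[OF gL])
  have "pairing ?l f = pairing ?r f" if f: "f \<in> Cc T" for f
  proof -
    let ?F = "\<lambda>x. f x * twist g (x \<otimes> k)"
    have tm: "?F x = (cnj (\<xi> k) * cnj (\<xi> k)) * (f x * twist ?l x)" if "x \<in> space (completion \<mu>G)" for x
      using e[of x] that by (simp add: space_carrier twist_def mult_ac)
    have m: "?F \<in> borel_measurable (completion \<mu>G)"
    proof -
      have "(\<lambda>x. (cnj (\<xi> k) * cnj (\<xi> k)) * (f x * twist ?l x)) \<in> borel_measurable (completion \<mu>G)"
        using pairing_integrable[OF l f] by simp
      also have "?this \<longleftrightarrow> ?thesis" by (rule measurable_cong) (simp only: tm)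
      finally show ?thesis .
    qed
    have "modular k * (\<integral>x. ?F x \<partial>completion \<mu>G) = (\<integral>x. ?F (x \<otimes> inv k) \<partial>completion \<mu>G)"
      by (rule integral_right[OF kG(1) m, symmetric])
    also have "\<dots> = pairing g (\<lambda>x. f (x \<otimes> inv k))"
      unfolding pairing_def
      by (rule Bochner_Integration.integral_cong[OF refl]) (use kG in \<open>simp add: space_carrier m_assoc\<close>)
    also have "\<dots> = \<phi> (A (\<lambda>x. f (x \<otimes> inv k)))" by (rule gp[OF Cc_right[OF kG(2) f], symmetric])
    also have "A (\<lambda>x. f (x \<otimes> inv k)) = A (\<lambda>x. (modular k * cnj (\<xi> k)) * f x)"
      using average_right_translate[OF xi f _ k] by (simp add: fun_eq_iff restrict_def average_scale)
    also have "\<phi> \<dots> = (modular k * cnj (\<xi> k)) * pairing g f"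
      unfolding functionalD(2)[OF phi f f] gp[OF f] ..
    finally have "complex_of_real (modular k) * (\<integral>x. ?F x \<partial>completion \<mu>G) =
        complex_of_real (modular k) * (cnj (\<xi> k) * pairing g f)" by (simp only: mult.assoc)
    then have "(\<integral>x. ?F x \<partial>completion \<mu>G) = cnj (\<xi> k) * pairing g f" using modular_nonzero[OF kG(1)] by simp
    moreover have "(\<integral>x. ?F x \<partial>completion \<mu>G) = (cnj (\<xi> k) * cnj (\<xi> k)) * pairing ?l f"
      unfolding pairing_def integral_mult_right_zero[symmetric]
      by (rule Bochner_Integration.integral_cong[OF refl tm])
    \<comment> \<open>The square of \<open>\<xi> k\<close> cancels the factor that the translation of \<open>u\<close> leaves in the twist.\<close>
    ultimately have "(\<xi> k * \<xi> k) * ((cnj (\<xi> k) * cnj (\<xi> k)) * pairing ?l f) = (\<xi> k * \<xi> k) * (cnj (\<xi> k) * pairing g f)"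
      by simp
    moreover have "(\<xi> k * \<xi> k) * ((cnj (\<xi> k) * cnj (\<xi> k)) * z) = (\<xi> k * cnj (\<xi> k)) * (\<xi> k * cnj (\<xi> k)) * z"
      "(\<xi> k * \<xi> k) * (cnj (\<xi> k) * z) = (\<xi> k * cnj (\<xi> k)) * (\<xi> k * z)" for z by (simp_all only: mult_ac)
    ultimately show ?thesis unfolding pairing_scale by (simp add: char_cnj(1)[OF xi k])
  qed
  then have "lae \<mu>G (\<lambda>x. ?l x = ?r x)" using pairing_eq_iff[OF l r] by blast
  then show ?thesis by (rule lae_mono) simp
qed

lemma mem_Linfty_xi_iff:
  assumes g: "g \<in> Linfty_funs \<mu>G"
  shows "ae_class g \<in> vset (Linfty_xi G N \<xi> \<mu>G) \<longleftrightarrow> (\<forall>k\<in>N. lae \<mu>G (\<lambda>x. g (x \<otimes> k) = \<xi> k * g x))"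
proof -
  have "right_translate G \<mu>G k (ae_class g) = vscale (Linfty \<mu>G) (\<xi> k) (ae_class g) \<longleftrightarrow>
      lae \<mu>G (\<lambda>x. g (x \<otimes> k) = \<xi> k * g x)" if k: "k \<in> N" for k
  proof -
    have "right_translate G \<mu>G k (ae_class g) = vscale (Linfty \<mu>G) (\<xi> k) (ae_class g) \<longleftrightarrow>
        lae \<mu>G (\<lambda>x. (\<lambda>x\<in>carrier G. g (x \<otimes> k)) x = (\<lambda>x\<in>carrier G. \<xi> k * g x) x)"
      unfolding right_translate_ae_class[OF g N_mem[OF k]] ae_class_scale[OF g]
      by (rule ae_class_eq_iff[OF Linfty_right[OF g N_mem[OF k]] Linfty_scale[OF g]])
    also have "\<dots> \<longleftrightarrow> lae \<mu>G (\<lambda>x. g (x \<otimes> k) = \<xi> k * g x)"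
      by (rule iffI; erule lae_mono; simp)
    finally show ?thesis .
  qed
  moreover have "ae_class g \<in> vset (Linfty \<mu>G)" using g by (simp add: vset_Linfty quotientI)
  ultimately show ?thesis by (simp add: Linfty_xi_def)
qed

text \<open>Conversely a covariant bounded function defines a functional, since its pairing vanishes on
  the kernel of the averaging map.\<close>

lemma functional_of_covariant:
  assumes g: "g \<in> Linfty_funs \<mu>G" and cov: "\<And>k. k \<in> N \<Longrightarrow> lae \<mu>G (\<lambda>x. g (x \<otimes> k) = \<xi> k * g x)"
  obtains \<phi> where "\<phi> \<in> bounded_functionals (C_space \<xi>)" "g \<in> representing \<phi>"
proof -
  obtain B where B: "loc_bounded (completion \<mu>G) g B" using g by (auto simp: Linfty_funs_iff)
  have "covariant_ae \<xi> (twist g)"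
    unfolding covariant_ae_def
  proof
    fix k assume k: "k \<in> N"
    show "lae \<mu>G (\<lambda>x. twist g (x \<otimes> k) = cnj (\<xi> k) * twist g x)"
      using cov[OF k]
    proof (rule lae_mono)
      fix x assume x: "x \<in> carrier G" and gx: "g (x \<otimes> k) = \<xi> k * g x"
      have "twist g (x \<otimes> k) = (\<xi> k * cnj (\<xi> k)) * (cnj (\<xi> k) * twist g x)"
        using gx u_cov[OF x k] by (simp add: twist_def mult_ac)
      then show "twist g (x \<otimes> k) = cnj (\<xi> k) * twist g x" by (simp add: char_cnj(1)[OF xi k])
    qed
  qed
  then have ker: "pairing g f = 0" if "f \<in> Cc T" "\<And>x. x \<in> carrier G \<Longrightarrow> average \<xi> f x = 0" for f
    unfolding pairing_def by (rule covariant_annihilates_kernel[OF xi twist_bounded[OF B] _ that])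
  have eq: "pairing g f = pairing g h" if f: "f \<in> Cc T" and h: "h \<in> Cc T" and fh: "A f = A h" for f h
  proof -
    have h': "(\<lambda>x. -1 * h x) \<in> Cc T" by (rule Cc_scale[OF h])
    have "average \<xi> (\<lambda>x. f x + -1 * h x) x = 0" if x: "x \<in> carrier G" for x
      using fun_cong[OF fh, of x] x unfolding average_add[OF xi f h' x] average_scale by simp
    from ker[OF Cc_add[OF f h'] this] show ?thesis
      unfolding pairing_add_right[OF g f h'] pairing_scale_right by simp
  qed
  have "\<forall>\<psi>\<in>C_xi G T N \<xi>. \<exists>f. f \<in> Cc T \<and> A f = \<psi> \<and> (\<integral>x. cmod (f x) \<partial>\<mu>G) = coset_norm \<psi>"
    using C_xi_lift[OF xi] by metis
  then obtain F where F: "\<And>\<psi>. \<psi> \<in> C_xi G T N \<xi> \<Longrightarrow> F \<psi> \<in> Cc T \<and> A (F \<psi>) = \<psi> \<and>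
      (\<integral>x. cmod (F \<psi> x) \<partial>\<mu>G) = coset_norm \<psi>" by metis
  define \<phi> where "\<phi> = (\<lambda>\<psi>\<in>C_xi G T N \<xi>. pairing g (F \<psi>))"
  have phiA: "\<phi> (A f) = pairing g f" if f: "f \<in> Cc T" for f
    using average_C_xi[OF xi f] F[OF average_C_xi[OF xi f]] eq[OF _ f] by (simp add: \<phi>_def)
  have "\<phi> \<in> bounded_functionals (C_space \<xi>)"
    unfolding bounded_functionals_def C_space_simps(1,2)
  proof (intro CollectI conjI ballI allI)
    show "\<phi> \<in> extensional (C_xi G T N \<xi>)" by (simp add: \<phi>_def)
    fix \<psi> assume psi: "\<psi> \<in> C_xi G T N \<xi>"
    note Fp = F[OF psi]
    {
      fix \<omega> assume om: "\<omega> \<in> C_xi G T N \<xi>"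
      note Fo = F[OF om]
      have "vadd (C_space \<xi>) \<psi> \<omega> = A (\<lambda>x. F \<psi> x + F \<omega> x)"
        using covariant_average_add[OF xi, of "F \<psi>" "F \<omega>"] Fp Fo by simp
      then have "\<phi> (vadd (C_space \<xi>) \<psi> \<omega>) = pairing g (\<lambda>x. F \<psi> x + F \<omega> x)"
        using phiA[OF Cc_add, of "F \<psi>" "F \<omega>"] Fp Fo by (simp only:)
      also have "\<dots> = \<phi> \<psi> + \<phi> \<omega>" using Fp Fo psi om by (simp add: pairing_add_right[OF g] \<phi>_def)
      finally show "\<phi> (vadd (C_space \<xi>) \<psi> \<omega>) = \<phi> \<psi> + \<phi> \<omega>" .
    next
      fix c
      have "vscale (C_space \<xi>) c \<psi> = A (\<lambda>x. c * F \<psi> x)"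
        using covariant_average_scale[of \<xi> c "F \<psi>"] Fp by simp
      then have "\<phi> (vscale (C_space \<xi>) c \<psi>) = pairing g (\<lambda>x. c * F \<psi> x)"
        using phiA[OF Cc_scale, of "F \<psi>" c] Fp by (simp only:)
      also have "\<dots> = c * \<phi> \<psi>" using psi by (simp add: pairing_scale_right \<phi>_def)
      finally show "\<phi> (vscale (C_space \<xi>) c \<psi>) = c * \<phi> \<psi>" .
    }
  next
    show "\<exists>B. \<forall>\<psi>\<in>C_xi G T N \<xi>. cmod (\<phi> \<psi>) \<le> B * coset_norm \<psi>"
    proof (intro exI ballI)
      fix \<psi> assume psi: "\<psi> \<in> C_xi G T N \<xi>"
      show "cmod (\<phi> \<psi>) \<le> B * coset_norm \<psi>"
        using pairing_bound[OF B, of "F \<psi>"] F[OF psi] psi by (simp add: \<phi>_def)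
    qed
  qed
  moreover have "g \<in> representing \<phi>" using g phiA by (simp add: representing_def)
  ultimately show thesis by (rule that)
qed

theorem dual_C_space: "isometrically_isomorphic dual (Linfty_xi G N \<xi> \<mu>G)"
  unfolding isometrically_isomorphic_def
proof (intro exI[of _ representing] conjI ballI allI)
  have vd: "vset dual = bounded_functionals (C_space \<xi>)" by (simp add: dual_space_def)
  have ops: "vadd (Linfty_xi G N \<xi> \<mu>G) = vadd (Linfty \<mu>G)" "vscale (Linfty_xi G N \<xi> \<mu>G) = vscale (Linfty \<mu>G)"
    "vnorm (Linfty_xi G N \<xi> \<mu>G) = vnorm (Linfty \<mu>G)" by (simp_all add: Linfty_xi_def)
  have AC: "A f \<in> C_xi G T N \<xi>" if "f \<in> Cc T" for f by (rule average_C_xi[OF xi that])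
  show "bij_betw representing (vset dual) (vset (Linfty_xi G N \<xi> \<mu>G))"
    unfolding vd
  proof (rule bij_betw_imageI)
    show "inj_on representing (bounded_functionals (C_space \<xi>))"
    proof (rule inj_onI)
      fix \<phi> \<phi>' assume p: "\<phi> \<in> bounded_functionals (C_space \<xi>)" and p': "\<phi>' \<in> bounded_functionals (C_space \<xi>)"
        and eq: "representing \<phi> = representing \<phi>'"
      obtain g where g: "g \<in> representing \<phi>" using representing_nonempty[OF p] .
      show "\<phi> = \<phi>'"
      proof (rule extensionalityI[of _ "C_xi G T N \<xi>"])
        show "\<phi> \<in> extensional (C_xi G T N \<xi>)" "\<phi>' \<in> extensional (C_xi G T N \<xi>)"
          using p p' by (simp_all add: bounded_functionals_def C_space_simps)
        fix \<psi> assume psi: "\<psi> \<in> C_xi G T N \<xi>"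
        obtain f where f: "f \<in> Cc T" "A f = \<psi>" using C_xi_lift[OF xi psi] by metis
        have "\<phi> (A f) = pairing g f" using g f(1) by (simp add: representing_def)
        moreover have "\<phi>' (A f) = pairing g f" using g f(1) unfolding eq by (simp add: representing_def)
        ultimately show "\<phi> \<psi> = \<phi>' \<psi>" using f(2) by simp
      qed
    qed
    show "representing ` bounded_functionals (C_space \<xi>) = vset (Linfty_xi G N \<xi> \<mu>G)"
    proof (intro equalityI subsetI)
      fix X assume "X \<in> representing ` bounded_functionals (C_space \<xi>)"
      then obtain \<phi> where p: "\<phi> \<in> bounded_functionals (C_space \<xi>)" "X = representing \<phi>" by blast
      obtain g where g: "g \<in> representing \<phi>" using representing_nonempty[OF p(1)] .
      then have "g \<in> Linfty_funs \<mu>G" by (simp add: representing_def)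
      then show "X \<in> vset (Linfty_xi G N \<xi> \<mu>G)"
        unfolding p(2) representing_eq[OF g] using representing_covariant[OF p(1) g] mem_Linfty_xi_iff by blast
    next
      fix X assume X: "X \<in> vset (Linfty_xi G N \<xi> \<mu>G)"
      then have "X \<in> Linfty_funs \<mu>G // lae_rel \<mu>G" by (simp add: Linfty_xi_def vset_Linfty)
      then obtain g where g: "g \<in> Linfty_funs \<mu>G" "X = ae_class g" by (rule quotientE)
      obtain \<phi> where "\<phi> \<in> bounded_functionals (C_space \<xi>)" "g \<in> representing \<phi>"
        using functional_of_covariant[OF g(1)] X g mem_Linfty_xi_iff[OF g(1)] by metis
      then show "X \<in> representing ` bounded_functionals (C_space \<xi>)" using representing_eq g(2) by blast
    qed
  qed
  fix \<phi> assume "\<phi> \<in> vset dual"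
  then have p: "\<phi> \<in> bounded_functionals (C_space \<xi>)" by (simp add: vd)
  obtain g where g: "g \<in> representing \<phi>" using representing_nonempty[OF p] .
  then have gL: "g \<in> Linfty_funs \<mu>G" and gp: "\<And>f. f \<in> Cc T \<Longrightarrow> \<phi> (A f) = pairing g f"
    by (auto simp: representing_def)
  show "representing (vscale dual c \<phi>) = vscale (Linfty_xi G N \<xi> \<mu>G) c (representing \<phi>)" for c
  proof -
    have "(\<lambda>x\<in>carrier G. c * g x) \<in> representing (vscale dual c \<phi>)"
      using AC gp by (simp add: representing_def Linfty_scale[OF gL] pairing_scale dual_space_def C_space_simps)
    from representing_eq[OF this] show ?thesis by (simp add: ops representing_eq[OF g] ae_class_scale[OF gL])
  qed
  show "vnorm (Linfty_xi G N \<xi> \<mu>G) (representing \<phi>) = vnorm dual \<phi>"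
  proof -
    have "vnorm (Linfty \<mu>G) (representing \<phi>) = Inf {t. vnorm dual \<phi> \<le> t}"
      unfolding representing_eq[OF g] ae_class_norm[OF gL] representing_bound[OF p g] ..
    also have "{t. vnorm dual \<phi> \<le> t} = {vnorm dual \<phi>..}" by auto
    finally show ?thesis by (simp add: ops)
  qed
  fix \<phi>' assume "\<phi>' \<in> vset dual"
  then have p': "\<phi>' \<in> bounded_functionals (C_space \<xi>)" by (simp add: vd)
  obtain g' where g': "g' \<in> representing \<phi>'" using representing_nonempty[OF p'] .
  then have gL': "g' \<in> Linfty_funs \<mu>G" and gp': "\<And>f. f \<in> Cc T \<Longrightarrow> \<phi>' (A f) = pairing g' f"
    by (auto simp: representing_def)
  have "(\<lambda>x\<in>carrier G. g x + g' x) \<in> representing (vadd dual \<phi> \<phi>')"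
    using AC gp gp' by (simp add: representing_def Linfty_add[OF gL gL'] pairing_add[OF gL gL'] dual_space_def C_space_simps)
  from representing_eq[OF this]
  show "representing (vadd dual \<phi> \<phi>') = vadd (Linfty_xi G N \<xi> \<mu>G) (representing \<phi>) (representing \<phi>')"
    by (simp add: ops representing_eq[OF g] representing_eq[OF g'] ae_class_add[OF gL gL'])
qed

end

theorem theorem5p8:
  fixes G :: "('a, 'b) monoid_scheme" and T :: "'a topology" and N :: "'a set"
    and \<xi> :: "'a \<Rightarrow> complex"
    and \<mu>G \<mu>N :: "'a measure" and \<mu>Q :: "'a set measure"
  assumes "locally_compact_group G T"
    and "N \<lhd> G" and "closedin T N"
    and "\<xi> \<in> characters (subgroup_of G N) (subtopology T N)"
    and "left_haar_measure G T \<mu>G"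
    and "left_haar_measure (subgroup_of G N) (subtopology T N) \<mu>N"
    and "left_haar_measure (G Mod N) (quot_topology G T N) \<mu>Q"
    and "weil_formula G \<mu>G \<mu>N \<mu>Q"
  shows "isometrically_isomorphic (dual_space (L1_xi G T N \<xi> \<mu>Q)) (Linfty_xi G N \<xi> \<mu>G)"
proof -
  interpret coset_integration G T N \<mu>G \<mu>N \<mu>Q
    by (rule coset_integration.intro[OF assms(1-3) assms(5-8)])
  obtain u where u: "locally_measurable \<mu>G u" "\<And>x. x \<in> carrier G \<Longrightarrow> cmod (u x) = 1"
    "\<And>x k. x \<in> carrier G \<Longrightarrow> k \<in> N \<Longrightarrow> u (x \<otimes>\<^bsub>G\<^esub> k) = \<xi> k * u x"
    by (rule covariant_phase[OF assms(4)]) (rule that; assumption)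
  interpret covariant_duality G T N \<mu>G \<mu>N \<mu>Q \<xi> u
    using assms(4) u by unfold_locales
  show ?thesis
    unfolding L1_xi_def
    by (rule isometrically_isomorphic_trans[OF cnormed.dual_completion[OF C_cnormed] dual_C_space])
qed

end
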